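(* Let $q\ge 2$ and let $f_1,\dots,f_q$ be germs of holomorphic functions defined in a neighborhood of $\mathbf 0$ in $\mathbb{C}^n$ such that the germ at $\mathbf 0$ of $(f_1,\dots,f_q)^{-1}(\mathbf 0)$ (which contains $\mathbf 0$) has pure codimension $q$. Let $\mathcal{F}$ be the germ of holomorphic foliation of codimension $q$ with complete first integral $(f_1,\dots,f_q)$. Then either $\mathcal{F}$ is regular at $\mathbf 0$ or $\dim(\mathrm{Sing}(\mathcal{F}))\ge 1$.
   Context: A (singular) holomorphic foliation $\mathcal{F}$ of codimension $q$ and dimension $n-q$ ($1\le q\le n-1$) on an $n$-dimensional complex manifold $M$ is a regular holomorphic foliation of codimension $q$ on $M\setminus \mathrm{Sing}(\mathcal{F})$, where the singular set $\mathrm{Sing}(\mathcal{F})$ is a closed analytic subset of codimension at least $2$ such that the regular foliation does not extend as a regular foliation to a neighborhood of any of its points. $\mathcal{F}$ is regular at $\mathbf 0$ if $\mathbf 0\notin\mathrm{Sing}(\mathcal{F})$; $\mathrm{Sing}(\mathcal F)$ is considered as a germ at $\mathbf 0$. $(f_1,\dots,f_q)$ is a complete first integral of a codimension $q$ foliation $\mathcal{F}$ if each $f_j$ is a (meromorphic, here holomorphic) function constant along the leaves of $\mathcal{F}$ and $df_1\wedge\cdots\wedge df_q\not\equiv 0$. A complete first integral determines the foliation: at generic points the tangent space of $\mathcal{F}$ is the common kernel of $df_1,\dots,df_q$. *)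

theory Defs
  imports "HOL-Analysis.Analysis"
begin

section \<open>Holomorphic functions and maps of several complex variables\<close>

definition holo_fun_on :: "(complex^'n \<Rightarrow> complex) \<Rightarrow> (complex^'n) set \<Rightarrow> bool" where
  "holo_fun_on h U \<longleftrightarrow>
     (\<forall>z\<in>U. \<exists>a :: complex^'n. (h has_derivative (\<lambda>v. \<Sum>i\<in>UNIV. a $ i * v $ i)) (at z))"

definition holo_map_on :: "(complex^'n \<Rightarrow> complex^'m) \<Rightarrow> (complex^'n) set \<Rightarrow> bool" where
  "holo_map_on \<phi> U \<longleftrightarrow> (\<forall>i. holo_fun_on (\<lambda>z. \<phi> z $ i) U)"

definition biholomorphic ::
  "(complex^'n \<Rightarrow> complex^'m) \<Rightarrow> (complex^'n) set \<Rightarrow> (complex^'m) set \<Rightarrow> bool" where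
  "biholomorphic \<phi> V W \<longleftrightarrow>
     open V \<and> open W \<and> bij_betw \<phi> V W \<and> holo_map_on \<phi> V \<and> holo_map_on (the_inv_into V \<phi>) W"

definition submersion_on :: "(complex^'n \<Rightarrow> complex^'q) \<Rightarrow> (complex^'n) set \<Rightarrow> bool" where
  "submersion_on \<phi> V \<longleftrightarrow>
     holo_map_on \<phi> V \<and> (\<forall>z\<in>V. surj (frechet_derivative \<phi> (at z)))"

text \<open>The \<open>q\<close>-form \<open>df\<^sub>1 \<and> \<dots> \<and> df\<^sub>q\<close> at \<open>z\<close>, evaluated on \<open>q\<close> tangent vectors.\<close>

definition wedge_differentials ::
  "('q \<Rightarrow> complex^'n \<Rightarrow> complex) \<Rightarrow> complex^'n \<Rightarrow> ('q::finite \<Rightarrow> complex^'n) \<Rightarrow> complex" where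
  "wedge_differentials f z v = det (\<chi> i j. frechet_derivative (f i) (at z) (v j))"


section \<open>Analytic sets and their dimension\<close>

text \<open>Since the condition is imposed at every point of \<open>U\<close>, such a set is closed in \<open>U\<close>.\<close>

definition analytic_subset :: "(complex^'n) set \<Rightarrow> (complex^'n) set \<Rightarrow> bool" where
  "analytic_subset S U \<longleftrightarrow> S \<subseteq> U \<and>
     (\<forall>p\<in>U. \<exists>V G. open V \<and> p \<in> V \<and> V \<subseteq> U \<and> finite G \<and> (\<forall>g\<in>G. holo_fun_on g V) \<and>
        S \<inter> V = {z\<in>V. \<forall>g\<in>G. g z = 0})"

text \<open>Near \<open>z\<close> the set \<open>A\<close> is a \<open>d\<close>-dimensional complex submanifold: a holomorphic chart flattens
  it to a coordinate subspace of dimension \<open>d\<close>.\<close>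

definition regular_point :: "(complex^'n) set \<Rightarrow> nat \<Rightarrow> complex^'n \<Rightarrow> bool" where
  "regular_point A d z \<longleftrightarrow> z \<in> A \<and>
     (\<exists>V W (\<phi> :: complex^'n \<Rightarrow> complex^'n) J. z \<in> V \<and> biholomorphic \<phi> V W \<and> card J = d \<and>
        \<phi> ` (A \<inter> V) = {w\<in>W. \<forall>i. i \<notin> J \<longrightarrow> w $ i = 0})"

text \<open>Dimension of the germ of \<open>A\<close> at \<open>p\<close>: the upper limit of the dimensions of \<open>A\<close> at its regular
  points tending to \<open>p\<close>. The empty germ has dimension \<open>-1\<close>.\<close>

definition dim_at :: "(complex^'n) set \<Rightarrow> complex^'n \<Rightarrow> int" where
  "dim_at A p = Max (insert (-1) {int d | d. p \<in> closure {z. regular_point A d z}})"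

definition pure_codim_at :: "(complex^'n) set \<Rightarrow> nat \<Rightarrow> complex^'n \<Rightarrow> bool" where
  "pure_codim_at A k p \<longleftrightarrow>
     (\<exists>V. open V \<and> p \<in> V \<and> (\<forall>z\<in>A \<inter> V. dim_at A z = int CARD('n) - int k))"


section \<open>Holomorphic foliations\<close>

text \<open>A regular foliation of codimension \<open>q = CARD('q)\<close> is given by an atlas of distinguished
  submersions to \<open>q\<close>-dimensional space which differ, locally, by biholomorphisms of the target.
  Atlases all of whose members are compatible with each other define the same foliation.\<close>

type_synonym ('n, 'q) fol_chart = "(complex^'n) set \<times> (complex^'n \<Rightarrow> complex^'q)"

definition compatible_charts :: "('n::finite, 'q::finite) fol_chart \<Rightarrow> ('n, 'q) fol_chart \<Rightarrow> bool" where
  "compatible_charts c d \<longleftrightarrow>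
     (\<forall>x \<in> fst c \<inter> fst d. \<exists>N g. open N \<and> x \<in> N \<and> N \<subseteq> fst c \<inter> fst d \<and>
        biholomorphic g (snd c ` N) (snd d ` N) \<and> (\<forall>z\<in>N. snd d z = g (snd c z)))"

definition regular_foliation ::
  "(complex^'n) set \<Rightarrow> ('n::finite, 'q::finite) fol_chart set \<Rightarrow> bool" where
  "regular_foliation M \<A> \<longleftrightarrow> open M \<and> (\<Union>c\<in>\<A>. fst c) = M \<and>
     (\<forall>c\<in>\<A>. open (fst c) \<and> submersion_on (snd c) (fst c)) \<and>
     (\<forall>c\<in>\<A>. \<forall>d\<in>\<A>. compatible_charts c d)"

text \<open>Two points are on the same leaf iff they are joined by a chain of plaques, the plaques being the
  connected components of the fibres of the distinguished submersions.\<close>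

definition same_plaque :: "('n::finite, 'q::finite) fol_chart set \<Rightarrow> complex^'n \<Rightarrow> complex^'n \<Rightarrow> bool" where
  "same_plaque \<A> x y \<longleftrightarrow>
     (\<exists>c\<in>\<A>. connected_component {z \<in> fst c. snd c z = snd c x} x y)"

definition leaf :: "('n::finite, 'q::finite) fol_chart set \<Rightarrow> complex^'n \<Rightarrow> (complex^'n) set" where
  "leaf \<A> x = {y. (same_plaque \<A>)\<^sup>*\<^sup>* x y}"

text \<open>A singular foliation on \<open>M\<close> with singular set \<open>S\<close>. In the last condition, compatibility of \<open>\<A>\<close>
  and \<open>\<B>\<close> says that both define the same foliation on \<open>V - S\<close>.\<close>

definition holomorphic_foliation ::
  "(complex^'n) set \<Rightarrow> (complex^'n) set \<Rightarrow> ('n::finite, 'q::finite) fol_chart set \<Rightarrow> bool" where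
  "holomorphic_foliation M S \<A> \<longleftrightarrow> open M \<and>
     analytic_subset S M \<and> (\<forall>p\<in>S. int CARD('n) - dim_at S p \<ge> 2) \<and>
     regular_foliation (M - S) \<A> \<and>
     (\<forall>p\<in>S. \<not> (\<exists>V \<B>. open V \<and> p \<in> V \<and> V \<subseteq> M \<and> regular_foliation V (\<B> :: ('n, 'q) fol_chart set) \<and>
        (\<forall>c\<in>\<A>. \<forall>d\<in>\<B>. compatible_charts c d)))"

text \<open>For germs at \<open>p\<close>, non-vanishing of \<open>df\<^sub>1 \<and> \<dots> \<and> df\<^sub>q\<close> means that it does not vanish identically
  on any neighbourhood of \<open>p\<close>.\<close>

definition complete_first_integral_at ::
  "complex^'n \<Rightarrow> (complex^'n) set \<Rightarrow> (complex^'n) set \<Rightarrow> ('n::finite, 'q::finite) fol_chart set \<Rightarrow>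
     ('q \<Rightarrow> complex^'n \<Rightarrow> complex) \<Rightarrow> bool" where
  "complete_first_integral_at p M S \<A> f \<longleftrightarrow>
     (\<forall>j. holo_fun_on (f j) M) \<and>
     (\<forall>x \<in> M - S. \<forall>j. f j constant_on leaf \<A> x) \<and>
     \<not> (\<forall>\<^sub>F z in nhds p. \<forall>v. wedge_differentials f z v = 0)"

end

theory Submission
  imports Defs "HOL-Complex_Analysis.Complex_Analysis"
begin

text \<open>Suppose that \<open>0\<close> is an isolated point of the singular set and put \<open>X = f\<inverse>(0)\<close>. Outside \<open>0\<close> the map
  \<open>f\<close> is locally a finite map of the leaf parameter, because \<open>X\<close> has pure codimension \<open>q\<close>. In a small ball
  \<open>K\<close> whose boundary is transverse to the leaves contained in \<open>X\<close>, the components of the nearby fibres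
  of \<open>f\<close> are compact pieces of leaves, and by the maximum principle they reach the boundary of \<open>K\<close>. Fix a
  distinguished chart at a suitable boundary point of \<open>X\<close>. The parameters of the plaques of this chart that
  lie in the component through \<open>z\<close> form a multivalued function of \<open>z\<close>; by holonomy it has locally countably
  many holomorphic branches, so that by Baire's theorem a branch can be continued along convex
  compact sets that avoid \<open>X\<close>. As \<open>q \<ge> 2\<close>, there is a Hartogs figure avoiding \<open>X\<close>, and a branch extends to a
  holomorphic map \<open>\<phi>\<close> on a neighbourhood of \<open>0\<close>. It is a submersion outside \<open>X\<close>, where it is locally a
  coordinate change of a distinguished submersion; along \<open>X\<close> outside \<open>0\<close>, because a single equation
  in \<open>q \<ge> 2\<close> variables has no isolated zeros; and at \<open>0\<close>, because the locus where two rows of its Jacobian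
  become dependent cannot be compact. Hence \<open>\<phi>\<close> defines a regular foliation near \<open>0\<close> extending the given one.\<close>

section \<open>Separately holomorphic functions\<close>

text \<open>Chains of plaques can be infinite in number, so the parameters may have infinitely many
  branches and no symmetric functions; what remains is countability. A branch may also have
  monodromy around \<open>X\<close>. It is therefore continued only along convex sets, where the
  identity theorem makes the result unique, and the Hartogs figure is built from one disc and a
  circle of discs. The figure avoids \<open>X\<close> by a dimension count: the directions to
  exclude have real dimension at most \<open>2n - 2q + 3 < 2n\<close>. The radius of
  \<open>K\<close> exists because the squared norm is the restriction of a holomorphic function of
  \<open>2n\<close> variables with countably many critical values on the set in question. Dimension
  is defined by regular points alone. That \<open>dim_at S 0 < 1\<close> isolates the singular
  point, and that pure codimension isolates the leaf parameters on \<open>X\<close>, both rest on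
  one fact: near an accumulation point a zero set has regular points of positive dimension. It is
  proved by eliminating one variable at a time, with Gram determinants formed from residue
  integrals.\<close>

lemma norm_vsm: "norm (c *s (v::complex^'n)) = cmod c * norm v"
  by (simp add: norm_vec_def norm_mult L2_set_right_distrib)

lemma bounded_linear_vsm: "bounded_linear (%c. c *s (v::complex^'n))"
  by (rule bounded_linear_intro[where K="norm v"])
     (simp_all add: vec_eq_iff algebra_simps norm_vsm)

lemma continuous_on_vsm [continuous_intros]:
  "continuous_on S f ==> continuous_on S g ==> continuous_on S (%x. f x *s (g x :: complex^'n))"
  unfolding vector_scalar_mult_def by (intro continuous_intros)

text \<open>Cauchy's inequality on discs of radius \<open>r / 4\<close> about points of the disc of
  radius \<open>r / 4\<close> bounds the second derivative; \<open>fact 2 / (1/4)^2 = 32\<close> is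
  the constant. The bound depends on \<open>M\<close> and \<open>r\<close> alone, which is what
  \<open>osgood\<close> needs.\<close>

lemma taylor2_bound:
  assumes f: "f holomorphic_on ball 0 r" and M: "!!l. l \<in> ball 0 r ==> cmod (f l) \<le> M" and "r > 0"
    and l: "cmod l \<le> r / 4"
  shows "cmod (f l - f 0 - l * deriv f 0) \<le> (32 * M / r\<^sup>2) * (cmod l)\<^sup>2"
proof -
  have B: "cmod ((deriv ^^ 2) f x) \<le> 32 * M / r\<^sup>2" if "x \<in> cball 0 (r/4)" for x
  proof -
    have sub: "cball x (r/4) \<subseteq> ball 0 r"
    proof
      fix y assume "y \<in> cball x (r/4)"
      then have "norm y \<le> norm x + r/4" using norm_triangle_ineq[of x "y - x"] by (simp add: dist_norm norm_minus_commute)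
      then show "y \<in> ball 0 r" using that \<open>r > 0\<close> by simp
    qed
    have "cmod ((deriv ^^ 2) f x) \<le> fact 2 * M / (r/4)^2"
    proof (rule Cauchy_inequality)
      show "f holomorphic_on ball x (r/4)" using f sub by (meson ball_subset_cball holomorphic_on_subset order_trans)
      show "continuous_on (cball x (r/4)) f" using f sub by (meson holomorphic_on_imp_continuous_on continuous_on_subset)
      show "0 < r/4" using \<open>r > 0\<close> by simp
      show "cmod (f y) \<le> M" if "cmod (x - y) = r/4" for y
        using M[of y] sub that by (force simp: dist_norm)
    qed
    also have "\<dots> = 32 * M / r\<^sup>2" by (simp add: power2_eq_square fact_2)
    finally show ?thesis .
  qed
  have "cmod ((deriv ^^ 0) f l - (\<Sum>i\<le>1. (deriv ^^ i) f 0 * (l - 0) ^ i / fact i)) \<le> (32 * M / r\<^sup>2) * cmod (l - 0) ^ Suc 1 / fact 1"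
  proof (rule complex_Taylor[where S="cball 0 (r/4)" and f="%i. (deriv ^^ i) f"])
    show "convex (cball (0::complex) (r/4))" by simp
    show "((deriv ^^ i) f has_field_derivative (deriv ^^ Suc i) f x) (at x within cball 0 (r/4))"
      if "x \<in> cball 0 (r/4)" "i \<le> 1" for i x
    proof -
      have "(deriv ^^ i) f holomorphic_on ball 0 r" using f by (simp add: holomorphic_higher_deriv)
      moreover have "x \<in> ball 0 r" using that \<open>r>0\<close> by auto
      ultimately have "((deriv ^^ i) f has_field_derivative deriv ((deriv ^^ i) f) x) (at x)"
        by (simp add: holomorphic_derivI)
      then show ?thesis by (simp add: has_field_derivative_at_within)
    qed
    show "cmod ((deriv ^^ Suc 1) f x) \<le> 32 * M / r\<^sup>2" if "x \<in> cball 0 (r/4)" for x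
      using B[OF that] by (simp add: numeral_2_eq_2)
    show "0 \<in> cball (0::complex) (r/4)" "l \<in> cball 0 (r/4)" using l \<open>r > 0\<close> by auto
  qed
  then show ?thesis by (simp add: power2_eq_square algebra_simps)
qed

text \<open>The bound of \<open>taylor2_bound\<close> holds with one constant for all unit
  directions and all base points near \<open>z\<close>, so the directional derivative
  \<open>d z\<close> approximates \<open>G\<close> to second order, and only its additivity must be
  proved. Continuity and differentiability along complex lines in every direction are what integrals
  with parameters provide.\<close>

lemma osgood:
  fixes G :: "complex^'n => complex"
  assumes opn: "open U" and cont: "continuous_on U G"
    and line: "!!z v. z \<in> U ==> (%l::complex. G (z + l *s v)) field_differentiable (at 0)"
  shows "holo_fun_on G U"
  unfolding holo_fun_on_def
proof
  fix z assume z: "z \<in> U"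
  obtain r0 where r0: "r0 > 0" "cball z r0 \<subseteq> U" using opn z open_contains_cball by blast
  define r where "r = r0 / 2"
  have r: "r > 0" "cball z (2*r) \<subseteq> U" using r0 by (auto simp: r_def)
  have "compact (G ` cball z (2*r))"
    using cont r(2) continuous_on_subset compact_continuous_image compact_cball by blast
  then obtain M where M: "!!w. w \<in> cball z (2*r) ==> cmod (G w) \<le> M"
    by (meson bounded_iff compact_imp_bounded imageI)
  have in2: "w + l *s v \<in> cball z (2*r)" if "w \<in> ball z r" "norm v \<le> 1" "l \<in> ball 0 r" for w v :: "complex^'n" and l :: complex
  proof -
    have "dist z (w + l *s v) \<le> dist z w + norm (l *s v)" by (metis dist_norm dist_triangle add_diff_cancel_left' dist_commute)
    also have "norm (l *s v) \<le> cmod l * 1" unfolding norm_vsm by (rule mult_left_mono) (use that in auto)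
    finally show ?thesis using that by (simp add: dist_norm)
  qed
  have hol: "(%l. G (w + l *s v)) holomorphic_on ball 0 r" if "w \<in> ball z r" "norm v \<le> 1" for w v
    unfolding holomorphic_on_def
  proof
    fix l :: complex assume l: "l \<in> ball 0 r"
    have "(%m. G ((w + l *s v) + m *s v)) field_differentiable (at 0)"
      using line in2[OF that l] r by blast
    then have "(%m. G (w + (l + m) *s v)) field_differentiable (at 0)"
      by (simp add: vector_sadd_rdistrib add.assoc)
    then obtain D where "((%m. G (w + (l + m) *s v)) has_field_derivative D) (at 0)"
      by (auto simp: field_differentiable_def)
    then have "((%m. G (w + m *s v)) has_field_derivative D) (at l)"
      using DERIV_shift[of "%m. G (w + m *s v)" D 0 l] by (simp add: add.commute)
    then show "(%l. G (w + l *s v)) field_differentiable at l within ball 0 r"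
      using field_differentiable_at_within field_differentiable_def by blast
  qed
  define d where "d w v = deriv (%l. G (w + l *s v)) 0" for w v
  have alg: "a * (x / a - y) = x - a * y" if "a ~= 0" for a x y :: complex
    using that by (simp add: field_simps)
  have canc: "cmod X \<le> C * \<bar>t\<bar>" if "cmod (of_real t * X) \<le> C * t\<^sup>2" "t ~= 0" for X and t C :: real
  proof -
    have "\<bar>t\<bar> * cmod X \<le> \<bar>t\<bar> * (C * \<bar>t\<bar>)"
      using that(1) by (simp add: norm_mult power2_eq_square mult.left_commute)
    then show ?thesis using that(2) by simp
  qed
  define C where "C = 32 * M / r\<^sup>2"
  have est: "cmod (G (w + l *s v) - G w - l * d w v) \<le> C * (cmod l)\<^sup>2"
    if "w \<in> ball z r" "norm v \<le> 1" "cmod l \<le> r/4" for w v l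
    using taylor2_bound[OF hol[OF that(1,2)] _ r(1) that(3)] M in2[OF that(1,2)] by (auto simp: d_def C_def)
  have "M \<ge> 0" using order_trans[OF norm_ge_zero M[of z]] r by simp
  then have C0: "C \<ge> 0" by (simp add: C_def)
  have zz: "z \<in> ball z r" using r by simp
  have dscale: "d z (c *s v) = c * d z v" for c v
  proof -
    have "((%l. G (z + l *s v)) has_field_derivative d z v) (at (0*c))"
      using line[OF z, of v] by (simp add: d_def DERIV_deriv_iff_field_differentiable)
    moreover have "((%l. l * c) has_field_derivative c) (at 0)" by (auto intro!: derivative_eq_intros)
    ultimately have "((%l. G (z + (l * c) *s v)) has_field_derivative d z v * c) (at 0)"
      using DERIV_chain2[of "%l. G (z + l *s v)" "d z v" "%l. l*c" 0 c] by simp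
    then show ?thesis unfolding d_def by (auto simp: vector_smult_assoc mult.commute intro!: DERIV_imp_deriv)
  qed
  \<comment> \<open>Difference quotients \<open>Q\<close> with a fixed step \<open>m\<close> are
    continuous and approximate the directional derivative uniformly up to \<open>C * m\<close>,
    where \<open>m\<close> may be small.\<close>
  have dcont: "(%t. d (z + of_real t *s u) v) \<midarrow>0\<rightarrow> d z v" if v: "norm v \<le> 1" and u: "norm u \<le> 1" for u v
    unfolding LIM_eq
  proof (intro allI impI)
    fix e :: real assume e: "e > 0"
    define m where "m = min (r/4) (e / (4*(C+1)))"
    have m: "m > 0" "m \<le> r/4" "C * m \<le> e/4"
    proof -
      show "m > 0" using r e C0 by (auto simp: m_def)
      show "m \<le> r/4" unfolding m_def by (rule min.cobounded1)
      have "C * m \<le> (C+1) * (e / (4*(C+1)))" by (rule mult_mono) (use C0 \<open>m>0\<close> e in \<open>auto simp: m_def\<close>)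
      also have "(C+1) * (e / (4*(C+1))) = e/4" using C0 by (auto simp: divide_simps)
      finally show "C * m \<le> e/4" .
    qed
    define Q where "Q t = (G (z + of_real t *s u + of_real m *s v) - G (z + of_real t *s u)) / of_real m" for t :: real
    have "isCont Q 0"
    proof -
      have "continuous_on (ball 0 r) (%t::real. G (z + of_real t *s u + of_real m *s v))"
      proof (rule continuous_on_compose2[OF cont])
        show "(%t::real. z + of_real t *s u + of_real m *s v) ` ball 0 r \<subseteq> U"
        proof safe
          fix t :: real assume t: "t \<in> ball 0 r"
          have "norm (of_real t *s u) \<le> \<bar>t\<bar> * 1" unfolding norm_vsm norm_of_real by (rule mult_left_mono) (use u in auto)
          then have "z + of_real t *s u \<in> ball z r" using t by (simp add: dist_norm)
          then show "z + of_real t *s u + of_real m *s v \<in> U" using in2[of _ v "of_real m"] v m r by (force simp: )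
        qed
      qed (intro continuous_intros)
      moreover have "continuous_on (ball 0 r) (%t::real. G (z + of_real t *s u))"
      proof (rule continuous_on_compose2[OF cont])
        show "(%t::real. z + of_real t *s u) ` ball 0 r \<subseteq> U"
          using in2[OF zz u, of "of_real t" for t] r by force
      qed (intro continuous_intros)
      ultimately have "continuous_on (ball 0 r) Q" unfolding Q_def using m by (intro continuous_intros) auto
      then show ?thesis using r by (simp add: continuous_on_eq_continuous_at)
    qed
    then obtain s where s: "s > 0" "!!t. dist t 0 < s ==> dist (Q t) (Q 0) < e/4"
      unfolding continuous_at_eps_delta using e by (metis divide_pos_pos zero_less_numeral)
    have near: "cmod (d (z + of_real t *s u) v - Q t) \<le> C * m" if "\<bar>t\<bar> < r" for t
    proof -
      have "norm (of_real t *s u) \<le> \<bar>t\<bar> * 1" unfolding norm_vsm norm_of_real by (rule mult_left_mono) (use u in auto)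
      then have w: "z + of_real t *s u \<in> ball z r" using that by (simp add: dist_norm)
      have "cmod (of_real m * (Q t - d (z + of_real t *s u) v)) \<le> C * m\<^sup>2"
        using est[OF w v, of "of_real m"] m by (simp add: Q_def alg)
      from canc[OF this] show ?thesis using m by (simp add: norm_minus_commute)
    qed
    show "\<exists>s>0. \<forall>t. t ~= 0 \<and> norm (t - 0) < s --> norm (d (z + of_real t *s u) v - d z v) < e"
    proof (intro exI[of _ "min s r"] conjI allI impI)
      show "0 < min s r" using s r by simp
      fix t :: real assume "t ~= 0 \<and> norm (t - 0) < min s r"
      then have t: "\<bar>t\<bar> < s" "\<bar>t\<bar> < r" by auto
      have "norm (d (z + of_real t *s u) v - d z v) \<le> cmod (d (z + of_real t *s u) v - Q t) + cmod (Q t - Q 0) + cmod (Q 0 - d z v)"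
        using norm_triangle_ineq[of "d (z + of_real t *s u) v - Q t" "Q t - d z v"] norm_triangle_ineq[of "Q t - Q 0" "Q 0 - d z v"] by simp
      also have "\<dots> < e" using near[OF t(2)] near[of 0] s(2)[of t] t(1) m(3) r e by (simp add: norm_minus_commute dist_norm)
      finally show "norm (d (z + of_real t *s u) v - d z v) < e" .
    qed
  qed
  have quot: "((%t::real. (G (z + of_real t *s v) - G z) / of_real t) \<longlongrightarrow> d z v) (at 0)" for v
  proof -
    have "((%l. G (z + l *s v)) has_field_derivative d z v) (at 0)"
      using line[OF z, of v] by (simp add: d_def DERIV_deriv_iff_field_differentiable)
    then have "((%h. (G (z + h *s v) - G z) / h) \<longlongrightarrow> d z v) (at 0)" by (simp add: DERIV_def)
    moreover have "filterlim (%t::real. complex_of_real t) (at 0) (at 0)"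
      by (rule filterlim_atI) (auto intro!: tendsto_eq_intros simp: eventually_at_filter)
    ultimately show ?thesis by (rule filterlim_compose)
  qed
  \<comment> \<open>A step in direction \<open>u + v\<close> is a step in direction \<open>u\<close>
    followed by one in direction \<open>v\<close> from the shifted point; by \<open>dcont\<close>
    the derivative at the shifted point tends to \<open>d z v\<close>.\<close>
  have dadd0: "d z (u + v) = d z u + d z v" if v: "norm v \<le> 1" and u: "norm u \<le> 1" for u v
  proof -
    have "((%t::real. (G (z + of_real t *s (u+v)) - G (z + of_real t *s u)) / of_real t - d (z + of_real t *s u) v) \<longlongrightarrow> 0) (at 0)"
    proof (rule Lim_null_comparison)
      show "\<forall>\<^sub>F t in at 0. norm ((G (z + of_real t *s (u+v)) - G (z + of_real t *s u)) / of_real t - d (z + of_real t *s u) v) \<le> C * \<bar>t\<bar>"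
        unfolding eventually_at
      proof (intro exI[of _ "r/4"] conjI ballI impI)
        show "0 < r/4" using r by simp
        fix t :: real assume "t ~= 0 \<and> dist t 0 < r/4"
        then have t: "t ~= 0" "\<bar>t\<bar> < r/4" by auto
        have "norm (of_real t *s u) \<le> \<bar>t\<bar> * 1" unfolding norm_vsm norm_of_real by (rule mult_left_mono) (use u in auto)
        then have w: "z + of_real t *s u \<in> ball z r" using t r by (simp add: dist_norm)
        have "cmod (of_real t * ((G (z + of_real t *s (u+v)) - G (z + of_real t *s u)) / of_real t - d (z + of_real t *s u) v)) \<le> C * t\<^sup>2"
          using est[OF w v, of "of_real t"] t by (simp add: alg vector_add_ldistrib add.assoc)
        from canc[OF this] t show "norm ((G (z + of_real t *s (u+v)) - G (z + of_real t *s u)) / of_real t - d (z + of_real t *s u) v) \<le> C * \<bar>t\<bar>"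
          by simp
      qed
      show "((%t. C * \<bar>t\<bar>) \<longlongrightarrow> 0) (at 0)" by (auto intro!: tendsto_eq_intros)
    qed
    from tendsto_add[OF tendsto_add[OF this dcont[OF v u]] quot[of u]]
    have "((%t::real. (G (z + of_real t *s (u+v)) - G z) / of_real t) \<longlongrightarrow> d z v + d z u) (at 0)"
      by (simp add: diff_divide_distrib algebra_simps)
    from tendsto_unique[OF _ quot[of "u+v"] this] show ?thesis by simp
  qed
  have dadd: "d z (u + v) = d z u + d z v" for u v
  proof -
    define m where "m = complex_of_real (1 + norm u + norm v)"
    have nm: "cmod m = 1 + norm u + norm v"
      unfolding m_def norm_of_real by simp
    then have m0: "m ~= 0" by (smt (verit) norm_ge_zero norm_zero)
    have sm: "norm (inverse m *s w) \<le> 1" if "norm w \<le> 1 + norm u + norm v" for w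
      unfolding norm_vsm norm_inverse nm using that norm_ge_zero[of u] norm_ge_zero[of v]
      by (simp add: field_simps add_pos_nonneg)
    have "d z (inverse m *s u + inverse m *s v) = d z (inverse m *s u) + d z (inverse m *s v)"
      by (rule dadd0) (rule sm, simp)+
    then show ?thesis using m0 by (simp add: dscale flip: vector_add_ldistrib distrib_left)
  qed
  define a :: "complex^'n" where "a = (\<chi> i. d z (axis i 1))"
  have dsum: "d z (\<Sum>i\<in>I. g i) = (\<Sum>i\<in>I. d z (g i))" if "finite I" for I and g :: "'n => complex^'n"
    using that by (induction I rule: finite_induct) (use dadd dscale[of 0 0] in auto)
  have deq: "d z v = (\<Sum>i\<in>UNIV. a $ i * v $ i)" for v
  proof -
    have "v = (\<Sum>i\<in>UNIV. v $ i *s axis i 1)" by (simp add: basis_expansion)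
    then have "d z v = (\<Sum>i\<in>UNIV. d z (v $ i *s axis i 1))" by (metis dsum finite_class.finite_UNIV)
    then show ?thesis by (simp add: dscale a_def mult.commute)
  qed
  have "(G has_derivative (%v. \<Sum>i\<in>UNIV. a $ i * v $ i)) (at z)"
    unfolding has_derivative_at
  proof
    show "bounded_linear (%v::complex^'n. \<Sum>i\<in>UNIV. a $ i * v $ i)"
      by (intro bounded_linear_sum bounded_linear_const_mult bounded_linear_vec_nth)
    show "(%h. norm (G (z + h) - G z - (\<Sum>i\<in>UNIV. a $ i * h $ i)) / norm h) \<midarrow>0\<rightarrow> 0"
    proof (rule Lim_null_comparison)
      show "\<forall>\<^sub>F h in at 0. norm (norm (G (z + h) - G z - (\<Sum>i\<in>UNIV. a $ i * h $ i)) / norm h) \<le> C * norm h"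
        unfolding eventually_at
      proof (intro exI[of _ "r/4"] conjI ballI impI)
        show "0 < r/4" using r by simp
        fix h :: "complex^'n" assume "h ~= 0 \<and> dist h 0 < r/4"
        then have h: "h ~= 0" "norm h < r/4" by auto
        define v where "v = inverse (of_real (norm h)) *s h"
        have v: "norm v \<le> 1" using h by (simp add: v_def norm_vsm norm_inverse)
        have hv: "h = of_real (norm h) *s v" using h by (simp add: v_def vector_smult_assoc)
        have "cmod (G (z + h) - G z - d z h) \<le> C * (norm h)\<^sup>2"
          using est[OF zz v, of "of_real (norm h)"] h hv dscale[of "of_real (norm h)" v] by simp
        then show "norm (norm (G (z + h) - G z - (\<Sum>i\<in>UNIV. a $ i * h $ i)) / norm h) \<le> C * norm h"
          using h by (simp add: deq field_simps power2_eq_square)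
      qed
      show "(%h::complex^'n. C * norm h) \<midarrow>0\<rightarrow> 0" by (auto intro!: tendsto_eq_intros)
    qed
  qed
  then show "\<exists>a. (G has_derivative (%v. \<Sum>i\<in>UNIV. a $ i * v $ i)) (at z)" by blast
qed

section \<open>Gradients and the calculus of holomorphic functions\<close>

definition grad :: "(complex^'n => complex) => complex^'n => complex^'n" where
  "grad h z = (\<chi> i. deriv (%l. h (z + l *s axis i 1)) 0)"

text \<open>Bilinear rather than Hermitian, so that the complex-linear functionals are exactly the
  maps \<open>cdot a\<close> and gradients depend holomorphically on the point.\<close>

definition cdot :: "complex^'n => complex^'n => complex" where
  "cdot a v = (\<Sum>i\<in>UNIV. a $ i * v $ i)"

lemma cdot_simps [simp]: "cdot a 0 = 0" "cdot 0 v = 0" "cdot a (axis i 1) = a $ i"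
  "cdot (axis i 1) v = v $ i" "cdot a (c *s v) = c * cdot a v" "cdot (c *s a) v = c * cdot a v"
  "cdot a (u + v) = cdot a u + cdot a v" "cdot a (u - v) = cdot a u - cdot a v"
  "cdot (a + b) v = cdot a v + cdot b v" "cdot (a - b) v = cdot a v - cdot b v"
proof -
  have "axis i 1 $ j * v $ j = (if j = i then v $ j else 0)" "a $ j * axis i 1 $ j = (if j = i then a $ j else 0)" for j
    by (auto simp: axis_def)
  then show "cdot a (axis i 1) = a $ i" "cdot (axis i 1) v = v $ i"
    by (simp_all add: cdot_def)
qed (auto simp: cdot_def algebra_simps sum.distrib sum_subtractf sum_distrib_left)

lemma cdot_eta: "(%v. \<Sum>i\<in>UNIV. a $ i * v $ i) = cdot a" "cdot 0 = (%v. 0)"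
  by (auto simp: cdot_def fun_eq_iff)

lemma bounded_linear_cdot: "bounded_linear (cdot a)"
  unfolding cdot_def by (intro bounded_linear_sum bounded_linear_const_mult bounded_linear_vec_nth)

lemma continuous_on_cdot [continuous_intros]:
  "continuous_on S f ==> continuous_on S g ==> continuous_on S (%x. cdot (f x) (g x))"
  unfolding cdot_def by (intro continuous_intros)

lemma line_has_derivative: "((%l. z + l *s v) has_derivative (%l. l *s (v::complex^'n))) (at l0)"
proof -
  have "((%l. l *s v) has_derivative (%l. l *s v)) (at l0)"
    by (rule bounded_linear_imp_has_derivative[OF bounded_linear_vsm])
  then show ?thesis by (auto intro!: derivative_eq_intros)
qed

lemma has_derivative_line:
  assumes "(h has_derivative cdot a) (at (z + l0 *s v))"
  shows "((%l. h (z + l *s v)) has_field_derivative cdot a v) (at l0)"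
proof -
  have "((%l. h (z + l *s v)) has_derivative (%l. cdot a (l *s v))) (at l0)"
    using has_derivative_compose[OF line_has_derivative assms] .
  then show ?thesis by (simp add: has_field_derivative_def mult_commute_abs)
qed

lemma has_derivative_imp_grad:
  assumes "(h has_derivative cdot a) (at z)" shows "grad h z = a"
proof -
  have "((%l. h (z + l *s axis i 1)) has_field_derivative a $ i) (at 0)" for i
    using has_derivative_line[of h a z 0 "axis i 1"] assms by simp
  then show ?thesis by (simp add: grad_def vec_eq_iff DERIV_imp_deriv)
qed

lemma holo_iff: "holo_fun_on h U \<longleftrightarrow> (\<forall>z\<in>U. (h has_derivative cdot (grad h z)) (at z))"
  unfolding holo_fun_on_def cdot_eta using has_derivative_imp_grad by metis

lemma holo_D: "holo_fun_on h U ==> z \<in> U ==> (h has_derivative cdot (grad h z)) (at z)"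
  by (simp add: holo_iff)

lemma holo_I: "(!!z. z \<in> U ==> (h has_derivative cdot (a z)) (at z)) ==> holo_fun_on h U"
  unfolding holo_fun_on_def cdot_eta by blast

lemma holo_line:
  assumes "holo_fun_on h U" "z + l0 *s v \<in> U"
  shows "((%l. h (z + l *s v)) has_field_derivative cdot (grad h (z + l0 *s v)) v) (at l0)"
  using has_derivative_line[OF holo_D[OF assms]] .

lemma holo_line_on:
  assumes "holo_fun_on h U" "!!l. l \<in> T ==> z + l *s v \<in> U"
  shows "(%l. h (z + l *s v)) holomorphic_on T"
  unfolding holomorphic_on_def field_differentiable_def
  using holo_line[OF assms(1)] assms(2) has_field_derivative_at_within by blast

lemma holo_continuous: "holo_fun_on h U ==> continuous_on U h"
  by (meson holo_D continuous_at_imp_continuous_on has_derivative_continuous)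

lemma holo_subset: "holo_fun_on h U ==> W \<subseteq> U ==> holo_fun_on h W"
  by (auto simp: holo_fun_on_def)

lemma holo_local: "(!!z. z \<in> U ==> \<exists>V. z \<in> V \<and> holo_fun_on h V) ==> holo_fun_on h U"
  unfolding holo_fun_on_def by blast

lemma holo_cong:
  assumes "holo_fun_on h U" "open U" "!!z. z \<in> U ==> h z = k z"
  shows "holo_fun_on k U"
  using assms has_derivative_transform_within_open unfolding holo_fun_on_def by blast

lemma grad_cong:
  assumes "open U" "z \<in> U" "!!z. z \<in> U ==> h z = k z" "holo_fun_on h U"
  shows "grad k z = grad h z"
  using has_derivative_transform_within_open[OF holo_D[OF assms(4,2)] assms(1,2,3)] has_derivative_imp_grad by blast

lemma holo_const [simp]: "holo_fun_on (%z. c) U"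
  by (rule holo_I[where a="%_. 0"]) (simp add: cdot_eta)

lemma cdot_linear_rep:
  assumes "bounded_linear L" "!!c v. L (c *s v) = c * L v"
  shows "L = cdot (\<chi> i. L (axis i 1))"
proof
  fix v :: "complex^'a"
  interpret bounded_linear L by fact
  have "L v = L (\<Sum>i\<in>UNIV. v $ i *s axis i 1)" by (simp add: basis_expansion)
  then show "L v = cdot (\<chi> i. L (axis i 1)) v" by (simp add: sum assms(2) cdot_def mult.commute)
qed

text \<open>A real derivative that commutes with complex scalars is complex linear. The rules for
  real derivatives thus suffice for the closure properties below.\<close>

lemma holo_I': assumes "!!z. z \<in> U ==> \<exists>L. (h has_derivative L) (at z) \<and> (\<forall>c v. L (c *s v) = c * L v)"
  shows "holo_fun_on h U"
  unfolding holo_fun_on_def cdot_eta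
proof
  fix z assume "z \<in> U"
  then obtain L where "(h has_derivative L) (at z)" "\<forall>c v. L (c *s v) = c * L v" using assms by blast
  then show "\<exists>a. (h has_derivative cdot a) (at z)"
    using cdot_linear_rep[of L] has_derivative_bounded_linear by metis
qed

lemma holo_nth [simp]: "holo_fun_on (%z. z $ i) U"
  by (rule holo_I') (auto intro!: exI[of _ "%v. v $ i"] bounded_linear_imp_has_derivative bounded_linear_vec_nth)

lemma holo_cdot [simp]: "holo_fun_on (%z. cdot a z) U"
  by (rule holo_I[where a="%_. a"]) (auto intro!: bounded_linear_imp_has_derivative bounded_linear_cdot)

lemma grad_cdot [simp]: "grad (%z. cdot a z) z = a"
  by (auto intro!: has_derivative_imp_grad bounded_linear_imp_has_derivative bounded_linear_cdot)

lemma grad_nth [simp]: "grad (%z. z $ i) z = axis i 1"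
proof -
  have "(%z::complex^'a. z $ i) = cdot (axis i 1)" by auto
  then show ?thesis using grad_cdot[of "axis i 1"] by metis
qed

lemma holo_add: assumes "holo_fun_on f U" "holo_fun_on g U" shows "holo_fun_on (%z. f z + g z) U"
  by (rule holo_I') (auto intro!: exI derivative_eq_intros holo_D[OF assms(1)] holo_D[OF assms(2)] simp: algebra_simps)

lemma holo_diff: assumes "holo_fun_on f U" "holo_fun_on g U" shows "holo_fun_on (%z. f z - g z) U"
  by (rule holo_I') (auto intro!: exI derivative_eq_intros holo_D[OF assms(1)] holo_D[OF assms(2)] simp: algebra_simps)

lemma holo_mult: assumes "holo_fun_on f U" "holo_fun_on g U" shows "holo_fun_on (%z. f z * g z) U"
  by (rule holo_I') (auto intro!: exI derivative_eq_intros holo_D[OF assms(1)] holo_D[OF assms(2)] simp: algebra_simps)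

lemma holo_inverse: assumes "holo_fun_on f U" "!!z. z \<in> U ==> f z ~= 0" shows "holo_fun_on (%z. inverse (f z)) U"
  by (rule holo_I') (auto intro!: exI Deriv.has_derivative_inverse holo_D[OF assms(1)] simp: assms(2) algebra_simps)

lemma holo_divide: assumes "holo_fun_on f U" "holo_fun_on g U" "!!z. z \<in> U ==> g z ~= 0"
  shows "holo_fun_on (%z. f z / g z) U"
  unfolding divide_inverse by (intro holo_mult holo_inverse assms)

lemma holo_sum: "(!!i. i \<in> I ==> holo_fun_on (f i) U) ==> holo_fun_on (%z. \<Sum>i\<in>I. f i z) U"
  by (induction I rule: infinite_finite_induct) (auto intro: holo_add)

lemma holo_prod: "(!!i. i \<in> I ==> holo_fun_on (f i) U) ==> holo_fun_on (%z. \<Prod>i\<in>I. f i z) U"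
  by (induction I rule: infinite_finite_induct) (auto intro: holo_mult)

lemma has_derivative_vec:
  fixes f :: "'a::real_normed_vector => complex^'m"
  assumes "!!i. ((%x. f x $ i) has_derivative (%x. f' x $ i)) (at x within S)"
  shows "(f has_derivative f') (at x within S)"
proof (subst has_derivative_componentwise_within, rule ballI)
  fix b :: "complex^'m" assume "b \<in> Basis"
  then obtain i c where b: "b = axis i c" by (auto simp: Basis_vec_def)
  show "((%x. f x \<bullet> b) has_derivative (%x. f' x \<bullet> b)) (at x within S)"
    using has_derivative_inner_left[OF assms[of i], of c] by (simp add: b inner_axis)
qed

section \<open>Jacobian matrices and the chain rule\<close>

definition jac :: "(complex^'n => complex^'m) => complex^'n => complex^'n^'m" where
  "jac \<phi> z = (\<chi> i. grad (%z. \<phi> z $ i) z)"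

lemma jac_mult: "(jac \<phi> z *v v) $ i = cdot (grad (%z. \<phi> z $ i) z) v"
  by (simp add: jac_def matrix_vector_mult_def cdot_def)

lemma holo_map_D:
  assumes "holo_map_on \<phi> U" "z \<in> U" shows "(\<phi> has_derivative (%v. jac \<phi> z *v v)) (at z)"
proof (rule has_derivative_vec)
  fix i
  have "(%v. (jac \<phi> z *v v) $ i) = cdot (grad (%z. \<phi> z $ i) z)" by (simp add: jac_mult fun_eq_iff)
  then show "((%x. \<phi> x $ i) has_derivative (%v. (jac \<phi> z *v v) $ i)) (at z)"
    using holo_D[of "%z. \<phi> z $ i" U z] assms by (simp add: holo_map_on_def)
qed

lemma holo_map_continuous: "holo_map_on \<phi> U ==> continuous_on U \<phi>"
  by (meson holo_map_D continuous_at_imp_continuous_on has_derivative_continuous)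

lemma matrix_vsm: "A *v (c *s v) = c *s (A *v (v::complex^'n))"
  by (simp add: matrix_vector_mult_def vec_eq_iff sum_distrib_left algebra_simps)

lemma compose_has_derivative:
  assumes "holo_map_on \<phi> U" "holo_fun_on h W" "z \<in> U" "\<phi> z \<in> W"
  shows "((%z. h (\<phi> z)) has_derivative (%v. cdot (grad h (\<phi> z)) (jac \<phi> z *v v))) (at z)"
  by (rule has_derivative_compose[OF holo_map_D[OF assms(1,3)] holo_D[OF assms(2,4)]])

lemma holo_compose:
  assumes "holo_map_on \<phi> U" "holo_fun_on h W" "!!z. z \<in> U ==> \<phi> z \<in> W"
  shows "holo_fun_on (%z. h (\<phi> z)) U"
  by (rule holo_I') (use compose_has_derivative[OF assms(1,2)] assms(3) in \<open>auto simp: matrix_vsm intro!: exI\<close>)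

lemma cdot_grad_compose:
  assumes "holo_map_on \<phi> U" "holo_fun_on h W" "z \<in> U" "\<phi> z \<in> W"
  shows "cdot (grad (%z. h (\<phi> z)) z) v = cdot (grad h (\<phi> z)) (jac \<phi> z *v v)"
proof -
  let ?L = "%v. cdot (grad h (\<phi> z)) (jac \<phi> z *v v)"
  have d: "((%z. h (\<phi> z)) has_derivative ?L) (at z)" by (rule compose_has_derivative[OF assms])
  then have "?L = cdot (\<chi> i. ?L (axis i 1))"
    by (intro cdot_linear_rep) (auto simp: matrix_vsm has_derivative_bounded_linear)
  then have "grad (%z. h (\<phi> z)) z = (\<chi> i. ?L (axis i 1))"
    using d has_derivative_imp_grad by metis
  then show ?thesis using \<open>?L = _\<close> by metis
qed

lemma holo_map_compose:
  assumes "holo_map_on \<phi> U" "holo_map_on \<psi> W" "!!z. z \<in> U ==> \<phi> z \<in> W"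
  shows "holo_map_on (%z. \<psi> (\<phi> z)) U"
  using holo_compose[OF assms(1)] assms(2,3) by (auto simp: holo_map_on_def)

lemma jac_compose:
  assumes "holo_map_on \<phi> U" "holo_map_on \<psi> W" "z \<in> U" "\<phi> z \<in> W"
  shows "jac (%z. \<psi> (\<phi> z)) z = jac \<psi> (\<phi> z) ** jac \<phi> z"
proof -
  have "jac (%z. \<psi> (\<phi> z)) z *v v = jac \<psi> (\<phi> z) *v (jac \<phi> z *v v)" for v
    using cdot_grad_compose[OF assms(1) _ assms(3,4), of "%z. \<psi> z $ i" for i] assms(2)
    by (auto simp: vec_eq_iff jac_mult holo_map_on_def)
  then show ?thesis by (simp add: matrix_eq matrix_vector_mul_assoc)
qed

lemma holo_map_subset: "holo_map_on \<phi> U ==> W \<subseteq> U ==> holo_map_on \<phi> W"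
  by (auto simp: holo_map_on_def intro: holo_subset)

lemma holo_map_shift: "holo_map_on (%z. z + a) U" "holo_map_on (%z. z) U"
  by (auto simp: holo_map_on_def intro!: holo_add)

lemma holo_det:
  fixes A :: "complex^'n => complex^'m^'m"
  assumes "!!i j. holo_fun_on (%z. A z $ i $ j) U" shows "holo_fun_on (%z. det (A z)) U"
  unfolding det_def by (intro holo_sum holo_mult holo_prod holo_const assms)

text \<open>On the complex line through a point of \<open>W\<close> and \<open>z\<close>, the
  parameters that stay in \<open>U\<close> form a convex set, so the identity theorem in one
  variable applies.\<close>

lemma identity_convex:
  assumes h: "holo_fun_on h U" and U: "open U" "convex U" and W: "open W" "W ~= {}" "W \<subseteq> U"
    and zero: "!!z. z \<in> W ==> h z = 0" and z: "z \<in> U"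
  shows "h z = 0"
proof -
  obtain a where a: "a \<in> W" using W by blast
  define T where "T = {l::complex. a + l *s (z - a) \<in> U}"
  have lin: "a + ((1-u) *\<^sub>R x + u *\<^sub>R y) *s (z - a) = (1-u) *\<^sub>R (a + x *s (z-a)) + u *\<^sub>R (a + y *s (z-a))" for x y :: complex and u :: real
    by (simp add: vec_eq_iff algebra_simps)
  have cont: "continuous_on UNIV (%l::complex. a + l *s (z - a))" by (intro continuous_intros)
  have T: "open T" unfolding T_def using open_vimage[OF U(1) cont] by (simp add: vimage_def)
  have "convex T"
    unfolding convex_alt
  proof safe
    fix x y :: complex and u :: real assume "x \<in> T" "y \<in> T" "0 \<le> u" "u \<le> 1"
    then show "(1 - u) *\<^sub>R x + u *\<^sub>R y \<in> T"
      unfolding T_def mem_Collect_eq lin using U(2) by (simp add: convex_alt)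
  qed
  define P where "P = {l::complex. a + l *s (z - a) \<in> W}"
  have P: "open P" unfolding P_def using open_vimage[OF W(1) cont] by (simp add: vimage_def)
  have "0 \<in> P" "1 \<in> T" "0 \<in> T" using a z W(3) by (auto simp: P_def T_def)
  have hol: "(%l. h (a + l *s (z - a))) holomorphic_on T"
    by (rule holo_line_on[OF h]) (simp add: T_def)
  have "h (a + 1 *s (z - a)) = 0"
  proof (rule analytic_continuation_open[where s=P and s'=T and g="%_. 0" and f="%l. h (a + l *s (z - a))" and z=1])
    show "connected T" using \<open>convex T\<close> by (rule convex_connected)
    show "P \<subseteq> T" using W(3) by (auto simp: P_def T_def)
    show "h (a + l *s (z - a)) = 0" if "l \<in> P" for l using that zero by (simp add: P_def)
    show "P ~= {}" using \<open>0 \<in> P\<close> by blast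
  qed (use P T \<open>1 \<in> T\<close> hol in auto)
  then show ?thesis by simp
qed

section \<open>Contour integrals with parameters and the inverse function theorem\<close>

lemma contour_integral_circle_continuous:
  fixes K :: "'a::topological_space => complex => complex"
  assumes K: "continuous_on (U \<times> sphere c \<bar>r\<bar>) (%(z, \<xi>). K z \<xi>)"
  shows "continuous_on U (%z. contour_integral (circlepath c r) (K z))"
proof -
  have "continuous_on (U \<times> cbox 0 1) (%(z,t). K z (circlepath c r t) * (2 * pi * \<i> * r * exp(2 * of_real pi * \<i> * of_real t)))"
    unfolding case_prod_unfold
  proof (intro continuous_intros)
    have "continuous_on (U \<times> cbox 0 1) (%x. circlepath c r (snd x))"
      unfolding circlepath by (intro continuous_intros)
    moreover have "circlepath c r t \<in> sphere c \<bar>r\<bar>" if "t \<in> cbox 0 1" for t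
      using that path_image_circlepath[of c r] unfolding path_image_def by auto
    ultimately have "continuous_on (U \<times> cbox 0 1) (%x. (%(z, \<xi>). K z \<xi>) (fst x, circlepath c r (snd x)))"
      by (intro continuous_on_compose2[OF K]) (auto intro!: continuous_intros)
    then show "continuous_on (U \<times> cbox 0 1) (%x. K (fst x) (circlepath c r (snd x)))" by simp
  qed
  from integral_continuous_on_param[OF this]
  show ?thesis by (simp add: contour_integral_integral vector_derivative_circlepath)
qed

lemma continuous_on_curry:
  assumes "continuous_on (U \<times> S) (%(z, \<xi>). K z \<xi>)" "z \<in> U" shows "continuous_on S (K z)"
proof -
  have "continuous_on S (%x. (%(z, \<xi>). K z \<xi>) (z, x))"
    by (rule continuous_on_compose2[OF assms(1)]) (use assms(2) in \<open>auto intro!: continuous_intros\<close>)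
  then show ?thesis by simp
qed

lemma norm_axis_c: "norm (axis i (1::complex)) = 1"
  by (simp add: norm_eq_sqrt_inner inner_axis_axis)

lemma matrix_inv_works: "invertible A ==> A ** matrix_inv A = mat 1 \<and> matrix_inv A ** A = mat 1"
  unfolding invertible_def matrix_inv_def by (rule someI_ex)

text \<open>Along a complex line the integral is its own Cauchy integral, because the kernel is and
  the two contour integrals may be swapped. Hence it is differentiable along lines and
  \<open>osgood\<close> applies.\<close>

lemma holo_contour_integral:
  fixes K :: "complex^'n => complex => complex"
  assumes U: "open U" and r: "r > 0" and K: "continuous_on (U \<times> sphere c r) (%(z, \<xi>). K z \<xi>)"
    and hol: "!!\<xi>. \<xi> \<in> sphere c r ==> holo_fun_on (%z. K z \<xi>) U"
  shows "holo_fun_on (%z. contour_integral (circlepath c r) (K z)) U"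
proof (rule osgood[OF U])
  show cont: "continuous_on U (%z. contour_integral (circlepath c r) (K z))"
    using contour_integral_circle_continuous[of U c r K] K r by simp
  fix z v assume z: "z \<in> U"
  have cl: "continuous_on UNIV (%l::complex. z + l *s v)" by (intro continuous_intros)
  have "open ((%l::complex. z + l *s v) -` U)" using open_vimage[OF U cl] .
  moreover have "0 \<in> (%l::complex. z + l *s v) -` U" using z by simp
  ultimately obtain s where s: "s > 0" "cball 0 s \<subseteq> (%l::complex. z + l *s v) -` U"
    using open_contains_cball by blast
  define G where "G l = contour_integral (circlepath c r) (K (z + l *s v))" for l
  have Gc: "continuous_on (cball 0 s) G"
    unfolding G_def by (rule continuous_on_compose2[OF cont]) (use s in \<open>auto intro!: continuous_intros\<close>)
  have vdc: "continuous_on {0..1} (%t. vector_derivative (circlepath a b) (at t))" for a b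
    unfolding vector_derivative_circlepath by (intro continuous_intros)
  have *: "((%u. G u / (u - w)) has_contour_integral (2 * pi * \<i> * G w)) (circlepath 0 s)" if w: "w \<in> ball 0 s" for w
  proof -
    have ne: "u - w ~= 0" if "u \<in> sphere 0 s" for u using that w by auto
    have pc: "continuous_on (sphere 0 s \<times> sphere c r) (%(u, \<xi>). K (z + u *s v) \<xi> / (u - w))"
      unfolding case_prod_unfold
    proof (intro continuous_intros)
      show "continuous_on (sphere 0 s \<times> sphere c r) (%x. K (z + fst x *s v) (snd x))"
        using continuous_on_compose2[OF K, of "sphere 0 s \<times> sphere c r" "%x. (z + fst x *s v, snd x)"] s
        by (force intro!: continuous_intros)
    qed (use ne in auto)
    have ci: "(%u. G u / (u - w)) contour_integrable_on (circlepath 0 s)"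
      by (rule contour_integrable_continuous_circlepath)
        (use ne s in \<open>auto intro!: continuous_intros continuous_on_subset[OF Gc]\<close>)
    have "contour_integral (circlepath 0 s) (%u. G u / (u - w)) =
       contour_integral (circlepath 0 s) (%u. contour_integral (circlepath c r) (%\<xi>. K (z + u *s v) \<xi> / (u - w)))"
    proof (rule contour_integral_cong[OF refl])
      fix u assume u: "u \<in> path_image (circlepath 0 s)"
      have "K (z + u *s v) contour_integrable_on circlepath c r"
      proof (rule contour_integrable_continuous_circlepath)
        have "z + u *s v \<in> U" using u s by (auto simp: subset_eq)
        then show "continuous_on (path_image (circlepath c r)) (K (z + u *s v))"
          using continuous_on_curry[OF K] r by simp
      qed
      then show "G u / (u - w) = contour_integral (circlepath c r) (%\<xi>. K (z + u *s v) \<xi> / (u - w))"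
        by (simp add: G_def contour_integral_div)
    qed
    also have "\<dots> = contour_integral (circlepath c r) (%\<xi>. contour_integral (circlepath 0 s) (%u. K (z + u *s v) \<xi> / (u - w)))"
      by (rule contour_integral_swap) (use pc r s vdc in auto)
    also have "\<dots> = contour_integral (circlepath c r) (%\<xi>. 2 * pi * \<i> * K (z + w *s v) \<xi>)"
    proof (rule contour_integral_cong[OF refl])
      fix \<xi> assume "\<xi> \<in> path_image (circlepath c r)"
      then have xi: "\<xi> \<in> sphere c r" using r by simp
      have h: "(%u. K (z + u *s v) \<xi>) holomorphic_on cball 0 s"
        by (rule holo_line_on[OF hol[OF xi]]) (use s in auto)
      have "((%u. K (z + u *s v) \<xi> / (u - w)) has_contour_integral (2 * of_real pi * \<i> * K (z + w *s v) \<xi>)) (circlepath 0 s)"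
        by (rule Cauchy_integral_circlepath_simple) (use h w in auto)
      then show "contour_integral (circlepath 0 s) (%u. K (z + u *s v) \<xi> / (u - w)) = 2 * pi * \<i> * K (z + w *s v) \<xi>"
        by (simp add: contour_integral_unique)
    qed
    also have "\<dots> = 2 * pi * \<i> * G w"
    proof -
      have "z + w *s v \<in> U" using w s(2) by (auto simp: subset_eq)
      then have "continuous_on (path_image (circlepath c r)) (K (z + w *s v))"
        using continuous_on_curry[OF K] r by simp
      then have "K (z + w *s v) contour_integrable_on circlepath c r"
        by (rule contour_integrable_continuous_circlepath)
      then show ?thesis by (simp add: G_def contour_integral_lmul)
    qed
    finally show ?thesis using has_contour_integral_integral[OF ci] by simp
  qed
  have "((%w. 2 * pi * \<i> * G w) has_field_derivative (of_nat 1 * contour_integral (circlepath 0 s) (%u. G u / (u - 0) ^ Suc 1))) (at 0)"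
  proof (rule Cauchy_next_derivative_circlepath(2))
    show "continuous_on (path_image (circlepath 0 s)) G" using Gc s continuous_on_subset by force
  qed (use * s in auto)
  note fd = DERIV_cmult[OF this, of "inverse (2 * pi * \<i>)"]
  have *: "inverse (2 * pi * \<i>) * (2 * pi * \<i> * G w) = G w" for w by (simp add: field_simps)
  have "G field_differentiable (at 0)" using fd unfolding * field_differentiable_def by blast
  then show "(%l. contour_integral (circlepath c r) (K (z + l *s v))) field_differentiable (at 0)"
    by (simp add: G_def[abs_def])
qed

text \<open>A partial derivative is a Cauchy integral with kernel \<open>1 / \<xi>^2\<close> over a
  circle of fixed radius, hence holomorphic in the centre.\<close>

lemma holo_grad:
  assumes U: "open U" and h: "holo_fun_on h U" shows "holo_fun_on (%z. grad h z $ i) U"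
proof (rule holo_local)
  fix z0 assume "z0 \<in> U"
  then obtain s where s: "s > 0" "ball z0 (2 * s) \<subseteq> U"
    using U open_contains_ball by (metis field_sum_of_halves half_gt_zero mult_2)
  have inU: "z + \<xi> *s axis i 1 \<in> U" if "z \<in> ball z0 s" "\<xi> \<in> cball 0 s" for z \<xi>
  proof -
    have "dist z0 (z + \<xi> *s axis i 1) \<le> dist z0 z + dist z (z + \<xi> *s axis i 1)" by (rule dist_triangle)
    also have "dist z (z + \<xi> *s axis i 1) = cmod \<xi>" by (simp add: dist_norm norm_vsm norm_axis_c)
    finally show ?thesis using that s by auto
  qed
  have 1: "holo_fun_on (%z. contour_integral (circlepath 0 s) (%\<xi>. h (z + \<xi> *s axis i 1) / \<xi>^2)) (ball z0 s)"
  proof (rule holo_contour_integral)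
    show "continuous_on (ball z0 s \<times> sphere 0 s) (%(z, \<xi>). h (z + \<xi> *s axis i 1) / \<xi>\<^sup>2)"
      unfolding case_prod_unfold
    proof (intro continuous_intros)
      show "continuous_on (ball z0 s \<times> sphere 0 s) (%x. h (fst x + snd x *s axis i 1))"
        by (rule continuous_on_compose2[OF holo_continuous[OF h]]) (use inU in \<open>auto intro!: continuous_intros\<close>)
    qed (use s in auto)
    show "holo_fun_on (%z. h (z + \<xi> *s axis i 1) / \<xi>\<^sup>2) (ball z0 s)" if "\<xi> \<in> sphere 0 s" for \<xi>
      by (intro holo_divide holo_const holo_compose[OF holo_map_shift(1) h]) (use that inU s in auto)
  qed (use s in auto)
  have 2: "contour_integral (circlepath 0 s) (%\<xi>. h (z + \<xi> *s axis i 1) / \<xi>^2) = 2 * pi * \<i> * grad h z $ i" if z: "z \<in> ball z0 s" for z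
  proof -
    have hol: "(%\<xi>. h (z + \<xi> *s axis i 1)) holomorphic_on cball 0 s"
      by (rule holo_line_on[OF h]) (use z inU in auto)
    have "((%u. h (z + u *s axis i 1) / (u - 0)^(Suc 1)) has_contour_integral ((2 * pi * \<i>) / (fact 1) * (deriv ^^ 1) (%\<xi>. h (z + \<xi> *s axis i 1)) 0)) (circlepath 0 s)"
      by (rule Cauchy_has_contour_integral_higher_derivative_circlepath)
        (use hol s in \<open>auto intro: holomorphic_on_imp_continuous_on holomorphic_on_subset\<close>)
    then show ?thesis by (simp add: contour_integral_unique grad_def numeral_2_eq_2)
  qed
  have *: "inverse (2 * pi * \<i>) * (2 * pi * \<i> * grad h z $ i) = grad h z $ i" for z by (simp add: field_simps)
  have "holo_fun_on (%z. inverse (2 * pi * \<i>) * (2 * pi * \<i> * grad h z $ i)) (ball z0 s)"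
    by (rule holo_mult[OF holo_const holo_cong[OF 1 _ 2]]) auto
  then have "holo_fun_on (%z. grad h z $ i) (ball z0 s)" unfolding * .
  then show "\<exists>V. z0 \<in> V \<and> holo_fun_on (%z. grad h z $ i) V" using s by (intro exI[of _ "ball z0 s"]) auto
qed

section \<open>The holomorphic inverse function theorem\<close>

lemma holo_jac: "open U ==> holo_map_on \<phi> U ==> holo_fun_on (%z. jac \<phi> z $ i $ j) U"
  unfolding jac_def by (simp add: holo_map_on_def holo_grad)

lemma holo_det_jac: "open U ==> holo_map_on \<phi> U ==> holo_fun_on (%z. det (jac \<phi> z)) U"
  by (intro holo_det holo_jac)

text \<open>The real theorem supplies the local inverse. Its derivative is multiplication by the
  inverse of a complex matrix, so it commutes with complex scalars.\<close>

lemma inverse_function_holo: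
  fixes \<Phi> :: "complex^'n => complex^'n"
  assumes U: "open U" and hol: "holo_map_on \<Phi> U" and a: "a \<in> U" and det: "det (jac \<Phi> a) ~= 0"
  obtains V W where "open V" "a \<in> V" "V \<subseteq> U" "biholomorphic \<Phi> V W" "!!z. z \<in> V ==> det (jac \<Phi> z) ~= 0"
proof -
  define U1 where "U1 = U \<inter> (%z. det (jac \<Phi> z)) -` (- {0})"
  have U1: "open U1" unfolding U1_def
    by (rule continuous_open_preimage) (use U hol holo_det_jac holo_continuous in auto)
  have a1: "a \<in> U1" using a det by (simp add: U1_def)
  define f' where "f' z = Blinfun (%v. jac \<Phi> z *v v)" for z
  have bl: "bounded_linear (%v. jac \<Phi> z *v v)" for z
    by (rule matrix_vector_mul_bounded_linear)
  have f': "blinfun_apply (f' z) = (%v. jac \<Phi> z *v v)" for z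
    unfolding f'_def by (rule bounded_linear_Blinfun_apply[OF bl])
  have cont: "continuous_on U1 f'"
    unfolding continuous_on_eq_continuous_within
  proof
    fix z assume z: "z \<in> U1"
    have "continuous_on U1 (%z. jac \<Phi> z *v b)" for b
      unfolding matrix_vector_mult_def
      by (intro continuous_intros holo_continuous holo_subset[OF holo_jac[OF U hol]]) (auto simp: U1_def)
    then show "continuous (at z within U1) f'"
      using z by (intro continuous_blinfun_componentwiseI1) (auto simp: f' continuous_on_eq_continuous_within)
  qed
  define B where "B = matrix_inv (jac \<Phi> a)"
  have inv: "matrix_inv (jac \<Phi> z) ** jac \<Phi> z = mat 1" "jac \<Phi> z ** matrix_inv (jac \<Phi> z) = mat 1" if "z \<in> U1" for z
    using that matrix_inv_works[of "jac \<Phi> z"] by (auto simp: U1_def invertible_det_nz)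
  have blB: "bounded_linear (%v. B *v v)"
    by (rule matrix_vector_mul_bounded_linear)
  obtain V W g g' where VW: "open V" "V \<subseteq> U1" "a \<in> V" "open W" "\<Phi> a \<in> W" "homeomorphism V W \<Phi> g"
    "!!y. y \<in> W ==> (g has_derivative (g' y)) (at y)"
    "!!y. y \<in> W ==> g' y = inv (blinfun_apply (f'(g y)))"
    "!!y. y \<in> W ==> bij (blinfun_apply (f'(g y)))"
  proof (rule inverse_function_theorem[OF U1 _ cont a1, of \<Phi> "Blinfun (%v. B *v v)"])
    show "(\<Phi> has_derivative blinfun_apply (f' x)) (at x)" if "x \<in> U1" for x
      unfolding f' using holo_map_D[OF hol] that by (simp add: U1_def)
    show "Blinfun (%v. B *v v) o\<^sub>L f' a = id_blinfun"
      by (rule blinfun_eqI) (simp add: f' bounded_linear_Blinfun_apply[OF blB] matrix_vector_mul_assoc inv(1)[OF a1, folded B_def])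
  qed blast
  have g: "!!y. y \<in> W ==> g y \<in> V" "!!y. y \<in> W ==> \<Phi> (g y) = y" "!!x. x \<in> V ==> g (\<Phi> x) = x" "\<Phi> ` V = W"
    using VW(6) by (auto simp: homeomorphism_def)
  have bij: "bij_betw \<Phi> V W" using g by (metis bij_betw_def inj_on_inverseI)
  have the: "the_inv_into V \<Phi> y = g y" if "y \<in> W" for y
    using g that bij by (metis bij_betw_def the_inv_into_f_f)
  have gd: "(g has_derivative (%v. matrix_inv (jac \<Phi> (g y)) *v v)) (at y)" if y: "y \<in> W" for y
  proof -
    have "g y \<in> U1" using g(1)[OF y] VW(2) by auto
    have "inv (%v. jac \<Phi> (g y) *v v) = (%v. matrix_inv (jac \<Phi> (g y)) *v v)"
      by (rule inv_unique_comp) (auto simp: fun_eq_iff matrix_vector_mul_assoc inv[OF \<open>g y \<in> U1\<close>])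
    then show ?thesis using VW(7,8)[OF y] by (simp add: f')
  qed
  have "holo_map_on g W"
    unfolding holo_map_on_def
  proof (intro allI holo_I')
    fix i z assume "z \<in> W"
    then show "\<exists>L. ((%z. g z $ i) has_derivative L) (at z) \<and> (\<forall>c v. L (c *s v) = c * L v)"
      using bounded_linear.has_derivative[OF bounded_linear_vec_nth gd, of z i]
      by (intro exI[of _ "%v. (matrix_inv (jac \<Phi> (g z)) *v v) $ i"]) (auto simp: matrix_vsm)
  qed
  note gh = this
  have "holo_map_on (the_inv_into V \<Phi>) W"
    unfolding holo_map_on_def
  proof (intro allI)
    fix i
    show "holo_fun_on (%w. the_inv_into V \<Phi> w $ i) W"
      by (rule holo_cong[of "%w. g w $ i", OF _ VW(4)]) (use gh the in \<open>auto simp: holo_map_on_def\<close>)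
  qed
  then have "biholomorphic \<Phi> V W"
    unfolding biholomorphic_def using VW bij holo_map_subset[OF hol] by (auto simp: U1_def)
  then show ?thesis using that[of V W] VW(1,2,3) by (auto simp: U1_def)
qed

lemma biholomorphic_D:
  assumes "biholomorphic \<Phi> V W"
  shows "open V" "open W" "holo_map_on \<Phi> V" "holo_map_on (the_inv_into V \<Phi>) W" "\<Phi> ` V = W" "inj_on \<Phi> V"
    "!!z. z \<in> V ==> the_inv_into V \<Phi> (\<Phi> z) = z" "!!w. w \<in> W ==> \<Phi> (the_inv_into V \<Phi> w) = w"
    "!!w. w \<in> W ==> the_inv_into V \<Phi> w \<in> V" "!!z. z \<in> V ==> \<Phi> z \<in> W"
  using assms unfolding biholomorphic_def bij_betw_def
  by (auto simp: the_inv_into_f_f f_the_inv_into_f intro: the_inv_into_into)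

lemma biholomorphic_restrict:
  assumes "biholomorphic \<Phi> V W" "open W'" "W' \<subseteq> W"
  shows "biholomorphic \<Phi> (V \<inter> \<Phi> -` W') W'"
proof -
  note B = biholomorphic_D[OF assms(1)]
  have o: "open (V \<inter> \<Phi> -` W')"
    by (rule continuous_open_preimage[OF holo_map_continuous[OF B(3)] B(1) assms(2)])
  have im: "\<Phi> ` (V \<inter> \<Phi> -` W') = W'" using B(5) assms(3) by auto
  have inj: "inj_on \<Phi> (V \<inter> \<Phi> -` W')" using B(6) by (auto simp: inj_on_def)
  have "the_inv_into (V \<inter> \<Phi> -` W') \<Phi> w = the_inv_into V \<Phi> w" if "w \<in> W'" for w
    by (rule the_inv_into_f_eq[OF inj]) (use that assms(3) B in auto)
  note eq = this
  have "holo_map_on (the_inv_into (V \<inter> \<Phi> -` W') \<Phi>) W'"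
    unfolding holo_map_on_def
  proof (intro allI)
    fix i
    show "holo_fun_on (%w. the_inv_into (V \<inter> \<Phi> -` W') \<Phi> w $ i) W'"
      by (rule holo_cong[of "%w. the_inv_into V \<Phi> w $ i", OF _ assms(2)])
         (use holo_map_subset[OF B(4) assms(3)] eq in \<open>auto simp: holo_map_on_def\<close>)
  qed
  then show ?thesis unfolding biholomorphic_def
    using o im inj assms(2) holo_map_subset[OF B(3)] by (auto simp: bij_betw_def)
qed

section \<open>The maximum principle on analytic sets\<close>

lemma det_zero_kernel:
  fixes A :: "complex^'n^'n" assumes "det A = 0" obtains v where "v ~= 0" "A *v v = 0"
proof -
  have "\<not> (\<exists>B. B ** A = mat 1)"
    using assms invertible_det_nz[of A] invertible_left_inverse[of A] by simp
  then show ?thesis using that matrix_left_invertible_ker[of A] by blast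
qed

text \<open>Fewer covectors than variables: padding with zero rows gives a singular square
  matrix.\<close>

lemma common_kernel:
  fixes g :: "'n::finite => complex^'n"
  assumes "J ~= UNIV" obtains v where "v ~= 0" "!!j. j \<in> J ==> cdot (g j) v = 0"
proof -
  define A :: "complex^'n^'n" where "A = (\<chi> i. if i \<in> J then g i else 0)"
  obtain k where "k \<notin> J" using assms by blast
  then have "row k A = 0" by (simp add: A_def row_def vec_eq_iff)
  then have "det A = 0" by (rule det_zero_row)
  then obtain v where v: "v ~= 0" "A *v v = 0" by (rule det_zero_kernel)
  have "cdot (g j) v = (A *v v) $ j" if "j \<in> J" for j
    using that by (simp add: A_def matrix_vector_mult_def cdot_def)
  then show ?thesis using that[of v] v by simp
qed

lemma taylor3:
  assumes "g holomorphic_on ball 0 s" "s > 0" "deriv g 0 = 0"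
  obtains C k where "C \<ge> 0" "!!l. cmod l \<le> s/2 ==> cmod (g l - g 0 - l^2 * k) \<le> C * (cmod l)^3"
proof -
  have hol: "(deriv ^^ i) g holomorphic_on ball 0 s" for i using assms by (simp add: holomorphic_higher_deriv)
  have sub: "cball 0 (s/2) \<subseteq> ball (0::complex) s" using assms by auto
  have "compact ((deriv ^^ 3) g ` cball 0 (s/2))"
    by (intro compact_continuous_image holomorphic_on_imp_continuous_on holomorphic_on_subset[OF hol sub] compact_cball)
  then obtain B where B: "!!x. x \<in> cball 0 (s/2) ==> cmod ((deriv ^^ 3) g x) \<le> B"
    by (meson bounded_iff compact_imp_bounded imageI)
  have B0: "B \<ge> 0" using order_trans[OF norm_ge_zero B[of 0]] assms by simp
  have "cmod (g l - g 0 - l^2 * ((deriv ^^ 2) g 0 / 2)) \<le> B * (cmod l)^3" if l: "cmod l \<le> s/2" for l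
  proof -
    have "cmod ((deriv ^^ 0) g l - (\<Sum>i\<le>2. (deriv ^^ i) g 0 * (l - 0) ^ i / fact i)) \<le> B * cmod (l - 0) ^ Suc 2 / fact 2"
    proof (rule complex_Taylor[where S="cball 0 (s/2)" and f="%i. (deriv ^^ i) g"])
      show "((deriv ^^ i) g has_field_derivative (deriv ^^ Suc i) g x) (at x within cball 0 (s/2))"
        if "x \<in> cball 0 (s/2)" for i x
        using holomorphic_derivI[OF hol[of i], of x] that sub by (auto intro: has_field_derivative_at_within)
      show "cmod ((deriv ^^ Suc 2) g x) \<le> B" if "x \<in> cball 0 (s/2)" for x using B[OF that] by (simp add: numeral_3_eq_3 numeral_2_eq_2)
    qed (use l assms in auto)
    also have "\<dots> \<le> B * (cmod l)^3" using B0 by (simp add: fact_2 numeral_3_eq_3 numeral_2_eq_2)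
    finally show ?thesis using assms(3) by (simp add: numeral_2_eq_2 algebra_simps)
  qed
  then show ?thesis using that B0 by blast
qed

text \<open>\<open>r\<close> times the fourth roots of unity, a finite stand-in for the mean over a
  circle.\<close>

definition four :: "real => complex set" where "four r = {of_real r, \<i> * of_real r, - of_real r, - \<i> * of_real r}"

lemma sum_four: "r > 0 ==> (\<Sum>l\<in>four r. F l) = F (of_real r) + F (\<i> * of_real r) + F (- of_real r) + (F (- \<i> * of_real r) :: real)"
  unfolding four_def by (subst sum.insert; simp add: complex_eq_iff)+

lemma four_norm: "l \<in> four r ==> r > 0 ==> cmod l = r"
  by (auto simp: four_def norm_mult)

lemma cmod_add_sq: "(cmod (x + y))\<^sup>2 = (cmod x)\<^sup>2 + 2 * Re (cnj x * y) + (cmod y)\<^sup>2"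
  unfolding cmod_power2 by (simp add: power2_eq_square algebra_simps)

text \<open>Averaging over four points kills the terms of order one and two of the Taylor expansion.\<close>

lemma four_avg:
  assumes "g holomorphic_on ball 0 s" "s > 0" "deriv g 0 = 0"
  obtains C t where "C \<ge> 0" "t > 0" "!!r. 0 < r ==> r < t ==> (\<Sum>l\<in>four r. (cmod (g l))\<^sup>2) \<le> 4 * (cmod (g 0))\<^sup>2 + C * r^3"
proof -
  obtain C k where C: "C \<ge> 0" "!!l. cmod l \<le> s/2 ==> cmod (g l - g 0 - l^2 * k) \<le> C * (cmod l)^3"
    using taylor3[OF assms] by blast
  define D where "D = 2 * cmod (g 0) * C + (cmod k + C)\<^sup>2"
  have one: "(cmod (g l))\<^sup>2 \<le> (cmod (g 0))\<^sup>2 + 2 * Re (cnj (g 0) * k * l\<^sup>2) + D * r^3"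
    if r: "0 < r" "r < min 1 (s/2)" and l: "cmod l = r" for l r
  proof -
    define E where "E = g l - g 0 - l^2 * k"
    have E: "cmod E \<le> C * r^3" using C(2)[of l] l r by (simp add: E_def)
    have r3: "r^3 \<le> r^2" using r by (simp add: power_decreasing)
    have r4: "(r^2)^2 \<le> r^3" using r by (simp add: power_decreasing flip: power_mult)
    have "cmod (l^2 * k + E) \<le> (cmod k + C) * r^2"
    proof -
      have "cmod (l^2 * k + E) \<le> r^2 * cmod k + C * r^3"
        using norm_triangle_ineq[of "l^2*k" E] E l by (simp add: norm_mult norm_power)
      also have "C * r^3 \<le> C * r^2" using r3 C(1) by (rule mult_left_mono)
      finally show ?thesis by (simp add: algebra_simps)
    qed
    then have "(cmod (l^2 * k + E))\<^sup>2 \<le> ((cmod k + C) * r^2)\<^sup>2" by (intro power_mono) auto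
    also have "\<dots> = (cmod k + C)\<^sup>2 * (r^2)^2" by (simp add: power_mult_distrib)
    also have "\<dots> \<le> (cmod k + C)\<^sup>2 * r^3" using r4 by (intro mult_left_mono) auto
    finally have a1: "(cmod (l^2 * k + E))\<^sup>2 \<le> (cmod k + C)\<^sup>2 * r^3" .
    have "Re (cnj (g 0) * E) \<le> cmod (g 0) * cmod E" by (metis complex_Re_le_cmod complex_mod_cnj norm_mult)
    also have "\<dots> \<le> cmod (g 0) * (C * r^3)" using E by (rule mult_left_mono) simp
    finally have a2: "Re (cnj (g 0) * E) \<le> cmod (g 0) * C * r^3" by simp
    have "g l = g 0 + (l^2 * k + E)" by (simp add: E_def)
    then have "(cmod (g l))\<^sup>2 = (cmod (g 0))\<^sup>2 + 2 * Re (cnj (g 0) * (l^2 * k + E)) + (cmod (l^2 * k + E))\<^sup>2"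
      using cmod_add_sq[of "g 0" "l^2 * k + E"] by simp
    moreover have "Re (cnj (g 0) * (l^2 * k + E)) = Re (cnj (g 0) * k * l\<^sup>2) + Re (cnj (g 0) * E)"
      by (simp only: distrib_left plus_complex.simps mult.assoc mult.commute[of k])
    ultimately show ?thesis using a1 a2 by (simp add: D_def algebra_simps)
  qed
  have "(\<Sum>l\<in>four r. (cmod (g l))\<^sup>2) \<le> 4 * (cmod (g 0))\<^sup>2 + (4 * D) * r^3" if r: "0 < r" "r < min 1 (s/2)" for r
  proof -
    have "(\<Sum>l\<in>four r. (cmod (g l))\<^sup>2) \<le> (\<Sum>l\<in>four r. (cmod (g 0))\<^sup>2 + 2 * Re (cnj (g 0) * k * l\<^sup>2) + D * r^3)"
      by (rule sum_mono, rule one) (use r four_norm in auto)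
    also have "\<dots> = 4 * (cmod (g 0))\<^sup>2 + (4 * D) * r^3"
      unfolding sum_four[OF r(1)] by (simp add: power_mult_distrib)
    finally show ?thesis .
  qed
  moreover have "D \<ge> 0" using C(1) by (simp add: D_def)
  ultimately show ?thesis using that[of "4 * D" "min 1 (s/2)"] assms(2) by auto
qed

lemma four_avg_family:
  assumes "finite J" "!!j. j \<in> J ==> g j holomorphic_on ball 0 s" "s > 0" "!!j. j \<in> J ==> deriv (g j) 0 = 0"
  obtains C t where "C \<ge> 0" "t > 0"
    "!!r. 0 < r ==> r < t ==> (\<Sum>l\<in>four r. \<Sum>j\<in>J. (cmod (g j l))\<^sup>2) \<le> 4 * (\<Sum>j\<in>J. (cmod (g j 0))\<^sup>2) + C * r^3"
proof -
  have "\<exists>C t. C \<ge> 0 \<and> t > 0 \<and> (\<forall>r. 0 < r --> r < t --> (\<Sum>l\<in>four r. (cmod (g j l))\<^sup>2) \<le> 4 * (cmod (g j 0))\<^sup>2 + C * r^3)"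
    if "j \<in> J" for j
    using four_avg[OF assms(2)[OF that] assms(3) assms(4)[OF that]] by metis
  then obtain C t where Ct: "!!j. j \<in> J ==> C j \<ge> 0 \<and> t j > 0 \<and> (\<forall>r. 0 < r --> r < t j --> (\<Sum>l\<in>four r. (cmod (g j l))\<^sup>2) \<le> 4 * (cmod (g j 0))\<^sup>2 + C j * r^3)"
    by metis
  define T where "T = Min (insert 1 (t ` J))"
  have T: "T > 0" "!!j. j \<in> J ==> T \<le> t j" using assms(1) Ct by (auto simp: T_def)
  show ?thesis
  proof (rule that[of "sum C J" T])
    fix r :: real assume r: "0 < r" "r < T"
    have "(\<Sum>l\<in>four r. \<Sum>j\<in>J. (cmod (g j l))\<^sup>2) = (\<Sum>j\<in>J. \<Sum>l\<in>four r. (cmod (g j l))\<^sup>2)" by (rule sum.swap)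
    also have "\<dots> \<le> (\<Sum>j\<in>J. 4 * (cmod (g j 0))\<^sup>2 + C j * r^3)"
      by (rule sum_mono) (use Ct T(2) r in force)
    finally show "(\<Sum>l\<in>four r. \<Sum>j\<in>J. (cmod (g j l))\<^sup>2) \<le> 4 * (\<Sum>j\<in>J. (cmod (g j 0))\<^sup>2) + sum C J * r^3"
      by (simp add: sum.distrib sum_distrib_left sum_distrib_right)
  qed (use T Ct in \<open>auto intro: sum_nonneg\<close>)
qed

lemma norm_sq_vec: "(norm (z::complex^'n))\<^sup>2 = (\<Sum>i\<in>UNIV. (cmod (z $ i))\<^sup>2)"
  by (simp add: norm_vec_def L2_set_def sum_nonneg)

lemma four_norm_vec:
  fixes b v :: "complex^'n"
  assumes "r > 0" shows "(\<Sum>l\<in>four r. (norm (b + l *s v))\<^sup>2) = 4 * (norm b)\<^sup>2 + 4 * r\<^sup>2 * (norm v)\<^sup>2"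
proof -
  have "(\<Sum>l\<in>four r. (cmod (b $ i + l * v $ i))\<^sup>2) = 4 * (cmod (b $ i))\<^sup>2 + 4 * r\<^sup>2 * (cmod (v $ i))\<^sup>2" for i
    unfolding sum_four[OF assms] cmod_add_sq by (simp add: norm_mult power_mult_distrib)
  then have "(\<Sum>i\<in>UNIV. \<Sum>l\<in>four r. (cmod (b $ i + l * v $ i))\<^sup>2) = 4 * (norm b)\<^sup>2 + 4 * r\<^sup>2 * (norm v)\<^sup>2"
    by (simp add: norm_sq_vec sum.distrib sum_distrib_left)
  then show ?thesis unfolding norm_sq_vec by (subst sum.swap) simp
qed

text \<open>In the application the Levi form gives a gain of order \<open>r^2\<close>, the Taylor
  remainders an error of order \<open>r^3\<close>.\<close>

lemma cubic_contra:
  assumes "(c::real) > 0" "t > 0" "C \<ge> 0" "!!r. 0 < r ==> r < t ==> c * r\<^sup>2 \<le> C * r^3" shows False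
proof -
  define r where "r = min (t/2) (c / (2 * (C + 1)))"
  have r: "0 < r" "r < t" using assms by (auto simp: r_def)
  have "C * r \<le> C * (c / (2 * (C + 1)))" using assms(3) by (intro mult_left_mono) (auto simp: r_def)
  also have "\<dots> < c" using assms by (simp add: field_simps add_nonneg_pos)
  finally have "C * r * r\<^sup>2 < c * r\<^sup>2" using r by simp
  moreover have "C * r^3 = C * r * r\<^sup>2" by (simp add: power2_eq_square power3_eq_cube)
  ultimately show False using assms(4)[OF r] by simp
qed

lemma deriv_line_zero:
  assumes "holo_fun_on h V" "b \<in> V" "cdot (grad h b) v = 0" shows "deriv (%l. h (b + l *s v)) 0 = 0"
  using holo_line[OF assms(1), of b 0 v] assms(2,3) by (auto intro: DERIV_imp_deriv)

lemma line_ball: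
  fixes b v :: "complex^'n"
  assumes "open V" "b \<in> V" obtains s where "s > 0" "!!l. l \<in> ball 0 s ==> b + l *s v \<in> V"
proof -
  have "open ((%l::complex. b + l *s v) -` V)"
    by (rule open_vimage[OF assms(1)]) (intro continuous_intros)
  moreover have "0 \<in> (%l::complex. b + l *s v) -` V" using assms by simp
  ultimately obtain s where "s > 0" "ball 0 s \<subseteq> (%l::complex. b + l *s v) -` V"
    by (meson open_contains_ball)
  then show ?thesis using that by blast
qed

text \<open>Penalising the defining functions turns a maximum on the zero set into an interior maximum on an
  open set; the Levi form is positive on a common kernel vector of their differentials.\<close>

lemma no_local_max_norm:
  fixes h :: "'n::finite => complex^'n => complex"
  assumes V: "open V" "a \<in> V" and J: "J ~= UNIV" and hol: "!!j. j \<in> J ==> holo_fun_on (h j) V"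
    and ha: "!!j. j \<in> J ==> h j a = 0"
    and mx: "!!z. z \<in> V ==> (!!j. j \<in> J ==> h j z = 0) ==> norm z \<le> norm a"
  shows False
proof -
  obtain \<rho> where \<rho>: "\<rho> > 0" "cball a \<rho> \<subseteq> V" using V open_contains_cball by blast
  \<comment> \<open>Subtracting half of the squared distance makes \<open>a\<close> a strict maximum
    on the zero set and still leaves half of the Levi form of the squared norm.\<close>
  define w where "w z = (norm z)\<^sup>2 - (norm (z - a))\<^sup>2 / 2" for z
  define H where "H z = (\<Sum>j\<in>J. (cmod (h j z))\<^sup>2)" for z
  have Hc: "continuous_on (cball a \<rho>) H"
    unfolding H_def by (intro continuous_intros holo_continuous holo_subset[OF hol \<rho>(2)])
  have wc: "continuous_on S w" for S unfolding w_def by (auto intro!: continuous_intros)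
  have H0: "H z \<ge> 0" for z by (simp add: H_def sum_nonneg)
  have ex: "\<exists>z\<in>cball a \<rho>. \<forall>y\<in>cball a \<rho>. w y - real k * H y \<le> w z - real k * H z" for k :: nat
    by (rule continuous_attains_sup) (use \<rho> in \<open>auto intro!: continuous_intros Hc wc\<close>)
  then obtain z where z: "!!k. z k \<in> cball a \<rho>" "!!k y. y \<in> cball a \<rho> ==> w y - real k * H y \<le> w (z k) - real k * H (z k)"
    by metis
  have Ha: "H a = 0" using ha by (simp add: H_def)
  have ge: "(norm a)\<^sup>2 \<le> w (z k) - real k * H (z k)" for k
    using z(2)[of a k] \<rho>(1) Ha by (simp add: w_def)
  \<comment> \<open>Otherwise the maximum points for all penalties lie on the sphere. At a limit
    point \<open>x\<close> of them the growing penalty forces \<open>H x = 0\<close>, so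
    \<open>x\<close> is in the zero set, where \<open>w\<close> is smaller than at
    \<open>a\<close>.\<close>
  have "\<exists>k. z k \<in> ball a \<rho>"
  proof (rule ccontr)
    assume "\<not> ?thesis"
    then have sph: "norm (z k - a) = \<rho>" for k using z(1)[of k] by (metis dist_commute dist_norm mem_ball mem_cball order_le_less)
    obtain x s where x: "x \<in> cball a \<rho>" and s: "strict_mono s" and lim: "(z \<circ> s) \<longlonglongrightarrow> x"
      using compact_cball[of a \<rho>] z(1) unfolding compact_def by metis
    have wl: "(%k. w (z (s k))) \<longlonglongrightarrow> w x"
      using lim wc[of UNIV] by (auto simp: o_def continuous_on_eq_continuous_at intro: isCont_tendsto_compose)
    have Hl: "(%k. H (z (s k))) \<longlonglongrightarrow> H x"
      by (rule continuous_on_tendsto_compose[OF Hc lim[unfolded o_def] x]) (rule always_eventually, rule allI, rule z(1))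
    have "(norm a)\<^sup>2 \<le> w x"
    proof (rule tendsto_lowerbound[OF wl always_eventually])
      show "\<forall>k. (norm a)\<^sup>2 \<le> w (z (s k))"
      proof
        fix k show "(norm a)\<^sup>2 \<le> w (z (s k))"
          using ge[of "s k"] H0[of "z (s k)"] mult_nonneg_nonneg[of "real (s k)" "H (z (s k))"] by linarith
      qed
    qed simp
    have "bounded (range (%k. w (z (s k))))" using wl convergent_imp_bounded by blast
    then obtain B where B: "!!k. \<bar>w (z (s k))\<bar> \<le> B" by (auto simp: bounded_iff)
    have "H x \<le> 0"
    proof (rule tendsto_le[OF _ _ Hl])
      have "H (z (s k)) \<le> B / real k" if "k \<ge> 1" for k
      proof -
        have "real k * H (z (s k)) \<le> real (s k) * H (z (s k))"
          using H0 seq_suble[OF s, of k] by (intro mult_right_mono) auto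
        also have "\<dots> \<le> B" using ge[of "s k"] B[of k] zero_le_power2[of "norm a"] by linarith
        finally show ?thesis using that by (simp add: field_simps)
      qed
      then show "\<forall>\<^sub>F k in sequentially. H (z (s k)) \<le> B / real k" using eventually_sequentially by blast
      show "(%k. B / real k) \<longlonglongrightarrow> 0" by (rule lim_const_over_n)
    qed auto
    then have "H x = 0" using H0[of x] by simp
    then have "h j x = 0" if "j \<in> J" for j
      using that by (simp add: H_def sum_nonneg_eq_0_iff)
    then have "norm x \<le> norm a" using mx x \<rho>(2) by blast
    moreover have nr: "norm (x - a) = \<rho>"
    proof -
      have "(%k. norm (z (s k) - a)) \<longlonglongrightarrow> norm (x - a)" using lim by (auto intro!: tendsto_intros simp: o_def)
      then show ?thesis using sph LIMSEQ_unique[of "%_. \<rho>"] by simp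
    qed
    moreover have "(norm x)\<^sup>2 \<le> (norm a)\<^sup>2" using \<open>norm x \<le> norm a\<close> by (rule power_mono) simp
    moreover have "\<rho>\<^sup>2 > 0" using \<rho>(1) by simp
    ultimately have "w x < (norm a)\<^sup>2" unfolding w_def nr by linarith
    then show False using \<open>(norm a)\<^sup>2 \<le> w x\<close> by simp
  qed
  then obtain k where k: "z k \<in> ball a \<rho>" by blast
  define b where "b = z k"
  have bV: "b \<in> V" using k \<rho> by (auto simp: b_def)
  \<comment> \<open>Along this direction no \<open>h j\<close> has a linear term at
    \<open>b\<close>, which is what the averages over four points require.\<close>
  obtain v where v: "v ~= 0" "!!j. j \<in> J ==> cdot (grad (h j) b) v = 0" using common_kernel[OF J, of "%j. grad (h j) b"] by blast
  obtain s where s: "s > 0" "!!l. l \<in> ball 0 s ==> b + l *s v \<in> ball a \<rho>"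
    using line_ball[of "ball a \<rho>" b v] k by (auto simp: b_def)
  obtain C t where Ct: "C \<ge> 0" "t > 0" "!!r. 0 < r ==> r < t ==>
      (\<Sum>l\<in>four r. \<Sum>j\<in>J. (cmod (h j (b + l *s v)))\<^sup>2) \<le> 4 * (\<Sum>j\<in>J. (cmod (h j (b + 0 *s v)))\<^sup>2) + C * r^3"
  proof (rule four_avg_family[of J "%j l. h j (b + l *s v)" s])
    show "(%l. h j (b + l *s v)) holomorphic_on ball 0 s" if "j \<in> J" for j
      by (rule holo_line_on[OF hol[OF that]]) (use s \<rho> in force)
    show "deriv (%l. h j (b + l *s v)) 0 = 0" if "j \<in> J" for j
      using deriv_line_zero[OF hol[OF that] bV v(2)[OF that]] .
  qed (use s in auto)
  show False
  proof (rule cubic_contra[of "2 * (norm v)\<^sup>2" "min t s" "real k * C"])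
    fix r :: real assume r: "0 < r" "r < min t s"
    have "(\<Sum>l\<in>four r. w (b + l *s v) - real k * H (b + l *s v)) \<le> (\<Sum>l\<in>four r. w b - real k * H b)"
    proof (rule sum_mono)
      fix l assume "l \<in> four r"
      then have "l \<in> ball 0 s" using four_norm r by auto
      then have "b + l *s v \<in> cball a \<rho>" using s(2) ball_subset_cball by blast
      then show "w (b + l *s v) - real k * H (b + l *s v) \<le> w b - real k * H b" using z(2) by (simp add: b_def)
    qed
    then have "(\<Sum>l\<in>four r. w (b + l *s v)) - real k * (\<Sum>l\<in>four r. H (b + l *s v)) \<le> 4 * (w b - real k * H b)"
      unfolding sum_subtractf sum_distrib_left[symmetric] sum_four[OF r(1), of "%_. w b"] sum_four[OF r(1), of "%_. real k * H b"]
        sum_four[OF r(1), of "%_. H b"] by argo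
    \<comment> \<open>The gain is \<open>4 * r^2\<close> from the squared norm minus half of that
      from the correction term.\<close>
    moreover have "(\<Sum>l\<in>four r. w (b + l *s v)) = 4 * w b + 2 * r\<^sup>2 * (norm v)\<^sup>2"
      using four_norm_vec[OF r(1), of b v] four_norm_vec[OF r(1), of "b - a" v]
      by (simp add: w_def sum_subtractf add_diff_eq diff_add_eq flip: sum_divide_distrib) (simp add: field_simps)
    moreover have "real k * (\<Sum>l\<in>four r. H (b + l *s v)) \<le> real k * (4 * H b + C * r^3)"
      using Ct(3)[of r] r by (intro mult_left_mono) (auto simp: H_def)
    ultimately show "2 * (norm v)\<^sup>2 * r\<^sup>2 \<le> real k * C * r^3" by (simp add: algebra_simps)
  qed (use v Ct s in auto)
qed

section \<open>Regular points and critical values\<close>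

definition rowmat :: "'n set => ('n => complex^'n => complex) => complex^'n => complex^'n^'n" where
  "rowmat R h z = (\<chi> i. if i \<in> R then grad (h i) z else axis i 1)"

definition vanishing :: "(complex^'n) set => (complex^'n) set => (complex^'n => complex) set" where
  "vanishing \<Omega> A = {F. holo_fun_on F \<Omega> \<and> (\<forall>a\<in>A. F a = 0)}"

definition flat_chart :: "'n set => ('n => complex^'n => complex) => complex^'n => complex^'n" where
  "flat_chart R h z = (\<chi> i. if i \<in> R then h i z else z $ i)"

lemma flat_chart_nth: "flat_chart R h z $ i = (if i \<in> R then h i z else z $ i)"
  by (simp add: flat_chart_def)

lemma holo_flat_chart: "(!!i. i \<in> R ==> holo_fun_on (h i) \<Omega>) ==> holo_map_on (flat_chart R h) \<Omega>"
  unfolding holo_map_on_def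
proof
  fix i assume "!!i. i \<in> R ==> holo_fun_on (h i) \<Omega>"
  then show "holo_fun_on (%z. flat_chart R h z $ i) \<Omega>" by (cases "i \<in> R") (simp_all add: flat_chart_nth)
qed

lemma holo_rowmat:
  assumes "open \<Omega>" "!!i. i \<in> R ==> holo_fun_on (h i) \<Omega>"
  shows "holo_fun_on (%z. rowmat R h z $ i $ k) \<Omega>"
  using assms by (cases "i \<in> R") (simp_all add: rowmat_def holo_grad)

lemma jac_flat_chart: "jac (flat_chart R h) z = rowmat R h z"
  by (auto simp: jac_def rowmat_def flat_chart_def vec_eq_iff)

text \<open>The rank is maximised over all points of \<open>A\<close> at once. Hence a determinant
  enlarged by one more row vanishes at every point of \<open>A\<close>, not only at
  \<open>a\<close>, and is itself a function vanishing on \<open>A\<close>.\<close>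

lemma maximal_rank:
  fixes A :: "(complex^'n) set"
  assumes "A ~= {}"
  obtains R :: "'n set" and h a where "a \<in> A" "!!i. i \<in> R ==> h i \<in> vanishing \<Omega> A" "det (rowmat R h a) ~= 0"
    "!!b g j. b \<in> A ==> g \<in> vanishing \<Omega> A ==> j \<notin> R ==> det (rowmat (insert j R) (h(j := g)) b) = 0"
proof -
  define P where "P R \<longleftrightarrow> (\<exists>h a. a \<in> A \<and> (\<forall>i\<in>R. h i \<in> vanishing \<Omega> A) \<and> det (rowmat R h a) ~= 0)" for R :: "'n set"
  have "P {}"
  proof -
    have "rowmat {} h a = mat 1" for h :: "'n => complex^'n => complex" and a by (simp add: rowmat_def mat_def axis_def vec_eq_iff)
    then show ?thesis using assms by (auto simp: P_def)
  qed
  moreover have "\<forall>R. P R --> card R < CARD('n) + 1"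
    by (simp add: card_mono less_Suc_eq_le)
  ultimately obtain R where R: "P R" "!!R'. P R' ==> card R' \<le> card R"
    using Lattices_Big.ex_has_greatest_nat[of P "{}" card "CARD('n) + 1"] by blast
  then obtain h a where h: "a \<in> A" "\<forall>i\<in>R. h i \<in> vanishing \<Omega> A" "det (rowmat R h a) ~= 0" by (auto simp: P_def)
  have "det (rowmat (insert j R) (h(j := g)) b) = 0" if "b \<in> A" "g \<in> vanishing \<Omega> A" "j \<notin> R" for b g j
  proof (rule ccontr)
    assume "det (rowmat (insert j R) (h(j := g)) b) ~= 0"
    then have "P (insert j R)" unfolding P_def using that h(2) by (intro exI[of _ "h(j := g)"] exI[of _ b]) auto
    then show False using R(2)[of "insert j R"] that(3) by simp
  qed
  then show ?thesis using that h by blast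
qed

text \<open>Cramer's rule for the coefficients of \<open>g\<close> in the basis formed by the rows
  of \<open>A\<close>, multiplied through by \<open>det A\<close>.\<close>

lemma cramer_rows:
  fixes A :: "complex^'n^'n"
  assumes "det A ~= 0"
  shows "det A * cdot g u = (\<Sum>j\<in>UNIV. (A *v u) $ j * det (\<chi> i. if i = j then g else A $ i))"
proof -
  define x where "x = transpose (matrix_inv A) *v g"
  have "A ** matrix_inv A = mat 1" "matrix_inv A ** A = mat 1" using assms matrix_inv_works invertible_det_nz by blast+
  then have "transpose A *v x = g"
    unfolding x_def matrix_vector_mul_assoc by (simp flip: matrix_transpose_mul)
  then have g: "(\<Sum>i\<in>UNIV. x $ i *s row i A) = g"
    by (simp add: vec_eq_iff sum_component matrix_vector_mult_def transpose_def row_def mult.commute)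
  have rw: "row i A = A $ i" for i by (simp add: row_def vec_eq_iff)
  have "det (\<chi> i. if i = j then g else A $ i) = x $ j * det A" for j
    using cramer_lemma_transpose[of j x A] unfolding g by (simp only: rw)
  moreover have "cdot g u = (\<Sum>j\<in>UNIV. (A *v u) $ j * x $ j)"
  proof -
    have "cdot g u = (\<Sum>k\<in>UNIV. (\<Sum>i\<in>UNIV. x $ i * A $ i $ k) * u $ k)"
      unfolding cdot_def by (subst g[symmetric]) (simp add: row_def sum_component)
    also have "\<dots> = (\<Sum>k\<in>UNIV. \<Sum>i\<in>UNIV. x $ i * A $ i $ k * u $ k)" by (simp add: sum_distrib_right)
    also have "\<dots> = (\<Sum>i\<in>UNIV. \<Sum>k\<in>UNIV. x $ i * A $ i $ k * u $ k)" by (rule sum.swap)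
    finally show ?thesis by (simp add: matrix_vector_mult_def sum_distrib_left sum_distrib_right mult_ac)
  qed
  ultimately show ?thesis by (simp add: sum_distrib_left mult_ac)
qed

text \<open>Up to the factor \<open>det (rowmat R h z)\<close>, the derivative of \<open>F\<close>
  in direction \<open>v\<close> along the level set of \<open>h\<close>, in the coordinates
  \<open>flat_chart R h\<close>. Without the denominator it is holomorphic on all of
  \<Omega>.\<close>

definition rowder :: "'n set => ('n => complex^'n => complex) => complex^'n => (complex^'n => complex) => complex^'n => complex" where
  "rowder R h v F z = (\<Sum>j\<in>-R. v $ j * det (rowmat (insert j R) (h(j := F)) z))"

lemma rowmat_insert: "rowmat (insert j R) (h(j := F)) z = (\<chi> i. if i = j then grad F z else rowmat R h z $ i)"
  by (auto simp: rowmat_def vec_eq_iff)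

lemma holo_rowder:
  assumes "open \<Omega>" "!!i. i \<in> R ==> holo_fun_on (h i) \<Omega>" "holo_fun_on F \<Omega>"
  shows "holo_fun_on (rowder R h v F) \<Omega>"
proof -
  have "holo_fun_on (%z. rowmat (insert j R) (h(j := F)) z $ i $ k) \<Omega>" for j i k
    by (rule holo_rowmat) (use assms in auto)
  then show ?thesis unfolding rowder_def[abs_def] by (intro holo_sum holo_mult holo_const holo_det)
qed

text \<open>If a class of functions vanishing at \<open>a\<close> is closed under differentiation along the leaf \<open>h = h a\<close>,
  all Taylor coefficients along the leaf vanish.\<close>

lemma flat_vanishing:
  fixes h :: "'n::finite => complex^'n => complex"
  assumes om: "open \<Omega>" and a: "a \<in> \<Omega>" and h: "!!i. i \<in> R ==> holo_fun_on (h i) \<Omega>"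
    and bi: "biholomorphic (flat_chart R h) V W" and aV: "a \<in> V" and V: "V \<subseteq> \<Omega>" and W: "convex W"
    and det: "!!z. z \<in> V ==> det (rowmat R h z) ~= 0"
    and Q: "!!F. F \<in> Q ==> holo_fun_on F \<Omega>" "!!F. F \<in> Q ==> F a = 0" "!!F v. F \<in> Q ==> rowder R h v F \<in> Q"
    and F: "F \<in> Q" and z: "z \<in> V" "!!i. i \<in> R ==> h i z = h i a"
  shows "F z = 0"
proof -
  note B = biholomorphic_D[OF bi]
  define \<Phi> where "\<Phi> = flat_chart R h"
  define \<Theta> where "\<Theta> = the_inv_into V \<Phi>"
  define v where "v = \<Phi> z - \<Phi> a"
  have vR: "v $ i = 0" if "i \<in> R" for i using z(2)[OF that] that by (simp add: v_def \<Phi>_def flat_chart_nth)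
  define T where "T = {l::complex. \<Phi> a + l *s v \<in> W}"
  have T: "open T" unfolding T_def using open_vimage[OF B(2), of "%l::complex. \<Phi> a + l *s v"]
    by (simp add: vimage_def continuous_intros)
  have "convex T"
    unfolding convex_alt
  proof safe
    fix x y :: complex and u :: real assume "x \<in> T" "y \<in> T" "0 \<le> u" "u \<le> 1"
    moreover have "\<Phi> a + ((1-u) *\<^sub>R x + u *\<^sub>R y) *s v = (1-u) *\<^sub>R (\<Phi> a + x *s v) + u *\<^sub>R (\<Phi> a + y *s v)"
      by (simp add: vec_eq_iff algebra_simps)
    ultimately show "(1 - u) *\<^sub>R x + u *\<^sub>R y \<in> T"
      using W unfolding T_def mem_Collect_eq by (metis convex_alt)
  qed
  have T01: "0 \<in> T" "1 \<in> T" using B(10) aV z(1) by (auto simp: T_def v_def \<Phi>_def)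
  define p where "p l = \<Theta> (\<Phi> a + l *s v)" for l
  have p: "p l \<in> V" if "l \<in> T" for l using B(9) that by (auto simp: p_def T_def \<Theta>_def \<Phi>_def)
  have p0: "p 0 = a" and p1: "p 1 = z" using B(7) aV z(1) by (auto simp: p_def v_def \<Theta>_def \<Phi>_def)
  have Th: "holo_map_on \<Theta> W" using B(4) by (simp add: \<Theta>_def \<Phi>_def)
  have hol: "holo_fun_on (%w. G (\<Theta> w)) W" if "holo_fun_on G \<Omega>" for G
    by (rule holo_compose[OF Th that]) (use B(9) V in \<open>auto simp: \<Theta>_def \<Phi>_def\<close>)
  have holT: "(%l. G (p l)) holomorphic_on T" if "holo_fun_on G \<Omega>" for G
    unfolding p_def by (rule holo_line_on[OF hol[OF that]]) (simp add: T_def)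
  define \<delta> where "\<delta> l = det (rowmat R h (p l))" for l
  have holdet: "holo_fun_on (%z. det (rowmat R h z)) \<Omega>"
    by (intro holo_det holo_rowmat h om)
  have d0: "\<delta> l ~= 0" if "l \<in> T" for l using det p that by (simp add: \<delta>_def)
  have hd: "(%l. inverse (\<delta> l)) holomorphic_on T"
    using holT[OF holdet] d0 by (auto intro!: holomorphic_intros simp: \<delta>_def)
  have der: "deriv (%l. G (p l)) l = inverse (\<delta> l) * rowder R h v G (p l)" if G: "holo_fun_on G \<Omega>" and l: "l \<in> T" for G l
  proof -
    define w where "w = \<Phi> a + l *s v"
    have w: "w \<in> W" using l by (simp add: T_def w_def)
    have pl: "p l = \<Theta> w" by (simp add: p_def w_def)
    define u where "u = jac \<Theta> w *v v"
    have "deriv (%l. G (p l)) l = cdot (grad (%w. G (\<Theta> w)) w) v"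
      unfolding p_def w_def by (rule DERIV_imp_deriv, rule holo_line[OF hol[OF G]]) (use w in \<open>simp add: w_def\<close>)
    also have "\<dots> = cdot (grad G (p l)) u"
      unfolding pl u_def by (rule cdot_grad_compose[OF Th G w]) (use B(9)[OF w] V in \<open>auto simp: \<Theta>_def \<Phi>_def\<close>)
    finally have 1: "deriv (%l. G (p l)) l = cdot (grad G (p l)) u" .
    have "jac (%w. \<Phi> (\<Theta> w)) w = jac \<Phi> (\<Theta> w) ** jac \<Theta> w"
      by (rule jac_compose[OF Th B(3)[folded \<Phi>_def] w]) (use B(9)[OF w] in \<open>auto simp: \<Theta>_def \<Phi>_def\<close>)
    moreover have "jac (%w. \<Phi> (\<Theta> w)) w = mat 1"
    proof -
      have "grad (%w. \<Phi> (\<Theta> w) $ i) w = grad (%w. w $ i) w" for i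
        by (rule grad_cong[OF B(2) w]) (use B(8) in \<open>auto simp: \<Theta>_def \<Phi>_def\<close>)
      then show ?thesis by (simp add: jac_def mat_def axis_def vec_eq_iff)
    qed
    ultimately have "rowmat R h (p l) *v u = v"
      by (simp add: u_def matrix_vector_mul_assoc \<Phi>_def jac_flat_chart pl)
    then have "\<delta> l * cdot (grad G (p l)) u = (\<Sum>j\<in>UNIV. v $ j * det (rowmat (insert j R) (h(j := G)) (p l)))"
      using cramer_rows[OF d0[OF l, unfolded \<delta>_def], of "grad G (p l)" u] by (simp add: rowmat_insert \<delta>_def)
    also have "\<dots> = rowder R h v G (p l)"
      unfolding rowder_def by (rule sum.mono_neutral_right) (use vR in auto)
    finally show ?thesis using 1 d0[OF l] by (simp add: field_simps)
  qed
  \<comment> \<open>By \<open>der\<close> one derivative turns \<open>G\<close> into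
    \<open>rowder R h v G\<close>, again in \<open>Q\<close>, divided by \<delta>; the Leibniz rule
    then reduces order \<open>n\<close> to lower orders of functions of \<open>Q\<close>.\<close>
  have all0: "\<forall>G\<in>Q. (deriv ^^ n) (%l. G (p l)) 0 = 0" for n
  proof (induction n rule: less_induct)
    case (less n)
    show ?case
    proof
      fix G assume G: "G \<in> Q"
      show "(deriv ^^ n) (%l. G (p l)) 0 = 0"
      proof (cases n)
        case 0
        then show ?thesis using Q(2)[OF G] p0 by simp
      next
        case (Suc m)
        note hG = holT[OF Q(1)[OF G]]
        note hD = holT[OF Q(1)[OF Q(3)[OF G, of v]]]
        have "(deriv ^^ n) (%l. G (p l)) 0 = (deriv ^^ m) (deriv (%l. G (p l))) 0"
          by (simp add: Suc funpow_Suc_right del: funpow.simps)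
        also have "\<dots> = (deriv ^^ m) (%l. inverse (\<delta> l) * rowder R h v G (p l)) 0"
          by (rule higher_deriv_transform_within_open[OF _ _ T T01(1)])
             (use der[OF Q(1)[OF G]] hG hD hd T in \<open>auto intro!: holomorphic_intros holomorphic_deriv\<close>)
        also have "\<dots> = (\<Sum>i = 0..m. of_nat (m choose i) * (deriv ^^ i) (%l. inverse (\<delta> l)) 0 * (deriv ^^ (m - i)) (%l. rowder R h v G (p l)) 0)"
          by (rule higher_deriv_mult[OF hd hD T T01(1)])
        also have "\<dots> = 0" using less.IH Q(3)[OF G] Suc by (intro sum.neutral) auto
        finally show ?thesis .
      qed
    qed
  qed
  have "F (p 1) = 0"
    by (rule holomorphic_fun_eq_0_on_connected[OF holT[OF Q(1)[OF F]] T convex_connected[OF \<open>convex T\<close>] _ T01])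
       (use all0 F in blast)
  then show ?thesis by (simp add: p1)
qed

text \<open>\<open>A\<close> may be any set, so the piece \<open>h = 0\<close> lies in the set cut
  out by all functions vanishing on \<open>A\<close>, and in \<open>A\<close> itself when
  \<open>A\<close> is a zero set. The last clause is Sard's theorem in infinitesimal form: if all
  points of \<open>A\<close> are critical for \<open>P\<close>, then \<open>P\<close> is constant
  along the piece.\<close>

definition flat_at :: "(complex^'n) set => (complex^'n) set => 'n set => ('n => complex^'n => complex) => complex^'n =>
    (complex^'n) set => (complex^'n) set => bool" where
  "flat_at \<Omega> A R h a V W \<longleftrightarrow> a \<in> A \<and> a \<in> V \<and> V \<subseteq> \<Omega> \<and> biholomorphic (flat_chart R h) V W \<and> convex W \<and>
     (\<forall>i\<in>R. h i \<in> vanishing \<Omega> A) \<and>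
     (\<forall>F\<in>vanishing \<Omega> A. \<forall>z\<in>V. (\<forall>i\<in>R. h i z = 0) --> F z = 0) \<and>
     (\<forall>P. holo_fun_on P \<Omega> --> (\<forall>b\<in>A. \<exists>S c. finite S \<and> S \<subseteq> vanishing \<Omega> A \<and> grad P b = (\<Sum>F\<in>S. c F *s grad F b)) -->
       (\<forall>z\<in>V. (\<forall>i\<in>R. h i z = 0) --> P z = P a))"

lemma det_row_sum:
  fixes c :: "'n::finite => complex^'n"
  assumes "finite S"
  shows "det (\<chi> i. if i = k then (\<Sum>F\<in>S. m F *s g F) else c i) = (\<Sum>F\<in>S. m F * det (\<chi> i. if i = k then g F else c i))"
  using assms
proof (induction rule: finite_induct)
  case empty
  have "det (\<chi> i. if i = k then (\<Sum>F\<in>{}. m F *s g F) else c i) = det (\<chi> i. if i = k then 0 else c i)"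
    by (simp cong: if_cong)
  then show ?case using det_row_0[of k c] by simp
next
  case (insert F S)
  have "det (\<chi> i. if i = k then (\<Sum>F\<in>insert F S. m F *s g F) else c i) = det (\<chi> i. if i = k then m F *s g F + (\<Sum>F\<in>S. m F *s g F) else c i)"
    using insert.hyps by (simp cong: if_cong)
  then show ?case using insert
    det_row_add[of k "%_. m F *s g F" "%_. \<Sum>F\<in>S. m F *s g F" c] det_row_mul[of k "m F" "%_. g F" c] by simp
qed

text \<open>By maximality of the rank \<open>vanishing\<close> is closed under
  \<open>rowder\<close>, and so is \<open>vanishing\<close> together with \<open>P - P a\<close>,
  because determinants are multilinear in the row that holds the gradient of \<open>P\<close>.
  \<open>flat_vanishing\<close> applies to both families.\<close>

lemma flat_point:
  fixes A :: "(complex^'n) set"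
  assumes om: "open \<Omega>" and A: "A \<subseteq> \<Omega>" "A ~= {}"
  shows "\<exists>R h a V W. flat_at \<Omega> A R h a V W"
proof -
  obtain R h a where m: "a \<in> A" "!!i. i \<in> R ==> h i \<in> vanishing \<Omega> A" "det (rowmat R h a) ~= 0"
    "!!b g j. b \<in> A ==> g \<in> vanishing \<Omega> A ==> j \<notin> R ==> det (rowmat (insert j R) (h(j := g)) b) = 0"
    by (rule maximal_rank[OF A(2), where \<Omega>=\<Omega>]) (rule that; assumption)
  have h: "!!i. i \<in> R ==> holo_fun_on (h i) \<Omega>" and ha: "!!i. i \<in> R ==> h i a = 0" using m by (auto simp: vanishing_def)
  have a: "a \<in> \<Omega>" using m(1) A by blast
  have hm: "holo_map_on (flat_chart R h) \<Omega>" by (rule holo_flat_chart[OF h])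
  have dj: "det (jac (flat_chart R h) a) ~= 0" unfolding jac_flat_chart by (rule m(3))
  obtain V0 W0 where V0: "open V0" "a \<in> V0" "V0 \<subseteq> \<Omega>" "biholomorphic (flat_chart R h) V0 W0"
    "!!z. z \<in> V0 ==> det (jac (flat_chart R h) z) ~= 0"
    by (rule inverse_function_holo[OF om hm a dj]) (rule that; assumption)
  note B0 = biholomorphic_D[OF V0(4)]
  obtain r where r: "r > 0" "ball (flat_chart R h a) r \<subseteq> W0" using B0(2) B0(10)[OF V0(2)] open_contains_ball by blast
  define W where "W = ball (flat_chart R h a) r"
  define V where "V = V0 \<inter> flat_chart R h -` W"
  have bi: "biholomorphic (flat_chart R h) V W" unfolding V_def by (rule biholomorphic_restrict[OF V0(4)]) (use r in \<open>auto simp: W_def\<close>)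
  have aV: "a \<in> V" using V0 r by (auto simp: V_def W_def)
  have VO: "V \<subseteq> \<Omega>" using V0 by (auto simp: V_def)
  have cW: "convex W" by (simp add: W_def)
  have det: "!!z. z \<in> V ==> det (rowmat R h z) ~= 0" using V0(5) by (auto simp: V_def jac_flat_chart)
  have rdh: "holo_fun_on (rowder R h v F) \<Omega>" if "holo_fun_on F \<Omega>" for v F
    by (rule holo_rowder[OF om _ that]) (rule h)
  have rd: "rowder R h v F \<in> vanishing \<Omega> A" if "F \<in> vanishing \<Omega> A" for v F
    using that m(4) rdh[of F v] by (auto simp: vanishing_def rowder_def intro!: sum.neutral)
  have c1: "F z = 0" if "F \<in> vanishing \<Omega> A" "z \<in> V" "!!i. i \<in> R ==> h i z = 0" for F z
      by (rule flat_vanishing[OF om a h bi aV VO cW det, where Q="vanishing \<Omega> A"])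
         (use that rd m(1) ha in \<open>auto simp: vanishing_def\<close>)
  have c2: "P z = P a" if P: "holo_fun_on P \<Omega>" "!!b. b \<in> A ==> \<exists>S c. finite S \<and> S \<subseteq> vanishing \<Omega> A \<and> grad P b = (\<Sum>F\<in>S. c F *s grad F b)"
      and z: "z \<in> V" "!!i. i \<in> R ==> h i z = 0" for P z
    proof -
      define P' where "P' = (%z. P z - P a)"
      have hP': "holo_fun_on P' \<Omega>" unfolding P'_def by (intro holo_diff P(1) holo_const)
      have gP': "grad P' b = grad P b" if "b \<in> \<Omega>" for b
        unfolding P'_def by (rule has_derivative_imp_grad) (auto intro!: derivative_eq_intros holo_D[OF P(1) that])
      have "rowder R h v P' b = 0" if b: "b \<in> A" for v b
      proof -
        obtain S c where S: "finite S" "S \<subseteq> vanishing \<Omega> A" "grad P b = (\<Sum>F\<in>S. c F *s grad F b)" using P(2)[OF b] by blast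
        have "det (rowmat (insert j R) (h(j := P')) b) = 0" if "j \<notin> R" for j
        proof -
          have "det (rowmat (insert j R) (h(j := P')) b) = (\<Sum>F\<in>S. c F * det (rowmat (insert j R) (h(j := F)) b))"
            unfolding rowmat_insert det_row_sum[OF S(1), symmetric] S(3)[symmetric] using gP'[of b] b A by (simp add: subset_iff cong: if_cong)
          also have "\<dots> = 0" using m(4)[OF b _ that] S(2) by (intro sum.neutral) auto
          finally show ?thesis .
        qed
        then show ?thesis by (simp add: rowder_def)
      qed
      then have rp: "rowder R h v P' \<in> vanishing \<Omega> A" for v using rdh[OF hP'] by (simp add: vanishing_def)
      have "P' z = 0"
        by (rule flat_vanishing[OF om a h bi aV VO cW det, where Q="insert P' (vanishing \<Omega> A)"])
           (use z rd rp m(1) ha hP' in \<open>auto simp: vanishing_def P'_def\<close>)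
      then show ?thesis by (simp add: P'_def)
    qed
  have "flat_at \<Omega> A R h a V W"
    unfolding flat_at_def
  proof (intro conjI ballI allI impI)
    show "h i \<in> vanishing \<Omega> A" if "i \<in> R" for i by (rule m(2)[OF that])
    show "F z = 0" if "F \<in> vanishing \<Omega> A" "z \<in> V" "\<forall>i\<in>R. h i z = 0" for F z by (rule c1) (use that in auto)
    show "P z = P a" if "holo_fun_on P \<Omega>" "\<forall>b\<in>A. \<exists>S c. finite S \<and> S \<subseteq> vanishing \<Omega> A \<and> grad P b = (\<Sum>F\<in>S. c F *s grad F b)"
      "z \<in> V" "\<forall>i\<in>R. h i z = 0" for P z by (rule c2) (use that in auto)
  qed (fact m(1) aV VO bi cW)+
  then show ?thesis by blast
qed

text \<open>The family \<G> is contained in \<open>vanishing\<close>, so near a flat point the zero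
  set and the flat piece coincide. Dimension zero means that \<open>R\<close> contains all indices,
  and then the flat piece is a single point.\<close>

lemma regular_points_exist:
  fixes A :: "(complex^'n) set"
  assumes om: "open \<Omega>" and hol: "!!g. g \<in> \<G> ==> holo_fun_on g \<Omega>"
    and A: "A \<inter> \<Omega> = {z\<in>\<Omega>. \<forall>g\<in>\<G>. g z = 0}" and ne: "A \<inter> \<Omega> ~= {}"
  obtains z d where "z \<in> A \<inter> \<Omega>" "regular_point A d z" "d = 0 ==> \<not> z islimpt A"
proof -
  obtain R :: "'n set" and h a V W where fl: "flat_at \<Omega> (A \<inter> \<Omega>) R h a V W"
    using flat_point[OF om Int_lower2 ne] by blast
  then have f: "a \<in> A \<inter> \<Omega>" "a \<in> V" "V \<subseteq> \<Omega>" "biholomorphic (flat_chart R h) V W" "convex W"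
    "!!i. i \<in> R ==> h i \<in> vanishing \<Omega> (A \<inter> \<Omega>)"
    "!!F z. F \<in> vanishing \<Omega> (A \<inter> \<Omega>) ==> z \<in> V ==> (!!i. i \<in> R ==> h i z = 0) ==> F z = 0"
    unfolding flat_at_def by blast+
  note B = biholomorphic_D[OF f(4)]
  have G: "\<G> \<subseteq> vanishing \<Omega> (A \<inter> \<Omega>)" using hol unfolding vanishing_def A by auto
  have AV: "z \<in> A \<longleftrightarrow> (\<forall>i\<in>R. h i z = 0)" if "z \<in> V" for z
  proof
    assume "z \<in> A" then show "\<forall>i\<in>R. h i z = 0" using f(3,6) that by (auto simp: vanishing_def)
  next
    assume "\<forall>i\<in>R. h i z = 0"
    then have "\<forall>g\<in>\<G>. g z = 0" using f(7)[OF _ that] G by blast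
    then have "z \<in> A \<inter> \<Omega>" unfolding A using that f(3) by blast
    then show "z \<in> A" by blast
  qed
  have im: "flat_chart R h ` (A \<inter> V) = {w\<in>W. \<forall>i. i \<notin> - R --> w $ i = 0}"
  proof (intro subset_antisym subsetI)
    fix w assume "w \<in> flat_chart R h ` (A \<inter> V)"
    then obtain z where z: "z \<in> A" "z \<in> V" "w = flat_chart R h z" by blast
    then show "w \<in> {w\<in>W. \<forall>i. i \<notin> - R --> w $ i = 0}"
      using B(10)[OF z(2)] AV[OF z(2)] by (auto simp: flat_chart_nth)
  next
    fix w assume "w \<in> {w\<in>W. \<forall>i. i \<notin> - R --> w $ i = 0}"
    then have w: "w \<in> W" "\<forall>i. i \<notin> - R --> w $ i = 0" by auto
    define z where "z = the_inv_into V (flat_chart R h) w"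
    have z: "z \<in> V" "flat_chart R h z = w" using B(8,9)[OF w(1)] by (auto simp: z_def)
    have "h i z = 0" if "i \<in> R" for i using z(2) w(2) that flat_chart_nth[of R h z i] by auto
    then show "w \<in> flat_chart R h ` (A \<inter> V)" using AV[OF z(1)] z by blast
  qed
  show ?thesis
  proof (rule that[of a "card (- R)"])
    show "a \<in> A \<inter> \<Omega>" by fact
    show "regular_point A (card (- R)) a"
      unfolding regular_point_def using f(1,2,4) im by blast
    assume "card (- R) = 0"
    then have "- R = {}" by simp
    then have "A \<inter> V = {a}"
    proof -
      have "z = a" if "z \<in> A" "z \<in> V" for z
      proof -
        have "flat_chart R h z = flat_chart R h a"
          using AV that f(1,2) \<open>- R = {}\<close> by (auto simp: vec_eq_iff flat_chart_nth)
        then show ?thesis using B(6) that f(2) by (meson inj_onD)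
      qed
      then show ?thesis using f(1,2) by blast
    qed
    then show "\<not> a islimpt A" using f(2) B(1) by (auto simp: islimpt_def)
  qed
qed

text \<open>Discarding the points near which \<open>P\<close> has a countable image loses only
  countably many values, by Lindelof.\<close>

lemma condensation:
  fixes A :: "'a::euclidean_space set"
  assumes "uncountable (P ` A)"
  shows "\<exists>B\<subseteq>A. B ~= {} \<and> (\<forall>V. open V --> B \<inter> V ~= {} --> uncountable (P ` (B \<inter> V)))"
proof -
  define B where "B = {a\<in>A. \<forall>V. open V --> a \<in> V --> uncountable (P ` (A \<inter> V))}"
  define \<F> where "\<F> = {V. open V \<and> countable (P ` (A \<inter> V))}"
  obtain \<F>' where F: "\<F>' \<subseteq> \<F>" "countable \<F>'" "\<Union>\<F>' = \<Union>\<F>"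
    using Lindelof[of \<F>] by (auto simp: \<F>_def)
  have "A - B \<subseteq> \<Union>\<F>" by (auto simp: B_def \<F>_def)
  then have "P ` (A - B) \<subseteq> (\<Union>V\<in>\<F>'. P ` (A \<inter> V))" unfolding F(3)[symmetric] by blast
  moreover have "countable (\<Union>V\<in>\<F>'. P ` (A \<inter> V))" using F by (intro countable_UN) (auto simp: \<F>_def)
  ultimately have c: "countable (P ` (A - B))" by (rule countable_subset)
  have unc: "uncountable (P ` (B \<inter> V))" if "open V" "B \<inter> V ~= {}" for V
  proof
    assume "countable (P ` (B \<inter> V))"
    then have "countable (P ` (B \<inter> V) \<union> P ` (A - B))" using c by simp
    moreover have "P ` (A \<inter> V) \<subseteq> P ` (B \<inter> V) \<union> P ` (A - B)" by blast
    ultimately have "countable (P ` (A \<inter> V))" using countable_subset by blast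
    then show False using that by (auto simp: B_def)
  qed
  have "B ~= {}" using c assms by auto
  then show ?thesis using unc by (intro exI[of _ B]) (auto simp: B_def)
qed

lemma vanishing_antimono: "B \<subseteq> A ==> vanishing \<Omega> A \<subseteq> vanishing \<Omega> B"
  by (auto simp: vanishing_def)

text \<open>A holomorphic Sard theorem: critical values are countable, not merely negligible.\<close>

lemma countable_critical_values:
  fixes A :: "(complex^'n) set"
  assumes om: "open \<Omega>" and A: "A \<subseteq> \<Omega>" and P: "holo_fun_on P \<Omega>"
    and span: "!!b. b \<in> A ==> \<exists>S c. finite S \<and> S \<subseteq> vanishing \<Omega> A \<and> grad P b = (\<Sum>F\<in>S. c F *s grad F b)"
  shows "countable (P ` A)"
proof (rule ccontr)
  assume "uncountable (P ` A)"
  \<comment> \<open>After condensation the image stays uncountable near every point of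
    \<open>B\<close>, whereas a flat point of \<open>B\<close> has a neighbourhood on which
    \<open>P\<close> takes one value.\<close>
  then obtain B where B: "B \<subseteq> A" "B ~= {}" "!!V. open V ==> B \<inter> V ~= {} ==> uncountable (P ` (B \<inter> V))"
    using condensation[of P A] by blast
  have BO: "B \<subseteq> \<Omega>" using B A by blast
  obtain R :: "'n set" and h a V W where fl: "flat_at \<Omega> B R h a V W"
    using flat_point[OF om BO B(2)] by blast
  then have f: "a \<in> B" "a \<in> V" "biholomorphic (flat_chart R h) V W" and h: "!!i. i \<in> R ==> h i \<in> vanishing \<Omega> B"
    unfolding flat_at_def by blast+
  have sp: "\<forall>b\<in>B. \<exists>S c. finite S \<and> S \<subseteq> vanishing \<Omega> B \<and> grad P b = (\<Sum>F\<in>S. c F *s grad F b)"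
  proof
    fix b assume "b \<in> B"
    then obtain S c where "finite S" "S \<subseteq> vanishing \<Omega> A" "grad P b = (\<Sum>F\<in>S. c F *s grad F b)"
      using span[OF subsetD[OF B(1)]] by metis
    then show "\<exists>S c. finite S \<and> S \<subseteq> vanishing \<Omega> B \<and> grad P b = (\<Sum>F\<in>S. c F *s grad F b)"
      using vanishing_antimono[OF B(1), of \<Omega>] by (intro exI[of _ S] exI[of _ c]) blast
  qed
  have "P z = P a" if "z \<in> B \<inter> V" for z
  proof -
    have "\<forall>i\<in>R. h i z = 0" using h that by (auto simp: vanishing_def)
    then show ?thesis using fl P sp that unfolding flat_at_def by blast
  qed
  then have "P ` (B \<inter> V) \<subseteq> {P a}" by blast
  then have "countable (P ` (B \<inter> V))" using countable_subset[of _ "{P a}"] by auto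
  then show False using B(3)[of V] f(1,2) biholomorphic_D(1)[OF f(3)] by blast
qed

text \<open>A countable closed set does not separate the plane, so the interior of \<open>T\<close>
  and the complement of \<open>T\<close> cannot both be nonempty.\<close>

lemma countable_compact_frontier:
  fixes T :: "complex set" assumes "compact T" "countable (frontier T)" shows "countable T"
proof -
  have c: "connected (UNIV - frontier T)" by (rule connected_open_diff_countable) (use assms in auto)
  have e: "UNIV - frontier T = interior T \<union> (- T)" using compact_imp_closed[OF assms(1)] by (auto simp: frontier_def)
  have "T ~= UNIV" using assms(1) not_compact_UNIV by metis
  then have "- T ~= {}" by blast
  have "interior T = {}"
  proof (rule ccontr)
    assume "interior T ~= {}"
    then show False using connectedD[OF c, of "interior T" "- T"] \<open>- T ~= {}\<close> e compact_imp_closed[OF assms(1)] interior_subset[of T]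
      by (auto simp: open_Compl)
  qed
  then have "T \<subseteq> frontier T" using closure_subset by (auto simp: frontier_def)
  then show ?thesis using assms(2) countable_subset by blast
qed

text \<open>If a coordinate took uncountably many frontier values on \<open>K\<close>, some flat
  piece through such a point would carry a holomorphic disc in \<open>K\<close> on which the
  coordinate is not constant; by the open mapping theorem the frontier value would be interior to
  the image. Countability is enough later to exclude regular points of positive dimension.\<close>

lemma compact_zero_set_countable:
  fixes K :: "(complex^'n) set"
  assumes om: "open \<Omega>" and hol: "!!g. g \<in> \<G> ==> holo_fun_on g \<Omega>" and K: "compact K" "K = {z\<in>\<Omega>. \<forall>g\<in>\<G>. g z = 0}"
  shows "countable K"
proof -
  have KO: "K \<subseteq> \<Omega>" using K(2) by blast
  have "countable ((%z. z $ i) ` K)" for i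
  proof (rule countable_compact_frontier)
    define T where "T = (%z. z $ i) ` K"
    show cT: "compact T" unfolding T_def using K(1) by (intro compact_continuous_image continuous_intros)
    define A where "A = {z\<in>K. z $ i \<in> frontier T}"
    have "countable ((%z. z $ i) ` A)"
    proof (rule ccontr)
      assume "uncountable ((%z. z $ i) ` A)"
      then obtain B where B: "B \<subseteq> A" "B ~= {}" "!!V. open V ==> B \<inter> V ~= {} ==> uncountable ((%z. z $ i) ` (B \<inter> V))"
        using condensation[of "%z. z $ i" A] by blast
      have BK: "B \<subseteq> K" and BO: "B \<subseteq> \<Omega>" using B KO by (auto simp: A_def)
      obtain R :: "'n set" and h a V W where fl: "flat_at \<Omega> B R h a V W"
        using flat_point[OF om BO B(2)] by blast
      then have f: "a \<in> B" "a \<in> V" "V \<subseteq> \<Omega>" "biholomorphic (flat_chart R h) V W" "convex W"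
        "!!i. i \<in> R ==> h i \<in> vanishing \<Omega> B"
        "!!F z. F \<in> vanishing \<Omega> B ==> z \<in> V ==> (!!i. i \<in> R ==> h i z = 0) ==> F z = 0"
        unfolding flat_at_def by blast+
      note BB = biholomorphic_D[OF f(4)]
      have "uncountable ((%z. z $ i) ` (B \<inter> V))" using B(3) f(1,2) BB(1) by blast
      then have "\<not> (%z. z $ i) ` (B \<inter> V) \<subseteq> {a $ i}" using countable_subset[of _ "{a $ i}"] by auto
      then obtain b where b: "b \<in> B" "b \<in> V" "b $ i ~= a $ i" by blast
      define \<Phi> where "\<Phi> = flat_chart R h"
      define v where "v = \<Phi> b - \<Phi> a"
      have h0: "h j z = 0" if "j \<in> R" "z \<in> B" for j z using f(6)[OF that(1)] that(2) by (auto simp: vanishing_def)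
      have vR: "v $ j = 0" if "j \<in> R" for j using h0 that b f(1) by (simp add: v_def \<Phi>_def flat_chart_nth)
      define Q where "Q = {l::complex. \<Phi> a + l *s v \<in> W}"
      have Q: "open Q" unfolding Q_def using open_vimage[OF BB(2), of "%l::complex. \<Phi> a + l *s v"]
        by (simp add: vimage_def continuous_intros)
      have "convex Q"
        unfolding convex_alt
      proof safe
        fix x y :: complex and u :: real assume "x \<in> Q" "y \<in> Q" "0 \<le> u" "u \<le> 1"
        moreover have "\<Phi> a + ((1-u) *\<^sub>R x + u *\<^sub>R y) *s v = (1-u) *\<^sub>R (\<Phi> a + x *s v) + u *\<^sub>R (\<Phi> a + y *s v)"
          by (simp add: vec_eq_iff algebra_simps)
        ultimately show "(1 - u) *\<^sub>R x + u *\<^sub>R y \<in> Q"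
          using f(5) unfolding Q_def mem_Collect_eq by (metis convex_alt)
      qed
      have Q01: "0 \<in> Q" "1 \<in> Q" using BB(10) f(2) b(2) by (auto simp: Q_def v_def \<Phi>_def)
      define p where "p l = the_inv_into V \<Phi> (\<Phi> a + l *s v)" for l
      have pV: "p l \<in> V" "\<Phi> (p l) = \<Phi> a + l *s v" if "l \<in> Q" for l
        using BB(8,9) that by (auto simp: p_def Q_def \<Phi>_def)
      have pK: "p l \<in> K" if l: "l \<in> Q" for l
      proof -
        have "h j (p l) = 0" if "j \<in> R" for j
        proof -
          have "\<Phi> (p l) $ j = \<Phi> a $ j" using pV(2)[OF l] vR[OF that] by simp
          then show ?thesis using that h0[OF that f(1)] by (simp add: \<Phi>_def flat_chart_nth)
        qed
        moreover have "g \<in> vanishing \<Omega> B" if "g \<in> \<G>" for g using hol[OF that] BK K(2) that by (auto simp: vanishing_def)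
        ultimately have "\<forall>g\<in>\<G>. g (p l) = 0" using f(7) pV(1)[OF l] by blast
        then show ?thesis using K(2) pV(1)[OF l] f(3) by blast
      qed
      have p0: "p 0 = a" and p1: "p 1 = b" using BB(7) f(2) b(2) by (auto simp: p_def v_def \<Phi>_def)
      have holp: "(%l. p l $ i) holomorphic_on Q"
        unfolding p_def by (rule holo_line_on[where h="%w. the_inv_into V \<Phi> w $ i" and U=W])
          (use BB(4) in \<open>auto simp: holo_map_on_def Q_def \<Phi>_def\<close>)
      have "\<not> (%l. p l $ i) constant_on Q"
        using Q01 p0 p1 b(3) unfolding constant_on_def by metis
      then have "open ((%l. p l $ i) ` Q)"
        using open_mapping_thm[OF holp Q convex_connected[OF \<open>convex Q\<close>] Q] by blast
      moreover have "(%l. p l $ i) ` Q \<subseteq> T" using pK by (auto simp: T_def)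
      ultimately have "a $ i \<in> interior T" using Q01(1) p0 interior_maximal by blast
      moreover have "a $ i \<in> frontier T" using f(1) B(1) by (auto simp: A_def)
      ultimately show False by (simp add: frontier_def)
    qed
    moreover have "frontier T \<subseteq> (%z. z $ i) ` A"
    proof
      fix x assume x: "x \<in> frontier T"
      then have "x \<in> T" using compact_imp_closed[OF cT] by (auto simp: frontier_def)
      then show "x \<in> (%z. z $ i) ` A" using x by (auto simp: T_def A_def)
    qed
    ultimately show "countable (frontier T)" using countable_subset by blast
  qed
  then have "countable (Pi\<^sub>E UNIV (%i. (%z. z $ i) ` K))" by (intro countable_PiE) auto
  then have "countable ((%f. \<chi> i. f i) ` (Pi\<^sub>E UNIV (%i. (%z. z $ i) ` K)))" by simp
  moreover have "K \<subseteq> (%f. \<chi> i. f i) ` (Pi\<^sub>E UNIV (%i. (%z. z $ i) ` K))"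
  proof
    fix z assume "z \<in> K"
    then show "z \<in> (%f. \<chi> i. f i) ` (Pi\<^sub>E UNIV (%i. (%z. z $ i) ` K))"
      by (intro image_eqI[of _ _ "%i. z $ i"]) (auto simp: vec_eq_iff)
  qed
  ultimately show ?thesis using countable_subset by blast
qed

section \<open>Isolated points of analytic sets\<close>

text \<open>The left-hand side is the determinant of a Gram matrix of rank at most \<open>r\<close> and size \<open>r + 1\<close>.\<close>

lemma gram_det_zero:
  fixes a :: "nat => 'b => complex"
  assumes X: "finite X" and card: "card {x\<in>X. \<exists>j\<le>r. a j x ~= 0} \<le> r"
  shows "(\<Sum>p | p permutes {..r}. of_int (sign p) * (\<Prod>j\<le>r. \<Sum>x\<in>X. c x * a j x * a (p j) x)) = 0"
proof -
  define Y where "Y = {x\<in>X. \<exists>j\<le>r. a j x ~= 0}"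
  have Y: "finite Y" "Y \<subseteq> X" using X by (auto simp: Y_def)
  have inner: "(\<Prod>j\<le>r. \<Sum>x\<in>X. c x * a j x * a (p j) x) = (\<Sum>g\<in>PiE {..r} (%_. Y). (\<Prod>j\<le>r. c (g j) * a j (g j)) * (\<Prod>j\<le>r. a (p j) (g j)))" for p
  proof -
    have "(\<Prod>j\<le>r. \<Sum>x\<in>X. c x * a j x * a (p j) x) = (\<Prod>j\<le>r. \<Sum>x\<in>Y. c x * a j x * a (p j) x)"
      by (intro prod.cong refl sum.mono_neutral_right) (auto simp: X Y_def)
    also have "\<dots> = (\<Sum>g\<in>PiE {..r} (%_. Y). \<Prod>j\<le>r. c (g j) * a j (g j) * a (p j) (g j))"
      by (rule prod_sum_PiE) (use Y in auto)
    finally show ?thesis by (simp add: prod.distrib)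
  qed
  have zero: "(\<Sum>p | p permutes {..r}. of_int (sign p) * (\<Prod>j\<le>r. a (p j) (g j))) = (0::complex)" if g: "g \<in> PiE {..r} (%_. Y)" for g
  proof -
    have "\<not> inj_on g {..r}"
    proof
      assume "inj_on g {..r}"
      moreover have "g ` {..r} \<subseteq> Y" using g by auto
      ultimately have "card {..r} \<le> card Y" using Y(1) by (metis card_inj_on_le)
      then show False using card by (simp add: Y_def)
    qed
    then obtain i k where ik: "i \<le> r" "k \<le> r" "i ~= k" "g i = g k" by (auto simp: inj_on_def)
    \<comment> \<open>Two of the \<open>r + 1\<close> indices are sent to the same point. Composing
      with their transposition changes the sign but not the product, so the sum is its own
      negative.\<close>
    define t where "t = Transposition.transpose i k"
    have t: "t permutes {..r}" unfolding t_def using ik by (intro permutes_swap_id) auto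
    define T where "T = (\<Sum>p | p permutes {..r}. of_int (sign p) * (\<Prod>j\<le>r. a (p j) (g j)))"
    have "T = (\<Sum>p | p permutes {..r}. of_int (sign (p \<circ> t)) * (\<Prod>j\<le>r. a ((p \<circ> t) j) (g j)))"
      unfolding T_def by (rule sum_permutations_compose_right[OF t])
    also have "\<dots> = (\<Sum>p | p permutes {..r}. - (of_int (sign p) * (\<Prod>j\<le>r. a (p j) (g j))))"
    proof (rule sum.cong[OF refl])
      fix p assume "p \<in> {p. p permutes {..r}}"
      then have p: "p permutes {..r}" by simp
      have "sign (p \<circ> t) = - sign p"
        using sign_compose[of p t] permutation_permutes[of p] permutation_permutes[of t] p t sign_swap_id[of i k] ik(3)
        by (auto simp: t_def)
      moreover have "(\<Prod>j\<le>r. a ((p \<circ> t) j) (g j)) = (\<Prod>j\<le>r. a (p j) (g j))"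
      proof -
        have gt: "g (t j) = g j" for j using ik(4) by (auto simp: t_def Transposition.transpose_def)
        have "(\<Prod>j\<le>r. a (p j) (g j)) = (\<Prod>j\<le>r. a (p (t j)) (g (t j)))"
          by (rule prod.reindex_bij_betw[OF permutes_imp_bij[OF t], symmetric])
        then show ?thesis by (simp add: gt)
      qed
      ultimately show "of_int (sign (p \<circ> t)) * (\<Prod>j\<le>r. a ((p \<circ> t) j) (g j)) = - (of_int (sign p) * (\<Prod>j\<le>r. a (p j) (g j)))" by simp
    qed
    also have "\<dots> = - T" by (simp add: T_def sum_negf)
    finally show ?thesis by (simp add: T_def)
  qed
  have "(\<Sum>p | p permutes {..r}. of_int (sign p) * (\<Prod>j\<le>r. \<Sum>x\<in>X. c x * a j x * a (p j) x)) =
     (\<Sum>p | p permutes {..r}. \<Sum>g\<in>PiE {..r} (%_. Y). (\<Prod>j\<le>r. c (g j) * a j (g j)) * (of_int (sign p) * (\<Prod>j\<le>r. a (p j) (g j))))"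
    unfolding inner sum_distrib_left by (intro sum.cong refl) (simp add: mult_ac)
  also have "\<dots> = (\<Sum>g\<in>PiE {..r} (%_. Y). \<Sum>p | p permutes {..r}. (\<Prod>j\<le>r. c (g j) * a j (g j)) * (of_int (sign p) * (\<Prod>j\<le>r. a (p j) (g j))))"
    by (rule sum.swap)
  also have "\<dots> = 0"
    by (rule sum.neutral) (simp add: zero flip: sum_distrib_left)
  finally show ?thesis .
qed

lemma gram_det_diagonal:
  fixes s :: "nat => nat => complex"
  assumes "!!j l. j \<le> r ==> l \<le> r ==> s j l ~= 0 \<longleftrightarrow> j = l"
  shows "(\<Sum>p | p permutes {..r}. of_int (sign p) * (\<Prod>j\<le>r. s j (p j))) ~= 0"
proof -
  have "(\<Sum>p | p permutes {..r}. of_int (sign p) * (\<Prod>j\<le>r. s j (p j))) = (\<Sum>p\<in>{id}. of_int (sign p) * (\<Prod>j\<le>r. s j (p j)))"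
  proof (rule sum.mono_neutral_right)
    show "\<forall>p\<in>{p. p permutes {..r}} - {id}. of_int (sign p) * (\<Prod>j\<le>r. s j (p j)) = 0"
    proof
      fix p assume p: "p \<in> {p. p permutes {..r}} - {id}"
      then have pp: "p permutes {..r}" by simp
      obtain j where j: "p j ~= j" using p by (auto simp: fun_eq_iff)
      then have "j \<le> r" using permutes_not_in[OF pp, of j] by auto
      moreover have "p j \<le> r" using permutes_in_image[OF pp, of j] \<open>j \<le> r\<close> by auto
      ultimately have "\<exists>j\<in>{..r}. s j (p j) = 0" using assms[of j "p j"] j by auto
      then show "of_int (sign p) * (\<Prod>j\<le>r. s j (p j)) = 0" by (simp add: prod_zero)
    qed
  qed (auto simp: finite_permutations permutes_id)
  then show ?thesis using assms by simp
qed

lemma tube_positive: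
  fixes F :: "'a::euclidean_space => 'b::metric_space => real"
  assumes U: "open U" "z \<in> U" and K: "compact K" and cont: "continuous_on (U \<times> K) (%(x,k). F x k)"
    and pos: "!!k. k \<in> K ==> F z k > 0"
  obtains d where "d > 0" "ball z d \<subseteq> U" "!!x k. x \<in> ball z d ==> k \<in> K ==> F x k > 0"
proof -
  obtain d0 where d0: "d0 > 0" "ball z d0 \<subseteq> U" using U open_contains_ball by blast
  have "\<exists>d>0. d \<le> d0 \<and> (\<forall>x\<in>ball z d. \<forall>k\<in>K. F x k > 0)"
  proof (rule ccontr)
    assume neg: "\<not> ?thesis"
    define e where "e n = min d0 (inverse (real (Suc n)))" for n
    have e: "e n > 0" "e n \<le> d0" "e n \<le> inverse (real (Suc n))" for n
      using d0(1) by (simp_all add: e_def)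
    have "\<exists>x k. x \<in> ball z (e n) \<and> k \<in> K \<and> F x k \<le> 0" for n
      using neg e(1,2)[of n] by (meson not_le)
    then obtain x k where xk: "!!n. x n \<in> ball z (e n)" "!!n. k n \<in> K" "!!n. F (x n) (k n) \<le> 0" by metis
    obtain k' s where k': "k' \<in> K" "strict_mono s" "(k \<circ> s) \<longlonglongrightarrow> k'" using K xk(2) unfolding compact_def by metis
    have "x \<longlonglongrightarrow> z"
    proof (rule metric_LIMSEQ_I)
      fix \<epsilon> :: real assume "\<epsilon> > 0"
      then obtain N where N: "inverse (real (Suc N)) < \<epsilon>" using reals_Archimedean by blast
      have "dist (x n) z < \<epsilon>" if "n \<ge> N" for n
      proof -
        have "inverse (real (Suc n)) \<le> inverse (real (Suc N))" using that by (intro le_imp_inverse_le) auto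
        moreover have "dist (x n) z < e n" using xk(1)[of n] by (simp add: dist_commute)
        ultimately show ?thesis using e(3)[of n] N by linarith
      qed
      then show "\<exists>N. \<forall>n\<ge>N. dist (x n) z < \<epsilon>" by blast
    qed
    then have "(%n. (x (s n), k (s n))) \<longlonglongrightarrow> (z, k')"
      using k'(2,3) by (intro tendsto_Pair) (auto simp: o_def LIMSEQ_subseq_LIMSEQ[unfolded o_def])
    then have "(%n. (%(x,k). F x k) (x (s n), k (s n))) \<longlonglongrightarrow> (%(x,k). F x k) (z, k')"
    proof (rule continuous_on_tendsto_compose[OF cont])
      show "(z, k') \<in> U \<times> K" using U k' by simp
      have "x n \<in> U" for n using xk(1)[of n] e(2)[of n] d0(2) by (auto simp: subset_eq)
      then show "\<forall>\<^sub>F n in sequentially. (x (s n), k (s n)) \<in> U \<times> K" using xk(2) by (simp add: always_eventually)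
    qed
    then have "F z k' \<le> 0" by (intro tendsto_upperbound[of "%n. F (x (s n)) (k (s n))" _ sequentially]) (use xk(3) in \<open>auto intro: always_eventually\<close>)
    then show False using pos[OF k'(1)] by simp
  qed
  then obtain d where d: "d > 0" "d \<le> d0" "\<forall>x\<in>ball z d. \<forall>k\<in>K. F x k > 0" by blast
  show ?thesis
  proof (rule that[of d])
    show "ball z d \<subseteq> U" using d(2) d0(2) by (auto simp: subset_eq)
  qed (use d in auto)
qed

text \<open>Otherwise \<open>inverse f\<close> would be larger at the centre than on the circle. The
  hypothesis compares continuous quantities, hence is stable when \<open>f\<close> depends on a
  parameter.\<close>

lemma root_in_disc:
  assumes s: "s > 0" and f: "continuous_on (cball \<alpha> s) f" "f holomorphic_on ball \<alpha> s"
    and big: "!!l. l \<in> sphere \<alpha> s ==> cmod (f l) > cmod (f \<alpha>)"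
  obtains l where "l \<in> ball \<alpha> s" "f l = 0"
proof -
  have "\<exists>l\<in>ball \<alpha> s. f l = 0"
  proof (rule ccontr)
    assume "\<not> ?thesis"
    then have nz: "f l ~= 0" if "l \<in> cball \<alpha> s" for l
      using that big[of l] by (cases "dist \<alpha> l = s") auto
    have "\<exists>l\<in>sphere \<alpha> s. \<forall>m\<in>sphere \<alpha> s. cmod (f l) \<le> cmod (f m)"
      by (rule continuous_attains_inf) (use s in \<open>auto intro!: continuous_intros continuous_on_subset[OF f(1)]\<close>)
    then obtain l0 where l0: "l0 \<in> sphere \<alpha> s" "!!m. m \<in> sphere \<alpha> s ==> cmod (f l0) \<le> cmod (f m)" by blast
    have l0nz: "f l0 ~= 0" using big[OF l0(1)] by auto
    have "cmod ((deriv ^^ 0) (%l. inverse (f l)) \<alpha>) \<le> fact 0 * inverse (cmod (f l0)) / s ^ 0"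
    proof (rule Cauchy_inequality)
      show "(%l. inverse (f l)) holomorphic_on ball \<alpha> s" using f(2) nz by (auto intro!: holomorphic_intros)
      show "continuous_on (cball \<alpha> s) (%l. inverse (f l))" using f(1) nz by (auto intro!: continuous_intros)
      show "cmod (inverse (f x)) \<le> inverse (cmod (f l0))" if "cmod (\<alpha> - x) = s" for x
        unfolding norm_inverse using that l0nz by (intro le_imp_inverse_le l0(2)) (auto simp: dist_norm)
    qed (use s in auto)
    then have "inverse (cmod (f \<alpha>)) \<le> inverse (cmod (f l0))" by (simp add: norm_inverse)
    moreover have "cmod (f \<alpha>) > 0" using nz[of \<alpha>] s by simp
    ultimately have "cmod (f l0) \<le> cmod (f \<alpha>)" using inverse_le_imp_le by blast
    then show False using big[OF l0(1)] by simp
  qed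
  then show ?thesis using that by blast
qed

text \<open>The argument principle with weight \<open>h\<close>. The integral depends
  holomorphically on parameters even where the individual zeros do not.\<close>

lemma zero_sum:
  assumes "0 < \<rho>" "\<rho> < \<rho>1" and f: "f holomorphic_on ball 0 \<rho>1" and h: "h holomorphic_on ball 0 \<rho>1"
    and nz: "!!l. l \<in> sphere 0 \<rho> ==> f l ~= 0"
  shows "finite {l\<in>ball 0 \<rho>. f l = 0}"
    "contour_integral (circlepath 0 \<rho>) (%l. deriv f l * h l / f l) = 2 * pi * \<i> * (\<Sum>l\<in>{l\<in>ball 0 \<rho>. f l = 0}. h l * of_int (zorder f l))"
    "!!l. l \<in> ball 0 \<rho> ==> f l = 0 ==> zorder f l \<ge> 1"
proof -
  define \<rho>2 where "\<rho>2 = (\<rho> + \<rho>1) / 2"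
  have r: "\<rho> < \<rho>2" "\<rho>2 < \<rho>1" "0 < \<rho>2" using assms(1,2) by (auto simp: \<rho>2_def)
  have fin2: "finite {l\<in>cball 0 \<rho>2. f l = 0}"
  proof (cases "f constant_on ball 0 \<rho>1")
    case True
    then obtain c where c: "!!l. l \<in> ball 0 \<rho>1 ==> f l = c" by (auto simp: constant_on_def)
    have "f (of_real \<rho>) ~= 0" using nz[of "of_real \<rho>"] assms(1) by simp
    then have "c ~= 0" using c[of "of_real \<rho>"] assms(1,2) by simp
    then have "{l\<in>cball 0 \<rho>2. f l = 0} = {}" using c r by auto
    then show ?thesis by (metis finite.emptyI)
  next
    case False
    then show ?thesis using r by (intro holomorphic_compact_finite_zeros[OF f]) auto
  qed
  have sub: "ball 0 \<rho>2 \<subseteq> ball (0::complex) \<rho>1" using r by auto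
  show fin: "finite {l\<in>ball 0 \<rho>. f l = 0}"
    by (rule finite_subset[OF _ fin2]) (use r in auto)
  have "contour_integral (circlepath 0 \<rho>) (%l. deriv f l * h l / f l) =
     2 * pi * \<i> * (\<Sum>p\<in>{w\<in>ball 0 \<rho>2. f w = 0 \<or> w \<in> {}}. winding_number (circlepath 0 \<rho>) p * h p * of_int (zorder f p))"
  proof (rule argument_principle)
    show "f holomorphic_on ball 0 \<rho>2 - {}" "h holomorphic_on ball 0 \<rho>2" using f h sub holomorphic_on_subset by auto
    show "path_image (circlepath 0 \<rho>) \<subseteq> ball 0 \<rho>2 - {w\<in>ball 0 \<rho>2. f w = 0 \<or> w \<in> {}}" using assms(1) r nz by auto
    show "\<forall>z. z \<notin> ball 0 \<rho>2 --> winding_number (circlepath 0 \<rho>) z = 0"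
    proof (intro allI impI)
      fix z :: complex assume "z \<notin> ball 0 \<rho>2"
      then show "winding_number (circlepath 0 \<rho>) z = 0"
        by (intro winding_number_zero_outside[where s="cball 0 \<rho>"]) (use assms(1) r in auto)
    qed
    show "finite {w\<in>ball 0 \<rho>2. f w = 0 \<or> w \<in> {}}" by (rule finite_subset[OF _ fin2]) auto
  qed auto
  also have "(\<Sum>p\<in>{w\<in>ball 0 \<rho>2. f w = 0 \<or> w \<in> {}}. winding_number (circlepath 0 \<rho>) p * h p * of_int (zorder f p)) =
     (\<Sum>l\<in>{l\<in>ball 0 \<rho>. f l = 0}. h l * of_int (zorder f l))"
  proof (rule sum.mono_neutral_cong_right)
    show "finite {w\<in>ball 0 \<rho>2. f w = 0 \<or> w \<in> {}}" by (rule finite_subset[OF _ fin2]) auto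
    show "{l\<in>ball 0 \<rho>. f l = 0} \<subseteq> {w\<in>ball 0 \<rho>2. f w = 0 \<or> w \<in> {}}" using r by auto
    show "\<forall>i\<in>{w\<in>ball 0 \<rho>2. f w = 0 \<or> w \<in> {}} - {l\<in>ball 0 \<rho>. f l = 0}. winding_number (circlepath 0 \<rho>) i * h i * of_int (zorder f i) = 0"
    proof
      fix i assume i: "i \<in> {w\<in>ball 0 \<rho>2. f w = 0 \<or> w \<in> {}} - {l\<in>ball 0 \<rho>. f l = 0}"
      then have "i \<notin> cball 0 \<rho>" using nz[of i] by (auto simp: dist_norm order_le_less)
      then have "winding_number (circlepath 0 \<rho>) i = 0"
        by (intro winding_number_zero_outside[where s="cball 0 \<rho>"]) (use assms(1) in auto)
      then show "winding_number (circlepath 0 \<rho>) i * h i * of_int (zorder f i) = 0" by simp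
    qed
    show "winding_number (circlepath 0 \<rho>) x * h x * of_int (zorder f x) = h x * of_int (zorder f x)" if "x \<in> {l\<in>ball 0 \<rho>. f l = 0}" for x
      using winding_number_circlepath[of x 0 \<rho>] that by simp
  qed
  finally show "contour_integral (circlepath 0 \<rho>) (%l. deriv f l * h l / f l) = 2 * pi * \<i> * (\<Sum>l\<in>{l\<in>ball 0 \<rho>. f l = 0}. h l * of_int (zorder f l))" .
  show "zorder f l \<ge> 1" if "l \<in> ball 0 \<rho>" "f l = 0" for l
  proof -
    have "\<exists>w\<in>ball 0 \<rho>1. f w ~= 0" using nz[of "of_real \<rho>"] assms(1,2) by (intro bexI[of _ "of_real \<rho>"]) auto
    then show ?thesis using zorder_exist_zero[OF f open_ball connected_ball, of l] that assms(2) by auto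
  qed
qed

section \<open>Elimination of one variable by Gram determinants\<close>

definition coord_zeros :: "'n set => real => (complex^'n => complex) set => (complex^'n) set" where
  "coord_zeros I r \<G> = {z\<in>ball 0 r. (\<forall>i. i \<notin> I --> z $ i = 0) \<and> (\<forall>g\<in>\<G>. g z = 0)}"

lemma holo_poly: "holo_fun_on (%z. poly p (z $ i)) U"
  by (induction p) (auto intro!: holo_add holo_mult)

lemma finite_Min_choose:
  fixes P :: "'a => real => bool"
  assumes "finite S" "!!x. x \<in> S ==> \<exists>d>0. \<forall>e. 0 < e --> e \<le> d --> P x e"
  obtains d where "d > 0" "!!x e. x \<in> S ==> 0 < e ==> e \<le> d ==> P x e"
proof -
  obtain f where f: "!!x. x \<in> S ==> f x > 0 \<and> (\<forall>e. 0 < e --> e \<le> f x --> P x e)" using assms(2) by metis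
  show ?thesis
  proof (rule that[of "Min (insert 1 (f ` S))"])
    show "Min (insert 1 (f ` S)) > 0" using assms(1) f by auto
    fix x e assume x: "x \<in> S" and e: "0 < e" "e \<le> Min (insert 1 (f ` S))"
    have "Min (insert 1 (f ` S)) \<le> f x" using assms(1) x by (intro Min_le) auto
    then show "P x e" using f[OF x] e by simp
  qed
qed

text \<open>The setting for eliminating the coordinate \<open>i0\<close>: base points
  \<open>z\<close> have \<open>z $ i0 = 0\<close>, and the fibre over \<open>z\<close> is the disc
  of points \<open>z + l *s e\<close> with \<open>cmod l < \<rho>\<close>. Since \<open>g1\<close>
  has no zero on the bounding circles, its zeros in these discs are counted by contour
  integrals.\<close>

locale slice =
  fixes r0 :: real and \<G> :: "(complex^'n => complex) set" and g1 :: "complex^'n => complex" and e :: "complex^'n"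
    and i0 :: 'n and I :: "'n set" and \<rho> d :: real
  assumes hol: "!!g. g \<in> \<G> ==> holo_fun_on g (ball 0 r0)" and g1: "g1 \<in> \<G>"
    and i0: "i0 \<in> I" "e $ i0 ~= 0" and eI: "!!i. i \<notin> I ==> e $ i = 0"
    and \<rho>: "0 < \<rho>" "\<rho> < 1" and d: "d > 0"
    and dom: "!!z l. z \<in> ball 0 d ==> cmod l \<le> 1 ==> z + l *s e \<in> ball 0 r0"
    and nz: "!!z l. z \<in> ball 0 d ==> l \<in> sphere 0 \<rho> ==> g1 (z + l *s e) ~= 0"
begin

definition "f z l = g1 (z + l *s e)"
definition "Rt z = {l\<in>ball 0 \<rho>. f z l = 0}"
text \<open>The zeros of \<open>g1\<close> over \<open>z\<close> that are not common zeros of \<G>;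
  there is a common zero over \<open>z\<close> iff this set is smaller than
  \<open>Rt z\<close>.\<close>

definition "NZ z = {l\<in>Rt z. \<exists>g\<in>\<G>. g (z + l *s e) ~= 0}"
text \<open>By residues this is \<open>2 * pi * \<i>\<close> times the sum of \<Phi> over
  \<open>Rt z\<close> with multiplicities, in a form that shows holomorphy in
  \<open>z\<close>.\<close>

definition "s \<Phi> z = contour_integral (circlepath 0 \<rho>) (%l. cdot (grad g1 (z + l *s e)) e * \<Phi> (z + l *s e) / g1 (z + l *s e))"
text \<open>The polynomial factor separates the points of a fibre: over a base point the coordinate
  \<open>i0\<close> of \<open>z + l *s e\<close> is \<open>l * e $ i0\<close>.\<close>

definition "\<M> = {%z. poly p (z $ i0) * g z | p g. g \<in> \<G>}"
text \<open>The Gram determinant of \<open>F 0, ..., F r\<close> for the form that sends two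
  functions to \<open>s\<close> of their product; a Leibniz sum over permutations of
  \<open>{..r}\<close>, because the size varies with \<open>r\<close>.\<close>

definition "Dt r F z = (\<Sum>p | p permutes {..r}. of_int (sign p) * (\<Prod>j\<le>r. s (%z. F j z * F (p j) z) z))" for r :: nat
definition "\<G>' r = {Dt r F | F. \<forall>j. F j \<in> \<M>}"

lemma holg1: "holo_fun_on g1 (ball 0 r0)" using hol g1 by blast

lemma fhol: "z \<in> ball 0 d ==> holo_fun_on \<Phi> (ball 0 r0) ==> (%l. \<Phi> (z + l *s e)) holomorphic_on ball 0 1"
  by (rule holo_line_on) (use dom in auto)

lemma s_eq:
  assumes z: "z \<in> ball 0 d" and \<Phi>: "holo_fun_on \<Phi> (ball 0 r0)"
  shows "s \<Phi> z = 2 * pi * \<i> * (\<Sum>l\<in>Rt z. \<Phi> (z + l *s e) * of_int (zorder (f z) l))"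
proof -
  have "s \<Phi> z = contour_integral (circlepath 0 \<rho>) (%l. deriv (f z) l * \<Phi> (z + l *s e) / f z l)"
    unfolding s_def
  proof (rule contour_integral_cong[OF refl])
    fix l assume "l \<in> path_image (circlepath 0 \<rho>)"
    then have "z + l *s e \<in> ball 0 r0" using \<rho> z by (intro dom) auto
    then have "deriv (f z) l = cdot (grad g1 (z + l *s e)) e"
      unfolding f_def[abs_def] by (rule DERIV_imp_deriv[OF holo_line[OF holg1]])
    then show "cdot (grad g1 (z + l *s e)) e * \<Phi> (z + l *s e) / g1 (z + l *s e) = deriv (f z) l * \<Phi> (z + l *s e) / f z l"
      by (simp add: f_def)
  qed
  also have "\<dots> = 2 * pi * \<i> * (\<Sum>l\<in>Rt z. \<Phi> (z + l *s e) * of_int (zorder (f z) l))"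
    unfolding Rt_def
  proof (rule zero_sum(2)[OF \<rho>])
    show "f z holomorphic_on ball 0 1" unfolding f_def[abs_def] by (rule fhol[OF z holg1])
    show "(%l. \<Phi> (z + l *s e)) holomorphic_on ball 0 1" by (rule fhol[OF z \<Phi>])
    show "f z l ~= 0" if "l \<in> sphere 0 \<rho>" for l using nz[OF z that] by (simp add: f_def)
  qed
  finally show ?thesis .
qed

lemma Rt: assumes z: "z \<in> ball 0 d" shows "finite (Rt z)" "!!l. l \<in> Rt z ==> zorder (f z) l \<ge> 1"
proof -
  have h: "f z holomorphic_on ball 0 1" unfolding f_def[abs_def] by (rule fhol[OF z holg1])
  have n: "f z l ~= 0" if "l \<in> sphere 0 \<rho>" for l using nz[OF z that] by (simp add: f_def)
  show "finite (Rt z)" unfolding Rt_def by (rule zero_sum(1)[OF \<rho> h h n])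
  show "zorder (f z) l \<ge> 1" if "l \<in> Rt z" for l
    by (rule zero_sum(3)[OF \<rho> h h n]) (use that in \<open>auto simp: Rt_def\<close>)
qed

lemma s_holo:
  assumes \<Phi>: "holo_fun_on \<Phi> (ball 0 r0)" shows "holo_fun_on (s \<Phi>) (ball 0 d)"
proof -
  define Q where "Q = {z\<in>ball 0 r0. g1 z ~= 0}"
  have inQ: "z + l *s e \<in> Q" if "z \<in> ball 0 d" "l \<in> sphere 0 \<rho>" for z l
    using dom[OF that(1), of l] nz[OF that] that(2) \<rho> by (auto simp: Q_def)
  have "holo_fun_on (%z. grad g1 z $ i) Q" for i
    by (rule holo_subset[OF holo_grad[OF open_ball holg1]]) (auto simp: Q_def)
  then have \<kappa>: "holo_fun_on (%z. cdot (grad g1 z) e * \<Phi> z / g1 z) Q"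
    unfolding cdot_def by (intro holo_divide holo_mult holo_sum holo_const holo_subset[OF \<Phi>] holo_subset[OF holg1]) (auto simp: Q_def)
  show ?thesis
    unfolding s_def[abs_def]
  proof (rule holo_contour_integral[OF open_ball \<rho>(1)])
    have "continuous_on (ball 0 d \<times> sphere 0 \<rho>) (%x. cdot (grad g1 (fst x + snd x *s e)) e * \<Phi> (fst x + snd x *s e) / g1 (fst x + snd x *s e))"
      by (rule continuous_on_compose2[OF holo_continuous[OF \<kappa>], of _ "%x. fst x + snd x *s e"]) (use inQ in \<open>auto intro!: continuous_intros\<close>)
    then show "continuous_on (ball 0 d \<times> sphere 0 \<rho>) (%(z, l). cdot (grad g1 (z + l *s e)) e * \<Phi> (z + l *s e) / g1 (z + l *s e))"
      by (simp add: case_prod_unfold)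
    show "holo_fun_on (%z. cdot (grad g1 (z + l *s e)) e * \<Phi> (z + l *s e) / g1 (z + l *s e)) (ball 0 d)" if "l \<in> sphere 0 \<rho>" for l
      by (rule holo_compose[OF holo_map_shift(1) \<kappa>]) (use inQ that in auto)
  qed
qed

lemma \<M>_holo: "F \<in> \<M> ==> holo_fun_on F (ball 0 r0)"
proof -
  assume "F \<in> \<M>"
  then obtain p g where F: "g \<in> \<G>" "F = (%z. poly p (z $ i0) * g z)" by (auto simp: \<M>_def)
  show ?thesis unfolding F(2) by (rule holo_mult[OF holo_poly hol[OF F(1)]])
qed

lemma \<G>'_holo: "D \<in> \<G>' r ==> holo_fun_on D (ball 0 d)"
proof -
  assume "D \<in> \<G>' r"
  then obtain F where F: "!!j. F j \<in> \<M>" "D = Dt r F" by (auto simp: \<G>'_def)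
  have "holo_fun_on (s (%z. F j z * F l z)) (ball 0 d)" for j l
    by (intro s_holo holo_mult) (rule \<M>_holo, rule F)+
  then show ?thesis unfolding F(2) Dt_def[abs_def] by (intro holo_sum holo_mult holo_prod holo_const) auto
qed

text \<open>Functions in \<M> vanish on \<open>Rt z\<close> outside \<open>NZ z\<close>, so the Gram
  form has rank at most \<open>card (NZ z)\<close>. Conversely, any \<open>r + 1\<close> points of
  \<open>NZ z\<close> admit functions in \<M> dual to them, with an invertible diagonal Gram matrix.
  Thus a bound on \<open>card (NZ z)\<close> is an analytic condition on the base point.\<close>

lemma NZ_char:
  assumes z: "z \<in> ball 0 d" "z $ i0 = 0"
  shows "(\<forall>D\<in>\<G>' r. D z = 0) \<longleftrightarrow> card (NZ z) \<le> r"
proof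
  assume le: "card (NZ z) \<le> r"
  show "\<forall>D\<in>\<G>' r. D z = 0"
  proof
    fix D assume "D \<in> \<G>' r"
    then obtain F where F: "!!j. F j \<in> \<M>" "D = Dt r F" by (auto simp: \<G>'_def)
    have s: "s (%z. F j z * F l z) z = (\<Sum>x\<in>Rt z. (2 * pi * \<i> * of_int (zorder (f z) x)) * F j (z + x *s e) * F l (z + x *s e))" for j l
      using s_eq[OF z(1) holo_mult[OF \<M>_holo[OF F(1)[of j]] \<M>_holo[OF F(1)[of l]]]]
      by (simp add: sum_distrib_left mult_ac)
    have "{x\<in>Rt z. \<exists>j\<le>r. F j (z + x *s e) ~= 0} \<subseteq> NZ z"
    proof safe
      fix x j assume x: "x \<in> Rt z" "F j (z + x *s e) ~= 0"
      obtain p g where "g \<in> \<G>" "F j = (%z. poly p (z $ i0) * g z)" using F(1)[of j] by (auto simp: \<M>_def)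
      then show "x \<in> NZ z" using x by (auto simp: NZ_def)
    qed
    then have "card {x\<in>Rt z. \<exists>j\<le>r. F j (z + x *s e) ~= 0} \<le> r"
    proof -
      have "finite (NZ z)" using Rt(1)[OF z(1)] by (simp add: NZ_def)
      with \<open>_ \<subseteq> NZ z\<close> have "card {x\<in>Rt z. \<exists>j\<le>r. F j (z + x *s e) ~= 0} \<le> card (NZ z)" by (rule card_mono[rotated])
      then show ?thesis using le by simp
    qed
    then show "D z = 0"
      unfolding F(2) Dt_def s by (rule gram_det_zero[OF Rt(1)[OF z(1)]])
  qed
next
  assume van: "\<forall>D\<in>\<G>' r. D z = 0"
  show "card (NZ z) \<le> r"
  proof (rule ccontr)
    assume "\<not> card (NZ z) \<le> r"
    then have "card {..r} \<le> card (NZ z)" by simp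
    moreover have finNZ: "finite (NZ z)" using Rt(1)[OF z(1)] by (auto simp: NZ_def)
    ultimately obtain \<beta> where \<beta>: "\<beta> ` {..r} \<subseteq> NZ z" "inj_on \<beta> {..r}"
      using card_le_inj[of "{..r}" "NZ z"] by auto
    have "\<exists>g\<in>\<G>. g (z + \<beta> j *s e) ~= 0" if "j \<le> r" for j using \<beta>(1) that by (auto simp: NZ_def)
    then obtain g where g: "!!j. j \<le> r ==> g j \<in> \<G> \<and> g j (z + \<beta> j *s e) ~= 0" by metis
    \<comment> \<open>Vanishes at all zeros of \<open>g1\<close> over \<open>z\<close> except
      \<open>\<beta> j\<close>.\<close>
    define q where "q j = (\<Prod>l\<in>Rt z - {\<beta> j}. [:- l * e $ i0, 1:])" for j
    have q: "poly (q j) ((z + l *s e) $ i0) = 0 \<longleftrightarrow> l ~= \<beta> j" if "l \<in> Rt z" for j l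
      using that Rt(1)[OF z(1)] z(2) i0(2) by (auto simp: q_def poly_prod prod_zero_iff)
    define F where "F j = (if j \<le> r then (%z. poly (q j) (z $ i0) * g j z) else (%z. poly 0 (z $ i0) * g1 z))" for j
    have FM: "F j \<in> \<M>" for j
    proof (cases "j \<le> r")
      case True
      then have "F j = (%z. poly (q j) (z $ i0) * g j z)" "g j \<in> \<G>" using g by (auto simp: F_def)
      then show ?thesis unfolding \<M>_def by blast
    next
      case False
      then have "F j = (%z. poly 0 (z $ i0) * g1 z)" unfolding F_def by meson
      then show ?thesis unfolding \<M>_def using g1 by blast
    qed
    have Fz: "F j (z + l *s e) ~= 0 \<longleftrightarrow> l = \<beta> j" if "j \<le> r" "l \<in> Rt z" for j l
      using q[OF that(2), of j] g[OF that(1)] that(1) by (auto simp: F_def)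
    have "s (%z. F j z * F l z) z ~= 0 \<longleftrightarrow> j = l" if jl: "j \<le> r" "l \<le> r" for j l
    proof -
      have b: "\<beta> j \<in> Rt z" using \<beta>(1) jl by (auto simp: NZ_def)
      have "s (%z. F j z * F l z) z = 2 * pi * \<i> * (\<Sum>x\<in>Rt z. F j (z + x *s e) * F l (z + x *s e) * of_int (zorder (f z) x))"
        by (rule s_eq[OF z(1)]) (intro holo_mult \<M>_holo FM)
      also have "(\<Sum>x\<in>Rt z. F j (z + x *s e) * F l (z + x *s e) * of_int (zorder (f z) x)) =
          (\<Sum>x\<in>{\<beta> j}. F j (z + x *s e) * F l (z + x *s e) * of_int (zorder (f z) x))"
        by (rule sum.mono_neutral_right) (use Rt(1)[OF z(1)] b Fz[OF jl(1)] in auto)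
      finally have "s (%z. F j z * F l z) z ~= 0 \<longleftrightarrow> F l (z + \<beta> j *s e) ~= 0"
        using Fz[OF jl(1) b] Rt(2)[OF z(1) b] by auto
      also have "\<dots> \<longleftrightarrow> j = l" using Fz[OF jl(2) b] \<beta>(2) jl by (auto simp: inj_on_def)
      finally show ?thesis .
    qed
    then have "Dt r F z ~= 0" unfolding Dt_def by (rule gram_det_diagonal)
    then show False using van FM by (auto simp: \<G>'_def)
  qed
qed

text \<open>The number of zeros is at most the number with multiplicities, which by
  \<open>s_eq\<close> is the modulus of the continuous function \<open>s (%_. 1)\<close> divided by
  \<open>2 * pi\<close>.\<close>

lemma card_Rt_bounded: "\<exists>N. \<forall>z\<in>cball 0 (d/2). card (Rt z) \<le> N"
proof -
  have sub: "cball 0 (d/2) \<subseteq> ball (0::complex^'n) d" using d by auto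
  have "compact (s (%_. 1) ` cball 0 (d/2))"
    by (intro compact_continuous_image continuous_on_subset[OF holo_continuous[OF s_holo] sub]) auto
  then obtain C where C: "!!z. z \<in> cball 0 (d/2) ==> cmod (s (%_. 1) z) \<le> C"
    by (meson bounded_iff compact_imp_bounded imageI)
  have "card (Rt z) \<le> nat \<lceil>C\<rceil>" if z: "z \<in> cball 0 (d/2)" for z
  proof -
    have zd: "z \<in> ball 0 d" using z sub by blast
    have "real (card (Rt z)) \<le> (\<Sum>l\<in>Rt z. real_of_int (zorder (f z) l))"
      using sum_mono[of "Rt z" "%_. 1::real" "%l. real_of_int (zorder (f z) l)"] Rt(2)[OF zd] by simp
    also have "\<dots> \<le> 2 * pi * (\<Sum>l\<in>Rt z. real_of_int (zorder (f z) l))"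
    proof -
      have "0 \<le> (\<Sum>l\<in>Rt z. real_of_int (zorder (f z) l))" using Rt(2)[OF zd] by (intro sum_nonneg) force
      moreover have "1 \<le> 2 * pi" using pi_gt3 by simp
      ultimately show ?thesis using mult_right_mono[of 1 "2 * pi"] by fastforce
    qed
    also have "\<dots> = cmod (s (%_. 1) z)"
    proof -
      have "0 \<le> (\<Sum>l\<in>Rt z. real_of_int (zorder (f z) l))" using Rt(2)[OF zd] by (intro sum_nonneg) force
      moreover have "s (%_. 1) z = 2 * pi * \<i> * of_real (\<Sum>l\<in>Rt z. real_of_int (zorder (f z) l))"
        using s_eq[OF zd, of "%_. 1"] by simp
      ultimately show ?thesis by (simp only: norm_mult norm_of_real) simp
    qed
    finally show ?thesis using C[OF z] by linarith
  qed
  then show ?thesis by blast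
qed

text \<open>Every zero of \<open>g1\<close> over \<open>z\<close> persists over nearby base points,
  and those in \<open>NZ z\<close> stay in \<open>NZ\<close>. If a nearby \<open>z'\<close> has no
  more points in \<open>NZ z'\<close> than \<open>z\<close> has in \<open>NZ z\<close>, the zero
  close to \<open>T\<close> cannot be one of them, so it is a common zero.\<close>

lemma near_root:
  assumes z: "z \<in> ball 0 d" and lim: "z islimpt {z\<in>ball 0 d. (\<forall>i. i \<notin> I - {i0} --> z $ i = 0) \<and> card (NZ z) \<le> card (NZ z0)}"
    and z0: "z0 = z" and zI: "!!i. i \<notin> I - {i0} ==> z $ i = 0" and T: "T \<in> Rt z" "T \<notin> NZ z"
  shows "(z + T *s e) islimpt coord_zeros I r0 \<G>"
  unfolding islimpt_approachable
proof (intro allI impI)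
  fix \<epsilon> :: real assume \<epsilon>: "\<epsilon> > 0"
  have finR: "finite (Rt z)" by (rule Rt(1)[OF z])
  have "\<exists>g. \<forall>l\<in>NZ z. g l \<in> \<G> \<and> g l (z + l *s e) ~= 0" by (rule bchoice) (auto simp: NZ_def)
  then obtain gg where gg: "!!l. l \<in> NZ z ==> gg l \<in> \<G> \<and> gg l (z + l *s e) ~= 0" by blast
  define P where "P l \<sigma> \<longleftrightarrow> cball l \<sigma> \<subseteq> ball 0 \<rho> \<and> (\<forall>l'\<in>Rt z. l' ~= l --> 2 * \<sigma> < dist l l') \<and>
      (l \<in> NZ z --> (\<forall>m\<in>cball l \<sigma>. gg l (z + m *s e) ~= 0)) \<and> \<sigma> * norm e < \<epsilon> / 2" for l \<sigma>
  have "\<exists>\<sigma>>0. \<forall>\<sigma>'. 0 < \<sigma>' --> \<sigma>' \<le> \<sigma> --> P l \<sigma>'" if l: "l \<in> Rt z" for l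
  proof -
    obtain a where a: "a > 0" "cball l a \<subseteq> ball 0 \<rho>" using l open_contains_cball[of "ball 0 \<rho>"] unfolding Rt_def by blast
    obtain b where b: "b > 0" "!!l'. l' \<in> Rt z ==> l' ~= l ==> b \<le> dist l l'" using finite_set_avoid[OF finR, of l] by blast
    have "\<exists>c>0. l \<in> NZ z --> (\<forall>m\<in>cball l c. gg l (z + m *s e) ~= 0)"
    proof (cases "l \<in> NZ z")
      case True
      have "continuous_on (ball 0 1) (%m. gg l (z + m *s e))"
        using fhol[OF z hol] gg[OF True] holomorphic_on_imp_continuous_on by blast
      then have "open (ball 0 1 \<inter> (%m. gg l (z + m *s e)) -` (- {0}))" by (intro continuous_open_preimage) auto
      moreover have "l \<in> ball 0 1 \<inter> (%m. gg l (z + m *s e)) -` (- {0})" using l gg[OF True] \<rho> by (auto simp: Rt_def)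
      ultimately obtain c where "c > 0" "cball l c \<subseteq> ball 0 1 \<inter> (%m. gg l (z + m *s e)) -` (- {0})"
        using open_contains_cball by blast
      then show ?thesis by (intro exI[of _ c]) auto
    qed (auto intro: exI[of _ 1])
    then obtain c where c: "c > 0" "l \<in> NZ z ==> m \<in> cball l c ==> gg l (z + m *s e) ~= 0" for m by metis
    define D where "D = min (min a (b/3)) (min c (\<epsilon> / (2 * (norm e + 1))))"
    have D: "D > 0" "D \<le> a" "D \<le> b/3" "D \<le> c" "D \<le> \<epsilon> / (2 * (norm e + 1))"
    proof -
      have "\<epsilon> / (2 * (norm e + 1)) > 0" using \<epsilon> by (simp add: add_nonneg_pos)
      then show "D > 0" using a(1) b(1) c(1) by (simp add: D_def)
      show "D \<le> a" "D \<le> b/3" "D \<le> c" "D \<le> \<epsilon> / (2 * (norm e + 1))" unfolding D_def by linarith+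
    qed
    show ?thesis
    proof (intro exI[of _ D] conjI allI impI)
      fix \<sigma>' assume s: "0 < \<sigma>'" "\<sigma>' \<le> D"
      have "\<sigma>' * norm e < \<sigma>' * (norm e + 1)" using s by simp
      also have "\<dots> \<le> \<epsilon> / (2 * (norm e + 1)) * (norm e + 1)" using s D(5) by (intro mult_right_mono) auto
      also have "\<dots> = \<epsilon> / 2" using norm_ge_zero[of e] by (subst times_divide_eq_left, subst mult_divide_mult_cancel_right) linarith+
      finally have 4: "\<sigma>' * norm e < \<epsilon> / 2" .
      have 1: "cball l \<sigma>' \<subseteq> ball 0 \<rho>" using s D(2) a(2) by (meson cball_subset_cball_iff order_trans subset_cball)
      have 2: "2 * \<sigma>' < dist l l'" if "l' \<in> Rt z" "l' ~= l" for l'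
        using b(2)[OF that] s D(3) b(1) by linarith
      have 3: "gg l (z + m *s e) ~= 0" if "l \<in> NZ z" "m \<in> cball l \<sigma>'" for m
        using c(2)[OF that(1)] that(2) s D(4) by auto
      show "P l \<sigma>'" unfolding P_def using 1 2 3 4 by blast
    qed (rule D(1))
  qed
  then obtain \<sigma> where \<sigma>: "\<sigma> > 0" "!!l. l \<in> Rt z ==> P l \<sigma>"
    using finite_Min_choose[OF finR, of P] by (metis order_refl)
  note Pd = \<sigma>(2)[unfolded P_def]
  have cf: "continuous_on (ball 0 d \<times> cball l \<sigma>) (%x. g (fst x + snd x *s e))" if "l \<in> Rt z" "g \<in> \<G>" for l g
  proof (rule continuous_on_compose2[OF holo_continuous[OF hol[OF that(2)]]])
    show "(%x. fst x + snd x *s e) ` (ball 0 d \<times> cball l \<sigma>) \<subseteq> ball 0 r0"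
    proof
      fix y assume "y \<in> (%x. fst x + snd x *s e) ` (ball 0 d \<times> cball l \<sigma>)"
      then obtain z' m where y: "y = z' + m *s e" "z' \<in> ball 0 d" "m \<in> cball l \<sigma>" by auto
      have "m \<in> ball 0 \<rho>" using Pd[OF that(1)] y(3) by blast
      then show "y \<in> ball 0 r0" unfolding y(1) using \<rho> by (intro dom y(2)) auto
    qed
  qed (intro continuous_intros)
  define Q where "Q l \<delta>' \<longleftrightarrow> (\<forall>z'\<in>ball z \<delta>' \<inter> ball 0 d. (\<exists>m\<in>ball l \<sigma>. f z' m = 0) \<and> (l \<in> NZ z --> (\<forall>m\<in>cball l \<sigma>. gg l (z' + m *s e) ~= 0)))" for l \<delta>'
  have Qex: "\<exists>\<delta>>0. \<forall>\<delta>'. 0 < \<delta>' --> \<delta>' \<le> \<delta> --> Q l \<delta>'"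
    if l: "l \<in> Rt z" for l
  proof -
    have c1: "continuous_on (ball 0 d \<times> sphere l \<sigma>) (%x. cmod (f (fst x) (snd x)) - cmod (f (fst x) l))"
    proof -
      have "continuous_on (ball 0 d \<times> sphere l \<sigma>) (%x. g1 (fst x + snd x *s e))"
        by (rule continuous_on_subset[OF cf[OF l g1]]) auto
      moreover have "continuous_on (ball 0 d \<times> sphere l \<sigma>) (%x. g1 (fst x + l *s e))"
        using continuous_on_compose2[OF cf[OF l g1], of "ball 0 d \<times> sphere l \<sigma>" "%x. (fst x, l)"] \<sigma>(1)
        by (force intro!: continuous_intros)
      ultimately show ?thesis unfolding f_def by (intro continuous_intros)
    qed
    obtain d1 where d1: "d1 > 0" "ball z d1 \<subseteq> ball 0 d" "!!x k. x \<in> ball z d1 ==> k \<in> sphere l \<sigma> ==> cmod (f x k) - cmod (f x l) > 0"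
    proof (rule tube_positive[OF open_ball z compact_sphere, of l \<sigma> "%x k. cmod (f x k) - cmod (f x l)"])
      show "continuous_on (ball 0 d \<times> sphere l \<sigma>) (%(x, k). cmod (f x k) - cmod (f x l))" using c1 by (simp add: case_prod_unfold)
      fix k assume k: "k \<in> sphere l \<sigma>"
      then have "k \<notin> Rt z" using Pd[OF l] \<sigma>(1) by force
      moreover have "k \<in> ball 0 \<rho>" using Pd[OF l] k by (auto simp: subset_eq)
      ultimately show "cmod (f z k) - cmod (f z l) > 0" using l by (simp add: Rt_def)
    qed blast
    have "\<exists>d2>0. l \<in> NZ z --> (\<forall>z'\<in>ball z d2. \<forall>m\<in>cball l \<sigma>. gg l (z' + m *s e) ~= 0)"
    proof (cases "l \<in> NZ z")
      case True
      have "continuous_on (ball 0 d \<times> cball l \<sigma>) (%(x, k). cmod (gg l (x + k *s e)))"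
        using cf[OF l, of "gg l"] gg[OF True] by (auto simp: case_prod_unfold intro!: continuous_intros)
      then obtain d2 where "d2 > 0" "!!x k. x \<in> ball z d2 ==> k \<in> cball l \<sigma> ==> cmod (gg l (x + k *s e)) > 0"
        using tube_positive[OF open_ball z compact_cball, of l \<sigma> "%x k. cmod (gg l (x + k *s e))"] Pd[OF l] True
        by (smt (verit, best) zero_less_norm_iff)
      then show ?thesis by (intro exI[of _ d2]) auto
    qed (auto intro: exI[of _ 1])
    then obtain d2 where d2: "d2 > 0" "l \<in> NZ z --> (\<forall>z'\<in>ball z d2. \<forall>m\<in>cball l \<sigma>. gg l (z' + m *s e) ~= 0)" by blast
    have root: "\<exists>m\<in>ball l \<sigma>. f z' m = 0" if z': "z' \<in> ball z d1" for z'
    proof -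
      have zd: "z' \<in> ball 0 d" using z' d1(2) by blast
      have h: "f z' holomorphic_on ball 0 1" unfolding f_def[abs_def] by (rule fhol[OF zd holg1])
      have sub: "cball l \<sigma> \<subseteq> ball 0 1" using Pd[OF l] \<rho> by (auto simp: subset_eq)
      obtain m where "m \<in> ball l \<sigma>" "f z' m = 0"
      proof (rule root_in_disc[OF \<sigma>(1), of l "f z'"])
        show "continuous_on (cball l \<sigma>) (f z')" using h sub holomorphic_on_imp_continuous_on continuous_on_subset by blast
        show "f z' holomorphic_on ball l \<sigma>" using h sub ball_subset_cball holomorphic_on_subset by (metis order_trans)
        show "cmod (f z' k) > cmod (f z' l)" if "k \<in> sphere l \<sigma>" for k using d1(3)[OF z' that] by simp
      qed blast
      then show ?thesis by blast
    qed
    show ?thesis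
    proof (intro exI[of _ "min d1 d2"] conjI allI impI)
      show "min d1 d2 > 0" using d1 d2 by simp
      fix \<delta>' assume "0 < \<delta>'" "\<delta>' \<le> min d1 d2"
      then have "ball z \<delta>' \<subseteq> ball z d1" "ball z \<delta>' \<subseteq> ball z d2" by auto
      then show "Q l \<delta>'"
        unfolding Q_def using root d2(2) by blast
    qed
  qed
  obtain \<delta> where \<delta>1: "\<delta> > 0" "!!l e. l \<in> Rt z ==> 0 < e ==> e \<le> \<delta> ==> Q l e"
    by (rule finite_Min_choose[OF finR Qex]) blast+
  then have \<delta>: "\<delta> > 0" "!!l z'. l \<in> Rt z ==> z' \<in> ball z \<delta> \<inter> ball 0 d ==> (\<exists>m\<in>ball l \<sigma>. f z' m = 0) \<and> (l \<in> NZ z --> (\<forall>m\<in>cball l \<sigma>. gg l (z' + m *s e) ~= 0))"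
    unfolding Q_def by (blast, meson order_refl)
  obtain z' where z': "z' \<in> ball 0 d" "!!i. i \<notin> I - {i0} ==> z' $ i = 0" "card (NZ z') \<le> card (NZ z)" "z' ~= z" "dist z' z < min \<delta> (\<epsilon>/2)"
  proof -
    have "min \<delta> (\<epsilon>/2) > 0" using \<delta>(1) \<epsilon> by simp
    then show ?thesis using lim that unfolding z0 islimpt_approachable by blast
  qed
  have zz': "z' \<in> ball z \<delta> \<inter> ball 0 d" using z' by (simp add: dist_commute)
  obtain m where m: "!!l. l \<in> Rt z ==> m l \<in> ball l \<sigma> \<and> f z' (m l) = 0" using \<delta>(2)[OF _ zz'] by metis
  have mR: "m l \<in> Rt z'" if "l \<in> Rt z" for l using m[OF that] Pd[OF that] by (auto simp: Rt_def subset_eq)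
  have mNZ: "m l \<in> NZ z'" if "l \<in> NZ z" for l
  proof -
    have "l \<in> Rt z" using that by (simp add: NZ_def)
    then show ?thesis using mR m[of l] \<delta>(2)[OF _ zz', of l] that gg[OF that] unfolding NZ_def by (auto simp: NZ_def)
  qed
  have inj: "inj_on m (Rt z)"
  proof (rule inj_onI, rule ccontr)
    fix l l' assume l: "l \<in> Rt z" "l' \<in> Rt z" "m l = m l'" "l ~= l'"
    have "dist l l' \<le> dist l (m l) + dist l' (m l')" using l(3) by (metis dist_commute dist_triangle)
    also have "\<dots> < 2 * \<sigma>" using m[OF l(1)] m[OF l(2)] by auto
    finally show False using Pd[OF l(1)] l by force
  qed
  have finNZ: "finite (NZ z')" using Rt(1)[OF z'(1)] by (auto simp: NZ_def)
  have "m T \<notin> NZ z'"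
  proof
    assume mT: "m T \<in> NZ z'"
    have "insert T (NZ z) \<subseteq> Rt z" using T by (auto simp: NZ_def)
    then have "inj_on m (insert T (NZ z))" using inj inj_on_subset by blast
    moreover have "m ` insert T (NZ z) \<subseteq> NZ z'" using mT mNZ by auto
    ultimately have "card (insert T (NZ z)) \<le> card (NZ z')" using finNZ card_inj_on_le by blast
    moreover have "finite (NZ z)" using finR by (auto simp: NZ_def)
    ultimately show False using T(2) z'(3) by simp
  qed
  then have van: "g (z' + m T *s e) = 0" if "g \<in> \<G>" for g using mR[OF T(1)] that by (auto simp: NZ_def)
  define y where "y = z' + m T *s e"
  have "y \<in> coord_zeros I r0 \<G>"
    unfolding coord_zeros_def
  proof (intro CollectI conjI allI impI ballI)
    show "y \<in> ball 0 r0" unfolding y_def using mR[OF T(1)] \<rho> by (intro dom z'(1)) (auto simp: Rt_def)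
    show "y $ i = 0" if "i \<notin> I" for i using z'(2)[of i] eI[OF that] that by (simp add: y_def)
    show "g y = 0" if "g \<in> \<G>" for g using van[OF that] by (simp add: y_def)
  qed
  \<comment> \<open>The coordinate \<open>i0\<close> gives the position within the fibre, so
    equality would force the base points to be equal as well.\<close>
  moreover have "y ~= z + T *s e"
  proof
    assume eq: "y = z + T *s e"
    have "z $ i0 = 0" "z' $ i0 = 0" using z'(2)[of i0] zI[of i0] by auto
    then have "m T = T" using arg_cong[OF eq, of "%v. v $ i0"] i0(2) by (simp add: y_def)
    then show False using eq z'(4) by (simp add: y_def)
  qed
  moreover have "dist y (z + T *s e) < \<epsilon>"
  proof -
    have "y - (z + T *s e) = (z' - z) + (m T - T) *s e" by (simp add: y_def vec_eq_iff algebra_simps)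
    then have "dist y (z + T *s e) \<le> dist z' z + cmod (m T - T) * norm e"
      unfolding dist_norm norm_vsm[symmetric] by (metis norm_triangle_ineq)
    also have "cmod (m T - T) * norm e \<le> \<sigma> * norm e" using m[OF T(1)] by (intro mult_right_mono) (auto simp: dist_norm norm_minus_commute)
    also have "\<dots> < \<epsilon> / 2" using Pd[OF T(1)] by blast
    finally show ?thesis using z'(5) by simp
  qed
  ultimately show "\<exists>x'\<in>coord_zeros I r0 \<G>. x' ~= z + T *s e \<and> dist x' (z + T *s e) < \<epsilon>" by blast
qed

end

text \<open>Induction on the number of free coordinates. A common zero \<open>x\<close> near
  \<open>0\<close> lies over a base point \<open>z\<close> different from \<open>0\<close>, which
  belongs to the analytic set of base points \<open>z'\<close> with \<open>card (NZ z')\<close> at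
  most \<open>card (NZ z)\<close>. By induction \<open>z\<close> is an accumulation point of that
  set, and \<open>near_root\<close> lifts this to \<open>x\<close>.\<close>

lemma isolated_points_discrete:
  fixes I :: "'n::finite set"
  assumes "r0 > 0" "!!g. g \<in> \<G> ==> holo_fun_on g (ball (0::complex^'n) r0)"
  shows "\<exists>r>0. \<forall>x\<in>coord_zeros I r0 \<G>. 0 < norm x \<and> norm x < r --> x islimpt coord_zeros I r0 \<G>"
  using assms
proof (induction "card I" arbitrary: I r0 \<G> rule: less_induct)
  case less
  note r0 = less.prems(1) and hol = less.prems(2)
  let ?E = "{z::complex^'n. \<forall>i. i \<notin> I --> z $ i = 0}"
  consider (all) "\<forall>g\<in>\<G>. \<forall>z\<in>?E \<inter> ball 0 r0. g z = 0" | (none) "\<exists>g\<in>\<G>. g 0 ~= 0"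
    | (some) g1 e where "g1 \<in> \<G>" "e \<in> ?E" "e \<in> ball 0 r0" "g1 e ~= 0" "g1 0 = 0" by blast
  then show ?case
  proof cases
    case all
    have "x islimpt coord_zeros I r0 \<G>" if x: "x \<in> coord_zeros I r0 \<G>" "0 < norm x" for x
      unfolding islimpt_approachable
    proof (intro allI impI)
      fix \<epsilon> :: real assume \<epsilon>: "\<epsilon> > 0"
      have xr: "norm x < r0" "!!i. i \<notin> I ==> x $ i = 0" using x by (auto simp: coord_zeros_def)
      define t where "t = min ((r0 - norm x) / (2 * norm x)) (\<epsilon> / (2 * norm x))"
      have t: "t > 0" "t \<le> (r0 - norm x) / (2 * norm x)" "t \<le> \<epsilon> / (2 * norm x)"
        using x(2) xr(1) \<epsilon> by (auto simp: t_def)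
      have t: "t > 0" "t * norm x \<le> (r0 - norm x) / 2" "t * norm x \<le> \<epsilon> / 2"
        using x(2) t by (simp_all add: field_simps)
      let ?y = "x + t *\<^sub>R x"
      have "norm ?y < r0" using norm_triangle_ineq[of x "t *\<^sub>R x"] t xr(1) by simp
      then have "?y \<in> coord_zeros I r0 \<G>" using all xr(2) by (auto simp: coord_zeros_def)
      moreover have "?y ~= x" using t x(2) by auto
      moreover have "dist ?y x < \<epsilon>" using t \<epsilon> by (simp add: dist_norm)
      ultimately show "\<exists>x'\<in>coord_zeros I r0 \<G>. x' ~= x \<and> dist x' x < \<epsilon>" by blast
    qed
    then show ?thesis using r0 by blast
  next
    case none
    then obtain g where g: "g \<in> \<G>" "g 0 ~= 0" by blast
    have "open (ball 0 r0 \<inter> g -` (- {0}))"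
      by (rule continuous_open_preimage[OF holo_continuous[OF hol[OF g(1)]]]) auto
    moreover have "0 \<in> ball 0 r0 \<inter> g -` (- {0})" using g r0 by auto
    ultimately obtain r where r: "r > 0" "ball 0 r \<subseteq> ball 0 r0 \<inter> g -` (- {0})" using open_contains_ball by blast
    then have "\<not> norm x < r" if "x \<in> coord_zeros I r0 \<G>" for x
      using that g(1) by (auto simp: coord_zeros_def subset_eq)
    then show ?thesis using r(1) by blast
  next
    case (some g1 e)
    have g1: "g1 \<in> \<G>" by fact
    have e0: "e ~= 0" using some(4,5) by auto
    then obtain i0 where i0: "e $ i0 ~= 0" by (auto simp: vec_eq_iff)
    have i0I: "i0 \<in> I" using some(2) i0 by auto
    have ne: "norm e > 0" "norm e < r0" using e0 some(3) by auto
    have inb: "l *s e \<in> ball 0 r0" if "l \<in> ball 0 (r0 / norm e)" for l :: complex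
      using that ne by (simp add: norm_vsm field_simps)
    have "(%l. g1 (0 + l *s e)) holomorphic_on ball 0 (r0 / norm e)"
      by (rule holo_line_on[OF hol[OF g1]]) (use inb in simp)
    then have hh: "(%l. g1 (l *s e)) holomorphic_on ball 0 (r0 / norm e)" by simp
    obtain r where r: "0 < r" "!!l. l \<in> ball 0 r - {0} ==> g1 (l *s e) ~= 0"
    proof (rule isolated_zeros[OF hh open_ball connected_ball, of 0 1])
      show "(0::complex) \<in> ball 0 (r0 / norm e)" "(1::complex) \<in> ball 0 (r0 / norm e)" using ne r0 by (auto simp: field_simps)
      show "g1 (0 *s e) = 0" "g1 (1 *s e) ~= 0" using some(4,5) by (simp_all add: vector_scalar_mult_def zero_vec_def)
    qed blast
    define \<rho> where "\<rho> = min r 1 / 2"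
    have \<rho>: "0 < \<rho>" "\<rho> < 1" "\<rho> < r" using r(1) by (auto simp: \<rho>_def)
    have hnz: "g1 (l *s e) ~= 0" if "l ~= 0" "cmod l \<le> \<rho>" for l using r(2)[of l] that \<rho> by simp
    have dom0: "z + l *s e \<in> ball 0 r0" if "z \<in> ball 0 (r0 - norm e)" "cmod l \<le> 1" for z and l :: complex
    proof -
      have "norm (l *s e) \<le> 1 * norm e" unfolding norm_vsm by (rule mult_right_mono) (use that in auto)
      then show ?thesis using norm_triangle_ineq[of z "l *s e"] that by simp
    qed
    obtain d where d: "d > 0" "ball 0 d \<subseteq> ball (0::complex^'n) (r0 - norm e)"
      "!!z l. z \<in> ball 0 d ==> l \<in> sphere 0 \<rho> ==> cmod (g1 (z + l *s e)) > 0"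
    proof (rule tube_positive[OF open_ball _ compact_sphere, of "0::complex^'n" 0 "r0 - norm e" "0::complex" \<rho> "%z l. cmod (g1 (z + l *s e))"])
      have "continuous_on (ball 0 (r0 - norm e) \<times> sphere 0 \<rho>) (%x. g1 (fst x + snd x *s e))"
        by (rule continuous_on_compose2[OF holo_continuous[OF hol[OF g1]]]) (use dom0 \<rho> in \<open>auto intro!: continuous_intros\<close>)
      then show "continuous_on (ball 0 (r0 - norm e) \<times> sphere 0 \<rho>) (%(z, l). cmod (g1 (z + l *s e)))"
        by (auto simp: case_prod_unfold intro!: continuous_intros)
      show "cmod (g1 (0 + k *s e)) > 0" if "k \<in> sphere 0 \<rho>" for k using hnz[of k] that \<rho> by auto
    qed (use ne in auto)
    interpret S: slice r0 \<G> g1 e i0 I \<rho> d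
    proof
      show "e $ i = 0" if "i \<notin> I" for i using some(2) that by auto
      show "z + l *s e \<in> ball 0 r0" if "z \<in> ball 0 d" "cmod l \<le> 1" for z l using dom0 d(2) that by blast
      show "g1 (z + l *s e) ~= 0" if "z \<in> ball 0 d" "l \<in> sphere 0 \<rho>" for z l using d(3)[OF that] by simp
    qed (use hol g1 i0I i0 \<rho> d in auto)
    obtain N where N: "!!z. z \<in> cball 0 (d/2) ==> card (S.Rt z) \<le> N" using S.card_Rt_bounded by blast
    define P where "P k \<epsilon> \<longleftrightarrow> (\<forall>x\<in>coord_zeros (I - {i0}) d (S.\<G>' k). 0 < norm x \<and> norm x < \<epsilon> --> x islimpt coord_zeros (I - {i0}) d (S.\<G>' k))"
      for k \<epsilon>
    have IH: "\<exists>r>0. P k r" for k unfolding P_def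
    proof (rule less.hyps[OF _ d(1)])
      show "card (I - {i0}) < card I" using i0I by (meson card_Diff1_less finite)
    qed (rule S.\<G>'_holo)
    \<comment> \<open>Only the ranks up to \<open>N\<close> occur, so the radii given by the
      induction hypothesis have a positive minimum.\<close>
    obtain m where m: "m > 0" "!!k e. k \<in> {..N} ==> 0 < e ==> e \<le> m ==> P k e"
    proof (rule finite_Min_choose[of "{..N}" P])
      fix k
      obtain r where "r > 0" "P k r" using IH by blast
      then show "\<exists>d>0. \<forall>e. 0 < e --> e \<le> d --> P k e" by (intro exI[of _ r]) (auto simp: P_def)
    qed auto
    define m' where "m' = min m (d/2)"
    have m': "m' > 0" "m' \<le> d/2" using m(1) d(1) by (auto simp: m'_def)
    define c where "c = 1 + norm e / cmod (e $ i0)"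
    have c: "c > 0" using ne i0 by (auto simp: c_def add_pos_nonneg)
    define r' where "r' = min (m' / c) (\<rho> * cmod (e $ i0))"
    have "r' > 0" using m'(1) c \<rho> i0 by (auto simp: r'_def)
    moreover have "x islimpt coord_zeros I r0 \<G>" if x: "x \<in> coord_zeros I r0 \<G>" "0 < norm x" "norm x < r'" for x
    proof -
      define T where "T = x $ i0 / e $ i0"
      define z where "z = x - T *s e"
      have xz: "x = z + T *s e" by (simp add: z_def)
      have xc: "!!i. i \<notin> I ==> x $ i = 0" "!!g. g \<in> \<G> ==> g x = 0" using x(1) by (auto simp: coord_zeros_def)
      have "cmod (x $ i0) \<le> norm x" by (rule Finite_Cartesian_Product.norm_nth_le)
      then have T1: "cmod T \<le> norm x / cmod (e $ i0)" unfolding T_def norm_divide by (intro divide_right_mono) auto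
      have T: "cmod T < \<rho>"
        using T1 x(3) i0 by (simp add: r'_def) (smt (verit, best) T1 divide_less_eq zero_less_norm_iff)
      have zi: "z $ i = 0" if "i \<notin> I - {i0}" for i
      proof (cases "i = i0")
        case False then show ?thesis using that xc(1)[of i] some(2) by (auto simp: z_def)
      qed (use i0 in \<open>simp add: z_def T_def\<close>)
      have "norm z \<le> norm x + cmod T * norm e" unfolding z_def using norm_triangle_ineq4[of x "T *s e"] by (simp add: norm_vsm)
      also have "\<dots> \<le> norm x + norm x / cmod (e $ i0) * norm e" using T1 by (intro add_left_mono mult_right_mono) auto
      also have "\<dots> = norm x * c" by (simp add: c_def algebra_simps)
      also have "\<dots> < m'" using x(3) c by (simp add: r'_def field_simps)
      finally have zm: "norm z < m'" .
      have zd: "z \<in> ball 0 d" using zm m' d(1) by simp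
      \<comment> \<open>Over the base point \<open>0\<close> the only zero of \<open>g1\<close> in
        the disc is \<open>l = 0\<close>, which is the excluded point \<open>x = 0\<close>.\<close>
      have z0: "z ~= 0"
      proof
        assume "z = 0"
        then have "x = T *s e" using xz by simp
        then have "g1 (T *s e) = 0" "T ~= 0" using xc(2)[OF g1] x(2) by auto
        then show False using hnz[of T] T by simp
      qed
      have TR: "T \<in> S.Rt z" "T \<notin> S.NZ z"
        using T xc(2) g1 by (auto simp: S.Rt_def S.NZ_def S.f_def xz)
      have "finite (S.Rt z)" by (rule S.Rt(1)[OF zd])
      then have "card (S.NZ z) \<le> card (S.Rt z)" by (intro card_mono) (auto simp: S.NZ_def)
      also have "\<dots> \<le> N" by (rule N) (use zm m' in auto)
      finally have k: "card (S.NZ z) \<in> {..N}" by simp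
      let ?C = "coord_zeros (I - {i0}) d (S.\<G>' (card (S.NZ z)))"
      have Ceq: "?C = {z'\<in>ball 0 d. (\<forall>i. i \<notin> I - {i0} --> z' $ i = 0) \<and> card (S.NZ z') \<le> card (S.NZ z)}"
        unfolding coord_zeros_def using S.NZ_char by blast
      have "z islimpt ?C"
        using m(2)[OF k m'(1)] zi zd z0 zm unfolding P_def Ceq by (simp add: m'_def)
      then show ?thesis unfolding xz Ceq by (intro S.near_root[OF zd _ refl zi TR]) auto
    qed
    ultimately show ?thesis by blast
  qed
qed

text \<open>Close to the accumulation point \<open>a\<close>, all other points of \<open>A\<close>
  are accumulation points too. A small ball about one of them contains a regular point by
  \<open>regular_points_exist\<close>, and its dimension cannot be zero.\<close>

lemma zero_set_positive_dim:
  fixes A :: "(complex^'n) set"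
  assumes om: "open \<Omega>" and hol: "!!g. g \<in> \<G> ==> holo_fun_on g \<Omega>"
    and A: "A \<inter> \<Omega> = {z\<in>\<Omega>. \<forall>g\<in>\<G>. g z = 0}" and a: "a \<in> \<Omega>" "a islimpt A" and O: "open O'" "a \<in> O'"
  obtains z d where "z \<in> A \<inter> \<Omega> \<inter> O'" "regular_point A d z" "d \<ge> 1"
proof -
  obtain r0 where r0: "r0 > 0" "ball a r0 \<subseteq> \<Omega> \<inter> O'" using om a(1) O open_contains_ball[of "\<Omega> \<inter> O'"] by blast
  define \<G>' where "\<G>' = (%g z. g (z + a)) ` \<G>"
  have sh: "z + a \<in> ball a r0" if "z \<in> ball 0 r0" for z using that by (simp add: dist_norm)
  have hol': "holo_fun_on g (ball 0 r0)" if "g \<in> \<G>'" for g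
  proof -
    obtain g' where g': "g' \<in> \<G>" "g = (%z. g' (z + a))" using \<open>g \<in> \<G>'\<close> unfolding \<G>'_def by blast
    show ?thesis unfolding g'(2) by (rule holo_compose[OF holo_map_shift(1) hol[OF g'(1)]]) (use sh r0(2) in blast)
  qed
  obtain r where r: "r > 0" "!!x. x \<in> coord_zeros UNIV r0 \<G>' ==> 0 < norm x ==> norm x < r ==> x islimpt coord_zeros UNIV r0 \<G>'"
    using isolated_points_discrete[OF r0(1) hol'] by blast
  have C: "coord_zeros UNIV r0 \<G>' = {x. x + a \<in> A \<inter> ball a r0}"
  proof -
    have "x + a \<in> A \<longleftrightarrow> (\<forall>g\<in>\<G>. g (x + a) = 0)" if "x \<in> ball 0 r0" for x
      using A sh[OF that] r0(2) by blast
    then show ?thesis by (auto simp: coord_zeros_def \<G>'_def dist_norm)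
  qed
  obtain y where y: "y \<in> A" "y ~= a" "dist y a < min r r0"
    using a(2) r r0(1) unfolding islimpt_approachable by (meson min_less_iff_conj)
  have yC: "y - a \<in> coord_zeros UNIV r0 \<G>'" "0 < norm (y - a)" "norm (y - a) < r"
    using y by (auto simp: C dist_norm norm_minus_commute)
  \<comment> \<open>With this radius the ball about \<open>y\<close> misses \<open>a\<close> and
    stays within distance \<open>r\<close> and \<open>r0\<close> of it.\<close>
  define r1 where "r1 = min (norm (y - a)) (min (r - norm (y - a)) (r0 - norm (y - a)))"
  have r1: "r1 > 0" using yC y(3) by (auto simp: r1_def dist_norm)
  define B where "B = ball y r1"
  have nB: "0 < norm (z - a) \<and> norm (z - a) < min r r0" if "z \<in> B" for z
  proof -
    have "norm (y - z) < r1" using that by (simp add: B_def dist_norm)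
    moreover have "norm (z - a) \<le> norm (y - a) + norm (y - z)" "norm (y - a) \<le> norm (y - z) + norm (z - a)"
      using norm_triangle_ineq4[of "y - a" "y - z"] norm_triangle_ineq[of "y - z" "z - a"] by (simp_all add: algebra_simps)
    ultimately show ?thesis unfolding r1_def by linarith
  qed
  have Bsub: "B \<subseteq> \<Omega> \<inter> O'"
  proof
    fix z assume "z \<in> B"
    then have "z \<in> ball a r0" using nB[of z] by (simp add: dist_norm norm_minus_commute)
    then show "z \<in> \<Omega> \<inter> O'" using r0(2) by blast
  qed
  have AB: "A \<inter> B = {z\<in>B. \<forall>g\<in>\<G>. g z = 0}" using A Bsub by blast
  have ne: "A \<inter> B ~= {}" using y(1) r1 by (auto simp: B_def)
  have oB: "open B" by (simp add: B_def)
  have hB: "holo_fun_on g B" if "g \<in> \<G>" for g by (rule holo_subset[OF hol[OF that]]) (use Bsub in blast)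
  obtain z d where z: "z \<in> A \<inter> B" "regular_point A d z" "d = 0 ==> \<not> z islimpt A"
    by (rule regular_points_exist[OF oB hB AB ne]) blast+
  have "z islimpt A"
  proof -
    have zC: "z - a \<in> coord_zeros UNIV r0 \<G>'" using nB[of z] z(1) by (simp add: C dist_norm norm_minus_commute)
    have lim: "(z - a) islimpt coord_zeros UNIV r0 \<G>'" using r(2)[OF zC] nB[of z] z(1) by simp
    show ?thesis unfolding islimpt_approachable
    proof (intro allI impI)
      fix \<epsilon> :: real assume "\<epsilon> > 0"
      then obtain x where x: "x \<in> coord_zeros UNIV r0 \<G>'" "x ~= z - a" "dist x (z - a) < \<epsilon>"
        using lim unfolding islimpt_approachable by blast
      have "x + a \<in> A" using x(1) by (simp add: C)
      moreover have "x + a ~= z" using x(2) by auto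
      moreover have "dist (x + a) z < \<epsilon>" using x(3) by (simp add: dist_norm algebra_simps)
      ultimately show "\<exists>x'\<in>A. x' ~= z \<and> dist x' z < \<epsilon>" by blast
    qed
  qed
  then have "d \<ge> 1" using z(3) by (cases d) auto
  then show ?thesis using z(1,2) Bsub that by blast
qed

section \<open>Submersions\<close>

text \<open>An exchange argument that starts from the unit rows and inserts the rows of
  \<open>M\<close> one at a time. \<open>cramer_rows\<close>, tested on a vector that
  \<open>M\<close> sends to \<open>axis j0 1\<close>, finds a row that may be replaced; it is none
  of those already inserted, because they annihilate that vector.\<close>

lemma independent_columns:
  fixes M :: "complex^'n^'q::finite"
  assumes surj: "surj (%v. M *v v)"
  shows "\<exists>\<iota>. inj \<iota> \<and> det (\<chi> i. if i \<in> range \<iota> then M $ inv \<iota> i else axis i 1) ~= 0"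
proof -
  have "\<exists>(\<iota> :: 'q => 'n) r. inj_on \<iota> J \<and> (\<forall>j\<in>J. r (\<iota> j) = M $ j) \<and> (\<forall>i. i \<notin> \<iota> ` J --> r i = axis i 1) \<and> det (\<chi> i. (r i :: complex^'n)) ~= 0"
    for J :: "'q set"
    using finite[of J]
  proof (induction J rule: finite_induct)
    case empty
    have "(\<chi> i. (axis i 1 :: complex^'n)) = (mat 1 :: complex^'n^'n)" by (simp add: vec_eq_iff mat_def axis_def)
    then have "det (\<chi> i. (axis i 1 :: complex^'n)) ~= 0" by simp
    then show ?case by (intro exI[of _ "%_. undefined"] exI[of _ "%i. axis i 1"]) simp
  next
    case (insert j0 J)
    then obtain \<iota> :: "'q => 'n" and r where I: "inj_on \<iota> J" "!!j. j \<in> J ==> r (\<iota> j) = M $ j" "!!i. i \<notin> \<iota> ` J ==> r i = axis i 1"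
      "det (\<chi> i. r i) ~= 0" by metis
    obtain v where v: "M *v v = axis j0 1" using surj by (metis surjD)
    have Mv: "cdot (M $ j) v = axis j0 1 $ j" for j using v by (simp add: matrix_vector_mult_def cdot_def vec_eq_iff)
    have Av: "((\<chi> i. r i) *v v) $ i = cdot (r i) v" for i by (simp add: matrix_vector_mult_def cdot_def)
    have "det (\<chi> i. r i) * cdot (M $ j0) v = (\<Sum>j\<in>UNIV. ((\<chi> i. r i) *v v) $ j * det (\<chi> i. if i = j then M $ j0 else (\<chi> i. r i) $ i))"
      by (rule cramer_rows[OF I(4)])
    then have "(\<Sum>j\<in>UNIV. ((\<chi> i. r i) *v v) $ j * det (\<chi> i. if i = j then M $ j0 else (\<chi> i. r i) $ i)) ~= 0"
      using I(4) by (simp add: Mv axis_def)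
    then obtain i where "((\<chi> i. r i) *v v) $ i * det (\<chi> k. if k = i then M $ j0 else (\<chi> i. r i) $ k) ~= 0"
      by (meson sum.neutral)
    then have i: "cdot (r i) v ~= 0" "det (\<chi> k. if k = i then M $ j0 else r k) ~= 0"
      unfolding Av vec_lambda_beta by auto
    have iJ: "i \<notin> \<iota> ` J"
    proof
      assume "i \<in> \<iota> ` J"
      then obtain j where "j \<in> J" "i = \<iota> j" by blast
      then show False using i(1) I(2)[of j] Mv[of j] insert(2) by (auto simp: axis_def split: if_splits)
    qed
    show ?case
    proof (intro exI conjI)
      show "inj_on (\<iota>(j0 := i)) (insert j0 J)" using I(1) insert(2) iJ by (auto simp: inj_on_def)
      show "\<forall>j\<in>insert j0 J. (r(i := M $ j0)) ((\<iota>(j0 := i)) j) = M $ j" using I(2) iJ insert(2) by auto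
      show "\<forall>k. k \<notin> (\<iota>(j0 := i)) ` insert j0 J --> (r(i := M $ j0)) k = axis k 1"
        using I(3) insert(2) by (auto simp: image_def)
      show "det (\<chi> k. (r(i := M $ j0)) k) ~= 0" using i(2) by (simp add: fun_upd_def)
    qed
  qed
  from this[of UNIV] obtain \<iota> :: "'q => 'n" and r where I: "inj \<iota>" "!!j. r (\<iota> j) = M $ j" "!!i. i \<notin> range \<iota> ==> r i = axis i 1"
      "det (\<chi> i. r i) ~= 0" by auto
  have "r = (%i. if i \<in> range \<iota> then M $ inv \<iota> i else axis i 1)"
  proof
    fix i show "r i = (if i \<in> range \<iota> then M $ inv \<iota> i else axis i 1)"
      using I(2)[of "inv \<iota> i"] I(3)[of i] by (auto simp: f_inv_into_f)
  qed
  then show ?thesis using I(1,4) by blast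
qed

lemma submersion_on_iff:
  "submersion_on \<phi> V \<longleftrightarrow> holo_map_on \<phi> V \<and> (\<forall>z\<in>V. surj (%v. jac \<phi> z *v v))"
  unfolding submersion_on_def using frechet_derivative_at[OF holo_map_D] by metis

lemma submersion_subset: "submersion_on \<phi> V ==> W \<subseteq> V ==> submersion_on \<phi> W"
  unfolding submersion_on_def using holo_map_subset by blast

lemma submersion_chart:
  fixes \<phi> :: "complex^'n => complex^'q"
  assumes D: "open D" "holo_map_on \<phi> D" "x \<in> D" "surj (%v. jac \<phi> x *v v)"
  shows "\<exists>\<iota> \<Phi> V W. inj \<iota> \<and> x \<in> V \<and> V \<subseteq> D \<and> biholomorphic \<Phi> V W \<and> (\<forall>z\<in>V. det (jac \<Phi> z) ~= 0) \<and>
    (\<forall>z j. \<Phi> z $ \<iota> j = \<phi> z $ j) \<and> (\<forall>z i. i \<notin> range \<iota> --> \<Phi> z $ i = z $ i)"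
proof -
  obtain \<iota> :: "'q => 'n" where \<iota>: "inj \<iota>" "det (\<chi> i. if i \<in> range \<iota> then jac \<phi> x $ inv \<iota> i else axis i 1) ~= 0"
    using independent_columns[OF D(4)] by blast
  define h where "h i z = \<phi> z $ inv \<iota> i" for i z
  define \<Phi> where "\<Phi> = flat_chart (range \<iota>) h"
  have hol: "holo_map_on \<Phi> D" unfolding \<Phi>_def
    by (rule holo_flat_chart) (use D(2) in \<open>simp add: h_def[abs_def] holo_map_on_def\<close>)
  have "jac \<Phi> x = (\<chi> i. if i \<in> range \<iota> then jac \<phi> x $ inv \<iota> i else axis i 1)"
    unfolding \<Phi>_def jac_flat_chart rowmat_def by (simp add: h_def[abs_def] jac_def vec_eq_iff)
  then have "det (jac \<Phi> x) ~= 0" using \<iota>(2) by simp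
  then obtain V W where VW: "open V" "x \<in> V" "V \<subseteq> D" "biholomorphic \<Phi> V W" "!!z. z \<in> V ==> det (jac \<Phi> z) ~= 0"
    using inverse_function_holo[OF D(1) hol D(3)] by metis
  have "\<forall>z j. \<Phi> z $ \<iota> j = \<phi> z $ j" "\<forall>z i. i \<notin> range \<iota> --> \<Phi> z $ i = z $ i"
    using \<iota>(1) by (auto simp: \<Phi>_def flat_chart_nth h_def)
  then show ?thesis using \<iota>(1) VW
    by (intro exI[of _ \<iota>] exI[of _ \<Phi>] exI[of _ V] exI[of _ W]) simp
qed

lemma submersion_section:
  fixes \<phi> :: "complex^'n => complex^'q"
  assumes D: "open D" "holo_map_on \<phi> D" "x \<in> D" "surj (%v. jac \<phi> x *v v)"
  shows "\<exists>T \<sigma>. open T \<and> \<phi> x \<in> T \<and> holo_map_on \<sigma> T \<and> \<sigma> ` T \<subseteq> D \<and> (\<forall>t\<in>T. \<phi> (\<sigma> t) = t) \<and> \<sigma> (\<phi> x) = x"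
proof -
  obtain \<iota> :: "'q => 'n" and \<Phi> :: "complex^'n => complex^'n" and V W where C: "inj \<iota>" "x \<in> V" "V \<subseteq> D" "biholomorphic \<Phi> V W"
    "!!z j. \<Phi> z $ \<iota> j = \<phi> z $ j" "!!z i. i \<notin> range \<iota> ==> \<Phi> z $ i = z $ i" using submersion_chart[OF D] by metis
  note B = biholomorphic_D[OF C(4)]
  define e :: "complex^'q => complex^'n" where "e t = (\<chi> i. if i \<in> range \<iota> then t $ inv \<iota> i else x $ i)" for t
  have eh: "holo_map_on e UNIV" unfolding holo_map_on_def
  proof
    fix i show "holo_fun_on (%t. e t $ i) UNIV" by (cases "i \<in> range \<iota>") (auto simp: e_def)
  qed
  have e\<phi>: "e (\<phi> x) = \<Phi> x"
    unfolding vec_eq_iff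
  proof
    fix i show "e (\<phi> x) $ i = \<Phi> x $ i"
      using C(1,5,6) by (cases "i \<in> range \<iota>") (auto simp: e_def)
  qed
  show ?thesis
  proof (intro exI conjI ballI)
    show "open (e -` W)" using holo_map_continuous[OF eh] B(2) by (intro open_vimage) auto
    show "\<phi> x \<in> e -` W" using e\<phi> B(10)[OF C(2)] by simp
    show "holo_map_on (%t. the_inv_into V \<Phi> (e t)) (e -` W)"
      by (rule holo_map_compose[OF holo_map_subset[OF eh] B(4)]) auto
    show "(%t. the_inv_into V \<Phi> (e t)) ` (e -` W) \<subseteq> D" using B(9) C(3) by auto
    show "the_inv_into V \<Phi> (e (\<phi> x)) = x" using e\<phi> B(7)[OF C(2)] by simp
    fix t assume "t \<in> e -` W"
    then have "\<Phi> (the_inv_into V \<Phi> (e t)) = e t" using B(8) by simp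
    then have "\<phi> (the_inv_into V \<Phi> (e t)) $ j = e t $ \<iota> j" for j using C(5)[of "the_inv_into V \<Phi> (e t)" j] by simp
    then show "\<phi> (the_inv_into V \<Phi> (e t)) = t" using C(1) by (simp add: vec_eq_iff e_def)
  qed
qed

lemma submersion_open_image:
  assumes "open D" "submersion_on \<phi> D" shows "open (\<phi> ` D)"
proof (subst open_subopen, intro ballI)
  fix t assume "t \<in> \<phi> ` D"
  then obtain x where "x \<in> D" "t = \<phi> x" by blast
  then obtain T \<sigma> where "open T" "t \<in> T" "\<sigma> ` T \<subseteq> D" "\<forall>t\<in>T. \<phi> (\<sigma> t) = t"
    using submersion_section[of D \<phi> x] assms unfolding submersion_on_iff by blast
  then have "T \<subseteq> \<phi> ` D" by (metis image_eqI image_subset_iff subsetI)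
  then show "\<exists>T. open T \<and> t \<in> T \<and> T \<subseteq> \<phi> ` D" using \<open>open T\<close> \<open>t \<in> T\<close> by blast
qed

lemma biholomorphic_jac:
  assumes "biholomorphic \<Phi> V W" "z \<in> V"
  shows "jac (the_inv_into V \<Phi>) (\<Phi> z) ** jac \<Phi> z = mat 1" "jac \<Phi> z ** jac (the_inv_into V \<Phi>) (\<Phi> z) = mat 1"
proof -
  note B = biholomorphic_D[OF assms(1)]
  have id: "jac (%z. z) x = mat 1" for x :: "complex^'k"
    by (simp add: jac_def vec_eq_iff mat_def axis_def)
  have cong: "jac f x = jac g x" if "open A" "x \<in> A" "holo_map_on f A" "!!z. z \<in> A ==> f z = g z" for f g :: "complex^'c => complex^'d" and A x
    unfolding jac_def using grad_cong[OF that(1,2), of "%z. f z $ i" "%z. g z $ i" for i] that(3,4)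
    by (simp add: vec_eq_iff holo_map_on_def)
  have "jac (%z. the_inv_into V \<Phi> (\<Phi> z)) z = jac (the_inv_into V \<Phi>) (\<Phi> z) ** jac \<Phi> z"
    by (rule jac_compose[OF B(3,4) assms(2) B(10)[OF assms(2)]])
  moreover have "jac (%z. z) z = jac (%z. the_inv_into V \<Phi> (\<Phi> z)) z"
    by (rule cong[OF B(1) assms(2) holo_map_shift(2)]) (simp add: B(7))
  ultimately show "jac (the_inv_into V \<Phi>) (\<Phi> z) ** jac \<Phi> z = mat 1" by (simp add: id)
  have "jac (%w. \<Phi> (the_inv_into V \<Phi> w)) (\<Phi> z) = jac \<Phi> (the_inv_into V \<Phi> (\<Phi> z)) ** jac (the_inv_into V \<Phi>) (\<Phi> z)"
    by (rule jac_compose[OF B(4,3) B(10)[OF assms(2)] B(9)[OF B(10)[OF assms(2)]]])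
  moreover have "jac (%z. z) (\<Phi> z) = jac (%w. \<Phi> (the_inv_into V \<Phi> w)) (\<Phi> z)"
    by (rule cong[OF B(2) B(10)[OF assms(2)] holo_map_shift(2)]) (simp add: B(8))
  ultimately show "jac \<Phi> z ** jac (the_inv_into V \<Phi>) (\<Phi> z) = mat 1" by (simp add: id B(7)[OF assms(2)])
qed

lemma biholomorphic_surj:
  assumes "biholomorphic \<Phi> V W" "z \<in> V" shows "surj (%v. jac \<Phi> z *v v)"
  by (rule surjI[where f="%v. jac (the_inv_into V \<Phi>) (\<Phi> z) *v v"])
     (simp add: matrix_vector_mul_assoc biholomorphic_jac(2)[OF assms])

section \<open>Local dimension and its behaviour under submersions\<close>

lemma regular_point_le: "regular_point (A :: (complex^'n) set) d z ==> d \<le> CARD('n)"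
  unfolding regular_point_def by (auto intro: card_mono)

lemma finite_dims: "finite {int d | d. p \<in> closure {z. regular_point (A :: (complex^'n) set) d z}}"
proof (rule finite_subset)
  show "{int d | d. p \<in> closure {z. regular_point A d z}} \<subseteq> int ` {..CARD('n)}"
  proof safe
    fix d assume "p \<in> closure {z. regular_point A d z}"
    then have "{z. regular_point A d z} ~= {}" by (metis closure_empty empty_iff)
    then show "int d \<in> int ` {..CARD('n)}" using regular_point_le by blast
  qed
qed simp

text \<open>Only finitely many dimensions occur, so the closure of the set of regular points of
  dimension at least \<open>k\<close> is the union of the closures for the single
  dimensions.\<close>

lemma dim_at_ge:
  fixes A :: "(complex^'n) set"
  assumes "!!V. open V ==> p \<in> V ==> \<exists>z\<in>V. \<exists>d\<ge>k. regular_point A d z"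
  shows "int k \<le> dim_at A p"
proof -
  have "p \<in> closure (\<Union>d\<in>{k..CARD('n)}. {z. regular_point A d z})"
    unfolding closure_iff_nhds_not_empty
  proof (intro allI impI)
    fix A' V assume "V \<subseteq> A'" "open V" "p \<in> V"
    then obtain z d where "z \<in> V" "d \<ge> k" "regular_point A d z" using assms by blast
    then show "(\<Union>d\<in>{k..CARD('n)}. {z. regular_point A d z}) \<inter> A' ~= {}"
      using regular_point_le[of A d z] \<open>V \<subseteq> A'\<close> by fastforce
  qed
  then have "p \<in> (\<Union>d\<in>{k..CARD('n)}. closure {z. regular_point A d z})"
  proof (rule subsetD[OF closure_minimal, rotated -1])
    show "closed (\<Union>d\<in>{k..CARD('n)}. closure {z. regular_point A d z})" by (intro closed_UN) auto
  qed (rule UN_mono[OF order_refl closure_subset])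
  then obtain d where d: "d \<ge> k" "p \<in> closure {z. regular_point A d z}" by auto
  have "int d \<le> dim_at A p" unfolding dim_at_def by (rule Max_ge) (use finite_dims d in auto)
  then show ?thesis using d(1) by simp
qed

lemma dim_at_zero_set:
  fixes A :: "(complex^'n) set"
  assumes om: "open \<Omega>" and hol: "!!g. g \<in> \<G> ==> holo_fun_on g \<Omega>"
    and A: "A \<inter> \<Omega> = {z\<in>\<Omega>. \<forall>g\<in>\<G>. g z = 0}" and a: "a \<in> \<Omega>" "a islimpt A"
  shows "1 \<le> dim_at A a"
proof -
  have "int 1 \<le> dim_at A a"
  proof (rule dim_at_ge)
    fix V assume "open V" "a \<in> V"
    then obtain z d where "z \<in> A \<inter> \<Omega> \<inter> V" "regular_point A d z" "d \<ge> 1"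
      using zero_set_positive_dim[OF om hol A a, of V] by metis
    then show "\<exists>z\<in>V. \<exists>d\<ge>1. regular_point A d z" by blast
  qed
  then show ?thesis by simp
qed

text \<open>The submersion followed by the flattening chart of \<open>Y\<close> is again a
  submersion, so its components serve as coordinates. Only the \<open>CARD('q) - d\<close>
  components outside \<open>J\<close> have to vanish; all other coordinates are free.\<close>

lemma regular_point_pullback:
  fixes \<phi> :: "complex^'n => complex^'q"
  assumes D: "open D" "submersion_on \<phi> D" "x \<in> D" and reg: "regular_point Y d (\<phi> x)"
    and A: "!!z. z \<in> D ==> z \<in> A \<longleftrightarrow> \<phi> z \<in> Y"
  shows "regular_point A (CARD('n) - CARD('q) + d) x"
proof -
  obtain V W and \<psi> :: "complex^'q => complex^'q" and J where r: "\<phi> x \<in> Y" "\<phi> x \<in> V" "biholomorphic \<psi> V W" "card J = d" "\<psi> ` (Y \<inter> V) = {w\<in>W. \<forall>i. i \<notin> J --> w $ i = 0}"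
    using reg unfolding regular_point_def by blast
  note B = biholomorphic_D[OF r(3)]
  define D' where "D' = D \<inter> \<phi> -` V"
  have s: "holo_map_on \<phi> D" "!!z. z \<in> D ==> surj (%v. jac \<phi> z *v v)" using D(2) by (auto simp: submersion_on_iff)
  have oD': "open D'" unfolding D'_def by (rule continuous_open_preimage[OF holo_map_continuous[OF s(1)] D(1) B(1)])
  have x: "x \<in> D'" using D(3) r(2) by (simp add: D'_def)
  have sD': "submersion_on \<phi> D'" by (rule submersion_subset[OF D(2)]) (auto simp: D'_def)
  have im: "\<phi> ` D' \<subseteq> V" by (auto simp: D'_def)
  have oim: "open (\<phi> ` D')" by (rule submersion_open_image[OF oD' sD'])
  have hol2: "holo_map_on (%z. \<psi> (\<phi> z)) D'" by (rule holo_map_compose[OF holo_map_subset[OF s(1)] B(3)]) (auto simp: D'_def)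
  have "jac (%z. \<psi> (\<phi> z)) x = jac \<psi> (\<phi> x) ** jac \<phi> x" by (rule jac_compose[OF s(1) B(3) D(3) r(2)])
  then have "(%v. jac (%z. \<psi> (\<phi> z)) x *v v) = (%v. jac \<psi> (\<phi> x) *v v) \<circ> (%v. jac \<phi> x *v v)"
    by (auto simp: fun_eq_iff matrix_vector_mul_assoc)
  then have sj: "surj (%v. jac (%z. \<psi> (\<phi> z)) x *v v)" using s(2)[OF D(3)] biholomorphic_surj[OF r(3,2)] comp_surj by metis
  obtain \<iota> :: "'q => 'n" and \<Phi> :: "complex^'n => complex^'n" and V2 W2 where C: "inj \<iota>" "x \<in> V2" "V2 \<subseteq> D'" "biholomorphic \<Phi> V2 W2"
    "!!z j. \<Phi> z $ \<iota> j = \<psi> (\<phi> z) $ j" using submersion_chart[OF oD' hol2 x sj] by blast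
  note B2 = biholomorphic_D[OF C(4)]
  have Yiff: "y \<in> Y \<longleftrightarrow> (\<forall>j. j \<notin> J --> \<psi> y $ j = 0)" if "y \<in> V" for y
  proof -
    have "y \<in> Y \<longleftrightarrow> \<psi> y \<in> \<psi> ` (Y \<inter> V)" using that B(6) by (auto dest: inj_onD)
    then show ?thesis unfolding r(5) using B(10)[OF that] by simp
  qed
  show ?thesis unfolding regular_point_def
  proof (intro conjI exI)
    show "x \<in> A" using A[OF D(3)] r(1) by simp
    show "x \<in> V2" "biholomorphic \<Phi> V2 W2" by fact+
    have "card (\<iota> ` (- J)) = CARD('q) - d" using C(1) r(4) by (simp add: card_image inj_on_subset Compl_eq_Diff_UNIV card_Diff_subset)
    moreover have "d \<le> CARD('q)" using r(4) card_mono[of UNIV J] by simp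
    moreover have "CARD('q) \<le> CARD('n)" using card_inj_on_le[OF C(1)] by simp
    ultimately show "card (- (\<iota> ` (- J))) = CARD('n) - CARD('q) + d" by (simp add: Compl_eq_Diff_UNIV card_Diff_subset)
    have zA: "z \<in> A \<longleftrightarrow> (\<forall>i. i \<notin> - (\<iota> ` (- J)) --> \<Phi> z $ i = 0)" if "z \<in> V2" for z
    proof -
      have "z \<in> D" "\<phi> z \<in> V" using that C(3) by (auto simp: D'_def)
      then have "z \<in> A \<longleftrightarrow> (\<forall>j. j \<notin> J --> \<psi> (\<phi> z) $ j = 0)" using A[of z] Yiff[of "\<phi> z"] by simp
      then show ?thesis using C(5)[of z] by auto
    qed
    show "\<Phi> ` (A \<inter> V2) = {w \<in> W2. \<forall>i. i \<notin> - (\<iota> ` (- J)) --> w $ i = 0}"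
    proof (intro set_eqI iffI)
      fix w assume "w \<in> \<Phi> ` (A \<inter> V2)"
      then obtain z where "z \<in> A" "z \<in> V2" "w = \<Phi> z" by blast
      then show "w \<in> {w \<in> W2. \<forall>i. i \<notin> - (\<iota> ` (- J)) --> w $ i = 0}" using zA[of z] B2(10)[of z] by blast
    next
      fix w assume w: "w \<in> {w \<in> W2. \<forall>i. i \<notin> - (\<iota> ` (- J)) --> w $ i = 0}"
      then have "the_inv_into V2 \<Phi> w \<in> V2" "\<Phi> (the_inv_into V2 \<Phi> w) = w" using B2(8,9) by blast+
      moreover from this have "the_inv_into V2 \<Phi> w \<in> A" using zA[of "the_inv_into V2 \<Phi> w"] w by simp
      ultimately have "\<Phi> (the_inv_into V2 \<Phi> w) \<in> \<Phi> ` (A \<inter> V2)" by blast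
      then show "w \<in> \<Phi> ` (A \<inter> V2)" using \<open>\<Phi> (the_inv_into V2 \<Phi> w) = w\<close> by simp
    qed
  qed
qed

section \<open>Foliation boxes\<close>

text \<open>The equations of a fibre are indexed by a proper subset of the coordinates, so
  \<open>no_local_max_norm\<close> applies.\<close>

lemma no_max_on_fibre:
  fixes \<phi> :: "complex^'n => complex^'q"
  assumes card: "CARD('q) < CARD('n)" and V: "open V" "a \<in> V" and hol: "holo_map_on \<phi> V"
    and mx: "!!z. z \<in> V ==> \<phi> z = \<phi> a ==> norm z \<le> norm a"
  shows False
proof -
  obtain \<iota> :: "'q => 'n" where \<iota>: "inj \<iota>"
    using card_le_inj[of "UNIV :: 'q set" "UNIV :: 'n set"] card by auto
  show False
  proof (rule no_local_max_norm[OF V, of "range \<iota>" "%i z. \<phi> z $ inv \<iota> i - \<phi> a $ inv \<iota> i"])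
    show "range \<iota> ~= UNIV" using card card_image[OF \<iota>] by auto
    show "holo_fun_on (%z. \<phi> z $ inv \<iota> j - \<phi> a $ inv \<iota> j) V" for j
      using hol by (intro holo_diff holo_const) (auto simp: holo_map_on_def)
    show "norm z \<le> norm a" if z: "z \<in> V" "!!j. j \<in> range \<iota> ==> \<phi> z $ inv \<iota> j - \<phi> a $ inv \<iota> j = 0" for z
    proof (rule mx[OF z(1)])
      show "\<phi> z = \<phi> a" unfolding vec_eq_iff
      proof
        fix j show "\<phi> z $ j = \<phi> a $ j" using z(2)[of "\<iota> j"] \<iota> by simp
      qed
    qed
  qed auto
qed

lemma matrix_scaleR: "A *v (r *\<^sub>R v) = r *\<^sub>R (A *v (v :: complex^'n))"
  by (simp add: vec_eq_iff matrix_vector_mult_def scaleR_sum_right)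

lemma connected_via_core:
  assumes "connected B" "B \<subseteq> T" "!!w. w \<in> T ==> \<exists>C. connected C \<and> C \<subseteq> T \<and> w \<in> C \<and> C \<inter> B ~= {}"
  shows "connected T"
  unfolding connected_iff_connected_component
proof (intro ballI)
  have core: "\<exists>b\<in>B. connected_component T x b" if "x \<in> T" for x
    using assms(3)[OF that] unfolding connected_component_def by blast
  fix x y assume "x \<in> T" "y \<in> T"
  then obtain b b' where b: "b \<in> B" "connected_component T x b" "b' \<in> B" "connected_component T y b'" using core by meson
  have "connected_component T b b'" unfolding connected_component_def using assms(1,2) b(1,3) by blast
  then show "connected_component T x y" using b by (meson connected_component_sym connected_component_trans)
qed

section \<open>Charts, plaques and boxes of a foliation with a first integral\<close>

locale foliated =
  fixes M :: "(complex^'n) set" and \<A> :: "('n::finite, 'q::finite) fol_chart set" and f :: "'q => complex^'n => complex"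
  assumes reg: "regular_foliation M \<A>" and f_holo: "!!j. holo_fun_on (f j) M"
    and f_leaf: "!!x j. x \<in> M ==> f j constant_on leaf \<A> x"
    and card_less: "CARD('q) < CARD('n)"
begin

definition F :: "complex^'n => complex^'q" where "F z = (\<chi> j. f j z)"

lemma holo_F: "holo_map_on F M" using f_holo by (simp add: holo_map_on_def F_def)

lemma chart_D:
  assumes "c \<in> \<A>"
  shows "open (fst c)" "submersion_on (snd c) (fst c)" "fst c \<subseteq> M" "holo_map_on (snd c) (fst c)"
    "!!z. z \<in> fst c ==> surj (%v. jac (snd c) z *v v)"
  using reg assms unfolding regular_foliation_def submersion_on_iff by blast+

lemma ex_chart: "x \<in> M ==> \<exists>c\<in>\<A>. x \<in> fst c"
  using reg unfolding regular_foliation_def by blast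

lemma compat:
  assumes "c \<in> \<A>" "d \<in> \<A>" "x \<in> fst c" "x \<in> fst d"
  shows "\<exists>N g. open N \<and> x \<in> N \<and> N \<subseteq> fst c \<inter> fst d \<and> biholomorphic g (snd c ` N) (snd d ` N) \<and> (\<forall>z\<in>N. snd d z = g (snd c z))"
proof -
  have "compatible_charts c d" using reg assms(1,2) unfolding regular_foliation_def by blast
  then show ?thesis using assms(3,4) unfolding compatible_charts_def by blast
qed

text \<open>The kernel is the tangent space of the leaf and so does not depend on the chart.\<close>

lemma kernel_chart:
  assumes "c \<in> \<A>" "d \<in> \<A>" "x \<in> fst c" "x \<in> fst d" "jac (snd c) x *v v = 0"
  shows "jac (snd d) x *v v = 0"
proof -
  obtain N g where N: "open N" "x \<in> N" "N \<subseteq> fst c \<inter> fst d" "biholomorphic g (snd c ` N) (snd d ` N)" "\<forall>z\<in>N. snd d z = g (snd c z)"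
    using compat[OF assms(1-4)] by blast
  note B = biholomorphic_D[OF N(4)]
  have hc: "holo_map_on (snd c) N" by (rule holo_map_subset[OF chart_D(4)[OF assms(1)]]) (use N(3) in blast)
  have "((%z. g (snd c z)) has_derivative (%v. jac g (snd c x) *v (jac (snd c) x *v v))) (at x)"
    by (rule has_derivative_compose[OF holo_map_D[OF hc N(2)] holo_map_D[OF B(3)]]) (use N(2) in blast)
  then have "(snd d has_derivative (%v. jac g (snd c x) *v (jac (snd c) x *v v))) (at x)"
    by (rule has_derivative_transform_within_open[OF _ N(1,2)]) (use N(5) in auto)
  moreover have "(snd d has_derivative (%v. jac (snd d) x *v v)) (at x)"
    by (rule holo_map_D[OF chart_D(4)[OF assms(2)] assms(4)])
  ultimately have "(%v. jac (snd d) x *v v) = (%v. jac g (snd c x) *v (jac (snd c) x *v v))"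
    by (rule has_derivative_unique[rotated])
  then have "jac (snd d) x *v v = jac g (snd c x) *v (jac (snd c) x *v v)" by meson
  then show ?thesis using assms(5) by simp
qed

lemma plaque_const:
  assumes c: "c \<in> \<A>" "d \<in> \<A>" and P: "connected P" "P \<subseteq> fst c \<inter> fst d" "!!p p'. p \<in> P ==> p' \<in> P ==> snd c p = snd c p'"
    and p: "p \<in> P" "p' \<in> P"
  shows "snd d p = snd d p'"
proof -
  have "snd d constant_on P"
  proof (rule locally_constant_imp_constant[OF P(1)])
    fix a assume a: "a \<in> P"
    then obtain N g where N: "open N" "a \<in> N" "\<forall>z\<in>N. snd d z = g (snd c z)"
      using compat[OF c, of a] P(2) by blast
    show "\<exists>T. openin (top_of_set P) T \<and> a \<in> T \<and> (\<forall>x\<in>T. snd d x = snd d a)"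
    proof (intro exI conjI ballI)
      show "openin (top_of_set P) (P \<inter> N)" using N(1) by (rule openin_open_Int)
      show "a \<in> P \<inter> N" using a N(2) by simp
      show "snd d x = snd d a" if "x \<in> P \<inter> N" for x
        using N(2,3) P(3)[of x a] a that by simp
    qed
  qed
  then show ?thesis using p by (auto simp: constant_on_def)
qed

lemma F_plaque:
  assumes c: "c \<in> \<A>" and P: "connected P" "P \<subseteq> fst c" "!!p p'. p \<in> P ==> p' \<in> P ==> snd c p = snd c p'"
    and p: "p \<in> P" "p' \<in> P"
  shows "F p = F p'"
proof -
  have "connected_component {z\<in>fst c. snd c z = snd c p} p p'"
    unfolding connected_component_def using P p by blast
  then have "same_plaque \<A> p p'" unfolding same_plaque_def using c by blast
  then have "p' \<in> leaf \<A> p" "p \<in> leaf \<A> p" by (auto simp: leaf_def)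
  moreover have "p \<in> M" using p(1) P(2) chart_D(3)[OF c] by blast
  ultimately have "f j p = f j p'" for j using f_leaf[of p j] by (auto simp: constant_on_def)
  then show ?thesis by (simp add: F_def)
qed

text \<open>A foliation box for a closed set \<open>K\<close> whose boundary it may straddle.
  Connected plaques make \<open>F\<close> constant on each of them; a point of each plaque interior
  to \<open>K\<close> makes the set of parameters open and functions of the parameter
  holomorphic.\<close>

definition box :: "(complex^'n) set => ('n, 'q) fol_chart => (complex^'n) set => bool" where
  "box K c V \<longleftrightarrow> c \<in> \<A> \<and> open V \<and> V \<subseteq> fst c \<and>
     (\<forall>p\<in>K \<inter> V. connected {z\<in>K \<inter> V. snd c z = snd c p} \<and> (\<exists>p'\<in>interior K \<inter> V. snd c p' = snd c p))"

lemma box_interior: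
  assumes x: "x \<in> interior K" "open O'" "x \<in> O'" and c: "c \<in> \<A>" "x \<in> fst c"
  shows "\<exists>V. x \<in> V \<and> V \<subseteq> O' \<inter> interior K \<and> box K c V"
proof -
  let ?D = "fst c \<inter> O' \<inter> interior K"
  have D: "open ?D" "holo_map_on (snd c) ?D" "x \<in> ?D" "surj (%v. jac (snd c) x *v v)"
    using x c chart_D[OF c(1)] holo_map_subset[OF chart_D(4)[OF c(1)], of ?D] by auto
  obtain \<iota> :: "'q => 'n" and \<Phi> :: "complex^'n => complex^'n" and V W where C: "inj \<iota>" "x \<in> V" "V \<subseteq> ?D"
    "biholomorphic \<Phi> V W" "!!z j. \<Phi> z $ \<iota> j = snd c z $ j" using submersion_chart[OF D] by blast
  note B = biholomorphic_D[OF C(4)]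
  obtain r where r: "r > 0" "ball (\<Phi> x) r \<subseteq> W" using B(2) B(10)[OF C(2)] open_contains_ball by blast
  define V' where "V' = V \<inter> \<Phi> -` ball (\<Phi> x) r"
  have bi: "biholomorphic \<Phi> V' (ball (\<Phi> x) r)" unfolding V'_def by (rule biholomorphic_restrict[OF C(4) open_ball r(2)])
  note B' = biholomorphic_D[OF bi]
  have V': "x \<in> V'" "V' \<subseteq> ?D" using C r by (auto simp: V'_def)
  have KV: "K \<inter> V' = V'" "interior K \<inter> V' = V'" using V'(2) interior_subset by blast+
  have "connected {z\<in>V'. snd c z = t}" for t
  proof -
    let ?T = "{w\<in>ball (\<Phi> x) r. \<forall>j. w $ \<iota> j = t $ j}"
    have "convex ?T"
    proof -
      have "?T = ball (\<Phi> x) r \<inter> (\<Inter>j. {w. w $ \<iota> j = t $ j})" by auto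
      moreover have "convex {w :: complex^'n. w $ \<iota> j = t $ j}" for j
        by (auto simp: convex_def algebra_simps simp flip: scaleR_left.add)
      ultimately show ?thesis by (simp add: convex_Int convex_INT)
    qed
    then have "connected (the_inv_into V' \<Phi> ` ?T)"
      by (intro connected_continuous_image convex_connected continuous_on_subset[OF holo_map_continuous[OF B'(4)]]) auto
    moreover have "the_inv_into V' \<Phi> ` ?T = {z\<in>V'. snd c z = t}"
    proof (intro set_eqI iffI)
      fix z assume "z \<in> the_inv_into V' \<Phi> ` ?T"
      then obtain w where w: "w \<in> ball (\<Phi> x) r" "!!j. w $ \<iota> j = t $ j" "z = the_inv_into V' \<Phi> w" by blast
      then have "\<Phi> z = w" "z \<in> V'" using B'(8,9) by blast+
      then show "z \<in> {z\<in>V'. snd c z = t}" using w(2) C(5)[of z] by (simp add: vec_eq_iff)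
    next
      fix z assume z: "z \<in> {z\<in>V'. snd c z = t}"
      then have "z = the_inv_into V' \<Phi> (\<Phi> z)" "\<Phi> z \<in> ?T" using B'(7,10)[of z] C(5)[of z] by auto
      then show "z \<in> the_inv_into V' \<Phi> ` ?T" by blast
    qed
    ultimately show ?thesis by simp
  qed
  then have "box K c V'" unfolding box_def KV using c(1) B'(1) V'(2) by blast
  then show ?thesis using V' by blast
qed

text \<open>In a chart that flattens the leaves, \<open>e\<close> is a direction along the leaf in
  which the norm increases. Sliding backwards along \<open>e\<close> keeps a point in the ball and
  on its level set until it reaches the convex core \<open>Co\<close> inside the open ball; hence
  the plaques are connected and meet the interior.\<close>

lemma box_boundary:
  assumes \<epsilon>: "\<epsilon> > 0" "norm x = \<epsilon>" "open O'" "x \<in> O'" and c: "c \<in> \<A>" "x \<in> fst c"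
    and v: "jac (snd c) x *v v = 0" "x \<bullet> v ~= 0"
  shows "\<exists>V. x \<in> V \<and> V \<subseteq> O' \<and> box (cball 0 \<epsilon>) c V"
proof -
  let ?D = "fst c \<inter> O'"
  have D: "open ?D" "holo_map_on (snd c) ?D" "x \<in> ?D" "surj (%v. jac (snd c) x *v v)"
    using \<epsilon> c chart_D[OF c(1)] holo_map_subset[OF chart_D(4)[OF c(1)], of ?D] by auto
  obtain \<iota> :: "'q => 'n" and \<Phi> :: "complex^'n => complex^'n" and V W where C: "inj \<iota>" "x \<in> V" "V \<subseteq> ?D"
    "biholomorphic \<Phi> V W" "!!z j. \<Phi> z $ \<iota> j = snd c z $ j" using submersion_chart[OF D] by blast
  note B = biholomorphic_D[OF C(4)]
  define \<Theta> where "\<Theta> = the_inv_into V \<Phi>"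
  define w0 where "w0 = \<Phi> x"
  have w0: "w0 \<in> W" "\<Theta> w0 = x" using B(7,10) C(2) by (auto simp: w0_def \<Theta>_def)
  \<comment> \<open>The sign makes the norm increase along \<open>e\<close>.\<close>
  define e where "e = (if x \<bullet> v > 0 then 1 else - 1 :: real) *\<^sub>R (jac \<Phi> x *v v)"
  have eR: "e $ \<iota> j = 0" for j
  proof -
    have "(jac \<Phi> x *v v) $ \<iota> j = (jac (snd c) x *v v) $ j" unfolding jac_mult C(5) ..
    then show ?thesis using v(1) by (simp add: e_def)
  qed
  have "jac \<Theta> w0 *v (jac \<Phi> x *v v) = v"
    unfolding \<Theta>_def w0_def using biholomorphic_jac(1)[OF C(4,2)] by (simp add: matrix_vector_mul_assoc)
  then have pos0: "\<Theta> w0 \<bullet> (jac \<Theta> w0 *v e) > 0"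
    using v(2) w0(2) unfolding e_def by (simp add: matrix_scaleR vec.neg)
  have h\<Theta>: "holo_map_on \<Theta> W" using B(4) by (simp add: \<Theta>_def)
  have cont: "continuous_on W (%w. \<Theta> w \<bullet> (jac \<Theta> w *v e))"
    unfolding matrix_vector_mult_def
    by (intro continuous_intros holo_map_continuous[OF h\<Theta>] holo_continuous[OF holo_jac[OF B(2) h\<Theta>]])
  have "open (W \<inter> (%w. \<Theta> w \<bullet> (jac \<Theta> w *v e)) -` {0<..})" by (rule continuous_open_preimage[OF cont B(2)]) simp
  then obtain r where r: "r > 0" "ball w0 r \<subseteq> W \<inter> (%w. \<Theta> w \<bullet> (jac \<Theta> w *v e)) -` {0<..}"
    using open_contains_ball w0(1) pos0 by (metis (no_types, lifting) IntI greaterThan_iff vimage_eq)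
  have e0: "e ~= 0" using pos0 by auto
  \<comment> \<open>Slides of length \<eta> cover the distance \<open>r / 2\<close>, so those that
    start within \<open>r / 2\<close> of \<open>w0\<close> stay where the derivative of the norm is
    positive.\<close>
  define \<eta> where "\<eta> = r / (2 * norm e)"
  have \<eta>: "\<eta> > 0" "\<eta> * norm e = r / 2" using r(1) e0 by (auto simp: \<eta>_def)
  have deriv: "((%s. (norm (\<Theta> (w + s *\<^sub>R e)))\<^sup>2) has_real_derivative 2 * (\<Theta> (w + s *\<^sub>R e) \<bullet> (jac \<Theta> (w + s *\<^sub>R e) *v e))) (at s)"
    if "w + s *\<^sub>R e \<in> W" for w s
  proof -
    have 1: "((%s. w + s *\<^sub>R e) has_derivative (%t. t *\<^sub>R e)) (at s)" by (auto intro!: derivative_eq_intros)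
    have 2: "((%s. \<Theta> (w + s *\<^sub>R e)) has_derivative (%t. jac \<Theta> (w + s *\<^sub>R e) *v (t *\<^sub>R e))) (at s)"
      by (rule has_derivative_compose[OF 1 holo_map_D[OF h\<Theta> that]])
    have "((%s. \<Theta> (w + s *\<^sub>R e) \<bullet> \<Theta> (w + s *\<^sub>R e)) has_derivative
       (%t. \<Theta> (w + s *\<^sub>R e) \<bullet> (jac \<Theta> (w + s *\<^sub>R e) *v (t *\<^sub>R e)) + (jac \<Theta> (w + s *\<^sub>R e) *v (t *\<^sub>R e)) \<bullet> \<Theta> (w + s *\<^sub>R e))) (at s)"
      by (rule has_derivative_inner[OF 2 2])
    moreover have "(%t. \<Theta> (w + s *\<^sub>R e) \<bullet> (jac \<Theta> (w + s *\<^sub>R e) *v (t *\<^sub>R e)) + (jac \<Theta> (w + s *\<^sub>R e) *v (t *\<^sub>R e)) \<bullet> \<Theta> (w + s *\<^sub>R e)) =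
        (*) (2 * (\<Theta> (w + s *\<^sub>R e) \<bullet> (jac \<Theta> (w + s *\<^sub>R e) *v e)))"
      by (simp add: fun_eq_iff matrix_scaleR inner_commute)
    ultimately show ?thesis unfolding has_field_derivative_def power2_norm_eq_inner by metis
  qed
  have mono: "(norm (\<Theta> (w + s *\<^sub>R e)))\<^sup>2 < (norm (\<Theta> (w + t *\<^sub>R e)))\<^sup>2"
    if w: "norm (w - w0) < r / 2" and st: "- \<eta> \<le> s" "s < t" "t \<le> \<eta>" for w s t
  proof (rule DERIV_pos_imp_increasing[OF st(2)])
    fix u assume u: "s \<le> u" "u \<le> t"
    have "\<bar>u\<bar> * norm e \<le> \<eta> * norm e" using u st by (intro mult_right_mono) auto
    then have "norm (w + u *\<^sub>R e - w0) < r" using norm_triangle_ineq[of "w - w0" "u *\<^sub>R e"] w \<eta>(2) by (simp add: algebra_simps)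
    then have "w + u *\<^sub>R e \<in> ball w0 r" by (simp add: dist_norm norm_minus_commute)
    then have "w + u *\<^sub>R e \<in> W" "\<Theta> (w + u *\<^sub>R e) \<bullet> (jac \<Theta> (w + u *\<^sub>R e) *v e) > 0" using r(2) by blast+
    then show "\<exists>y. ((%s. (norm (\<Theta> (w + s *\<^sub>R e)))\<^sup>2) has_real_derivative y) (at u) \<and> 0 < y"
      using deriv by (metis mult_pos_pos zero_less_numeral)
  qed
  define wm where "wm = w0 + (- \<eta>) *\<^sub>R e"
  have wm_r: "wm \<in> ball w0 r" using \<eta> r(1) by (simp add: wm_def dist_norm)
  have "(norm (\<Theta> (w0 + (- \<eta>) *\<^sub>R e)))\<^sup>2 < (norm (\<Theta> (w0 + 0 *\<^sub>R e)))\<^sup>2" using \<eta>(1) r(1) by (intro mono) auto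
  then have "(norm (\<Theta> wm))\<^sup>2 < \<epsilon>\<^sup>2" using w0(2) \<epsilon>(2) by (simp add: wm_def)
  then have "norm (\<Theta> wm) < \<epsilon>" using \<epsilon>(1) power2_less_imp_less by fastforce
  moreover have cn: "continuous_on W (%w. norm (\<Theta> w))" by (intro continuous_intros holo_map_continuous[OF h\<Theta>])
  ultimately have "open (W \<inter> (%w. norm (\<Theta> w)) -` {..<\<epsilon>})" "wm \<in> W \<inter> (%w. norm (\<Theta> w)) -` {..<\<epsilon>}"
    using continuous_open_preimage[OF cn B(2)] wm_r r(2) by auto
  then obtain r0 where r0: "r0 > 0" "ball wm r0 \<subseteq> W \<inter> (%w. norm (\<Theta> w)) -` {..<\<epsilon>}" using open_contains_ball by blast
  define r1 where "r1 = min r0 (r / 2)"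
  have r1: "r1 > 0" "r1 \<le> r / 2" "r1 \<le> r0" using r0 r by (auto simp: r1_def)
  \<comment> \<open>A tube about the segment in direction \<open>e\<close>, thin enough that its end
    at \<open>wm\<close> is mapped inside the open ball of radius \<epsilon>.\<close>
  define T where "T = (\<Union>s\<in>{-\<eta>..\<eta>}. ball (w0 + s *\<^sub>R e) r1)"
  have Tin: "w + s *\<^sub>R e \<in> T" if "norm (w - w0) < r1" "s \<in> {-\<eta>..\<eta>}" for w s
  proof -
    have "w + s *\<^sub>R e \<in> ball (w0 + s *\<^sub>R e) r1" using that(1) by (simp add: dist_norm norm_minus_commute)
    then show ?thesis unfolding T_def using that(2) by blast
  qed
  have Tout: "\<exists>a s. w = a + s *\<^sub>R e \<and> norm (a - w0) < r1 \<and> s \<in> {-\<eta>..\<eta>}" if w: "w \<in> T" for w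
  proof -
    obtain s where "s \<in> {-\<eta>..\<eta>}" "dist (w0 + s *\<^sub>R e) w < r1" using w by (auto simp: T_def)
    then show ?thesis by (intro exI[of _ "w - s *\<^sub>R e"] exI[of _ s]) (simp add: dist_norm norm_minus_commute algebra_simps)
  qed
  have TW: "T \<subseteq> W"
  proof
    fix w assume "w \<in> T"
    then obtain a s where as: "w = a + s *\<^sub>R e" "norm (a - w0) < r1" "s \<in> {-\<eta>..\<eta>}" using Tout by blast
    have "\<bar>s\<bar> * norm e \<le> \<eta> * norm e" using as(3) by (intro mult_right_mono) auto
    then have "norm (w - w0) < r" using norm_triangle_ineq[of "a - w0" "s *\<^sub>R e"] as(1,2) \<eta>(2) r1(2) by (simp add: algebra_simps)
    then have "w \<in> ball w0 r" by (simp add: dist_norm norm_minus_commute)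
    then show "w \<in> W" using r(2) by blast
  qed
  have oT: "open T" unfolding T_def by auto
  define V' where "V' = V \<inter> \<Phi> -` T"
  have bi: "biholomorphic \<Phi> V' T" unfolding V'_def by (rule biholomorphic_restrict[OF C(4) oT TW])
  note B' = biholomorphic_D[OF bi]
  have \<Theta>: "\<Theta> w \<in> V'" "\<Phi> (\<Theta> w) = w" if "w \<in> T" for w
    using B(8,9) that TW by (auto simp: V'_def \<Theta>_def subset_eq)
  have \<Theta>2: "\<Theta> (\<Phi> z) = z" "\<Phi> z \<in> T" if "z \<in> V'" for z using B(7) that by (auto simp: V'_def \<Theta>_def)
  have xV': "x \<in> V'" using C(2) Tin[of w0 0] r1(1) \<eta>(1) by (simp add: V'_def w0_def)
  define Sl where "Sl t = {w\<in>T. norm (\<Theta> w) \<le> \<epsilon> \<and> (\<forall>j. w $ \<iota> j = t $ j)}" for t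
  define Co where "Co t = {w\<in>ball wm r1. \<forall>j. w $ \<iota> j = t $ j}" for t
  have Co_sub: "w \<in> Sl t \<and> norm (\<Theta> w) < \<epsilon>" if "w \<in> Co t" for w t
  proof -
    have "w \<in> ball wm r0" using that r1(3) by (auto simp: Co_def)
    then have "norm (\<Theta> w) < \<epsilon>" using r0(2) by blast
    moreover have "w \<in> T" using that \<eta>(1) by (auto simp: T_def Co_def wm_def intro!: bexI[of _ "-\<eta>"])
    ultimately show ?thesis using that by (simp add: Sl_def Co_def)
  qed
  have slide: "\<exists>D. connected D \<and> D \<subseteq> Sl t \<and> w \<in> D \<and> D \<inter> Co t ~= {}" if w: "w \<in> Sl t" for w t
  proof -
    obtain a s where as: "w = a + s *\<^sub>R e" "norm (a - w0) < r1" "s \<in> {-\<eta>..\<eta>}" using Tout[of w] w unfolding Sl_def by blast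
    let ?D = "(%u. a + u *\<^sub>R e) ` {-\<eta>..s}"
    have at: "a $ \<iota> j = t $ j" for j using w as(1) eR by (simp add: Sl_def)
    have "connected ?D" by (intro connected_continuous_image continuous_intros) auto
    moreover have "?D \<subseteq> Sl t"
    proof
      fix w' assume "w' \<in> ?D"
      then obtain u where u: "-\<eta> \<le> u" "u \<le> s" "w' = a + u *\<^sub>R e" by auto
      have "(norm (\<Theta> w'))\<^sup>2 \<le> (norm (\<Theta> w))\<^sup>2"
      proof (cases "u = s")
        case False
        show ?thesis unfolding u(3) as(1) by (rule less_imp_le[OF mono]) (use False as r1(2) u in auto)
      qed (simp add: u as)
      also have "\<dots> \<le> \<epsilon>\<^sup>2" using w by (intro power_mono) (auto simp: Sl_def)
      finally have "norm (\<Theta> w') \<le> \<epsilon>" using \<epsilon>(1) power2_le_imp_le by fastforce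
      moreover have "w' \<in> T" unfolding u(3) using as u by (intro Tin) auto
      ultimately show "w' \<in> Sl t" using u(3) at eR by (simp add: Sl_def)
    qed
    moreover have "w \<in> ?D" using as by auto
    moreover have "a + (-\<eta>) *\<^sub>R e \<in> Co t" using as(2) at eR by (simp add: Co_def wm_def dist_norm norm_minus_commute)
    moreover have "a + (-\<eta>) *\<^sub>R e \<in> ?D" by (rule image_eqI[OF refl]) (use as(3) in auto)
    ultimately show ?thesis by blast
  qed
  have "connected (Sl t)" for t
  proof (rule connected_via_core[of "Co t"])
    have "Co t = ball wm r1 \<inter> (\<Inter>j. {w. w $ \<iota> j = t $ j})" by (auto simp: Co_def)
    moreover have "convex {w :: complex^'n. w $ \<iota> j = t $ j}" for j
      by (auto simp: convex_def algebra_simps simp flip: scaleR_left.add)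
    ultimately show "connected (Co t)" by (simp add: convex_connected convex_Int convex_INT)
    show "Co t \<subseteq> Sl t" using Co_sub by blast
  qed (rule slide)
  then have conn: "connected (\<Theta> ` Sl t)" for t
    by (intro connected_continuous_image continuous_on_subset[OF holo_map_continuous[OF h\<Theta>]]) (use TW in \<open>auto simp: Sl_def\<close>)
  have im: "{z\<in>cball 0 \<epsilon> \<inter> V'. snd c z = t} = \<Theta> ` Sl t" for t
  proof (intro set_eqI iffI)
    fix z assume z: "z \<in> {z\<in>cball 0 \<epsilon> \<inter> V'. snd c z = t}"
    then have "z = \<Theta> (\<Phi> z)" "\<Phi> z \<in> Sl t" using \<Theta>2[of z] C(5)[of z] by (auto simp: Sl_def)
    then show "z \<in> \<Theta> ` Sl t" by blast
  next
    fix z assume "z \<in> \<Theta> ` Sl t"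
    then obtain w where w: "w \<in> T" "norm (\<Theta> w) \<le> \<epsilon>" "!!j. w $ \<iota> j = t $ j" "z = \<Theta> w" by (auto simp: Sl_def)
    then have "\<Phi> z = w" "z \<in> V'" "norm z \<le> \<epsilon>" using \<Theta>[OF w(1)] by auto
    moreover from this have "snd c z = t" using w(3) C(5)[of z] by (simp add: vec_eq_iff)
    ultimately show "z \<in> {z\<in>cball 0 \<epsilon> \<inter> V'. snd c z = t}" by simp
  qed
  have "box (cball 0 \<epsilon>) c V'"
    unfolding box_def
  proof (intro conjI ballI)
    show "c \<in> \<A>" "open V'" by fact (rule B'(1))
    show "V' \<subseteq> fst c" using C(3) by (auto simp: V'_def)
    fix p assume p: "p \<in> cball 0 \<epsilon> \<inter> V'"
    show "connected {z \<in> cball 0 \<epsilon> \<inter> V'. snd c z = snd c p}" unfolding im by (rule conn)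
    have "\<Phi> p \<in> Sl (snd c p)" using p \<Theta>2[of p] C(5)[of p] by (auto simp: Sl_def)
    then obtain w where w: "w \<in> Co (snd c p)" using slide by blast
    then have "w \<in> Sl (snd c p)" "norm (\<Theta> w) < \<epsilon>" using Co_sub by blast+
    then have "\<Theta> w \<in> interior (cball 0 \<epsilon>) \<inter> V'" "snd c (\<Theta> w) = snd c p" using im[of "snd c p"] by (auto simp: image_iff)
    then show "\<exists>p'\<in>interior (cball 0 \<epsilon>) \<inter> V'. snd c p' = snd c p" by blast
  qed
  moreover have "V' \<subseteq> O'" using C(3) by (auto simp: V'_def)
  ultimately show ?thesis using xV' by blast
qed

lemma box_base_open:
  assumes "box K c V" shows "open (snd c ` (K \<inter> V))"
proof -
  have b: "c \<in> \<A>" "open V" "V \<subseteq> fst c" "!!p. p \<in> K \<inter> V ==> \<exists>p'\<in>interior K \<inter> V. snd c p' = snd c p"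
    using assms by (auto simp: box_def)
  have "snd c ` (K \<inter> V) = snd c ` (interior K \<inter> V)"
  proof (intro equalityI subsetI)
    fix t assume "t \<in> snd c ` (K \<inter> V)"
    then obtain q where "q \<in> K \<inter> V" "t = snd c q" by blast
    then show "t \<in> snd c ` (interior K \<inter> V)" using b(4)[of q] by (metis imageI)
  qed (use interior_subset in blast)
  moreover have "open (snd c ` (interior K \<inter> V))"
    by (rule submersion_open_image[OF _ submersion_subset[OF chart_D(2)[OF b(1)]]]) (use b(2,3) in \<open>auto simp: open_Int\<close>)
  ultimately show ?thesis by simp
qed

text \<open>Locally the factor is \<open>h\<close> composed with a holomorphic section of the chart
  through a point of the plaque that is interior to \<open>K\<close>.\<close>

lemma box_factor:
  fixes h :: "complex^'n => complex^'m"
  assumes "box K c V" and h: "holo_map_on h V" and const: "!!p p'. p \<in> K \<inter> V ==> p' \<in> K \<inter> V ==> snd c p = snd c p' ==> h p = h p'"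
  shows "\<exists>g. holo_map_on g (snd c ` (K \<inter> V)) \<and> (\<forall>p\<in>K \<inter> V. h p = g (snd c p))"
proof -
  have b: "c \<in> \<A>" "open V" "V \<subseteq> fst c" "!!p. p \<in> K \<inter> V ==> \<exists>p'\<in>interior K \<inter> V. snd c p' = snd c p"
    using assms by (auto simp: box_def)
  define g where "g t = h (SOME p. p \<in> K \<inter> V \<and> snd c p = t)" for t
  have g: "g (snd c p) = h p" if "p \<in> K \<inter> V" for p
  proof -
    have "(SOME p'. p' \<in> K \<inter> V \<and> snd c p' = snd c p) \<in> K \<inter> V \<and> snd c (SOME p'. p' \<in> K \<inter> V \<and> snd c p' = snd c p) = snd c p"
      by (rule someI[of "%p'. p' \<in> K \<inter> V \<and> snd c p' = snd c p" p]) (use that in blast)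
    then show ?thesis unfolding g_def using const that by blast
  qed
  have "holo_fun_on (%t. g t $ i) (snd c ` (K \<inter> V))" for i
  proof (rule holo_local)
    fix t assume "t \<in> snd c ` (K \<inter> V)"
    then obtain q where q: "q \<in> K \<inter> V" "t = snd c q" by blast
    obtain p where p: "p \<in> interior K \<inter> V" "t = snd c p" using b(4)[OF q(1)] q(2) by auto
    have "\<exists>T \<sigma>. open T \<and> snd c p \<in> T \<and> holo_map_on \<sigma> T \<and> \<sigma> ` T \<subseteq> interior K \<inter> V \<and> (\<forall>t\<in>T. snd c (\<sigma> t) = t) \<and> \<sigma> (snd c p) = p"
    proof (rule submersion_section)
      show "holo_map_on (snd c) (interior K \<inter> V)" by (rule holo_map_subset[OF chart_D(4)[OF b(1)]]) (use b(3) in blast)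
      show "surj (%v. jac (snd c) p *v v)" by (rule chart_D(5)[OF b(1)]) (use p b(3) in blast)
    qed (use b(2) p in \<open>auto simp: open_Int\<close>)
    then obtain T \<sigma> where T: "open T" "t \<in> T" "holo_map_on \<sigma> T" "\<sigma> ` T \<subseteq> interior K \<inter> V" "!!t. t \<in> T ==> snd c (\<sigma> t) = t"
      unfolding p(2) by blast
    have KV: "\<sigma> s \<in> K \<inter> V" if "s \<in> T" for s using T(4) that interior_subset by blast
    have hi: "holo_fun_on (%z. h z $ i) V" using h by (simp add: holo_map_on_def)
    have "holo_fun_on (%t. h (\<sigma> t) $ i) T"
      by (rule holo_compose[OF T(3) hi]) (use KV in blast)
    then have "holo_fun_on (%t. g t $ i) T"
    proof (rule holo_cong[OF _ T(1)])
      fix s assume "s \<in> T"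
      then show "h (\<sigma> s) $ i = g s $ i" using g[OF KV] T(5) by simp
    qed
    then show "\<exists>V. t \<in> V \<and> holo_fun_on (%t. g t $ i) V" using T(2) by blast
  qed
  then show ?thesis using g unfolding holo_map_on_def by metis
qed

lemma box_plaque:
  assumes "box K c V" "p \<in> K \<inter> V" "p' \<in> K \<inter> V" "snd c p = snd c p'"
  obtains P where "connected P" "P \<subseteq> K \<inter> V" "!!z. z \<in> P \<longleftrightarrow> z \<in> K \<inter> V \<and> snd c z = snd c p" "p \<in> P" "p' \<in> P"
  by (rule that[of "{z\<in>K \<inter> V. snd c z = snd c p}"]) (use assms in \<open>auto simp: box_def\<close>)

lemma box_F:
  assumes "box K c V"
  shows "\<exists>g. holo_map_on g (snd c ` (K \<inter> V)) \<and> (\<forall>p\<in>K \<inter> V. F p = g (snd c p))"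
proof (rule box_factor[OF assms])
  have c: "c \<in> \<A>" "V \<subseteq> fst c" using assms by (auto simp: box_def)
  show "holo_map_on F V" by (rule holo_map_subset[OF holo_F]) (use c chart_D(3) in blast)
  fix p p' assume p: "p \<in> K \<inter> V" "p' \<in> K \<inter> V" "snd c p = snd c p'"
  obtain P where P: "connected P" "P \<subseteq> K \<inter> V" "!!z. z \<in> P \<longleftrightarrow> z \<in> K \<inter> V \<and> snd c z = snd c p" "p \<in> P" "p' \<in> P"
    using box_plaque[OF assms p] by blast
  show "F p = F p'" by (rule F_plaque[OF c(1) P(1) _ _ P(4,5)]) (use P(2,3) c(2) in auto)
qed

lemma box_transition:
  assumes "box K c V" and d: "d \<in> \<A>" "V \<subseteq> fst d"
  shows "\<exists>\<kappa>. holo_map_on \<kappa> (snd c ` (K \<inter> V)) \<and> (\<forall>p\<in>K \<inter> V. snd d p = \<kappa> (snd c p)) \<and>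
    (\<forall>t\<in>snd c ` (K \<inter> V). surj (%v. jac \<kappa> t *v v))"
proof -
  have c: "c \<in> \<A>" "V \<subseteq> fst c" "open V" "!!p. p \<in> K \<inter> V ==> \<exists>p'\<in>interior K \<inter> V. snd c p' = snd c p" using assms by (auto simp: box_def)
  have "\<exists>\<kappa>. holo_map_on \<kappa> (snd c ` (K \<inter> V)) \<and> (\<forall>p\<in>K \<inter> V. snd d p = \<kappa> (snd c p))"
  proof (rule box_factor[OF assms(1) holo_map_subset[OF chart_D(4)[OF d(1)] d(2)]])
    fix p p' assume p: "p \<in> K \<inter> V" "p' \<in> K \<inter> V" "snd c p = snd c p'"
    obtain P where P: "connected P" "P \<subseteq> K \<inter> V" "!!z. z \<in> P \<longleftrightarrow> z \<in> K \<inter> V \<and> snd c z = snd c p" "p \<in> P" "p' \<in> P"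
      using box_plaque[OF assms(1) p] by blast
    show "snd d p = snd d p'" by (rule plaque_const[OF c(1) d(1) P(1) _ _ P(4,5)]) (use P(2,3) c(2) d(2) in auto)
  qed
  then obtain \<kappa> where \<kappa>: "holo_map_on \<kappa> (snd c ` (K \<inter> V))" "!!p. p \<in> K \<inter> V ==> snd d p = \<kappa> (snd c p)" by blast
  have "surj (%v. jac \<kappa> t *v v)" if t: "t \<in> snd c ` (K \<inter> V)" for t
  proof -
    obtain q where q: "q \<in> K \<inter> V" "t = snd c q" using t by blast
    obtain p where p: "p \<in> interior K \<inter> V" "t = snd c p" using c(4)[OF q(1)] q(2) by auto
    have pK: "z \<in> K \<inter> V" if "z \<in> interior K \<inter> V" for z using that interior_subset by blast
    have hc: "holo_map_on (snd c) (interior K \<inter> V)" by (rule holo_map_subset[OF chart_D(4)[OF c(1)]]) (use c(2) in blast)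
    have "((%z. \<kappa> (snd c z)) has_derivative (%v. jac \<kappa> t *v (jac (snd c) p *v v))) (at p)"
      unfolding p(2) by (rule has_derivative_compose[OF holo_map_D[OF hc p(1)] holo_map_D[OF \<kappa>(1)]]) (use pK[OF p(1)] in blast)
    then have "(snd d has_derivative (%v. jac \<kappa> t *v (jac (snd c) p *v v))) (at p)"
      by (rule has_derivative_transform_within_open[of _ _ _ _ "interior K \<inter> V"]) (use p c(3) \<kappa>(2) pK in \<open>auto simp: open_Int\<close>)
    moreover have "(snd d has_derivative (%v. jac (snd d) p *v v)) (at p)"
      by (rule holo_map_D[OF chart_D(4)[OF d(1)]]) (use d(2) p in blast)
    ultimately have eq: "(%v. jac (snd d) p *v v) = (%v. jac \<kappa> t *v (jac (snd c) p *v v))"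
      by (rule has_derivative_unique[rotated])
    have "surj (%v. jac (snd d) p *v v)" by (rule chart_D(5)[OF d(1)]) (use d(2) p in blast)
    show ?thesis
    proof (unfold surj_def, rule allI)
      fix w
      obtain v where "w = jac (snd d) p *v v" using surjD[OF \<open>surj (%v. jac (snd d) p *v v)\<close>, of w] by blast
      then show "\<exists>v. w = jac \<kappa> t *v v" using fun_cong[OF eq, of v] by blast
    qed
  qed
  then show ?thesis using \<kappa> by blast
qed

end

section \<open>A ball transverse to the leaves\<close>

definition cnjv :: "complex^'n => complex^'n" where "cnjv x = (\<chi> i. cnj (x $ i))"

lemma cnjv_simps [simp]: "cnjv (cnjv x) = x" "cnjv x $ i = cnj (x $ i)" "cnjv (c *s x) = cnj c *s cnjv x"
  by (simp_all add: cnjv_def vec_eq_iff)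

lemma bounded_linear_cnjv: "bounded_linear cnjv"
proof (rule bounded_linear_intro[where K=1])
  show "norm (cnjv x) \<le> norm x * 1" for x :: "complex^'n" by (simp add: cnjv_def norm_vec_def)
qed (simp_all add: cnjv_def vec_eq_iff)

lemma inner_cdot: "x \<bullet> v = Re (cdot (cnjv x) v)"
  by (simp add: inner_vec_def cdot_def inner_complex_def)

lemma cdot_inject: "(!!v. cdot a v = cdot b v) ==> a = b"
  by (metis cdot_simps(3) vec_eq_iff)

text \<open>Lagrange multipliers for complex-linear constraints; the multipliers are the values of
  the functional on preimages of the unit vectors.\<close>

lemma kernel_functional:
  fixes A :: "complex^'n^'q::finite"
  assumes surj: "surj (%v. A *v v)" and ker: "!!v. A *v v = 0 ==> cdot w v = 0"
  shows "\<exists>c. w = (\<Sum>j\<in>UNIV. c j *s (A $ j))"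
proof -
  obtain s where s: "!!j. A *v s j = axis j 1"
  proof -
    have "\<exists>v. A *v v = axis j 1" for j using surjD[OF surj, of "axis j 1"] by auto
    then have "\<forall>j. \<exists>v. A *v v = axis j 1" by blast
    from choice[OF this] show ?thesis using that by blast
  qed
  have lin: "cdot w (\<Sum>j\<in>S. c j *s s j) = (\<Sum>j\<in>S. c j * cdot w (s j))" for c and S :: "'q set"
    by (induction S rule: infinite_finite_induct) auto
  have linA: "A *v (\<Sum>j\<in>S. c j *s s j) = (\<Sum>j\<in>S. c j *s axis j 1)" for c and S :: "'q set"
    by (induction S rule: infinite_finite_induct) (auto simp: matrix_vector_right_distrib matrix_vsm s)
  have "w = (\<Sum>j\<in>UNIV. cdot w (s j) *s (A $ j))"
  proof (rule cdot_inject)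
    fix v
    define v' where "v' = v - (\<Sum>j\<in>UNIV. (A *v v) $ j *s s j)"
    have "(\<Sum>j\<in>UNIV. (A *v v) $ j *s axis j (1::complex)) = A *v v"
      by (simp add: vec_eq_iff axis_def if_distrib cong: if_cong)
    then have "A *v v' = 0" by (simp add: v'_def matrix_vector_mult_diff_distrib linA)
    then have "cdot w v = (\<Sum>j\<in>UNIV. (A *v v) $ j * cdot w (s j))" using ker[of v'] by (simp add: v'_def lin)
    moreover have "cdot (\<Sum>j\<in>S. cdot w (s j) *s (A $ j)) v = (\<Sum>j\<in>S. cdot w (s j) * cdot (A $ j) v)" for S
      by (induction S rule: infinite_finite_induct) auto
    ultimately show "cdot w v = cdot (\<Sum>j\<in>UNIV. cdot w (s j) *s (A $ j)) v"
      by (simp add: matrix_vector_mult_def cdot_def mult.commute)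
  qed
  then show ?thesis by (rule exI[of _ "%j. cdot w (s j)"])
qed

lemma regular_point_uncountable:
  assumes "regular_point A d z" "d \<ge> 1" shows "uncountable A"
proof
  assume cA: "countable A"
  obtain V W and \<phi> :: "complex^'a => complex^'a" and J where r: "z \<in> A" "z \<in> V" "biholomorphic \<phi> V W" "card J = d"
    "\<phi> ` (A \<inter> V) = {w\<in>W. \<forall>i. i \<notin> J --> w $ i = 0}" using assms(1) unfolding regular_point_def by blast
  note B = biholomorphic_D[OF r(3)]
  obtain i where i: "i \<in> J" using r(4) assms(2) by fastforce
  obtain s where s: "s > 0" "!!l. l \<in> ball 0 s ==> \<phi> z + l *s axis i 1 \<in> W" using line_ball[OF B(2) B(10)[OF r(2)]] by blast
  have z0: "\<phi> z $ k = 0" if "k \<notin> J" for k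
  proof -
    have "\<phi> z \<in> \<phi> ` (A \<inter> V)" using r(1,2) by blast
    then show ?thesis unfolding r(5) using that by blast
  qed
  have "(%l. \<phi> z + l *s axis i 1) ` ball 0 s \<subseteq> \<phi> ` (A \<inter> V)" unfolding r(5) using s(2) z0 i by (auto simp: axis_def)
  moreover have "countable (\<phi> ` (A \<inter> V))" using cA by auto
  ultimately have "countable ((%l. \<phi> z + l *s axis i 1) ` ball 0 s)" using countable_subset by blast
  moreover have "inj_on (%l. \<phi> z + l *s axis i (1::complex)) (ball 0 s)"
    by (rule inj_onI) (metis add_left_cancel axis_nth mult.right_neutral vector_smult_component)
  ultimately have "countable (ball (0::complex) s)" using countable_image_inj_on by blast
  then show False using uncountable_ball[OF s(1)] by blast
qed

text \<open>The embedding as a totally real subspace, on which the squared norm is the restriction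
  of the holomorphic function \<open>cdot (left z) (right z)\<close>.\<close>

definition complexify :: "complex^'n => complex^('n + 'n)" where
  "complexify x = (\<chi> i. case i of Inl k => x $ k | Inr k => cnj (x $ k))"

definition left :: "complex^('n + 'n) => complex^'n" where "left z = (\<chi> k. z $ Inl k)"
definition right :: "complex^('n + 'n) => complex^'n" where "right z = (\<chi> k. z $ Inr k)"

lemma left_right_simps [simp]: "left (complexify x) = x" "right (complexify x) = cnjv x"
  "left (c *s z) = c *s left z" "right (c *s z) = c *s right z" "left z $ k = z $ Inl k" "right z $ k = z $ Inr k"
  by (simp_all add: left_def right_def complexify_def cnjv_def vec_eq_iff)

lemma bounded_linear_left: "bounded_linear left" and bounded_linear_right: "bounded_linear right"
  by (simp_all add: linear_conv_bounded_linear[symmetric]) (rule linearI; simp add: left_def right_def vec_eq_iff)+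

lemma bounded_bilinear_cdot: "bounded_bilinear (cdot :: complex^'n => complex^'n => complex)"
proof
  show "\<exists>K. \<forall>a b. norm (cdot a (b :: complex^'n)) \<le> norm a * norm b * K"
  proof (intro exI allI)
    fix a b :: "complex^'n"
    have "norm (cdot a b) \<le> (\<Sum>i\<in>UNIV. \<bar>cmod (a $ i)\<bar> * \<bar>cmod (b $ i)\<bar>)"
      unfolding cdot_def by (rule sum_norm_le) (simp add: norm_mult)
    also have "\<dots> \<le> norm a * norm b" unfolding norm_vec_def by (rule L2_set_mult_ineq)
    finally show "norm (cdot a b) \<le> norm a * norm b * 1" by simp
  qed
qed (simp_all add: cdot_def sum.distrib algebra_simps scaleR_sum_right)

text \<open>At a critical point \<open>x\<close>, multipliers give a holomorphic \<open>H\<close>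
  that vanishes on the level set of \<phi> and has gradient \<open>cnjv x\<close> there.
  \<open>G\<close> combines \<open>H\<close> with its conjugate, so that it is holomorphic, vanishes
  on the complexified set and has the same gradient as the complexified squared norm
  \<open>P\<close>. This is the hypothesis of \<open>countable_critical_values\<close>.\<close>

lemma countable_critical_norms:
  fixes \<phi> :: "complex^'n => complex^'q::finite"
  assumes V: "open V" and \<phi>: "submersion_on \<phi> V" and C: "C \<subseteq> V" "!!x. x \<in> C ==> \<phi> x = t0"
    and crit: "!!x v. x \<in> C ==> jac \<phi> x *v v = 0 ==> x \<bullet> v = 0"
  shows "countable (norm ` C)"
proof -
  have h: "holo_map_on \<phi> V" "!!z. z \<in> V ==> surj (%v. jac \<phi> z *v v)" using \<phi> by (auto simp: submersion_on_iff)
  define \<Omega> where "\<Omega> = {z. left z \<in> V \<and> cnjv (right z) \<in> V}"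
  have cl: "continuous_on UNIV left" "continuous_on UNIV (%z. cnjv (right z))"
    using linear_continuous_on[OF bounded_linear_left] linear_continuous_on[OF bounded_linear_compose[OF bounded_linear_cnjv bounded_linear_right]]
    by auto
  have "\<Omega> = left -` V \<inter> (%z. cnjv (right z)) -` V" by (auto simp: \<Omega>_def)
  then have o\<Omega>: "open \<Omega>" using open_Int[OF open_vimage[OF V cl(1)] open_vimage[OF V cl(2)]] by simp
  define P :: "complex^('n + 'n) => complex" where "P z = cdot (left z) (right z)" for z
  have dl: "(left has_derivative left) F" and dr: "(right has_derivative right) F" for F
    by (simp_all add: bounded_linear_imp_has_derivative bounded_linear_left bounded_linear_right)
  have P_holo: "holo_fun_on P \<Omega>" unfolding P_def cdot_def left_right_simps
    by (intro holo_sum holo_mult holo_nth)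
  have P_complexify: "P (complexify x) = of_real ((norm x)\<^sup>2)" for x :: "complex^'n"
    by (simp add: P_def cdot_def norm_sq_vec complex_norm_square del: of_real_power)
  have "countable (P ` complexify ` C)"
  proof (rule countable_critical_values[OF o\<Omega> _ P_holo])
    show "complexify ` C \<subseteq> \<Omega>" using C(1) by (auto simp: \<Omega>_def)
    fix b assume "b \<in> complexify ` C"
    then obtain x where x: "x \<in> C" "b = complexify x" by blast
    have xV: "x \<in> V" using x(1) C(1) by blast
    have b: "b \<in> \<Omega>" using xV by (simp add: \<Omega>_def x(2))
    have "cdot (cnjv x) v = 0" if v: "jac \<phi> x *v v = 0" for v
    proof -
      have "Re (cdot (cnjv x) v) = 0" using crit[OF x(1) v] by (simp add: inner_cdot)
      \<comment> \<open>The kernel is a complex subspace, so the real condition for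
        \<open>\<i> *s v\<close> supplies the imaginary part.\<close>
      moreover have "jac \<phi> x *v (\<i> *s v) = 0" using v by (simp add: matrix_vsm)
      then have "Re (cdot (cnjv x) (\<i> *s v)) = 0" using crit[OF x(1)] by (simp only: inner_cdot)
      ultimately show ?thesis by (simp add: complex_eq_iff)
    qed
    then obtain c where c: "cnjv x = (\<Sum>j\<in>UNIV. c j *s (jac \<phi> x $ j))" using kernel_functional[OF h(2)[OF xV]] by blast
    define H where "H z = (\<Sum>j\<in>UNIV. c j * (\<phi> z $ j - t0 $ j))" for z
    have hH: "holo_fun_on H V" unfolding H_def[abs_def]
      by (intro holo_sum holo_mult holo_diff holo_const) (use h(1) in \<open>auto simp: holo_map_on_def\<close>)
    have "(H has_derivative cdot (cnjv x)) (at x)"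
    proof -
      have lin: "cdot (\<Sum>j\<in>S. c j *s (jac \<phi> x $ j)) v = (\<Sum>j\<in>S. c j * cdot (jac \<phi> x $ j) v)" for S v
        by (induction S rule: infinite_finite_induct) auto
      have d: "((%z. \<phi> z $ j) has_derivative cdot (jac \<phi> x $ j)) (at x)" for j
        using holo_D[of "%z. \<phi> z $ j" V x] h(1) xV by (simp add: holo_map_on_def jac_def)
      have "(H has_derivative (%v. \<Sum>j\<in>UNIV. c j * cdot (jac \<phi> x $ j) v)) (at x)"
        unfolding H_def[abs_def] by (auto intro!: derivative_eq_intros d)
      then show ?thesis unfolding c using lin by presburger
    qed
    note dH = this
    define G where "G z = H (left z) + cnj (H (cnjv (right z)))" for z
    have dG: "(G has_derivative (%v. cdot (grad H (left z)) (left v) + cnj (cdot (grad H (cnjv (right z))) (cnjv (right v))))) (at z)"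
      if z: "z \<in> \<Omega>" for z
    proof -
      have "((%z. H (left z)) has_derivative (%v. cdot (grad H (left z)) (left v))) (at z)"
        using has_derivative_compose[of left left z UNIV H, OF dl holo_D[OF hH]] z unfolding \<Omega>_def by blast
      moreover have "((%z. cnj (H (cnjv (right z)))) has_derivative (%v. cnj (cdot (grad H (cnjv (right z))) (cnjv (right v))))) (at z)"
      proof (rule bounded_linear.has_derivative[OF bounded_linear_cnj])
        have "((%z. cnjv (right z)) has_derivative (%v. cnjv (right v))) (at z)"
          by (rule bounded_linear_imp_has_derivative[OF bounded_linear_compose[OF bounded_linear_cnjv bounded_linear_right]])
        then show "((%z. H (cnjv (right z))) has_derivative (%v. cdot (grad H (cnjv (right z))) (cnjv (right v)))) (at z)"
          using has_derivative_compose[of "%z. cnjv (right z)" "%v. cnjv (right v)" z UNIV H, OF _ holo_D[OF hH]] z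
          unfolding \<Omega>_def by blast
      qed
      ultimately show ?thesis unfolding G_def[abs_def] by (rule has_derivative_add)
    qed
    have hG: "holo_fun_on G \<Omega>"
      by (rule holo_I') (use dG in \<open>auto intro!: exI simp: algebra_simps\<close>)
    have "G \<in> vanishing \<Omega> (complexify ` C)"
      using hG C(2) by (auto simp: vanishing_def G_def H_def)
    moreover have "grad P b = grad G b"
    proof (rule cdot_inject)
      fix v
      have gH: "grad H x = cnjv x" by (rule has_derivative_imp_grad[OF dH])
      have "(P has_derivative (%v. cdot (left b) (right v) + cdot (left v) (right b))) (at b)"
      proof -
        have bb: "bounded_bilinear (cdot :: complex^'n => _)"
          by (rule bounded_bilinear_cdot)
        show ?thesis unfolding P_def[abs_def]
          by (rule bounded_bilinear.FDERIV[OF bb dl dr])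
      qed
      then have "cdot (grad P b) = (%v. cdot (left b) (right v) + cdot (left v) (right b))"
        using has_derivative_unique[OF holo_D[OF P_holo b]] by blast
      then have 1: "cdot (grad P b) v = cdot x (right v) + cdot (left v) (cnjv x)" by (simp add: x(2))
      have "cdot (grad G b) = (%v. cdot (grad H (left b)) (left v) + cnj (cdot (grad H (cnjv (right b))) (cnjv (right v))))"
        by (rule has_derivative_unique[OF holo_D[OF hG b] dG[OF b]])
      then have 2: "cdot (grad G b) v = cdot (cnjv x) (left v) + cnj (cdot (cnjv x) (cnjv (right v)))" by (simp add: x(2) gH)
      show "cdot (grad P b) v = cdot (grad G b) v" unfolding 1 2 by (simp add: cdot_def mult.commute)
    qed
    ultimately show "\<exists>S c. finite S \<and> S \<subseteq> vanishing \<Omega> (complexify ` C) \<and> grad P b = (\<Sum>F\<in>S. c F *s grad F b)"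
      by (intro exI[of _ "{G}"] exI[of _ "%_. 1"]) simp
  qed
  then have "countable ((%w. sqrt (Re w)) ` P ` complexify ` C)" by simp
  moreover have "(%w. sqrt (Re w)) ` P ` complexify ` C = norm ` C" by (simp add: image_image P_complexify)
  ultimately show ?thesis by simp
qed

text \<open>\<open>isol\<close> is the form in which pure codimension enters: near each of its
  points other than \<open>0\<close>, the zero fibre of \<open>F\<close> has a single value of the
  leaf parameter.\<close>

locale isolated = foliated M \<A> f
  for M :: "(complex^'n) set" and \<A> :: "('n::finite, 'q::finite) fol_chart set" and f +
  fixes \<rho>0 :: real
  assumes \<rho>0: "\<rho>0 > 0" "ball 0 \<rho>0 \<subseteq> insert 0 M" and f_holo0: "!!j. holo_fun_on (f j) (ball 0 \<rho>0)"
    and f0: "!!j. f j 0 = 0" and q2: "2 \<le> CARD('q)"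
    and isol: "!!c z. c \<in> \<A> ==> z \<in> fst c ==> z \<in> ball 0 \<rho>0 ==> F z = 0 ==>
      \<exists>V. open V \<and> z \<in> V \<and> V \<subseteq> fst c \<and> (\<forall>p\<in>V. F p = 0 --> snd c p = snd c z)"
begin

lemma holo_F0: "holo_map_on F (ball 0 \<rho>0)"
  using f_holo0 by (simp add: holo_map_on_def F_def)

lemma cont_F: "S \<subseteq> ball 0 \<rho>0 ==> continuous_on S F"
  using holo_map_continuous[OF holo_F0] continuous_on_subset by blast

lemma F_zero: "F 0 = 0" by (simp add: F_def f0 vec_eq_iff)

text \<open>The leaf parameter at \<open>z\<close> is isolated within the fibre of \<open>F\<close>
  through \<open>z\<close>; by \<open>iso_chart\<close> this does not depend on the chart.\<close>

definition iso :: "complex^'n => bool" where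
  "iso z \<longleftrightarrow> (\<exists>c\<in>\<A>. \<exists>V. open V \<and> z \<in> V \<and> V \<subseteq> fst c \<and> (\<forall>p\<in>V. F p = F z --> snd c p = snd c z))"

lemma iso_chart:
  assumes "iso z" "d \<in> \<A>" "z \<in> fst d"
  shows "\<exists>V. open V \<and> z \<in> V \<and> V \<subseteq> fst d \<and> (\<forall>p\<in>V. F p = F z --> snd d p = snd d z)"
proof -
  obtain c V where c: "c \<in> \<A>" "open V" "z \<in> V" "V \<subseteq> fst c" "!!p. p \<in> V ==> F p = F z ==> snd c p = snd c z"
    using assms(1) unfolding iso_def by blast
  obtain N g where N: "open N" "z \<in> N" "N \<subseteq> fst c \<inter> fst d" "!!p. p \<in> N ==> snd d p = g (snd c p)"
    using compat[OF c(1) assms(2) _ assms(3)] c(3,4) by blast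
  show ?thesis
  proof (intro exI conjI ballI impI)
    show "open (V \<inter> N)" using c(2) N(1) by (rule open_Int)
    show "snd d p = snd d z" if "p \<in> V \<inter> N" "F p = F z" for p using N(2,4) c(5) that by auto
  qed (use c(3) N(2,3) in auto)
qed

lemma chart_at:
  assumes "z \<in> ball 0 \<rho>0" "z ~= 0" obtains c where "c \<in> \<A>" "z \<in> fst c"
  using ex_chart[of z] \<rho>0(2) assms by blast

lemma iso_zero: "z \<in> ball 0 \<rho>0 ==> z ~= 0 ==> F z = 0 ==> iso z"
  using chart_at isol unfolding iso_def by metis

text \<open>The sphere about \<open>0\<close> through \<open>x\<close> is tangent to the leaf, as
  seen in real inner products.\<close>

definition crit :: "complex^'n => bool" where
  "crit x \<longleftrightarrow> (\<forall>c\<in>\<A>. x \<in> fst c --> (\<forall>v. jac (snd c) x *v v = 0 --> x \<bullet> v = 0))"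

text \<open>Locally the zero fibre lies in one level set of a chart, where
  \<open>countable_critical_norms\<close> applies; by Lindelof countably many such pieces
  suffice.\<close>

lemma countable_crit: "countable (norm ` {x\<in>ball 0 \<rho>0 - {0}. F x = 0 \<and> crit x})"
proof -
  define C where "C = {x\<in>ball 0 \<rho>0 - {0}. F x = 0 \<and> crit x}"
  have "\<exists>V. open V \<and> x \<in> V \<and> countable (norm ` (C \<inter> V))" if x: "x \<in> C" for x
  proof -
    have xb: "x \<in> ball 0 \<rho>0" "x ~= 0" "F x = 0" using x by (auto simp: C_def)
    obtain c where c: "c \<in> \<A>" "x \<in> fst c" using chart_at[OF xb(1,2)] by blast
    obtain V where V: "open V" "x \<in> V" "V \<subseteq> fst c" "!!p. p \<in> V ==> F p = 0 ==> snd c p = snd c x"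
      using isol[OF c xb(1,3)] by blast
    have "countable (norm ` (C \<inter> V))"
    proof (rule countable_critical_norms[OF V(1) submersion_subset[OF chart_D(2)[OF c(1)] V(3)]])
      show "snd c y = snd c x" if "y \<in> C \<inter> V" for y using that V(4) by (auto simp: C_def)
      show "y \<bullet> v = 0" if y: "y \<in> C \<inter> V" "jac (snd c) y *v v = 0" for y v
        using that V(3) c(1) unfolding C_def crit_def by blast
    qed auto
    then show ?thesis using V by blast
  qed
  then have "\<forall>x\<in>C. \<exists>V. open V \<and> x \<in> V \<and> countable (norm ` (C \<inter> V))" by blast
  from bchoice[OF this] obtain V where "\<forall>x\<in>C. open (V x) \<and> x \<in> V x \<and> countable (norm ` (C \<inter> V x))" ..
  then have V: "!!x. x \<in> C ==> open (V x) \<and> x \<in> V x \<and> countable (norm ` (C \<inter> V x))" by simp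
  obtain \<V> where \<V>: "\<V> \<subseteq> V ` C" "countable \<V>" "\<Union>\<V> = \<Union>(V ` C)"
    using Lindelof[of "V ` C"] V by blast
  have "norm ` C \<subseteq> (\<Union>W\<in>\<V>. norm ` (C \<inter> W))" using V \<V>(3) by blast
  moreover have "countable (\<Union>W\<in>\<V>. norm ` (C \<inter> W))" using \<V>(1,2) V by blast
  ultimately show ?thesis unfolding C_def using countable_subset by blast
qed

text \<open>A tangent vector at \<open>x\<close> extends to the field \<open>w\<close> of tangent
  vectors that is constant in a flattening chart, so a nonzero inner product persists
  nearby.\<close>

lemma open_noncrit:
  assumes "\<not> crit x" shows "\<exists>N. open N \<and> x \<in> N \<and> (\<forall>z\<in>N. \<exists>c\<in>\<A>. z \<in> fst c \<and> (\<exists>v. jac (snd c) z *v v = 0 \<and> z \<bullet> v ~= 0))"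
proof -
  obtain c v where c: "c \<in> \<A>" "x \<in> fst c" "jac (snd c) x *v v = 0" "x \<bullet> v ~= 0" using assms unfolding crit_def by blast
  note cD = chart_D[OF c(1)]
  obtain \<iota> :: "'q => 'n" and \<Phi> :: "complex^'n => complex^'n" and V W where C: "inj \<iota>" "x \<in> V" "V \<subseteq> fst c"
    "biholomorphic \<Phi> V W" "!!z j. \<Phi> z $ \<iota> j = snd c z $ j" using submersion_chart[OF cD(1,4) c(2) cD(5)[OF c(2)]] by blast
  note B = biholomorphic_D[OF C(4)]
  define \<Theta> where "\<Theta> = the_inv_into V \<Phi>"
  define e where "e = jac \<Phi> x *v v"
  define w where "w z = jac \<Theta> (\<Phi> z) *v e" for z
  have h\<Theta>: "holo_map_on \<Theta> W" using B(4) by (simp add: \<Theta>_def)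
  have ker: "jac (snd c) z *v w z = 0" if "z \<in> V" for z
  proof -
    have "jac \<Phi> z *v w z = e"
      unfolding w_def \<Theta>_def using biholomorphic_jac(2)[OF C(4) that] by (simp add: matrix_vector_mul_assoc)
    moreover have "(jac \<Phi> z *v u) $ \<iota> j = (jac (snd c) z *v u) $ j" for u j z unfolding jac_mult C(5) ..
    ultimately have "(jac (snd c) z *v w z) $ j = 0" for j using c(3) by (metis e_def zero_index)
    then show ?thesis by (simp add: vec_eq_iff)
  qed
  have "w x = v" unfolding w_def \<Theta>_def e_def using biholomorphic_jac(1)[OF C(4,2)] by (simp add: matrix_vector_mul_assoc)
  moreover have "continuous_on V (%z. z \<bullet> w z)"
  proof -
    have "continuous_on W (%u. jac \<Theta> u *v e)"
      unfolding matrix_vector_mult_def by (intro continuous_intros holo_continuous[OF holo_jac[OF B(2) h\<Theta>]])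
    then have "continuous_on V w" unfolding w_def
      by (rule continuous_on_compose2[OF _ holo_map_continuous[OF B(3)]]) (use B(5) in auto)
    then show ?thesis by (intro continuous_intros)
  qed
  then have "open (V \<inter> (%z. z \<bullet> w z) -` (- {0}))" by (intro continuous_open_preimage B(1)) auto
  ultimately show ?thesis using C(2,3) c(1,4) ker by (intro exI[of _ "V \<inter> (%z. z \<bullet> w z) -` (- {0})"]) auto
qed

text \<open>In the leaf parameter, a fibre of \<open>F\<close> over a value close to
  \<open>0\<close> misses a small sphere, so its part inside is a compact zero set. Such a set is
  countable, hence has no regular point of positive dimension and no accumulation point
  inside.\<close>

lemma iso_near_zero_fibre:
  assumes x: "x \<in> ball 0 \<rho>0" "x ~= 0" "F x = 0" shows "\<exists>N. open N \<and> x \<in> N \<and> (\<forall>z\<in>N. iso z)"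
proof -
  obtain c where c: "c \<in> \<A>" "x \<in> fst c" using chart_at[OF x(1,2)] by blast
  note cD = chart_D[OF c(1)]
  obtain V0 where V0: "x \<in> V0" "box UNIV c V0" using box_interior[of x UNIV UNIV c] c by auto
  have V0': "open V0" "V0 \<subseteq> fst c" using V0(2) by (auto simp: box_def)
  obtain g where g: "holo_map_on g (snd c ` V0)" "!!p. p \<in> V0 ==> F p = g (snd c p)" using box_F[OF V0(2)] by auto
  obtain V1 where V1: "open V1" "x \<in> V1" "V1 \<subseteq> fst c" "!!p. p \<in> V1 ==> F p = 0 ==> snd c p = snd c x"
    using isol[OF c x(1,3)] by blast
  define t0 where "t0 = snd c x"
  have "open (snd c ` (V0 \<inter> V1))"
    by (rule submersion_open_image[OF _ submersion_subset[OF cD(2)]]) (use V0' V1 in \<open>auto simp: open_Int\<close>)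
  moreover have "t0 \<in> snd c ` (V0 \<inter> V1)" using V0 V1 by (auto simp: t0_def)
  ultimately obtain r where r: "r > 0" "cball t0 r \<subseteq> snd c ` (V0 \<inter> V1)" using open_contains_cball by blast
  have g0: "t = t0" if t: "t \<in> cball t0 r" "g t = 0" for t
  proof -
    obtain p where p: "p \<in> V0" "p \<in> V1" "t = snd c p" using r(2) t(1) by blast
    then show ?thesis using V1(4)[of p] g(2)[of p] t(2) by (simp add: t0_def)
  qed
  have gc: "continuous_on (cball t0 r) g"
    by (rule continuous_on_subset[OF holo_map_continuous[OF g(1)]]) (use r(2) in blast)
  have "\<exists>m>0. \<forall>t\<in>sphere t0 r. m \<le> norm (g t)"
  proof -
    have cs: "compact ((%t. norm (g t)) ` sphere t0 r)"
      by (intro compact_continuous_image continuous_on_norm continuous_on_subset[OF gc]) auto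
    have "sphere t0 r ~= {}" using r(1) by simp
    then obtain s where s: "s \<in> sphere t0 r" "!!t. t \<in> sphere t0 r ==> norm (g s) \<le> norm (g t)"
      using compact_attains_inf[OF cs] by auto
    have "g s ~= 0" using g0[of s] s(1) r(1) by auto
    then show ?thesis using s by (intro exI[of _ "norm (g s)"]) auto
  qed
  then obtain m where m: "m > 0" "!!t. t \<in> sphere t0 r ==> m \<le> norm (g t)" by blast
  define N0 where "N0 = V0 \<inter> snd c -` ball t0 r"
  have sc: "continuous_on V0 (snd c)" using holo_map_continuous[OF cD(4)] V0'(2) continuous_on_subset by blast
  have oN0: "open N0" unfolding N0_def by (rule continuous_open_preimage[OF sc V0'(1)]) simp
  have "continuous_on N0 F"
    by (rule continuous_on_subset[OF holo_map_continuous[OF holo_F]]) (use V0'(2) cD(3) in \<open>auto simp: N0_def\<close>)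
  then have oN: "open (N0 \<inter> F -` ball 0 m)" by (intro continuous_open_preimage oN0) auto
  have xN: "x \<in> N0 \<inter> F -` ball 0 m" using V0(1) x(3) m(1) r(1) by (simp add: N0_def t0_def)
  have "iso z" if z: "z \<in> N0 \<inter> F -` ball 0 m" for z
  proof -
    have zV: "z \<in> V0" "snd c z \<in> ball t0 r" "norm (F z) < m" using z by (auto simp: N0_def)
    define Y where "Y = {t\<in>ball t0 r. \<forall>h\<in>range (%j t. g t $ j - F z $ j). h t = 0}"
    have Yg: "t \<in> Y \<longleftrightarrow> t \<in> ball t0 r \<and> g t = F z" for t by (auto simp: Y_def vec_eq_iff)
    have hol: "holo_fun_on h (ball t0 r)" if "h \<in> range (%j t. g t $ j - F z $ j)" for h
    proof -
      obtain j where h: "h = (%t. g t $ j - F z $ j)" using \<open>h \<in> _\<close> by blast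
      have "ball t0 r \<subseteq> snd c ` V0" using r(2) ball_subset_cball[of t0 r] by blast
      then show ?thesis unfolding h using g(1) by (intro holo_diff holo_const) (auto simp: holo_map_on_def intro: holo_subset)
    qed
    have "Y = {t\<in>cball t0 r. g t = F z}"
    proof (intro set_eqI iffI)
      fix t assume t: "t \<in> {t\<in>cball t0 r. g t = F z}"
      then have "t \<notin> sphere t0 r" using m(2)[of t] zV(3) by auto
      then show "t \<in> Y" using t by (auto simp: Yg)
    qed (auto simp: Yg)
    also have "\<dots> = cball t0 r \<inter> g -` {F z}" by auto
    finally have "closed Y" using continuous_closed_preimage[OF gc closed_cball, of "{F z}"] by simp
    moreover have "bounded Y" by (rule bounded_subset[OF bounded_ball[of t0 r]]) (auto simp: Y_def)
    ultimately have "compact Y" by (simp add: compact_eq_bounded_closed)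
    have cY: "countable Y" by (rule compact_zero_set_countable[OF open_ball hol \<open>compact Y\<close> Y_def])
    have "\<not> snd c z islimpt Y"
    proof
      assume L: "snd c z islimpt Y"
      have YB: "Y \<inter> ball t0 r = {t\<in>ball t0 r. \<forall>h\<in>range (%j t. g t $ j - F z $ j). h t = 0}" by (auto simp: Y_def)
      obtain y d where "regular_point Y d y" "d \<ge> 1"
        by (rule zero_set_positive_dim[OF open_ball hol YB zV(2) L open_UNIV UNIV_I]) blast+
      then show False using regular_point_uncountable cY by blast
    qed
    then obtain T where T: "open T" "snd c z \<in> T" "!!t. t \<in> T ==> t \<in> Y ==> t = snd c z" unfolding islimpt_def by blast
    show ?thesis unfolding iso_def
    proof (intro bexI exI conjI ballI impI)
      show "open (N0 \<inter> snd c -` T)"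
        by (rule continuous_open_preimage[OF continuous_on_subset[OF sc] oN0 T(1)]) (auto simp: N0_def)
      show "z \<in> N0 \<inter> snd c -` T" using z T(2) by auto
      show "N0 \<inter> snd c -` T \<subseteq> fst c" using V0'(2) by (auto simp: N0_def)
      fix p assume p: "p \<in> N0 \<inter> snd c -` T" "F p = F z"
      then have "snd c p \<in> Y" using g(2)[of p] by (auto simp: Yg N0_def)
      then show "snd c p = snd c z" using T(3) p(1) by blast
    qed (rule c(1))
  qed
  then show ?thesis using oN xN by blast
qed

text \<open>Failure of \<open>iso\<close> spreads along plaques. A bad point of largest norm on one
  fibre of \<open>F\<close> is interior by \<open>bd\<close>, and its plaque consists of bad points,
  against \<open>no_max_on_fibre\<close>.\<close>

lemma iso_inside:
  assumes \<epsilon>: "0 < \<epsilon>" "\<epsilon> < \<rho>0" and bd: "!!z. norm z = \<epsilon> ==> norm (F z) < \<delta> ==> iso z"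
    and z0: "z0 \<in> cball 0 \<epsilon>" "z0 ~= 0" "norm (F z0) < \<delta>"
  shows "iso z0"
proof (rule ccontr)
  assume neg: "\<not> iso z0"
  then have Fz0: "F z0 ~= 0" using iso_zero[of z0] z0(1,2) \<epsilon> by auto
  have sub: "cball 0 \<epsilon> \<subseteq> ball (0::complex^'n) \<rho>0" using \<epsilon> by auto
  define Bad where "Bad = {z\<in>cball 0 \<epsilon>. F z = F z0 \<and> \<not> iso z}"
  \<comment> \<open>On the fibre of \<open>F\<close> through \<open>z0\<close> this open set cuts
    out exactly the points with \<open>iso\<close>, so \<open>Bad\<close> is closed.\<close>
  define O' where "O' = \<Union>{V. open V \<and> (\<forall>p\<in>V. F p = F z0 --> iso p)}"
  have O_iff: "iso z \<longleftrightarrow> z \<in> O'" if Fz: "F z = F z0" for z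
  proof
    assume "iso z"
    then obtain c V where c: "c \<in> \<A>" "open V" "z \<in> V" "V \<subseteq> fst c" "!!p. p \<in> V ==> F p = F z ==> snd c p = snd c z"
      unfolding iso_def by blast
    have "iso p" if "p \<in> V" "F p = F z0" for p
    proof -
      have "F p = F z" "snd c p = snd c z" using that Fz c(5)[of p] by simp_all
      then have "\<forall>p'\<in>V. F p' = F p --> snd c p' = snd c p" using c(5) by simp
      then show ?thesis unfolding iso_def using c(1,2,4) that(1) by blast
    qed
    then show "z \<in> O'" unfolding O'_def using c(2,3) by blast
  qed (use Fz in \<open>auto simp: O'_def\<close>)
  have "Bad = (cball 0 \<epsilon> \<inter> F -` {F z0}) - O'" using O_iff by (auto simp: Bad_def)
  moreover have "closed (cball 0 \<epsilon> \<inter> F -` {F z0})" by (rule continuous_closed_preimage[OF cont_F[OF sub]]) auto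
  moreover have "open O'" by (auto simp: O'_def)
  ultimately have "closed Bad" by (simp add: closed_Diff)
  moreover have "bounded Bad" by (rule bounded_subset[OF bounded_cball[of 0 \<epsilon>]]) (auto simp: Bad_def)
  ultimately have "compact Bad" by (simp add: compact_eq_bounded_closed)
  moreover have "z0 \<in> Bad" using neg z0 by (simp add: Bad_def)
  ultimately obtain a where a: "a \<in> Bad" "!!z. z \<in> Bad ==> norm z \<le> norm a"
    using continuous_attains_sup[of Bad norm] by (auto intro: continuous_intros)
  have aF: "F a = F z0" "\<not> iso a" "norm a \<le> \<epsilon>" using a(1) by (auto simp: Bad_def)
  have "norm a ~= \<epsilon>" using bd[of a] aF z0(3) by auto
  then have ai: "a \<in> interior (cball 0 \<epsilon>)" using aF(3) by simp
  have a0: "a ~= 0" using aF(1) Fz0 F_zero by auto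
  obtain c where c: "c \<in> \<A>" "a \<in> fst c" using chart_at[of a] a0 aF(3) \<epsilon> by auto
  obtain V where V: "a \<in> V" "V \<subseteq> interior (cball 0 \<epsilon>)" "box (cball 0 \<epsilon>) c V"
    using box_interior[OF ai open_UNIV UNIV_I c] by auto
  have V': "open V" "V \<subseteq> fst c" "V \<subseteq> cball 0 \<epsilon>" "cball 0 \<epsilon> \<inter> V = V" using V(2,3) interior_subset[of "cball 0 \<epsilon>"] by (auto simp: box_def)
  obtain g where g: "!!p. p \<in> V ==> F p = g (snd c p)" using box_F[OF V(3)] V'(4) by auto
  show False
  proof (rule no_max_on_fibre[OF card_less V'(1) V(1) holo_map_subset[OF chart_D(4)[OF c(1)] V'(2)]])
    fix p assume p: "p \<in> V" "snd c p = snd c a"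
    have Fp: "F p = F a" using g p V(1) by metis
    \<comment> \<open>In a box \<open>F\<close> depends on the leaf parameter alone, so
      \<open>iso\<close> at one point of a plaque would carry over to \<open>a\<close>.\<close>
    have "\<not> iso p"
    proof
      assume "iso p"
      then obtain Vp where Vp: "open Vp" "p \<in> Vp" "Vp \<subseteq> fst c" "!!z. z \<in> Vp ==> F z = F p ==> snd c z = snd c p"
        using iso_chart[of p c] c(1) p(1) V'(2) by blast
      have oT: "open (snd c ` (V \<inter> Vp))"
        by (rule submersion_open_image[OF _ submersion_subset[OF chart_D(2)[OF c(1)]]]) (use V' Vp in \<open>auto simp: open_Int\<close>)
      have "iso a" unfolding iso_def
      proof (intro bexI exI conjI ballI impI)
        show "open (V \<inter> snd c -` (snd c ` (V \<inter> Vp)))"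
          by (rule continuous_open_preimage[OF holo_map_continuous[OF holo_map_subset[OF chart_D(4)[OF c(1)] V'(2)]] V'(1) oT])
        show "a \<in> V \<inter> snd c -` (snd c ` (V \<inter> Vp))" using V(1) p Vp(2) by (metis Int_iff imageI vimage_eq)
        show "V \<inter> snd c -` (snd c ` (V \<inter> Vp)) \<subseteq> fst c" using V'(2) by blast
        fix z assume z: "z \<in> V \<inter> snd c -` (snd c ` (V \<inter> Vp))" "F z = F a"
        then obtain p' where p': "p' \<in> V" "p' \<in> Vp" "snd c z = snd c p'" by blast
        have "F p' = F p" using g p' z Fp by (metis IntD1)
        then show "snd c z = snd c a" using Vp(4)[OF p'(2)] p'(3) p(2) by simp
      qed (rule c(1))
      then show False using aF(2) by blast
    qed
    then show "norm p \<le> norm a" using a(2) p(1) V'(3) Fp aF(1) by (auto simp: Bad_def)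
  qed
qed

text \<open>Avoiding countably many radii makes the sphere transverse to the leaves at its points on
  the zero fibre. Transversality and \<open>iso\<close> persist on the open set \<open>G\<close>,
  and compactness of the rest of the sphere yields \<delta>. Inside the ball \<open>iso\<close> is
  inherited from the sphere by \<open>iso_inside\<close>.\<close>

lemma good_ball:
  obtains \<epsilon> \<delta> where "0 < \<epsilon>" "\<epsilon> < \<rho>0" "\<delta> > 0"
    "!!z. z \<in> cball 0 \<epsilon> ==> z ~= 0 ==> norm (F z) < \<delta> ==> iso z"
    "!!z O' c. z \<in> cball 0 \<epsilon> ==> z ~= 0 ==> norm (F z) < \<delta> ==> open O' ==> z \<in> O' ==> c \<in> \<A> ==> z \<in> fst c ==>
      \<exists>V. z \<in> V \<and> V \<subseteq> O' \<and> box (cball 0 \<epsilon>) c V"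
proof -
  have "uncountable {0<..<\<rho>0}" using \<rho>0(1) by (simp add: uncountable_open_interval)
  then have "\<not> {0<..<\<rho>0} \<subseteq> norm ` {x\<in>ball 0 \<rho>0 - {0}. F x = 0 \<and> crit x}" using countable_crit countable_subset by blast
  then obtain \<epsilon> where "\<epsilon> \<in> {0<..<\<rho>0}" and \<epsilon>3: "\<epsilon> \<notin> norm ` {x\<in>ball 0 \<rho>0 - {0}. F x = 0 \<and> crit x}" by blast
  then have \<epsilon>: "0 < \<epsilon>" "\<epsilon> < \<rho>0" by simp_all
  have sub: "cball 0 \<epsilon> \<subseteq> ball (0::complex^'n) \<rho>0" using \<epsilon> by auto
  define noncrit where "noncrit z \<longleftrightarrow> (\<exists>c\<in>\<A>. z \<in> fst c \<and> (\<exists>v. jac (snd c) z *v v = 0 \<and> z \<bullet> v ~= 0))" for z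
  define G where "G = \<Union>{N. open N \<and> (\<forall>z\<in>N. iso z \<and> noncrit z)}"
  have oG: "open G" by (auto simp: G_def)
  have Gin: "x \<in> G" if x: "norm x = \<epsilon>" "F x = 0" for x
  proof -
    have xb: "x \<in> ball 0 \<rho>0" "x ~= 0" using x \<epsilon> by auto
    have "\<not> crit x" using \<epsilon>3 x xb by blast
    then obtain N where N: "open N" "x \<in> N" "!!z. z \<in> N ==> noncrit z" using open_noncrit[of x] unfolding noncrit_def by blast
    obtain N' where N': "open N'" "x \<in> N'" "!!z. z \<in> N' ==> iso z" using iso_near_zero_fibre[OF xb x(2)] by blast
    have "N \<inter> N' \<in> {N. open N \<and> (\<forall>z\<in>N. iso z \<and> noncrit z)}" using N N' by (simp add: open_Int)
    then show ?thesis unfolding G_def using N(2) N'(2) by blast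
  qed
  have "\<exists>\<delta>>0. \<forall>z\<in>sphere 0 \<epsilon> - G. \<delta> \<le> norm (F z)"
  proof (cases "sphere 0 \<epsilon> - G = {}")
    case True then show ?thesis by (auto intro: exI[of _ 1])
  next
    case False
    have "compact (sphere 0 \<epsilon> - G)" using oG by (intro compact_diff) auto
    moreover have "continuous_on (sphere 0 \<epsilon> - G) (%z. norm (F z))"
      by (intro continuous_on_norm cont_F) (use sub in auto)
    ultimately obtain x where x: "x \<in> sphere 0 \<epsilon> - G" "!!z. z \<in> sphere 0 \<epsilon> - G ==> norm (F x) \<le> norm (F z)"
      using continuous_attains_inf[of "sphere 0 \<epsilon> - G" "%z. norm (F z)"] False by blast
    have "F x ~= 0" using Gin[of x] x(1) by auto
    then show ?thesis using x(2) by (intro exI[of _ "norm (F x)"]) auto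
  qed
  then obtain \<delta> where \<delta>: "\<delta> > 0" "!!z. norm z = \<epsilon> ==> norm (F z) < \<delta> ==> z \<in> G" by force
  have G: "iso z" "noncrit z" if "norm z = \<epsilon>" "norm (F z) < \<delta>" for z using \<delta>(2)[OF that] by (auto simp: G_def)
  show ?thesis
  proof (rule that[OF \<epsilon> \<delta>(1)])
    fix z assume z: "z \<in> cball 0 \<epsilon>" "z ~= 0" "norm (F z) < \<delta>"
    show "iso z" by (rule iso_inside[OF \<epsilon>(1,2) G(1) z])
    fix O' c assume O': "open O'" "z \<in> O'" and c: "c \<in> \<A>" "z \<in> fst c"
    show "\<exists>V. z \<in> V \<and> V \<subseteq> O' \<and> box (cball 0 \<epsilon>) c V"
    proof (cases "norm z = \<epsilon>")
      case True
      then obtain d v where d: "d \<in> \<A>" "z \<in> fst d" "jac (snd d) z *v v = 0" "z \<bullet> v ~= 0" using G(2) z(3) unfolding noncrit_def by blast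
      show ?thesis by (rule box_boundary[OF \<epsilon>(1) True O' c kernel_chart[OF d(1) c(1) d(2) c(2) d(3)] d(4)])
    next
      case False
      then have zi: "z \<in> interior (cball 0 \<epsilon>)" using z(1) by simp
      show ?thesis using box_interior[OF zi O' c] by blast
    qed
  qed
qed

end

section \<open>Fibre components in the ball and a target chart on its boundary\<close>

lemma connected_in_ball:
  fixes t :: "'a::metric_space"
  assumes "connected S" "S \<inter> ball t r ~= {}" "S \<inter> sphere t r = {}" shows "S \<subseteq> ball t r"
proof (rule ccontr)
  assume "\<not> S \<subseteq> ball t r"
  moreover have "S \<subseteq> ball t r \<union> - cball t r" using assms(3) by force
  ultimately have "S \<inter> - cball t r ~= {}" by blast
  moreover have "ball t r \<inter> - cball t r \<inter> S = {}" by auto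
  moreover have "ball t r \<inter> S = {} \<or> - cball t r \<inter> S = {}"
    by (rule connectedD[OF assms(1)]) (use \<open>S \<subseteq> _ \<union> _\<close> in auto)
  ultimately show False using assms(2) by blast
qed

lemma positive_lower_bound:
  fixes h :: "'a::topological_space => 'b::real_normed_vector"
  assumes "compact S" "continuous_on S h" "!!x. x \<in> S ==> h x ~= 0"
  obtains m where "m > 0" "!!x. x \<in> S ==> m \<le> norm (h x)"
proof (cases "S = {}")
  case True then show ?thesis by (intro that[of 1]) auto
next
  case False
  obtain x where x: "x \<in> S" "!!y. y \<in> S ==> norm (h x) \<le> norm (h y)"
    using continuous_attains_inf[OF assms(1) False, of "%x. norm (h x)"] assms(2) continuous_on_norm by blast
  then show ?thesis using assms(3)[OF x(1)] by (intro that[of "norm (h x)"]) auto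
qed

locale good = isolated M \<A> f \<rho>0
  for M :: "(complex^'n) set" and \<A> :: "('n::finite, 'q::finite) fol_chart set" and f \<rho>0 +
  fixes \<epsilon> \<delta> :: real
  assumes \<epsilon>: "0 < \<epsilon>" "\<epsilon> < \<rho>0" and \<delta>: "\<delta> > 0"
    and iso_K: "!!z. z \<in> cball 0 \<epsilon> ==> z ~= 0 ==> norm (F z) < \<delta> ==> iso z"
    and box_K: "!!z O' c. z \<in> cball 0 \<epsilon> ==> z ~= 0 ==> norm (F z) < \<delta> ==> open O' ==> z \<in> O' ==> c \<in> \<A> ==> z \<in> fst c ==>
      \<exists>V. z \<in> V \<and> V \<subseteq> O' \<and> box (cball 0 \<epsilon>) c V"
begin

abbreviation K :: "(complex^'n) set" where "K \<equiv> cball 0 \<epsilon>"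

lemma K_sub: "K \<subseteq> ball 0 \<rho>0" using \<epsilon> by auto

lemma cont_F_K: "continuous_on K F" by (rule cont_F[OF K_sub])

lemma box_D:
  assumes "box K c V" shows "c \<in> \<A>" "open V" "V \<subseteq> fst c" "continuous_on V (snd c)"
  using assms holo_map_continuous[OF chart_D(4)[of c]] continuous_on_subset unfolding box_def by blast+

definition comp :: "complex^'n => (complex^'n) set" where
  "comp z = connected_component_set {w\<in>K. F w = F z} z"

lemma comp_D: "w \<in> comp z ==> w \<in> K \<and> F w = F z"
  unfolding comp_def using connected_component_in by fastforce

lemma comp_refl: "z \<in> K ==> z \<in> comp z"
  by (simp add: comp_def connected_component_refl)

lemma connected_comp: "connected (comp z)" by (simp add: comp_def)

lemma comp_absorb:
  assumes "connected P" "P \<subseteq> K" "p \<in> P" "p \<in> comp z" "!!w. w \<in> P ==> F w = F z" shows "P \<subseteq> comp z"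
proof -
  have "P \<subseteq> connected_component_set {w\<in>K. F w = F z} p" by (rule connected_component_maximal) (use assms in auto)
  also have "\<dots> = comp z" using assms(4) unfolding comp_def by (rule connected_component_eq)
  finally show ?thesis .
qed

lemma box_F_eq:
  assumes "box K c V" "p \<in> K \<inter> V" "p' \<in> K \<inter> V" "snd c p = snd c p'" shows "F p = F p'"
  using box_F[OF assms(1)] assms(2-4) by metis

lemma comp_plaque:
  assumes "box K c V" "p \<in> K \<inter> V" "p' \<in> K \<inter> V" "snd c p = snd c p'" "p \<in> comp z" shows "p' \<in> comp z"
proof -
  obtain P where P: "connected P" "P \<subseteq> K \<inter> V" "!!z. z \<in> P \<longleftrightarrow> z \<in> K \<inter> V \<and> snd c z = snd c p" "p \<in> P" "p' \<in> P"
    using box_plaque[OF assms(1-4)] by blast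
  have "P \<subseteq> comp z"
  proof (rule comp_absorb[OF P(1) _ P(4) assms(5)])
    fix w assume "w \<in> P"
    then have "F w = F p" using box_F_eq[OF assms(1)] P(2,3) assms(2) by blast
    then show "F w = F z" using comp_D[OF assms(5)] by simp
  qed (use P(2) in blast)
  then show ?thesis using P(5) by blast
qed

lemma comp_reaches_boundary:
  assumes z: "z \<in> K" "F z ~= 0" shows "\<exists>p\<in>comp z. norm p = \<epsilon>"
proof -
  have "closed (K \<inter> F -` {F z})" by (rule continuous_closed_preimage[OF cont_F_K]) auto
  moreover have "K \<inter> F -` {F z} = {w\<in>K. F w = F z}" by auto
  ultimately have "closed (comp z)" unfolding comp_def by (simp add: closed_connected_component)
  moreover have "bounded (comp z)" by (rule bounded_subset[OF bounded_cball[of 0 \<epsilon>]]) (use comp_D in blast)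
  ultimately have "compact (comp z)" by (simp add: compact_eq_bounded_closed)
  then obtain a where a: "a \<in> comp z" "!!w. w \<in> comp z ==> norm w \<le> norm a"
    using continuous_attains_sup[of "comp z" norm] comp_refl[OF z(1)] by (auto intro: continuous_intros)
  have aK: "a \<in> K" "F a = F z" using comp_D[OF a(1)] by auto
  show ?thesis
  proof (rule ccontr)
    assume "\<not> ?thesis"
    then have "norm a ~= \<epsilon>" using a(1) by blast
    then have ai: "a \<in> interior K" using aK(1) by simp
    have a0: "a ~= 0" using aK(2) z(2) F_zero by auto
    obtain c where c: "c \<in> \<A>" "a \<in> fst c" using chart_at[of a] a0 aK(1) K_sub by blast
    obtain V where V: "a \<in> V" "V \<subseteq> interior K" "box K c V" using box_interior[OF ai open_UNIV UNIV_I c] by auto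
    note B = box_D[OF V(3)]
    have KV: "V \<subseteq> K" using V(2) interior_subset by blast
    show False
    proof (rule no_max_on_fibre[OF card_less B(2) V(1) holo_map_subset[OF chart_D(4)[OF c(1)] B(3)]])
      fix p assume p: "p \<in> V" "snd c p = snd c a"
      have "p \<in> comp z" by (rule comp_plaque[OF V(3), of a p]) (use p V(1) KV a(1) in auto)
      then show "norm p \<le> norm a" by (rule a(2))
    qed
  qed
qed

text \<open>If \<open>F\<close> vanished near \<open>0\<close>, \<open>isol\<close> would make a
  distinguished submersion constant near some point, although submersions are open.\<close>

lemma F_not_zero:
  assumes "\<nu> > 0" obtains e where "norm e < \<nu>" "F e ~= 0"
proof -
  have "\<exists>e. norm e < \<nu> \<and> F e ~= 0"
  proof (rule ccontr)
    assume neg: "\<not> ?thesis"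
    define x :: "complex^'n" where "x = of_real (min \<nu> \<rho>0 / 2) *s axis undefined 1"
    have nx: "norm x = min \<nu> \<rho>0 / 2" using assms \<rho>0(1) by (simp add: x_def norm_vsm norm_axis_c)
    then have x: "x \<in> ball 0 \<rho>0" "x ~= 0" "norm x < \<nu>" using assms \<rho>0(1) by auto
    obtain c where c: "c \<in> \<A>" "x \<in> fst c" using chart_at[OF x(1,2)] by blast
    obtain V where V: "open V" "x \<in> V" "V \<subseteq> fst c" "!!p. p \<in> V ==> F p = 0 ==> snd c p = snd c x"
      using isol[OF c x(1)] neg x(3) by blast
    have "open (snd c ` (V \<inter> ball 0 \<nu>))"
      by (rule submersion_open_image[OF _ submersion_subset[OF chart_D(2)[OF c(1)]]]) (use V in \<open>auto simp: open_Int\<close>)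
    moreover have "snd c ` (V \<inter> ball 0 \<nu>) = {snd c x}"
    proof
      show "snd c ` (V \<inter> ball 0 \<nu>) \<subseteq> {snd c x}"
      proof
        fix t assume "t \<in> snd c ` (V \<inter> ball 0 \<nu>)"
        then obtain p where p: "p \<in> V" "norm p < \<nu>" "t = snd c p" by auto
        then show "t \<in> {snd c x}" using V(4)[OF p(1)] neg by blast
      qed
      show "{snd c x} \<subseteq> snd c ` (V \<inter> ball 0 \<nu>)" using V(2) x(3) by simp
    qed
    ultimately show False using not_open_singleton by metis
  qed
  then show ?thesis using that by blast
qed

text \<open>\<open>B\<close> acts as a trap for leaf parameters: where
  \<open>norm (F p) < m\<close>, a connected set of parameters that meets \<open>B\<close> stays in
  \<open>B\<close>, so a branch cannot leave it while it is continued. The compact \<open>Q\<close>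
  realises all parameters of \<open>B\<close> with uniform room inside \<open>V\<close>.\<close>

definition target :: "('n, 'q) fol_chart => (complex^'n) set => (complex^'q) set => real => (complex^'n) set => bool" where
  "target c V B m Q \<longleftrightarrow> box K c V \<and> compact Q \<and> Q \<subseteq> K \<inter> V \<and> B \<subseteq> snd c ` Q \<and> 0 < m \<and> m \<le> \<delta> \<and>
     (\<forall>S. connected S --> S \<subseteq> snd c ` {p\<in>K \<inter> V. norm (F p) < m} --> S \<inter> B ~= {} --> S \<subseteq> B)"

text \<open>Since the leaf parameter of the zero fibre is isolated, \<open>F\<close> has no zero on
  the part of \<open>Q\<close> over a sphere about \<open>snd c x\<close>; its minimum there is the
  height \<open>m0\<close> of the wall around \<open>B\<close>.\<close>

lemma target_at:
  assumes x: "norm x = \<epsilon>" "F x = 0"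
  shows "\<exists>c V B m Q O'. target c V B m Q \<and> open O' \<and> x \<in> O' \<and> O' \<subseteq> {p\<in>V. snd c p \<in> B}"
proof -
  have xK: "x \<in> K" "x ~= 0" "x \<in> ball 0 \<rho>0" "norm (F x) < \<delta>" using x \<epsilon> \<delta> by auto
  obtain c where c: "c \<in> \<A>" "x \<in> fst c" using chart_at[OF xK(3,2)] by blast
  obtain V1 where V1: "open V1" "x \<in> V1" "V1 \<subseteq> fst c" "!!p. p \<in> V1 ==> F p = 0 ==> snd c p = snd c x"
    using isol[OF c xK(3) x(2)] by blast
  obtain V where V: "x \<in> V" "V \<subseteq> V1" "box K c V" using box_K[OF xK(1,2,4) V1(1,2) c] by blast
  note B = box_D[OF V(3)]
  obtain r' where r': "r' > 0" "cball x r' \<subseteq> V" using B(2) V(1) open_contains_cball by blast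
  obtain V2 where V2: "x \<in> V2" "V2 \<subseteq> ball x r'" "box K c V2" using box_K[OF xK(1,2,4) open_ball _ c, of x r'] r'(1) by auto
  define Q where "Q = K \<inter> cball x r'"
  have Q: "compact Q" "Q \<subseteq> K \<inter> V" "K \<inter> V2 \<subseteq> Q" using r' V2(2) by (auto simp: Q_def subset_eq)
  have "snd c x \<in> snd c ` (K \<inter> V2)" using V2(1) xK(1) by blast
  then obtain r where r: "r > 0" "cball (snd c x) r \<subseteq> snd c ` (K \<inter> V2)" using box_base_open[OF V2(3)] open_contains_cball by blast
  have cQ: "continuous_on Q (snd c)" using B(4) Q(2) continuous_on_subset by blast
  have "closed (Q \<inter> snd c -` sphere (snd c x) r)"
    by (rule continuous_closed_preimage[OF cQ]) (use Q(1) compact_imp_closed in auto)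
  then have "compact (Q \<inter> snd c -` sphere (snd c x) r)" using Q(1) by (metis Int_left_absorb compact_Int_closed)
  moreover have "continuous_on (Q \<inter> snd c -` sphere (snd c x) r) F" by (rule continuous_on_subset[OF cont_F_K]) (use Q(2) in blast)
  moreover have "F p ~= 0" if p: "p \<in> Q \<inter> snd c -` sphere (snd c x) r" for p
  proof
    assume "F p = 0"
    then have "snd c p = snd c x" using V1(4)[of p] p Q(2) V(2) by blast
    then show False using p r(1) by auto
  qed
  ultimately obtain m0 where m0: "m0 > 0" "!!p. p \<in> Q \<inter> snd c -` sphere (snd c x) r ==> m0 \<le> norm (F p)"
    using positive_lower_bound by blast
  define m where "m = min m0 \<delta>"
  have "target c V (ball (snd c x) r) m Q"
    unfolding target_def
  proof (intro conjI allI impI)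
    show "box K c V" "compact Q" "Q \<subseteq> K \<inter> V" by fact+
    show "ball (snd c x) r \<subseteq> snd c ` Q" using r(2) Q(3) ball_subset_cball by blast
    show "0 < m" "m \<le> \<delta>" using m0(1) \<delta> by (auto simp: m_def)
    fix S assume S: "connected S" "S \<subseteq> snd c ` {p \<in> K \<inter> V. norm (F p) < m}" "S \<inter> ball (snd c x) r ~= {}"
    show "S \<subseteq> ball (snd c x) r"
    proof (rule connected_in_ball[OF S(1,3)])
      have False if t: "t \<in> S" "t \<in> sphere (snd c x) r" for t
      proof -
        obtain p where p: "p \<in> K \<inter> V" "norm (F p) < m" "t = snd c p" using S(2) t(1) by blast
        have "t \<in> cball (snd c x) r" using t(2) by simp
        then obtain p' where p': "p' \<in> K \<inter> V2" "t = snd c p'" using r(2) by blast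
        have p'Q: "p' \<in> Q" using p'(1) Q(3) by blast
        have "F p = F p'" by (rule box_F_eq[OF V(3) p(1)]) (use p'Q Q(2) p(3) p'(2) in auto)
        moreover have "m0 \<le> norm (F p')" by (rule m0(2)) (use p'Q p'(2) t(2) in auto)
        ultimately show False using p(2) by (simp add: m_def)
      qed
      then show "S \<inter> sphere (snd c x) r = {}" by blast
    qed
  qed
  moreover have "open (V \<inter> snd c -` ball (snd c x) r)" by (rule continuous_open_preimage[OF B(4,2)]) simp
  moreover have "x \<in> V \<inter> snd c -` ball (snd c x) r" using V(1) r(1) by simp
  moreover have "V \<inter> snd c -` ball (snd c x) r \<subseteq> {p\<in>V. snd c p \<in> ball (snd c x) r}" by auto
  ultimately show ?thesis by blast
qed

text \<open>Points \<open>e n\<close> off the zero fibre tend to \<open>0\<close>, and their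
  components reach the sphere at points \<open>p n\<close>. A limit of these lies on the sphere and,
  by continuity of \<open>F\<close>, on the zero fibre; the target is placed there.\<close>

lemma target_exists:
  obtains c V B m Q where "target c V B m Q" "!!\<nu>. \<nu> > 0 ==> \<exists>e. norm e < \<nu> \<and> norm e < \<epsilon> \<and> F e ~= 0 \<and> (\<exists>p\<in>comp e. p \<in> V \<and> snd c p \<in> B)"
proof -
  have "\<exists>e. norm e < min \<epsilon> (inverse (Suc n)) \<and> F e ~= 0" for n
    using F_not_zero[of "min \<epsilon> (inverse (Suc n))"] \<epsilon>(1) by (metis inverse_positive_iff_positive min_less_iff_conj of_nat_0_less_iff zero_less_Suc)
  then obtain e where e: "!!n. norm (e n) < min \<epsilon> (inverse (Suc n))" "!!n. F (e n) ~= 0" by metis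
  have eK: "e n \<in> K" for n using e(1)[of n] by simp
  have "\<forall>n. \<exists>p. p \<in> comp (e n) \<and> norm p = \<epsilon>" using comp_reaches_boundary[OF eK e(2)] by blast
  then obtain p where p: "!!n. p n \<in> comp (e n)" "!!n. norm (p n) = \<epsilon>" by metis
  have "\<forall>n. p n \<in> sphere 0 \<epsilon>" using p(2) by simp
  then obtain x s where xs: "x \<in> sphere 0 \<epsilon>" "strict_mono s" "(p \<circ> s) \<longlonglongrightarrow> x"
    using compact_sphere[of "0::complex^'n" \<epsilon>] unfolding compact_def by metis
  have "e \<longlonglongrightarrow> 0"
  proof (rule Lim_null_comparison)
    show "\<forall>\<^sub>F n in sequentially. norm (e n) \<le> inverse (Suc n)" using e(1) by (simp add: less_imp_le)
    show "(%n. inverse (real (Suc n))) \<longlonglongrightarrow> 0" by (rule LIMSEQ_inverse_real_of_nat)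
  qed
  then have es: "(e \<circ> s) \<longlonglongrightarrow> 0" using xs(2) LIMSEQ_subseq_LIMSEQ by blast
  have "(%n. F ((e \<circ> s) n)) \<longlonglongrightarrow> F 0"
    by (rule continuous_on_tendsto_compose[OF cont_F_K es]) (use eK \<epsilon> in auto)
  moreover have "(%n. F ((p \<circ> s) n)) \<longlonglongrightarrow> F x"
    by (rule continuous_on_tendsto_compose[OF cont_F_K xs(3)]) (use xs(1) p(2) in auto)
  moreover have "F ((p \<circ> s) n) = F ((e \<circ> s) n)" for n using comp_D[OF p(1)] by simp
  ultimately have Fx: "F x = 0" using LIMSEQ_unique F_zero by fastforce
  have nx: "norm x = \<epsilon>" using xs(1) by simp
  obtain c V B m Q O' where T: "target c V B m Q" "open O'" "x \<in> O'" "O' \<subseteq> {p\<in>V. snd c p \<in> B}" using target_at[OF nx Fx] by blast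
  show ?thesis
  proof (rule that[OF T(1)])
    fix \<nu> :: real assume "\<nu> > 0"
    then have "\<forall>\<^sub>F n in sequentially. (e \<circ> s) n \<in> ball 0 \<nu>" using topological_tendstoD[OF es open_ball, of 0 \<nu>] by simp
    moreover have "\<forall>\<^sub>F n in sequentially. (p \<circ> s) n \<in> O'" using topological_tendstoD[OF xs(3) T(2,3)] .
    ultimately have "\<forall>\<^sub>F n in sequentially. (e \<circ> s) n \<in> ball 0 \<nu> \<and> (p \<circ> s) n \<in> O'" by eventually_elim simp
    then obtain n where n: "(e \<circ> s) n \<in> ball 0 \<nu>" "(p \<circ> s) n \<in> O'"
      using eventually_happens'[OF sequentially_bot] by blast
    have "norm (e (s n)) < \<epsilon>" using e(1)[of "s n"] by simp
    then show "\<exists>e. norm e < \<nu> \<and> norm e < \<epsilon> \<and> F e ~= 0 \<and> (\<exists>p\<in>comp e. p \<in> V \<and> snd c p \<in> B)"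
      using n T(4) p(1)[of "s n"] e(2)[of "s n"] by (intro exI[of _ "e (s n)"]) auto
  qed
qed

text \<open>A finite atlas of the compact fibre over \<open>y0\<close> with room to spare: a piece
  \<open>U x\<close> lies in \<open>ball x (L/4)\<close>, while all of \<open>ball x L\<close> lies
  in a box. \<open>C x\<close> is a component of the parameters with \<open>F\<close> close to
  \<open>y0\<close>, and a connected set of such parameters cannot leave it, because on the bounding
  sphere \<open>F\<close> has distance at least \<open>e x\<close> from \<open>y0\<close>.\<close>

lemma pieces:
  assumes y0: "y0 ~= 0" "norm y0 < \<delta>" and L0: "L0 > 0" and \<eta>0: "\<eta>0 > 0"
  obtains L X0 \<eta> \<eta>' c V U C where "L > 0" "L \<le> L0" "finite X0" "\<eta> > 0" "\<eta> \<le> \<eta>0" "\<eta>' > 0"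
    "!!x. x \<in> X0 ==> box K (c x) (V x) \<and> box K (c x) (U x) \<and> ball x L \<subseteq> V x \<and> U x \<subseteq> ball x (L/4)"
    "!!x. x \<in> X0 ==> open (C x) \<and> connected (C x) \<and> C x \<subseteq> snd (c x) ` (K \<inter> U x)"
    "!!x p. x \<in> X0 ==> p \<in> K \<inter> V x ==> snd (c x) p \<in> C x ==> norm (F p - y0) < \<eta>"
    "!!x S. x \<in> X0 ==> connected S ==> S \<subseteq> snd (c x) ` {p\<in>K \<inter> V x. norm (F p - y0) < \<eta>} ==> S \<inter> C x ~= {} ==> S \<subseteq> C x"
    "!!z. z \<in> K ==> norm (F z - y0) < \<eta>' ==> \<exists>x\<in>X0. z \<in> U x \<and> snd (c x) z \<in> C x"
proof -
  define K0 where "K0 = {z\<in>K. F z = y0}"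
  have "K0 = K \<inter> F -` {y0}" by (auto simp: K0_def)
  then have "closed K0" using continuous_closed_preimage[OF cont_F_K, of "{y0}"] by simp
  moreover have "bounded K0" by (rule bounded_subset[OF bounded_cball[of 0 \<epsilon>]]) (auto simp: K0_def)
  ultimately have cK0: "compact K0" by (simp add: compact_eq_bounded_closed)
  have K0: "x \<in> K" "x ~= 0" "norm (F x) < \<delta>" "F x = y0" "x \<in> ball 0 \<rho>0" if "x \<in> K0" for x
    using that y0 F_zero K_sub by (auto simp: K0_def)
  obtain L1 where L1: "L1 > 0" "!!x. x \<in> K0 ==> \<exists>V\<in>{V. \<exists>c. box K c V}. ball x L1 \<subseteq> V"
  proof (rule Heine_Borel_lemma[OF cK0, of "{V. \<exists>c. box K c V}"])
    show "K0 \<subseteq> \<Union>{V. \<exists>c. box K c V}"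
    proof
      fix x assume x: "x \<in> K0"
      obtain c where "c \<in> \<A>" "x \<in> fst c" using chart_at[OF K0(5,2)[OF x]] by blast
      then show "x \<in> \<Union>{V. \<exists>c. box K c V}" using box_K[OF K0(1-3)[OF x] open_UNIV UNIV_I] by blast
    qed
    show "open G" if "G \<in> {V. \<exists>c. box K c V}" for G using that box_D(2) by blast
  qed blast
  define L where "L = min L0 L1"
  have L: "L > 0" "L \<le> L0" using L0 L1(1) by (auto simp: L_def)
  have "\<exists>c V U r e G. box K c V \<and> box K c U \<and> ball x L \<subseteq> V \<and> U \<subseteq> ball x (L/4) \<and> x \<in> U \<and> r > 0 \<and> e > 0 \<and>
      cball (snd c x) r \<subseteq> snd c ` (K \<inter> U) \<and> (\<forall>p\<in>K \<inter> U. F p = y0 --> snd c p = snd c x) \<and>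
      continuous_on (snd c ` (K \<inter> V)) G \<and> (\<forall>p\<in>K \<inter> V. F p = G (snd c p)) \<and> (\<forall>t\<in>sphere (snd c x) r. e \<le> norm (G t - y0))"
    if x: "x \<in> K0" for x
  proof -
    obtain V c where V: "box K c V" "ball x L1 \<subseteq> V" using L1(2)[OF x] by blast
    have bxL: "ball x L \<subseteq> ball x L1" by (auto simp: L_def)
    then have bV: "ball x L \<subseteq> V" using V(2) by blast
    note B = box_D[OF V(1)]
    have xc: "x \<in> fst c" using B(3) bV L(1) by (meson centre_in_ball subsetD)
    obtain W where W: "open W" "x \<in> W" "W \<subseteq> fst c" "!!p. p \<in> W ==> F p = y0 ==> snd c p = snd c x"
      using iso_chart[OF iso_K[OF K0(1-3)[OF x]] B(1) xc] K0(4)[OF x] by blast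
    obtain U where U: "x \<in> U" "U \<subseteq> W \<inter> ball x (L/4)" "box K c U"
      using box_K[OF K0(1-3)[OF x] _ _ B(1) xc, of "W \<inter> ball x (L/4)"] W(1,2) L(1) by auto
    have "snd c x \<in> snd c ` (K \<inter> U)" using U(1) K0(1)[OF x] by blast
    then obtain r where r: "r > 0" "cball (snd c x) r \<subseteq> snd c ` (K \<inter> U)" using box_base_open[OF U(3)] open_contains_cball by blast
    obtain G where G: "holo_map_on G (snd c ` (K \<inter> V))" "!!p. p \<in> K \<inter> V ==> F p = G (snd c p)" using box_F[OF V(1)] by blast
    have "ball x (L/4) \<subseteq> ball x L" using L(1) by auto
    then have UV: "U \<subseteq> V" using U(2) bV by blast
    have Gc: "continuous_on (snd c ` (K \<inter> V)) G" by (rule holo_map_continuous[OF G(1)])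
    have sub: "sphere (snd c x) r \<subseteq> snd c ` (K \<inter> U)" using r(2) by auto
    have "continuous_on (sphere (snd c x) r) (%t. G t - y0)"
      by (intro continuous_intros continuous_on_subset[OF Gc]) (use sub UV in blast)
    moreover have "G t - y0 ~= 0" if t: "t \<in> sphere (snd c x) r" for t
    proof
      assume "G t - y0 = 0"
      moreover obtain p where p: "p \<in> K \<inter> U" "t = snd c p" using sub t by blast
      ultimately have "F p = y0" using G(2)[of p] UV by auto
      then have "t = snd c x" using W(4)[of p] p U(2) by blast
      then show False using t r(1) by simp
    qed
    ultimately obtain e where e: "e > 0" "!!t. t \<in> sphere (snd c x) r ==> e \<le> norm (G t - y0)"
      using positive_lower_bound[OF compact_sphere] by blast
    have Uy: "\<forall>p\<in>K \<inter> U. F p = y0 --> snd c p = snd c x" using W(4) U(2) by blast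
    show ?thesis
      by (intro exI[of _ c] exI[of _ V] exI[of _ U] exI[of _ r] exI[of _ e] exI[of _ G] conjI)
         (use V(1) U bV r e Gc G(2) Uy in auto)
  qed
  then obtain c V U r e G where H: "!!x. x \<in> K0 ==> box K (c x) (V x) \<and> box K (c x) (U x) \<and> ball x L \<subseteq> V x \<and> U x \<subseteq> ball x (L/4) \<and> x \<in> U x \<and> r x > 0 \<and> e x > 0 \<and>
      cball (snd (c x) x) (r x) \<subseteq> snd (c x) ` (K \<inter> U x) \<and> (\<forall>p\<in>K \<inter> U x. F p = y0 --> snd (c x) p = snd (c x) x) \<and>
      continuous_on (snd (c x) ` (K \<inter> V x)) (G x) \<and> (\<forall>p\<in>K \<inter> V x. F p = G x (snd (c x) p)) \<and> (\<forall>t\<in>sphere (snd (c x) x) (r x). e x \<le> norm (G x t - y0))"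
    by metis
  obtain X0 where X0: "X0 \<subseteq> K0" "finite X0" "K0 \<subseteq> (\<Union>x\<in>X0. U x)"
  proof (rule compactE_image[OF cK0, of K0 U])
    show "open (U x)" if "x \<in> K0" for x using H[OF that] box_D(2) by blast
    show "K0 \<subseteq> \<Union>(U ` K0)" using H by blast
  qed blast
  define \<eta> where "\<eta> = Min (insert \<eta>0 (e ` X0))"
  have \<eta>: "\<eta> > 0" "\<eta> \<le> \<eta>0" using X0(1,2) \<eta>0 H by (auto simp: \<eta>_def)
  have \<eta>e: "\<eta> \<le> e x" if "x \<in> X0" for x unfolding \<eta>_def using X0(2) that by (intro Min_le) auto
  define E where "E x = ball (snd (c x) x) (r x) \<inter> G x -` ball y0 \<eta>" for x
  define C where "C x = connected_component_set (E x) (snd (c x) x)" for x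
  have UV: "U x \<subseteq> V x" if "x \<in> K0" for x
  proof -
    have "ball x (L/4) \<subseteq> ball x L" using L(1) by auto
    then show ?thesis using H[OF that] by blast
  qed
  have oE: "open (E x)" if "x \<in> K0" for x
    unfolding E_def
  proof (rule continuous_open_preimage)
    show "continuous_on (ball (snd (c x) x) (r x)) (G x)"
    proof (rule continuous_on_subset)
      show "continuous_on (snd (c x) ` (K \<inter> V x)) (G x)" using H[OF that] by blast
      have "ball (snd (c x) x) (r x) \<subseteq> snd (c x) ` (K \<inter> U x)" using H[OF that] ball_subset_cball by blast
      then show "ball (snd (c x) x) (r x) \<subseteq> snd (c x) ` (K \<inter> V x)" using UV[OF that] by blast
    qed
  qed auto
  have CE: "C x \<subseteq> E x" for x by (simp add: C_def connected_component_subset)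
  have cen: "snd (c x) x \<in> C x" if "x \<in> K0" for x
  proof -
    have "x \<in> K \<inter> V x" using H[OF that] UV[OF that] K0(1)[OF that] by blast
    then have "G x (snd (c x) x) = y0" using H[OF that] K0(4)[OF that] by metis
    then have "snd (c x) x \<in> E x" using H[OF that] \<eta>(1) by (simp add: E_def)
    then show ?thesis by (simp add: C_def connected_component_refl)
  qed
  have oC: "open (C x)" if "x \<in> K0" for x unfolding C_def by (rule open_connected_component[OF oE[OF that]])
  define O' where "O' = (\<Union>x\<in>X0. U x \<inter> snd (c x) -` C x)"
  have oO: "open O'" unfolding O'_def
  proof (intro open_UN ballI continuous_open_preimage)
    fix x assume "x \<in> X0"
    then have x: "x \<in> K0" using X0(1) by blast
    then show "continuous_on (U x) (snd (c x))" "open (U x)" using H[OF x] box_D by blast+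
    show "open (C x)" by (rule oC[OF x])
  qed
  have KO: "K0 \<subseteq> O'"
  proof
    fix z assume z: "z \<in> K0"
    then obtain x where x: "x \<in> X0" "z \<in> U x" using X0(3) by blast
    then have "snd (c x) z = snd (c x) x" using H[of x] X0(1) K0(1,4)[OF z] by blast
    moreover have "snd (c x) x \<in> C x" using cen x(1) X0(1) by blast
    ultimately have "z \<in> U x \<inter> snd (c x) -` C x" using x(2) by simp
    then show "z \<in> O'" unfolding O'_def using x(1) by blast
  qed
  \<comment> \<open>By compactness every point of \<open>K\<close> with \<open>F\<close> close
    enough to \<open>y0\<close> lies in one of the pieces.\<close>
  have "\<exists>\<eta>'>0. \<forall>z\<in>K - O'. \<eta>' \<le> norm (F z - y0)"
  proof -
    have "compact (K - O')" using oO by (intro compact_diff) auto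
    moreover have "continuous_on (K - O') (%z. F z - y0)" by (intro continuous_intros continuous_on_subset[OF cont_F_K]) auto
    moreover have "F z - y0 ~= 0" if "z \<in> K - O'" for z using that KO by (auto simp: K0_def)
    ultimately obtain b where "b > 0" "!!z. z \<in> K - O' ==> b \<le> norm (F z - y0)" using positive_lower_bound by blast
    then show ?thesis by blast
  qed
  then obtain \<eta>' where \<eta>': "\<eta>' > 0" "!!z. z \<in> K - O' ==> \<eta>' \<le> norm (F z - y0)" by blast
  show ?thesis
  proof (rule that[OF L X0(2) \<eta> \<eta>'(1), of c V U C])
    fix x assume "x \<in> X0"
    then have x: "x \<in> K0" "x \<in> X0" using X0(1) by auto
    show "box K (c x) (V x) \<and> box K (c x) (U x) \<and> ball x L \<subseteq> V x \<and> U x \<subseteq> ball x (L/4)" using H[OF x(1)] by blast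
    have "E x \<subseteq> cball (snd (c x) x) (r x)" by (auto simp: E_def)
    then show "open (C x) \<and> connected (C x) \<and> C x \<subseteq> snd (c x) ` (K \<inter> U x)"
      using oC[OF x(1)] CE H[OF x(1)] unfolding C_def by (meson connected_connected_component order_trans)
    show "norm (F p - y0) < \<eta>" if p: "p \<in> K \<inter> V x" "snd (c x) p \<in> C x" for p
    proof -
      have "G x (snd (c x) p) \<in> ball y0 \<eta>" using p(2) CE[of x] unfolding E_def by blast
      moreover have "F p = G x (snd (c x) p)" using H[OF x(1)] p(1) by blast
      ultimately show ?thesis by (simp add: dist_norm norm_minus_commute)
    qed
    fix S assume S: "connected S" "S \<subseteq> snd (c x) ` {p\<in>K \<inter> V x. norm (F p - y0) < \<eta>}" "S \<inter> C x ~= {}"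
    have SG: "norm (G x t - y0) < \<eta>" if t: "t \<in> S" for t
    proof -
      obtain p where "p \<in> K \<inter> V x" "norm (F p - y0) < \<eta>" "t = snd (c x) p" using S(2) t by blast
      then show ?thesis using H[OF x(1)] by metis
    qed
    have "S \<inter> sphere (snd (c x) x) (r x) = {}"
    proof -
      have "e x \<le> norm (G x t - y0)" if "t \<in> sphere (snd (c x) x) (r x)" for t using H[OF x(1)] that by blast
      then show ?thesis using SG \<eta>e[OF x(2)] by fastforce
    qed
    moreover have "S \<inter> ball (snd (c x) x) (r x) ~= {}" using S(3) CE by (auto simp: E_def)
    ultimately have "S \<subseteq> ball (snd (c x) x) (r x)" by (intro connected_in_ball[OF S(1)])
    then have SE: "S \<subseteq> E x" using SG by (auto simp: E_def dist_norm norm_minus_commute)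
    obtain t where t: "t \<in> S" "t \<in> C x" using S(3) by blast
    have "S \<subseteq> connected_component_set (E x) t" by (rule connected_component_maximal[OF t(1) S(1) SE])
    also have "\<dots> = C x" using t(2) unfolding C_def by (rule connected_component_eq)
    finally show "S \<subseteq> C x" .
  next
    fix z assume "z \<in> K" "norm (F z - y0) < \<eta>'"
    then have "z \<in> O'" using \<eta>'(2)[of z] by force
    then show "\<exists>x\<in>X0. z \<in> U x \<and> snd (c x) z \<in> C x" by (auto simp: O'_def)
  qed
qed

end

section \<open>Holonomy\<close>

context good
begin

text \<open>The multivalued function of \<open>z\<close> that will be continued.\<close>

definition rel :: "('n, 'q) fol_chart => (complex^'n) set => (complex^'q) set => complex^'n => complex^'q => bool" where
  "rel c V B z t \<longleftrightarrow> t \<in> B \<and> (\<exists>p\<in>comp z \<inter> V. snd c p = t)"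

text \<open>\<theta> is a local coordinate change of the leaf parameter; this condition on a branch
  is what later ties the extension to the given foliation.\<close>

definition transverse :: "(complex^'n => complex^'q) => (complex^'n) set => bool" where
  "transverse \<psi> N \<longleftrightarrow> (\<exists>d\<in>\<A>. N \<subseteq> fst d \<and> (\<exists>\<theta>. holo_map_on \<theta> (snd d ` N) \<and>
     (\<forall>x\<in>N. \<psi> x = \<theta> (snd d x) \<and> surj (%v. jac \<theta> (snd d x) *v v))))"

lemma surj_jac_compose:
  assumes "holo_map_on \<theta> C" "holo_map_on \<kappa> D" "t \<in> C" "\<theta> t \<in> D" "surj (%v. jac \<theta> t *v v)" "surj (%v. jac \<kappa> (\<theta> t) *v v)"
  shows "surj (%v. jac (%t. \<kappa> (\<theta> t)) t *v v)"
proof -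
  have "(%v. jac (%t. \<kappa> (\<theta> t)) t *v v) = (%v. jac \<kappa> (\<theta> t) *v v) \<circ> (%v. jac \<theta> t *v v)"
    by (auto simp: fun_eq_iff matrix_vector_mul_assoc jac_compose[OF assms(1-4)])
  then show ?thesis using comp_surj[OF assms(5,6)] by metis
qed

text \<open>The component through a point near \<open>z0\<close> is followed along chains of
  overlapping pieces. Each overlap gives a transition map of leaf parameters, and each chain that
  ends at the target gives one branch. There are finitely many pieces, hence countably many
  chains.\<close>

lemma holonomy:
  assumes T: "target cs Vs B m Q" and z0: "norm z0 < \<epsilon>" "F z0 ~= 0" "norm (F z0) < m"
  shows "\<exists>N \<Psi>. open N \<and> z0 \<in> N \<and> N \<subseteq> ball 0 \<epsilon> \<and> countable \<Psi> \<and>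
    (\<forall>\<psi>\<in>\<Psi>. transverse \<psi> N \<and> (\<forall>x\<in>N. rel cs Vs B x (\<psi> x))) \<and> (\<forall>x\<in>N. \<forall>t. rel cs Vs B x t --> (\<exists>\<psi>\<in>\<Psi>. \<psi> x = t))"
proof -
  have T': "box K cs Vs" "compact Q" "Q \<subseteq> K \<inter> Vs" "B \<subseteq> snd cs ` Q" "m \<le> \<delta>"
    "!!S. connected S ==> S \<subseteq> snd cs ` {p\<in>K \<inter> Vs. norm (F p) < m} ==> S \<inter> B ~= {} ==> S \<subseteq> B"
    using T by (simp_all add: target_def)
  note Bs = box_D[OF T'(1)]
  define y0 where "y0 = F z0"
  have y0: "y0 ~= 0" "norm y0 < \<delta>" using z0 T'(5) by (auto simp: y0_def)
  have "Q \<subseteq> Vs" using T'(3) by blast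
  then obtain L0 where L0: "L0 > 0" "(\<Union>w\<in>Q. ball w L0) \<subseteq> Vs"
    using compact_subset_open_imp_ball_epsilon_subset[OF T'(2) Bs(2)] by blast
  \<comment> \<open>This bound keeps \<open>F\<close> nonzero and below \<open>m\<close> in norm on
    all pieces.\<close>
  have \<eta>0: "min (norm y0) (m - norm y0) > 0" using z0 by (simp add: y0_def)
  obtain L X0 c V U C \<eta> \<eta>' where pc: "L > 0" "L \<le> L0" "finite X0" "\<eta> > 0" "\<eta> \<le> min (norm y0) (m - norm y0)" "\<eta>' > 0"
    "!!x. x \<in> X0 ==> box K (c x) (V x) \<and> box K (c x) (U x) \<and> ball x L \<subseteq> V x \<and> U x \<subseteq> ball x (L/4)"
    "!!x. x \<in> X0 ==> open (C x) \<and> connected (C x) \<and> C x \<subseteq> snd (c x) ` (K \<inter> U x)"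
    "!!x p. x \<in> X0 ==> p \<in> K \<inter> V x ==> snd (c x) p \<in> C x ==> norm (F p - y0) < \<eta>"
    "!!x S. x \<in> X0 ==> connected S ==> S \<subseteq> snd (c x) ` {p\<in>K \<inter> V x. norm (F p - y0) < \<eta>} ==> S \<inter> C x ~= {} ==> S \<subseteq> C x"
    "!!z. z \<in> K ==> norm (F z - y0) < \<eta>' ==> \<exists>x\<in>X0. z \<in> U x \<and> snd (c x) z \<in> C x"
  proof (rule pieces[OF y0 L0(1) \<eta>0], goal_cases)
    case (1 L X0 \<eta> \<eta>' c V U C)
    show ?case by (rule 1(1)[OF 1(2-12)])
  qed
  have bV: "box K (c x) (V x)" and bU: "box K (c x) (U x)" and ULV: "ball x L \<subseteq> V x" "U x \<subseteq> ball x (L/4)"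
    and C: "open (C x)" "connected (C x)" "C x \<subseteq> snd (c x) ` (K \<inter> U x)" if "x \<in> X0" for x
    using pc(7,8)[OF that] by auto
  have UV: "U x \<subseteq> V x" if "x \<in> X0" for x
  proof -
    have "ball x (L/4) \<subseteq> ball x L" using pc(1) by auto
    then show ?thesis using ULV[OF that] by blast
  qed
  define P where "P x = {p\<in>K \<inter> U x. snd (c x) p \<in> C x}" for x
  have PV: "p \<in> K \<inter> V x" if "p \<in> P x" "x \<in> X0" for p x using that UV by (auto simp: P_def)
  have smallF: "norm (F p - y0) < \<eta>" "F p ~= 0" "norm (F p) < m" "p ~= 0" if "p \<in> P x" "x \<in> X0" for p x
  proof -
    show 1: "norm (F p - y0) < \<eta>" by (rule pc(9)[OF that(2) PV[OF that]]) (use that in \<open>simp add: P_def\<close>)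
    then show F0: "F p ~= 0" using pc(5) by auto
    show "norm (F p) < m" using 1 pc(5) norm_triangle_ineq[of "F p - y0" y0] by simp
    show "p ~= 0" using F0 F_zero by auto
  qed
  define edge where "edge x x' \<longleftrightarrow> x \<in> X0 \<and> x' \<in> X0 \<and> P x \<inter> P x' ~= {}" for x x'
  \<comment> \<open>Three distances below \<open>L/4\<close> add up to less than \<open>L\<close>,
    so a piece lies in the larger box of each neighbour.\<close>
  have edgeU: "U x \<subseteq> V x'" if e: "edge x x'" for x x'
  proof
    fix u assume u: "u \<in> U x"
    obtain w where "w \<in> U x" "w \<in> U x'" using e by (auto simp: edge_def P_def)
    then have "dist x w < L/4" "dist x' w < L/4" "dist x u < L/4" using u ULV(2) e unfolding edge_def by (meson mem_ball subsetD)+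
    then have "dist x' u < L" using pc(1) dist_triangle[of x' u x] dist_triangle[of x' x w] by (simp add: dist_commute)
    then show "u \<in> V x'" using ULV(1)[of x'] e by (auto simp: edge_def)
  qed
  have "\<exists>\<kappa>. holo_map_on \<kappa> (snd (c x) ` (K \<inter> U x)) \<and> (\<forall>p\<in>K \<inter> U x. snd (c x') p = \<kappa> (snd (c x) p)) \<and>
    (\<forall>t\<in>snd (c x) ` (K \<inter> U x). surj (%v. jac \<kappa> t *v v))" if e: "edge x x'" for x x'
  proof (rule box_transition)
    have x: "x \<in> X0" "x' \<in> X0" using e by (auto simp: edge_def)
    show "box K (c x) (U x)" "c x' \<in> \<A>" using bU[OF x(1)] box_D(1)[OF bV[OF x(2)]] by auto
    show "U x \<subseteq> fst (c x')" using edgeU[OF e] box_D(3)[OF bV[OF x(2)]] by blast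
  qed
  then obtain \<kappa> where \<kappa>: "!!x x'. edge x x' ==> holo_map_on (\<kappa> x x') (snd (c x) ` (K \<inter> U x)) \<and> (\<forall>p\<in>K \<inter> U x. snd (c x') p = \<kappa> x x' (snd (c x) p)) \<and>
    (\<forall>t\<in>snd (c x) ` (K \<inter> U x). surj (%v. jac (\<kappa> x x') t *v v))" by metis
  \<comment> \<open>The image of \<open>C x\<close> is connected, meets \<open>C x'\<close> and
    consists of parameters with \<open>F\<close> close to \<open>y0\<close>, so it is trapped in
    \<open>C x'\<close>.\<close>
  have \<kappa>C: "\<kappa> x x' ` C x \<subseteq> C x'" if e: "edge x x'" for x x'
  proof -
    have x: "x \<in> X0" "x' \<in> X0" using e by (auto simp: edge_def)
    show ?thesis
    proof (rule pc(10)[OF x(2)])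
      have "continuous_on (C x) (\<kappa> x x')"
        by (rule continuous_on_subset[OF holo_map_continuous]) (use \<kappa>[OF e] C(3)[OF x(1)] in auto)
      then show "connected (\<kappa> x x' ` C x)" using C(2)[OF x(1)] by (rule connected_continuous_image)
      show "\<kappa> x x' ` C x \<subseteq> snd (c x') ` {p\<in>K \<inter> V x'. norm (F p - y0) < \<eta>}"
      proof
        fix s assume "s \<in> \<kappa> x x' ` C x"
        then obtain t where t: "t \<in> C x" "s = \<kappa> x x' t" by blast
        then obtain p where p: "p \<in> K \<inter> U x" "t = snd (c x) p" using C(3)[OF x(1)] by blast
        have "p \<in> P x" using p t(1) by (simp add: P_def)
        then have "norm (F p - y0) < \<eta>" using smallF(1) x(1) by blast
        moreover have "s = snd (c x') p" using \<kappa>[OF e] p t(2) by simp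
        ultimately show "s \<in> snd (c x') ` {p\<in>K \<inter> V x'. norm (F p - y0) < \<eta>}" using p(1) edgeU[OF e] by blast
      qed
      obtain w where "w \<in> P x" "w \<in> P x'" using e by (auto simp: edge_def)
      then have "snd (c x) w \<in> C x" "snd (c x') w \<in> C x'" "snd (c x') w = \<kappa> x x' (snd (c x) w)" using \<kappa>[OF e] by (auto simp: P_def)
      then show "\<kappa> x x' ` C x \<inter> C x' ~= {}" by (metis IntI empty_iff imageI)
    qed
  qed
  \<comment> \<open>The pieces from which the target is entered, at a point of \<open>Q\<close>;
    since \<open>L \<le> L0\<close>, such a piece lies entirely in \<open>Vs\<close>.\<close>
  define en where "en x \<longleftrightarrow> x \<in> X0 \<and> (\<exists>w\<in>P x \<inter> Q. snd cs w \<in> B)" for x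
  have enU: "U x \<subseteq> Vs" if e: "en x" for x
  proof
    fix u assume u: "u \<in> U x"
    obtain w where w: "w \<in> P x" "w \<in> Q" using e by (auto simp: en_def)
    then have "dist x w < L/4" "dist x u < L/4" using u ULV(2) e unfolding en_def P_def by (auto simp: subset_eq)
    then have "u \<in> ball w L0" using pc(1,2) dist_triangle[of w u x] by (simp add: dist_commute)
    then show "u \<in> Vs" using L0(2) w(2) by blast
  qed
  have "\<exists>\<kappa>. holo_map_on \<kappa> (snd (c x) ` (K \<inter> U x)) \<and> (\<forall>p\<in>K \<inter> U x. snd cs p = \<kappa> (snd (c x) p)) \<and>
    (\<forall>t\<in>snd (c x) ` (K \<inter> U x). surj (%v. jac \<kappa> t *v v))" if e: "en x" for x
    by (rule box_transition[OF bU Bs(1)]) (use e enU[OF e] Bs(3) in \<open>auto simp: en_def\<close>)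
  then obtain \<kappa>s where \<kappa>s: "!!x. en x ==> holo_map_on (\<kappa>s x) (snd (c x) ` (K \<inter> U x)) \<and> (\<forall>p\<in>K \<inter> U x. snd cs p = \<kappa>s x (snd (c x) p)) \<and>
    (\<forall>t\<in>snd (c x) ` (K \<inter> U x). surj (%v. jac (\<kappa>s x) t *v v))" by metis
  have \<kappa>sC: "\<kappa>s x ` C x \<subseteq> B" if e: "en x" for x
  proof -
    have x: "x \<in> X0" using e by (auto simp: en_def)
    show ?thesis
    proof (rule T'(6))
      have "continuous_on (C x) (\<kappa>s x)"
        by (rule continuous_on_subset[OF holo_map_continuous]) (use \<kappa>s[OF e] C(3)[OF x] in auto)
      then show "connected (\<kappa>s x ` C x)" using C(2)[OF x] by (rule connected_continuous_image)
      show "\<kappa>s x ` C x \<subseteq> snd cs ` {p\<in>K \<inter> Vs. norm (F p) < m}"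
      proof
        fix s assume "s \<in> \<kappa>s x ` C x"
        then obtain t where t: "t \<in> C x" "s = \<kappa>s x t" by blast
        then obtain p where p: "p \<in> K \<inter> U x" "t = snd (c x) p" using C(3)[OF x] by blast
        have "p \<in> P x" using p t(1) by (simp add: P_def)
        then have "norm (F p) < m" using smallF(3) x by blast
        moreover have "s = snd cs p" using \<kappa>s[OF e] p t(2) by simp
        ultimately show "s \<in> snd cs ` {p\<in>K \<inter> Vs. norm (F p) < m}" using p(1) enU[OF e] by blast
      qed
      obtain w where "w \<in> P x" "snd cs w \<in> B" using e by (auto simp: en_def)
      then have "snd (c x) w \<in> C x" "snd cs w \<in> B" "snd cs w = \<kappa>s x (snd (c x) w)" using \<kappa>s[OF e] by (auto simp: P_def)
      then show "\<kappa>s x ` C x \<inter> B ~= {}" by (metis IntI empty_iff imageI)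
    qed
  qed
  obtain x0 where x0: "x0 \<in> X0" "z0 \<in> U x0" "snd (c x0) z0 \<in> C x0" using pc(11)[of z0] z0(1) pc(6) by (auto simp: y0_def)
  define N where "N = (U x0 \<inter> snd (c x0) -` C x0) \<inter> (ball 0 \<epsilon> \<inter> F -` ball y0 \<eta>')"
  have "open (U x0 \<inter> snd (c x0) -` C x0)"
    using continuous_open_preimage[OF box_D(4,2)[OF bU[OF x0(1)]] C(1)[OF x0(1)]] .
  moreover have "open (ball 0 \<epsilon> \<inter> F -` ball y0 \<eta>')"
    by (rule continuous_open_preimage[OF continuous_on_subset[OF cont_F_K]]) auto
  ultimately have oN: "open N" unfolding N_def by (rule open_Int)
  have z0N: "z0 \<in> N" using x0 z0(1) pc(6) by (simp add: N_def y0_def)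
  have Nx: "x \<in> P x0" "x \<in> K" "snd (c x0) x \<in> C x0" "norm (F x - y0) < \<eta>'" if "x \<in> N" for x
    using that by (auto simp: N_def P_def dist_norm norm_minus_commute)
  \<comment> \<open>The invariant of a chain that ends at \<open>x\<close> with accumulated
    transition \<theta>: its last clause says that the plaque reached from \<open>p\<close> really
    belongs to the component through \<open>p\<close>.\<close>
  define Inv where "Inv = {(x, \<theta>). x \<in> X0 \<and> holo_map_on \<theta> (C x0) \<and> \<theta> ` C x0 \<subseteq> C x \<and> (\<forall>t\<in>C x0. surj (%v. jac \<theta> t *v v)) \<and>
    (\<forall>p\<in>N. \<forall>p'\<in>P x. snd (c x) p' = \<theta> (snd (c x0) p) --> p' \<in> comp p)}"
  define step where "step S = {(x', %t. \<kappa> x x' (\<theta> t)) | x x' \<theta>. (x, \<theta>) \<in> S \<and> edge x x'}" for S :: "((complex^'n) \<times> (complex^'q => complex^'q)) set"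
  define A where "A = (\<Union>n. (step ^^ n) {(x0, %t. t)})"
  have A0: "(x0, %t. t) \<in> A" unfolding A_def by (rule UN_I[of 0]) auto
  have Astep: "(x', %t. \<kappa> x x' (\<theta> t)) \<in> A" if xA: "(x, \<theta>) \<in> A" "edge x x'" for x x' \<theta>
  proof -
    obtain n where "(x, \<theta>) \<in> (step ^^ n) {(x0, %t. t)}" using xA(1) by (auto simp: A_def)
    then have "(x', %t. \<kappa> x x' (\<theta> t)) \<in> (step ^^ Suc n) {(x0, %t. t)}" unfolding funpow.simps o_def using xA(2) by (auto simp: step_def)
    then show ?thesis unfolding A_def by blast
  qed
  have "finite ((step ^^ n) {(x0, %t. t)})" for n
  proof (induction n)
    case (Suc n)
    have "step S \<subseteq> (%((x, \<theta>), x'). (x', %t. \<kappa> x x' (\<theta> t))) ` (S \<times> X0)" for S by (force simp: step_def edge_def)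
    then show ?case unfolding funpow.simps o_def using Suc pc(3) by (meson finite_SigmaI finite_imageI finite_subset)
  qed simp
  then have cA: "countable A" unfolding A_def by (intro countable_UN) (auto intro: countable_finite)
  have base: "(x0, %t. t) \<in> Inv"
  proof -
    have j: "jac (%t. t) x = mat 1" for x :: "complex^'q" by (simp add: jac_def vec_eq_iff mat_def axis_def)
    have "p' \<in> comp p" if p: "p \<in> N" "p' \<in> P x0" "snd (c x0) p' = snd (c x0) p" for p p'
      by (rule comp_plaque[OF bU[OF x0(1)], of p p' p]) (use p Nx[OF p(1)] comp_refl in \<open>auto simp: P_def\<close>)
    then show ?thesis unfolding Inv_def using x0(1) holo_map_shift(2) by (simp add: j)
  qed
  have stepI: "step S \<subseteq> Inv" if S: "S \<subseteq> Inv" for S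
  proof
    fix a assume "a \<in> step S"
    then obtain x x' \<theta> where a: "a = (x', %t. \<kappa> x x' (\<theta> t))" "(x, \<theta>) \<in> Inv" and e: "edge x x'" using S by (auto simp: step_def)
    have I: "x \<in> X0" "holo_map_on \<theta> (C x0)" "\<theta> ` C x0 \<subseteq> C x" "!!t. t \<in> C x0 ==> surj (%v. jac \<theta> t *v v)"
      "!!p p'. p \<in> N ==> p' \<in> P x ==> snd (c x) p' = \<theta> (snd (c x0) p) ==> p' \<in> comp p" using a(2) by (auto simp: Inv_def)
    have x': "x' \<in> X0" using e by (simp add: edge_def)
    have \<kappa>h: "holo_map_on (\<kappa> x x') (C x)" using \<kappa>[OF e] C(3)[OF I(1)] holo_map_subset by blast
    have 1: "holo_map_on (%t. \<kappa> x x' (\<theta> t)) (C x0)" by (rule holo_map_compose[OF I(2) \<kappa>h]) (use I(3) in blast)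
    have 2: "(%t. \<kappa> x x' (\<theta> t)) ` C x0 \<subseteq> C x'" using I(3) \<kappa>C[OF e] by blast
    have 3: "surj (%v. jac (%t. \<kappa> x x' (\<theta> t)) t *v v)" if t: "t \<in> C x0" for t
    proof -
      have "\<theta> t \<in> C x" using I(3) t by blast
      moreover from this have "\<theta> t \<in> snd (c x) ` (K \<inter> U x)" using C(3)[OF I(1)] by blast
      then have "surj (%v. jac (\<kappa> x x') (\<theta> t) *v v)" by (rule bspec[OF conjunct2[OF conjunct2[OF \<kappa>[OF e]]]])
      ultimately show ?thesis by (rule surj_jac_compose[OF I(2) \<kappa>h t _ I(4)[OF t]])
    qed
    have 4: "p'' \<in> comp p" if p: "p \<in> N" "p'' \<in> P x'" "snd (c x') p'' = \<kappa> x x' (\<theta> (snd (c x0) p))" for p p''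
    proof -
      have "\<theta> (snd (c x0) p) \<in> C x" using I(3) Nx(3)[OF p(1)] by blast
      then obtain p' where p': "p' \<in> K \<inter> U x" "snd (c x) p' = \<theta> (snd (c x0) p)" "p' \<in> P x" using C(3)[OF I(1)] unfolding P_def by auto
      have "p' \<in> comp p" by (rule I(5)[OF p(1) p'(3,2)])
      moreover have "snd (c x') p' = snd (c x') p''" using \<kappa>[OF e] p'(1,2) p(3) by simp
      moreover have "p' \<in> K \<inter> V x'" using p'(1) edgeU[OF e] by blast
      ultimately show ?thesis using comp_plaque[OF bV[OF x']] PV[OF p(2) x'] by blast
    qed
    show "a \<in> Inv" unfolding a(1) Inv_def using x' 1 2 3 4 by blast
  qed
  have "(step ^^ n) {(x0, %t. t)} \<subseteq> Inv" for n
    by (induction n) (use base stepI in auto)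
  then have AInv: "A \<subseteq> Inv" by (auto simp: A_def)
  \<comment> \<open>Induction along the connected component: near \<open>q\<close> it has a single
    leaf parameter in one piece, by \<open>iso\<close>, so a chain reaching one nearby point extends
    by one step to all the others.\<close>
  have chain: "\<exists>x \<theta>. (x, \<theta>) \<in> A \<and> p' \<in> P x \<and> snd (c x) p' = \<theta> (snd (c x0) p)" if p: "p \<in> N" "p' \<in> comp p" for p p'
  proof (rule connected_induction_simple[OF connected_comp comp_refl[OF Nx(2)[OF p(1)]] p(2)])
    show "\<exists>x \<theta>. (x, \<theta>) \<in> A \<and> p \<in> P x \<and> snd (c x) p = \<theta> (snd (c x0) p)"
      using A0 Nx(1)[OF p(1)] by blast
    fix q assume q: "q \<in> comp p"
    have qK: "q \<in> K" "F q = F p" using comp_D[OF q] by auto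
    obtain x' where x': "x' \<in> X0" "q \<in> U x'" "snd (c x') q \<in> C x'" using pc(11)[OF qK(1)] qK(2) Nx(4)[OF p(1)] by auto
    have qP: "q \<in> P x'" using x' qK by (simp add: P_def)
    have "norm (F q) < \<delta>" using smallF(3)[OF qP x'(1)] T'(5) by simp
    then have "iso q" by (rule iso_K[OF qK(1) smallF(4)[OF qP x'(1)]])
    then obtain W where W: "open W" "q \<in> W" "!!w. w \<in> W ==> F w = F q ==> snd (c x') w = snd (c x') q"
      using iso_chart[of q "c x'"] box_D(1,3)[OF bU[OF x'(1)]] x'(2) by blast
    show "\<exists>T. openin (top_of_set (comp p)) T \<and> q \<in> T \<and>
       (\<forall>w\<in>T. \<forall>y\<in>T. (\<exists>x \<theta>. (x, \<theta>) \<in> A \<and> w \<in> P x \<and> snd (c x) w = \<theta> (snd (c x0) p)) -->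
          (\<exists>x \<theta>. (x, \<theta>) \<in> A \<and> y \<in> P x \<and> snd (c x) y = \<theta> (snd (c x0) p)))"
    proof (intro exI[of _ "comp p \<inter> (W \<inter> U x')"] conjI ballI impI)
      show "openin (top_of_set (comp p)) (comp p \<inter> (W \<inter> U x'))"
        by (intro openin_open_Int open_Int W(1) box_D(2)[OF bU[OF x'(1)]])
      show "q \<in> comp p \<inter> (W \<inter> U x')" using q W(2) x'(2) by blast
      fix w y assume w: "w \<in> comp p \<inter> (W \<inter> U x')" and y: "y \<in> comp p \<inter> (W \<inter> U x')"
      assume "\<exists>x \<theta>. (x, \<theta>) \<in> A \<and> w \<in> P x \<and> snd (c x) w = \<theta> (snd (c x0) p)"
      then obtain x \<theta> where x: "(x, \<theta>) \<in> A" "w \<in> P x" "snd (c x) w = \<theta> (snd (c x0) p)" by blast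
      have sn: "snd (c x') u = snd (c x') q \<and> u \<in> P x'" if "u \<in> comp p \<inter> (W \<inter> U x')" for u
      proof -
        have "u \<in> K" "F u = F q" using comp_D[of u p] that qK(2) by auto
        then show ?thesis using W(3)[of u] that x'(3) by (simp add: P_def)
      qed
      have "x \<in> X0" using subsetD[OF AInv x(1)] by (auto simp: Inv_def)
      then have e: "edge x x'" using x(2) sn[OF w] x'(1) by (auto simp: edge_def)
      have "snd (c x') y = snd (c x') w" using sn[OF w] sn[OF y] by simp
      also have "\<dots> = \<kappa> x x' (snd (c x) w)" using \<kappa>[OF e] x(2) by (auto simp: P_def)
      finally have "snd (c x') y = \<kappa> x x' (\<theta> (snd (c x0) p))" using x(3) by simp
      then show "\<exists>x \<theta>. (x, \<theta>) \<in> A \<and> y \<in> P x \<and> snd (c x) y = \<theta> (snd (c x0) p)"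
        using Astep[OF x(1) e] sn[OF y] by (intro exI[of _ x'] exI[of _ "%t. \<kappa> x x' (\<theta> t)"]) simp
    qed
  qed
  define \<Psi> where "\<Psi> = (%(x, \<theta>) z. \<kappa>s x (\<theta> (snd (c x0) z))) ` {(x, \<theta>) \<in> A. en x}"
  show ?thesis
  proof (intro exI[of _ N] exI[of _ \<Psi>] conjI ballI allI impI)
    show "open N" "z0 \<in> N" by fact+
    show "N \<subseteq> ball 0 \<epsilon>" by (auto simp: N_def)
    show "countable \<Psi>" unfolding \<Psi>_def by (intro countable_image countable_subset[OF _ cA]) auto
    fix \<psi> assume "\<psi> \<in> \<Psi>"
    then obtain x \<theta> where x: "(x, \<theta>) \<in> A" "en x" "\<psi> = (%z. \<kappa>s x (\<theta> (snd (c x0) z)))" by (auto simp: \<Psi>_def)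
    have I: "x \<in> X0" "holo_map_on \<theta> (C x0)" "\<theta> ` C x0 \<subseteq> C x" "!!t. t \<in> C x0 ==> surj (%v. jac \<theta> t *v v)"
      "!!p p'. p \<in> N ==> p' \<in> P x ==> snd (c x) p' = \<theta> (snd (c x0) p) ==> p' \<in> comp p"
      using subsetD[OF AInv x(1)] by (auto simp: Inv_def)
    have \<kappa>h: "holo_map_on (\<kappa>s x) (C x)" using \<kappa>s[OF x(2)] C(3)[OF I(1)] holo_map_subset by blast
    show "transverse \<psi> N"
      unfolding transverse_def
    proof (intro bexI[of _ "c x0"] conjI exI[of _ "%t. \<kappa>s x (\<theta> t)"] ballI)
      show "c x0 \<in> \<A>" by (rule box_D(1)[OF bU[OF x0(1)]])
      show "N \<subseteq> fst (c x0)" using box_D(3)[OF bU[OF x0(1)]] by (auto simp: N_def)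
      have "holo_map_on (%t. \<kappa>s x (\<theta> t)) (C x0)" by (rule holo_map_compose[OF I(2) \<kappa>h]) (use I(3) in blast)
      then show "holo_map_on (%t. \<kappa>s x (\<theta> t)) (snd (c x0) ` N)" by (rule holo_map_subset) (use Nx(3) in blast)
      fix z assume z: "z \<in> N"
      show "\<psi> z = \<kappa>s x (\<theta> (snd (c x0) z))" by (simp add: x(3))
      show "surj (%v. jac (%t. \<kappa>s x (\<theta> t)) (snd (c x0) z) *v v)"
      proof -
        have "\<theta> (snd (c x0) z) \<in> C x" using I(3) Nx(3)[OF z] by blast
        moreover from this have "\<theta> (snd (c x0) z) \<in> snd (c x) ` (K \<inter> U x)" using C(3)[OF I(1)] by blast
        then have "surj (%v. jac (\<kappa>s x) (\<theta> (snd (c x0) z)) *v v)" by (rule bspec[OF conjunct2[OF conjunct2[OF \<kappa>s[OF x(2)]]]])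
        ultimately show ?thesis by (rule surj_jac_compose[OF I(2) \<kappa>h Nx(3)[OF z] _ I(4)[OF Nx(3)[OF z]]])
      qed
    qed
    fix z assume z: "z \<in> N"
    have s: "\<theta> (snd (c x0) z) \<in> C x" using I(3) Nx(3)[OF z] by blast
    then obtain p' where p': "p' \<in> K \<inter> U x" "snd (c x) p' = \<theta> (snd (c x0) z)" "p' \<in> P x" using C(3)[OF I(1)] unfolding P_def by auto
    have "p' \<in> comp z" by (rule I(5)[OF z p'(3,2)])
    moreover have "snd cs p' = \<psi> z" using \<kappa>s[OF x(2)] p'(1,2) x(3) by simp
    moreover have "\<psi> z \<in> B" using \<kappa>sC[OF x(2)] s x(3) by blast
    ultimately show "rel cs Vs B z (\<psi> z)" unfolding rel_def using p'(1) enU[OF x(2)] by blast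
  next
    fix z t assume z: "z \<in> N" and r: "rel cs Vs B z t"
    then obtain p where p: "t \<in> B" "p \<in> comp z" "p \<in> Vs" "snd cs p = t" by (auto simp: rel_def)
    \<comment> \<open>The plaque with parameter \<open>t\<close> is also met in \<open>Q\<close>,
      which makes the last piece of the chain an entry piece.\<close>
    obtain p' where p': "p' \<in> Q" "snd cs p' = t" using T'(4) p(1) by blast
    have "p' \<in> comp z" by (rule comp_plaque[OF T'(1) _ _ _ p(2)]) (use p p' T'(3) comp_D[OF p(2)] in auto)
    then obtain x \<theta> where x: "(x, \<theta>) \<in> A" "p' \<in> P x" "snd (c x) p' = \<theta> (snd (c x0) z)" using chain[OF z] by blast
    have "x \<in> X0" using subsetD[OF AInv x(1)] by (auto simp: Inv_def)
    then have e: "en x" using x(2) p' p(1) by (auto simp: en_def)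
    have eq: "t = \<kappa>s x (\<theta> (snd (c x0) z))" using \<kappa>s[OF e] x(2,3) p'(2) by (auto simp: P_def)
    have mem: "(%z. \<kappa>s x (\<theta> (snd (c x0) z))) \<in> \<Psi>" unfolding \<Psi>_def using x(1) e by (intro image_eqI[of _ _ "(x, \<theta>)"]) auto
    show "\<exists>\<psi>\<in>\<Psi>. \<psi> z = t" by (rule bexI[OF _ mem]) (simp add: eq)
  qed
qed

end

section \<open>Continuation of branches\<close>

lemma holo_exp:
  assumes "holo_fun_on h U" shows "holo_fun_on (%z. exp (h z)) U"
proof (rule holo_I')
  fix z assume z: "z \<in> U"
  have "(exp has_derivative (%w. exp (h z) * w)) (at (h z))"
    using DERIV_exp[of "h z"] unfolding has_field_derivative_def .
  then have "((%z. exp (h z)) has_derivative (%v. exp (h z) * cdot (grad h z) v)) (at z)"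
    by (rule has_derivative_compose[OF holo_D[OF assms z]])
  then show "\<exists>L. ((%z. exp (h z)) has_derivative L) (at z) \<and> (\<forall>c v. L (c *s v) = c * L v)"
    by (intro exI conjI) (auto simp: algebra_simps)
qed

lemma agree_convex:
  assumes "holo_map_on \<phi> U" "holo_map_on \<psi> U" "open U" "convex U" and W: "open W" "W ~= {}" "W \<subseteq> U"
    and eq: "!!x. x \<in> W ==> \<phi> x = \<psi> x" and x: "x \<in> U"
  shows "\<phi> x = \<psi> x"
  unfolding vec_eq_iff
proof
  fix i
  have "holo_fun_on (%z. \<phi> z $ i - \<psi> z $ i) U" using assms(1,2) by (intro holo_diff) (auto simp: holo_map_on_def)
  then have "\<phi> x $ i - \<psi> x $ i = 0" by (rule identity_convex[OF _ assms(3,4) W _ x]) (simp add: eq)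
  then show "\<phi> x $ i = \<psi> x $ i" by simp
qed

text \<open>Countably many closed coincidence sets cover a ball, so one of them has interior, and
  from there the identity theorem takes over.\<close>

lemma baire_agree:
  fixes \<phi> :: "complex^'n => complex^'q"
  assumes W: "open W" "convex W" "W ~= {}" and \<phi>: "holo_map_on \<phi> W"
    and \<Psi>: "countable \<Psi>" "!!\<psi>. \<psi> \<in> \<Psi> ==> holo_map_on \<psi> W" and cover: "!!x. x \<in> W ==> \<exists>\<psi>\<in>\<Psi>. \<psi> x = \<phi> x"
  shows "\<exists>\<psi>\<in>\<Psi>. \<forall>x\<in>W. \<psi> x = \<phi> x"
proof -
  obtain a where "a \<in> W" using W(3) by blast
  then obtain r where r: "r > 0" "cball a r \<subseteq> W" using W(1) open_contains_cball by blast
  define T where "T \<psi> = cball a r - {x\<in>cball a r. \<psi> x = \<phi> x}" for \<psi>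
  have oT: "openin (top_of_set (cball a r)) (T \<psi>)" if \<psi>: "\<psi> \<in> \<Psi>" for \<psi>
  proof -
    have "continuous_on (cball a r) (%x. \<psi> x - \<phi> x)"
      by (intro continuous_intros continuous_on_subset[OF holo_map_continuous[OF \<Psi>(2)[OF \<psi>]] r(2)]
          continuous_on_subset[OF holo_map_continuous[OF \<phi>] r(2)])
    then have "closedin (top_of_set (cball a r)) (cball a r \<inter> (%x. \<psi> x - \<phi> x) -` {0})"
      by (rule continuous_closedin_preimage) simp
    moreover have "cball a r \<inter> (%x. \<psi> x - \<phi> x) -` {0} = {x\<in>cball a r. \<psi> x = \<phi> x}" by auto
    ultimately show ?thesis unfolding T_def by (simp add: openin_diff)
  qed
  have "\<not> (\<forall>\<psi>\<in>\<Psi>. cball a r \<subseteq> closure (T \<psi>))"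
  proof
    assume d: "\<forall>\<psi>\<in>\<Psi>. cball a r \<subseteq> closure (T \<psi>)"
    have "cball a r \<subseteq> closure (\<Inter>(T ` \<Psi>))"
      by (rule Baire) (use oT d \<Psi>(1) in auto)
    moreover have "\<Inter>(T ` \<Psi>) = {}"
    proof -
      have False if x: "x \<in> \<Inter>(T ` \<Psi>)" for x
      proof -
        obtain \<psi>0 where "\<psi>0 \<in> \<Psi>" using cover \<open>a \<in> W\<close> by blast
        then have "x \<in> T \<psi>0" using x by blast
        then have xb: "x \<in> cball a r" by (simp add: T_def)
        then obtain \<psi> where "\<psi> \<in> \<Psi>" "\<psi> x = \<phi> x" using cover r(2) by blast
        moreover from this have "x \<in> T \<psi>" using x by blast
        ultimately show False by (simp add: T_def)
      qed
      then show ?thesis by blast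
    qed
    ultimately show False using r(1) by (metis centre_in_cball closure_empty empty_iff less_imp_le subsetD)
  qed
  then obtain \<psi> y where \<psi>: "\<psi> \<in> \<Psi>" "y \<in> cball a r" "y \<notin> closure (T \<psi>)" by blast
  define U where "U = ball a r \<inter> - closure (T \<psi>)"
  have U: "open U" "U \<subseteq> W" using r(2) ball_subset_cball[of a r] by (auto simp: U_def open_Int)
  have "y \<in> closure (ball a r)" using \<psi>(2) r(1) by simp
  moreover have "open (- closure (T \<psi>))" "y \<in> - closure (T \<psi>)" using \<psi>(3) by auto
  ultimately have Une: "U ~= {}" unfolding U_def by (metis Int_commute closure_iff_nhds_not_empty order_refl)
  have "\<psi> x = \<phi> x" if "x \<in> U" for x
  proof -
    have "x \<in> cball a r" "x \<notin> T \<psi>" using that closure_subset[of "T \<psi>"] by (auto simp: U_def)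
    then show ?thesis by (simp add: T_def)
  qed
  then have "\<psi> x = \<phi> x" if "x \<in> W" for x
    using agree_convex[OF \<Psi>(2)[OF \<psi>(1)] \<phi> W(1,2) U(1) Une U(2) _ that] by blast
  then show ?thesis using \<psi>(1) by blast
qed

lemma dual_functionals:
  fixes e v :: "complex^'n"
  assumes "e ~= 0" "!!c. v ~= c *s e"
  obtains a b where "cdot a e = 1" "cdot a v = 0" "cdot b e = 0" "cdot b v = 1"
proof -
  obtain i1 where i1: "e $ i1 ~= 0" using assms(1) by (auto simp: vec_eq_iff)
  define w where "w = v - (v $ i1 / e $ i1) *s e"
  have "w ~= 0" using assms(2)[of "v $ i1 / e $ i1"] by (simp add: w_def)
  then obtain i2 where i2: "w $ i2 ~= 0" by (auto simp: vec_eq_iff)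
  define b :: "complex^'n" where "b = (1 / w $ i2) *s (axis i2 1 - (e $ i2 / e $ i1) *s axis i1 1)"
  define a :: "complex^'n" where "a = (1 / e $ i1) *s axis i1 1 - (v $ i1 / e $ i1) *s b"
  have be: "cdot b e = 0" using i1 by (simp add: b_def)
  have "cdot b v = (1 / w $ i2) * (v $ i2 - e $ i2 / e $ i1 * v $ i1)" by (simp add: b_def diff_divide_distrib mult.commute)
  also have "v $ i2 - e $ i2 / e $ i1 * v $ i1 = w $ i2" by (simp add: w_def)
  finally have bv: "cdot b v = 1" using i2 by simp
  show ?thesis by (rule that[of a b]) (use i1 be bv in \<open>simp_all add: a_def\<close>)
qed

lemma convex_tube: "convex S ==> convex (\<Union>z\<in>S. ball z \<sigma>)" for S :: "'a::real_normed_vector set"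
proof -
  assume "convex S"
  have "(\<Union>z\<in>S. ball z \<sigma>) = (\<Union>x\<in>S. \<Union>y\<in>ball 0 \<sigma>. {x + y})"
  proof (intro set_eqI iffI)
    fix u assume "u \<in> (\<Union>z\<in>S. ball z \<sigma>)"
    then obtain z where "z \<in> S" "dist z u < \<sigma>" by auto
    then show "u \<in> (\<Union>x\<in>S. \<Union>y\<in>ball 0 \<sigma>. {x + y})"
      by (intro UN_I[of z] UN_I[of "u - z"]) (auto simp: dist_norm norm_minus_commute)
  next
    fix u assume "u \<in> (\<Union>x\<in>S. \<Union>y\<in>ball 0 \<sigma>. {x + y})"
    then obtain x y where "x \<in> S" "norm y < \<sigma>" "u = x + y" by auto
    then show "u \<in> (\<Union>z\<in>S. ball z \<sigma>)" by (intro UN_I[of x]) (auto simp: dist_norm)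
  qed
  then show ?thesis using convex_sums[OF \<open>convex S\<close> convex_ball[of 0 \<sigma>]] by simp
qed

section \<open>Generic directions whose circle of lines avoids the zero fibre\<close>

context isolated
begin

text \<open>Near \<open>x\<close> the zero fibre is contained in a level set of complex dimension
  \<open>n - q\<close>. Two real parameters for \<open>l\<close> and one for the argument of \<xi>
  bring the real dimension to \<open>2n - 2q + 3\<close>, which is less than \<open>2n\<close> as
  \<open>q \<ge> 2\<close>.\<close>

lemma negligible_cone:
  assumes x: "x \<in> ball 0 \<rho>0" "x ~= 0" "F x = 0"
  shows "\<exists>V. open V \<and> x \<in> V \<and> negligible {v. \<exists>x'\<in>V. F x' = 0 \<and> (\<exists>l \<xi>. cmod \<xi> = 1 \<and> x' = l *s e + \<xi> *s v)}"
proof -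
  obtain c where c: "c \<in> \<A>" "x \<in> fst c" using chart_at[OF x(1,2)] by blast
  obtain V1 where V1: "open V1" "x \<in> V1" "V1 \<subseteq> fst c" "!!p. p \<in> V1 ==> F p = 0 ==> snd c p = snd c x"
    using isol[OF c x(1,3)] by blast
  obtain \<iota> :: "'q => 'n" and \<Phi> :: "complex^'n => complex^'n" and V W where C: "inj \<iota>" "x \<in> V" "V \<subseteq> V1"
    "biholomorphic \<Phi> V W" "!!z j. \<Phi> z $ \<iota> j = snd c z $ j"
    using submersion_chart[OF V1(1) holo_map_subset[OF chart_D(4)[OF c(1)] V1(3)] V1(2) chart_D(5)[OF c]] by blast
  note B = biholomorphic_D[OF C(4)]
  have "\<not> CARD('q) \<le> Suc 0" using q2 by simp
  then obtain j1 j2 :: 'q where j: "j1 ~= j2" using card_le_Suc0_iff_eq[of "UNIV :: 'q set"] by auto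
  define s :: "complex^'n => complex^'n" where "s u = (\<chi> i. if i \<in> range \<iota> then snd c x $ inv \<iota> i else u $ i)" for u
  \<comment> \<open>The coordinates in \<open>range \<iota>\<close> are fixed on the level set, so
    two of them are free to carry \<open>l\<close> and the argument of \<xi>; from these data
    \<open>g\<close> recovers \<open>v\<close>.\<close>
  define g :: "complex^'n => complex^'n" where "g u = exp (- \<i> * u $ \<iota> j2) *s (the_inv_into V \<Phi> (s u) - u $ \<iota> j1 *s e)" for u
  have sh: "holo_map_on s UNIV" unfolding holo_map_on_def
  proof
    fix i show "holo_fun_on (%u. s u $ i) UNIV" by (cases "i \<in> range \<iota>") (auto simp: s_def)
  qed
  define D where "D = s -` W"
  have gh: "holo_map_on g D" unfolding holo_map_on_def
  proof
    fix i
    have "holo_map_on (%u. the_inv_into V \<Phi> (s u)) D"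
      by (rule holo_map_compose[OF holo_map_subset[OF sh] B(4)]) (auto simp: D_def)
    then have "holo_fun_on (%u. the_inv_into V \<Phi> (s u) $ i) D" by (simp add: holo_map_on_def)
    then show "holo_fun_on (%u. g u $ i) D" unfolding g_def vector_smult_component vector_minus_component
      by (intro holo_mult holo_exp holo_diff holo_const holo_nth)
  qed
  \<comment> \<open>The condition says that the coordinate \<open>\<iota> j2\<close> is real, as an
    argument should be; this is what makes the source negligible.\<close>
  define S where "S = {u. u \<bullet> axis (\<iota> j2) \<i> = 0} \<inter> D"
  have "negligible {u :: complex^'n. u \<bullet> axis (\<iota> j2) \<i> = 0}"
    using negligible_hyperplane[of "axis (\<iota> j2) \<i> :: complex^'n" 0] by (simp add: inner_commute axis_eq_0_iff)
  then have "negligible S" unfolding S_def by (rule negligible_subset) auto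
  moreover have "g differentiable_on S"
    unfolding differentiable_on_def differentiable_def
    using has_derivative_at_withinI[OF holo_map_D[OF gh]] by (auto simp: S_def)
  ultimately have neg: "negligible (g ` S)" by (intro negligible_differentiable_image_negligible) auto
  have "{v. \<exists>x'\<in>V. F x' = 0 \<and> (\<exists>l \<xi>. cmod \<xi> = 1 \<and> x' = l *s e + \<xi> *s v)} \<subseteq> g ` S"
  proof
    fix v assume "v \<in> {v. \<exists>x'\<in>V. F x' = 0 \<and> (\<exists>l \<xi>. cmod \<xi> = 1 \<and> x' = l *s e + \<xi> *s v)}"
    then obtain x' l \<xi> where x': "x' \<in> V" "F x' = 0" "cmod \<xi> = 1" "x' = l *s e + \<xi> *s v" by blast
    obtain th where th: "\<xi> = exp (\<i> * of_real th)" using complex_norm_eq_1_exp[of \<xi>] x'(3) by metis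
    define u :: "complex^'n" where "u = (\<chi> i. if i = \<iota> j1 then l else if i = \<iota> j2 then of_real th else \<Phi> x' $ i)"
    have ne: "\<iota> j1 ~= \<iota> j2" using j C(1) by (auto dest: injD)
    have "s u $ i = \<Phi> x' $ i" for i
    proof (cases "i \<in> range \<iota>")
      case True
      then obtain k where k: "i = \<iota> k" by blast
      have "snd c x' = snd c x" using V1(4) x'(1,2) C(3) by blast
      then show ?thesis using k C(1,5) by (simp add: s_def)
    next
      case False
      then have "i ~= \<iota> j1" "i ~= \<iota> j2" by auto
      then show ?thesis using False by (simp add: s_def u_def)
    qed
    then have su: "s u = \<Phi> x'" by (simp add: vec_eq_iff)
    have "u \<in> S" using su B(10)[OF x'(1)] ne by (simp add: S_def D_def inner_axis u_def inner_complex_def)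
    moreover have "g u = v"
    proof -
      have "g u = exp (- \<i> * of_real th) *s (x' - l *s e)" using ne su B(7)[OF x'(1)] by (simp add: g_def u_def)
      also have "\<dots> = exp (- \<i> * of_real th) *s (exp (\<i> * of_real th) *s v)" using x'(4) th by simp
      also have "\<dots> = v" by (simp add: vector_smult_assoc flip: exp_add)
      finally show ?thesis .
    qed
    ultimately show "v \<in> g ` S" by blast
  qed
  then have "negligible {v. \<exists>x'\<in>V. F x' = 0 \<and> (\<exists>l \<xi>. cmod \<xi> = 1 \<and> x' = l *s e + \<xi> *s v)}" using neg negligible_subset by blast
  then show ?thesis using B(1) C(2) by blast
qed

text \<open>By Lindelof the bad directions form a countable union of negligible sets, and the
  multiples of \<open>e\<close> are negligible too, so some direction is left in every ball about
  \<open>0\<close>.\<close>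

lemma exists_direction:
  assumes "s > 0"
  obtains v where "norm v < s" "!!c. v ~= c *s e" "!!l \<xi>. cmod \<xi> = 1 ==> norm (l *s e + \<xi> *s v) < \<rho>0 ==> F (l *s e + \<xi> *s v) ~= 0"
proof -
  define X where "X = {x\<in>ball 0 \<rho>0. x ~= 0 \<and> F x = 0}"
  define Bd where "Bd V = {v. \<exists>x'\<in>V. F x' = 0 \<and> (\<exists>l \<xi>. cmod \<xi> = 1 \<and> x' = l *s e + \<xi> *s v)}" for V
  have "\<forall>x\<in>X. \<exists>V. open V \<and> x \<in> V \<and> negligible (Bd V)" using negligible_cone unfolding X_def Bd_def by blast
  from bchoice[OF this] obtain V where "\<forall>x\<in>X. open (V x) \<and> x \<in> V x \<and> negligible (Bd (V x))" ..
  then have V: "!!x. x \<in> X ==> open (V x) \<and> x \<in> V x \<and> negligible (Bd (V x))" by simp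
  obtain \<V> where \<V>: "\<V> \<subseteq> V ` X" "countable \<V>" "\<Union>\<V> = \<Union>(V ` X)"
    using Lindelof[of "V ` X"] V by blast
  have n1: "negligible (\<Union>W\<in>\<V>. Bd W)"
    by (rule negligible_countable_Union) (use \<V>(1,2) V in auto)
  define i0 :: 'n where "i0 = undefined"
  define g :: "complex^'n => complex^'n" where "g u = (u $ i0) *s e" for u
  have n2: "negligible (range (%c. c *s e))"
  proof -
    have "\<not> CARD('n) \<le> Suc 0" using q2 card_less by simp
    then obtain k1 k2 :: 'n where k: "k1 ~= k2" using card_le_Suc0_iff_eq[of "UNIV :: 'n set"] by auto
    obtain i :: 'n where i: "i ~= i0" using k by metis
    have "negligible {u :: complex^'n. u \<bullet> axis i \<i> = 0}"
      using negligible_hyperplane[of "axis i \<i> :: complex^'n" 0] by (simp add: inner_commute axis_eq_0_iff)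
    moreover have gh: "holo_map_on g UNIV" by (auto simp: holo_map_on_def g_def intro!: holo_mult)
    then have "g differentiable_on {u. u \<bullet> axis i \<i> = 0}"
      unfolding differentiable_on_def differentiable_def using has_derivative_at_withinI[OF holo_map_D[OF gh]] by auto
    ultimately have "negligible (g ` {u. u \<bullet> axis i \<i> = 0})" by (intro negligible_differentiable_image_negligible) auto
    moreover have "range (%c. c *s e) \<subseteq> g ` {u. u \<bullet> axis i \<i> = 0}"
    proof
      fix y assume "y \<in> range (%c. c *s e)"
      then obtain c where "y = c *s e" by blast
      then have "y = g (c *s axis i0 1)" by (simp add: g_def)
      moreover have "(c *s axis i0 (1::complex)) $ i = 0" using i by (simp add: axis_def)
      then have "c *s axis i0 1 \<in> {u. u \<bullet> axis i \<i> = 0}" by (simp add: inner_axis del: vector_smult_component)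
      ultimately show "y \<in> g ` {u. u \<bullet> axis i \<i> = 0}" by blast
    qed
    ultimately show ?thesis using negligible_subset by blast
  qed
  have "\<not> ball 0 s \<subseteq> (\<Union>W\<in>\<V>. Bd W) \<union> range (%c. c *s e)"
  proof
    assume "ball 0 s \<subseteq> (\<Union>W\<in>\<V>. Bd W) \<union> range (%c. c *s e)"
    then have "negligible (ball (0::complex^'n) s)" using negligible_Un[OF n1 n2] negligible_subset by blast
    then show False using open_not_negligible[of "ball (0::complex^'n) s"] assms by auto
  qed
  then obtain v where v: "norm v < s" "v \<notin> (\<Union>W\<in>\<V>. Bd W)" "v \<notin> range (%c. c *s e)" by (auto simp: subset_eq)
  show ?thesis
  proof (rule that[OF v(1)])
    show ve: "v ~= c *s e" for c using v(3) by blast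
    fix l \<xi> :: complex assume \<xi>: "cmod \<xi> = 1" and n: "norm (l *s e + \<xi> *s v) < \<rho>0"
    let ?x = "l *s e + \<xi> *s v"
    have x0: "?x ~= 0"
    proof
      assume "?x = 0"
      then have "\<xi> *s v = (- l) *s e" by (simp add: add_eq_0_iff)
      then have "(1/\<xi>) *s (\<xi> *s v) = (1/\<xi>) *s ((- l) *s e)" by simp
      moreover have "\<xi> ~= 0" using \<xi> by auto
      ultimately have "v = (- l / \<xi>) *s e" by (simp add: vector_smult_assoc)
      then show False using ve by blast
    qed
    show "F ?x ~= 0"
    proof
      assume F0: "F ?x = 0"
      then have "?x \<in> X" using n x0 by (simp add: X_def)
      then have "?x \<in> \<Union>\<V>" using V \<V>(3) by blast
      then obtain W where "W \<in> \<V>" "?x \<in> W" by blast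
      then have "v \<in> Bd W" unfolding Bd_def using F0 \<xi> by blast
      then show False using v(2) \<open>W \<in> \<V>\<close> by blast
    qed
  qed
qed

end

section \<open>Holomorphic branches and their continuation\<close>

locale targeted = good M \<A> f \<rho>0 \<epsilon> \<delta>
  for M :: "(complex^'n) set" and \<A> :: "('n::finite, 'q::finite) fol_chart set" and f \<rho>0 \<epsilon> \<delta> +
  fixes cs :: "('n, 'q) fol_chart" and Vs :: "(complex^'n) set" and B :: "(complex^'q) set" and m :: real
    and Q :: "(complex^'n) set" and R0 :: real
  assumes tgt: "target cs Vs B m Q" and R0: "0 < R0" "R0 \<le> \<epsilon>" and Fm: "!!z. z \<in> ball 0 R0 ==> norm (F z) < m"
begin

definition dom :: "(complex^'n) set" where "dom = {z\<in>ball 0 R0. F z ~= 0}"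

lemma open_dom: "open dom"
proof -
  have "ball 0 R0 \<subseteq> ball (0::complex^'n) \<rho>0" using R0 \<epsilon> by auto
  then have "open (ball 0 R0 \<inter> F -` (- {0}))" by (intro continuous_open_preimage cont_F) auto
  moreover have "dom = ball 0 R0 \<inter> F -` (- {0})" by (auto simp: dom_def)
  ultimately show ?thesis by simp
qed

text \<open>A holomorphic selection from \<open>rel\<close>; its coincidence with branches supplied
  by \<open>holonomy\<close> is a consequence of \<open>baire_agree\<close>, on convex sets.\<close>

definition lifts :: "(complex^'n => complex^'q) => (complex^'n) set => bool" where
  "lifts \<psi> W \<longleftrightarrow> open W \<and> W \<subseteq> dom \<and> holo_map_on \<psi> W \<and> (\<forall>x\<in>W. rel cs Vs B x (\<psi> x))"

lemma lifts_subset: "lifts \<psi> W ==> open W' ==> W' \<subseteq> W ==> lifts \<psi> W'"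
  unfolding lifts_def using holo_map_subset by blast

lemma transverse_subset: "transverse \<psi> N ==> N' \<subseteq> N ==> transverse \<psi> N'"
  unfolding transverse_def by (meson holo_map_subset image_mono subset_iff order_trans)

lemma transverse_holo:
  assumes "transverse \<psi> N" "open N" shows "holo_map_on \<psi> N"
proof -
  obtain d \<theta> where d: "d \<in> \<A>" "N \<subseteq> fst d" "holo_map_on \<theta> (snd d ` N)" "!!x. x \<in> N ==> \<psi> x = \<theta> (snd d x)"
    using assms(1) unfolding transverse_def by blast
  have "holo_map_on (%x. \<theta> (snd d x)) N"
    by (rule holo_map_compose[OF holo_map_subset[OF chart_D(4)[OF d(1)] d(2)] d(3)]) auto
  then have "holo_fun_on (%x. \<theta> (snd d x) $ i) N" for i by (simp add: holo_map_on_def)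
  then have "holo_fun_on (%x. \<psi> x $ i) N" for i by (rule holo_cong[OF _ assms(2)]) (simp add: d(4))
  then show ?thesis by (simp add: holo_map_on_def)
qed

text \<open>One radius serves all branches: a lift on a convex \<open>W\<close> coincides, on the
  part of \<open>W\<close> in the ball, with one of the countably many branches, and that branch is
  defined and transverse on the entire ball.\<close>

lemma local_lifts:
  assumes "z0 \<in> dom"
  shows "\<exists>r>0. ball z0 r \<subseteq> dom \<and> (\<forall>t. rel cs Vs B z0 t --> (\<exists>\<psi>. lifts \<psi> (ball z0 r) \<and> \<psi> z0 = t)) \<and>
    (\<forall>W \<psi>. lifts \<psi> W --> convex W --> W \<inter> ball z0 r ~= {} -->
      (\<exists>\<psi>'. lifts \<psi>' (ball z0 r) \<and> transverse \<psi>' (ball z0 r) \<and> (\<forall>x\<in>W \<inter> ball z0 r. \<psi>' x = \<psi> x)))"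
proof -
  have z0: "norm z0 < \<epsilon>" "F z0 ~= 0" "norm (F z0) < m" using assms R0 Fm by (auto simp: dom_def)
  from holonomy[OF tgt z0] obtain N \<Psi> where H: "open N \<and> z0 \<in> N \<and> N \<subseteq> ball 0 \<epsilon> \<and> countable \<Psi> \<and>
    (\<forall>\<psi>\<in>\<Psi>. transverse \<psi> N \<and> (\<forall>x\<in>N. rel cs Vs B x (\<psi> x))) \<and> (\<forall>x\<in>N. \<forall>t. rel cs Vs B x t --> (\<exists>\<psi>\<in>\<Psi>. \<psi> x = t))"
    by (elim exE)
  then have N: "open N" "z0 \<in> N" "countable \<Psi>" "!!\<psi>. \<psi> \<in> \<Psi> ==> transverse \<psi> N"
    "!!\<psi> x. \<psi> \<in> \<Psi> ==> x \<in> N ==> rel cs Vs B x (\<psi> x)" "!!x t. x \<in> N ==> rel cs Vs B x t ==> \<exists>\<psi>\<in>\<Psi>. \<psi> x = t"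
    by simp_all
  obtain r where r: "r > 0" "ball z0 r \<subseteq> N \<inter> dom"
    using open_contains_ball[of "N \<inter> dom"] open_Int[OF N(1) open_dom] N(2) assms by blast
  have L: "lifts \<psi> (ball z0 r)" "transverse \<psi> (ball z0 r)" if "\<psi> \<in> \<Psi>" for \<psi>
  proof -
    show t: "transverse \<psi> (ball z0 r)" using transverse_subset[OF N(4)[OF that]] r(2) by blast
    show "lifts \<psi> (ball z0 r)" unfolding lifts_def using transverse_holo[OF t open_ball] r(2) N(5)[OF that] by blast
  qed
  have 1: "\<exists>\<psi>. lifts \<psi> (ball z0 r) \<and> \<psi> z0 = t" if "rel cs Vs B z0 t" for t using N(6)[OF N(2) that] L by blast
  have 2: "\<exists>\<psi>'. lifts \<psi>' (ball z0 r) \<and> transverse \<psi>' (ball z0 r) \<and> (\<forall>x\<in>W \<inter> ball z0 r. \<psi>' x = \<psi> x)"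
    if W: "lifts \<psi> W" "convex W" "W \<inter> ball z0 r ~= {}" for W \<psi>
  proof -
    have oW: "open W" "holo_map_on \<psi> W" "!!x. x \<in> W ==> rel cs Vs B x (\<psi> x)" using W(1) by (auto simp: lifts_def)
    have "\<exists>\<psi>'\<in>\<Psi>. \<forall>x\<in>W \<inter> ball z0 r. \<psi>' x = \<psi> x"
    proof (rule baire_agree)
      show "open (W \<inter> ball z0 r)" "convex (W \<inter> ball z0 r)" using oW(1) W(2) by (auto simp: convex_Int)
      show "holo_map_on \<psi> (W \<inter> ball z0 r)" by (rule holo_map_subset[OF oW(2)]) auto
      show "holo_map_on \<psi>' (W \<inter> ball z0 r)" if "\<psi>' \<in> \<Psi>" for \<psi>'
        using L(1)[OF that] holo_map_subset[of \<psi>' "ball z0 r" "W \<inter> ball z0 r"] by (auto simp: lifts_def)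
      show "\<exists>\<psi>'\<in>\<Psi>. \<psi>' x = \<psi> x" if "x \<in> W \<inter> ball z0 r" for x using N(6) oW(3) that r(2) by blast
    qed (use W(3) N(3) in auto)
    then show ?thesis using L by blast
  qed
  show ?thesis using r 1 2 by blast
qed

end

text \<open>Two points are joined inside a complex line, where one function that is nonzero at both
  has only countably many zeros. If no \<open>h j\<close> is nonzero at both points, the sum of two
  of them is.\<close>

lemma connected_nonzero:
  fixes U :: "(complex^'n) set" and h :: "'q::finite => complex^'n => complex"
  assumes U: "open U" "convex U" and h: "!!j. holo_fun_on (h j) U"
  shows "connected {z\<in>U. \<exists>j. h j z ~= 0}"
  unfolding connected_iff_connected_component
proof (intro ballI)
  fix p p' assume p: "p \<in> {z\<in>U. \<exists>j. h j z ~= 0}" and p': "p' \<in> {z\<in>U. \<exists>j. h j z ~= 0}"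
  have "\<exists>g. holo_fun_on g U \<and> g p ~= 0 \<and> g p' ~= 0 \<and> (\<forall>z. g z ~= 0 --> (\<exists>j. h j z ~= 0))"
  proof -
    obtain j k where jk: "h j p ~= 0" "h k p' ~= 0" using p p' by blast
    show ?thesis
    proof (cases "h j p' ~= 0 \<or> h k p ~= 0")
      case True then show ?thesis using h jk by blast
    next
      case False
      have "\<exists>j. h j z ~= 0" if "h j z + h k z ~= 0" for z using that by (metis add_0)
      then show ?thesis using False jk holo_add[OF h[of j] h[of k]] by (intro exI[of _ "%z. h j z + h k z"]) auto
    qed
  qed
  then obtain g where g: "holo_fun_on g U" "g p ~= 0" "g p' ~= 0" "!!z. g z ~= 0 ==> \<exists>j. h j z ~= 0" by blast
  define L where "L l = p + l *s (p' - p)" for l :: complex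
  have cL: "continuous_on A L" for A unfolding L_def by (intro continuous_intros)
  define T where "T = {l. L l \<in> U}"
  have "T = L -` U" by (auto simp: T_def)
  then have oT: "open T" using open_vimage[OF U(1) cL] by simp
  have convT: "convex T"
  proof (rule convexI)
    fix l k :: complex and u v :: real assume a: "l \<in> T" "k \<in> T" "0 \<le> u" "0 \<le> v" "u + v = 1"
    have v: "v = 1 - u" using a(5) by simp
    have "L (u *\<^sub>R l + v *\<^sub>R k) = u *\<^sub>R L l + v *\<^sub>R L k"
      unfolding L_def v by (simp add: vec_eq_iff algebra_simps scaleR_conv_of_real[where 'a=complex])
    then show "u *\<^sub>R l + v *\<^sub>R k \<in> T" using a U(2) by (auto simp: T_def convex_def)
  qed
  have T01: "0 \<in> T" "1 \<in> T" using p p' by (auto simp: T_def L_def)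
  have hol: "(%l. g (L l)) holomorphic_on T" unfolding L_def by (rule holo_line_on[OF g(1)]) (auto simp: T_def L_def)
  have cZ: "countable {l\<in>T. g (L l) = 0}"
  proof (cases "(%l. g (L l)) constant_on T")
    case True
    then obtain k where "!!l. l \<in> T ==> g (L l) = k" by (auto simp: constant_on_def)
    moreover from this have "k ~= 0" using T01(1) g(2) by (force simp: L_def)
    ultimately have "{l\<in>T. g (L l) = 0} = {}" by auto
    then show ?thesis by (metis countable_empty)
  next
    case False
    have "\<exists>C :: nat => complex set. (\<forall>n. closed (C n)) \<and> T = (\<Union>(C ` UNIV))"
    proof (rule open_Union_compact_subsets[OF oT])
      fix C :: "nat => complex set" assume "!!n. compact (C n)" "\<Union>(range C) = T"
      then show ?thesis using compact_imp_closed by metis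
    qed
    then have "fsigma T" by (auto intro: fsigma.intros)
    then show ?thesis by (rule holomorphic_countable_zeros[OF hol oT convex_connected[OF convT] _ False])
  qed
  have "connected (T - {l\<in>T. g (L l) = 0})"
    by (rule connected_open_diff_countable[OF _ oT convex_connected[OF convT] cZ]) simp
  then have "connected (L ` (T - {l\<in>T. g (L l) = 0}))" by (intro connected_continuous_image cL)
  moreover have "L ` (T - {l\<in>T. g (L l) = 0}) \<subseteq> {z\<in>U. \<exists>j. h j z ~= 0}" using g(4) by (auto simp: T_def)
  moreover have "p = L 0" "p' = L 1" by (simp_all add: L_def)
  then have "p \<in> L ` (T - {l\<in>T. g (L l) = 0})" "p' \<in> L ` (T - {l\<in>T. g (L l) = 0})" using T01 g(2,3) by auto
  ultimately show "connected_component {z\<in>U. \<exists>j. h j z ~= 0} p p'" unfolding connected_component_def by blast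
qed

lemma (in good) transverse_cong: "transverse \<psi> N ==> (!!x. x \<in> N ==> \<phi> x = \<psi> x) ==> transverse \<phi> N"
  unfolding transverse_def by auto

context targeted
begin

lemma lifts_holo: "lifts \<psi> W ==> W' \<subseteq> W ==> holo_map_on \<psi> W'"
  unfolding lifts_def using holo_map_subset by blast

text \<open>A radius of continuation common to all points of \<open>H\<close>. The factor 4 is for
  \<open>extend\<close>, where each new centre has distance less than \<open>3 * \<sigma>\<close>
  from the part already covered.\<close>

definition uni :: "(complex^'n) set => real => bool" where
  "uni H \<sigma> \<longleftrightarrow> \<sigma> > 0 \<and> (\<forall>z\<in>H. ball z (4 * \<sigma>) \<subseteq> dom \<and> (\<forall>W \<psi>. lifts \<psi> W --> convex W --> W \<inter> ball z (4 * \<sigma>) ~= {} -->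
     (\<exists>\<psi>'. lifts \<psi>' (ball z (4 * \<sigma>)) \<and> (\<forall>x\<in>W \<inter> ball z (4 * \<sigma>). \<psi>' x = \<psi> x))))"

lemma uniform:
  assumes H: "compact H" "H \<subseteq> dom" and s: "s > 0" shows "\<exists>\<sigma>\<le>s. uni H \<sigma>"
proof -
  define P where "P z0 r \<longleftrightarrow> r > 0 \<and> ball z0 r \<subseteq> dom \<and> (\<forall>W \<psi>. lifts \<psi> W --> convex W --> W \<inter> ball z0 r ~= {} -->
      (\<exists>\<psi>'. lifts \<psi>' (ball z0 r) \<and> (\<forall>x\<in>W \<inter> ball z0 r. \<psi>' x = \<psi> x)))" for z0 r
  have "\<exists>r. P z0 r" if z0: "z0 \<in> H" for z0
  proof -
    have "z0 \<in> dom" using z0 H(2) by blast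
    from local_lifts[OF this] obtain r where r: "r > 0" "ball z0 r \<subseteq> dom"
      "\<forall>W \<psi>. lifts \<psi> W --> convex W --> W \<inter> ball z0 r ~= {} -->
        (\<exists>\<psi>'. lifts \<psi>' (ball z0 r) \<and> transverse \<psi>' (ball z0 r) \<and> (\<forall>x\<in>W \<inter> ball z0 r. \<psi>' x = \<psi> x))" by (elim exE conjE)
    have "P z0 r" unfolding P_def
    proof (intro conjI r(1,2) allI impI)
      fix W \<psi> assume "lifts \<psi> W" "convex W" "W \<inter> ball z0 r ~= {}"
      then have "\<exists>\<psi>'. lifts \<psi>' (ball z0 r) \<and> transverse \<psi>' (ball z0 r) \<and> (\<forall>x\<in>W \<inter> ball z0 r. \<psi>' x = \<psi> x)" using r(3) by simp
      then show "\<exists>\<psi>'. lifts \<psi>' (ball z0 r) \<and> (\<forall>x\<in>W \<inter> ball z0 r. \<psi>' x = \<psi> x)" by (elim exE conjE) (intro exI conjI)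
    qed
    then show ?thesis ..
  qed
  then obtain e where e: "e > 0" "!!z. z \<in> H ==> \<exists>G\<in>{ball z0 r | z0 r. P z0 r}. ball z e \<subseteq> G"
  proof (elim Heine_Borel_lemma[OF H(1), of "{ball z0 r | z0 r. P z0 r}", rotated 2], goal_cases)
    case 1
    show ?case
    proof
      fix z assume "z \<in> H"
      then obtain r where "P z r" using 1(1) by blast
      then show "z \<in> \<Union>{ball z0 r | z0 r. P z0 r}" by (auto simp: P_def intro!: exI[of _ "ball z r"])
    qed
  qed auto
  define \<sigma> where "\<sigma> = min s (e / 4)"
  have \<sigma>: "\<sigma> > 0" "\<sigma> \<le> s" "4 * \<sigma> \<le> e" using s e(1) by (auto simp: \<sigma>_def)
  have "uni H \<sigma>" unfolding uni_def
  proof (intro conjI ballI allI impI \<sigma>(1))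
    fix z assume "z \<in> H"
    then obtain z0 r where z0: "P z0 r" "ball z e \<subseteq> ball z0 r" using e(2) by blast
    have sub: "ball z (4 * \<sigma>) \<subseteq> ball z0 r" using z0(2) \<sigma>(3) subset_ball[of "4 * \<sigma>" e z] by blast
    then show "ball z (4 * \<sigma>) \<subseteq> dom" using z0(1) unfolding P_def by blast
    fix W \<psi> assume W: "lifts \<psi> W" "convex W" "W \<inter> ball z (4 * \<sigma>) ~= {}"
    then have "W \<inter> ball z0 r ~= {}" using sub by blast
    then obtain \<psi>' where "lifts \<psi>' (ball z0 r)" "\<forall>x\<in>W \<inter> ball z0 r. \<psi>' x = \<psi> x" using z0(1) W(1,2) unfolding P_def by blast
    then show "\<exists>\<psi>'. lifts \<psi>' (ball z (4 * \<sigma>)) \<and> (\<forall>x\<in>W \<inter> ball z (4 * \<sigma>). \<psi>' x = \<psi> x)"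
      using lifts_subset[of \<psi>' "ball z0 r" "ball z (4 * \<sigma>)"] sub by blast
  qed
  then show ?thesis using \<sigma>(2) by blast
qed

text \<open>The tube about a convex set is exhausted by its intersections with balls about
  \<open>q0\<close> of radii \<open>(j + 1) * \<sigma>\<close>. Convexity of the parts makes the
  local continuations unique, so that they fit together.\<close>

lemma extend:
  assumes uni: "uni H \<sigma>" and Q0: "Q0 \<subseteq> H" "convex Q0" "bounded Q0" "q0 \<in> Q0" and \<psi>0: "lifts \<psi>0 (ball q0 \<sigma>)"
  shows "\<exists>\<psi>. lifts \<psi> (\<Union>z\<in>Q0. ball z \<sigma>) \<and> (\<forall>x\<in>ball q0 \<sigma>. \<psi> x = \<psi>0 x)"
proof -
  have \<sigma>: "\<sigma> > 0" using uni by (simp add: uni_def)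
  define O' where "O' = (\<Union>z\<in>Q0. ball z \<sigma>)"
  have O': "open O'" "convex O'" "ball q0 \<sigma> \<subseteq> O'" using convex_tube[OF Q0(2)] Q0(4) by (auto simp: O'_def)
  have q0O: "q0 \<in> O'" using O'(3) \<sigma> by auto
  have claim: "\<exists>\<psi>. lifts \<psi> (O' \<inter> ball q0 ((real j + 1) * \<sigma>)) \<and> (\<forall>x\<in>ball q0 \<sigma>. \<psi> x = \<psi>0 x)" for j
  proof (induction j)
    case 0
    have "O' \<inter> ball q0 ((real 0 + 1) * \<sigma>) = ball q0 \<sigma>" using O'(3) by auto
    then show ?case using \<psi>0 by auto
  next
    case (Suc j)
    define W where "W = O' \<inter> ball q0 ((real j + 1) * \<sigma>)"
    define W' where "W' = O' \<inter> ball q0 ((real (Suc j) + 1) * \<sigma>)"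
    obtain \<psi> where \<psi>: "lifts \<psi> W" "!!x. x \<in> ball q0 \<sigma> ==> \<psi> x = \<psi>0 x" using Suc by (auto simp: W_def)
    have "ball q0 \<sigma> \<subseteq> ball q0 ((real j + 1) * \<sigma>)" "ball q0 ((real j + 1) * \<sigma>) \<subseteq> ball q0 ((real (Suc j) + 1) * \<sigma>)"
      using \<sigma> by (intro subset_ball; simp add: algebra_simps)+
    then have W: "open W" "convex W" "ball q0 \<sigma> \<subseteq> W" "W \<subseteq> W'" using O' by (auto simp: W_def W'_def open_Int convex_Int)
    \<comment> \<open>Pulling \<open>y\<close> towards \<open>q0\<close> by the factor \<tau> brings
      it within \<open>(j + 1/2) * \<sigma>\<close> of \<open>q0\<close>, into the part already
      covered, and moves it by less than \<open>2 * \<sigma>\<close>.\<close>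
    have near: "\<exists>y'\<in>W. dist y y' < 2 * \<sigma>" if y: "y \<in> W'" for y
    proof -
      define \<tau> where "\<tau> = (real j + 1/2) / (real j + 2)"
      have \<tau>: "0 \<le> \<tau>" "\<tau> \<le> 1" "\<tau> * (real j + 2) = real j + 1/2" by (auto simp: \<tau>_def)
      define y' where "y' = (1 - \<tau>) *\<^sub>R q0 + \<tau> *\<^sub>R y"
      have n: "norm (y - q0) < (real j + 2) * \<sigma>" using y by (simp add: W'_def dist_norm norm_minus_commute algebra_simps)
      have "y' - q0 = \<tau> *\<^sub>R (y - q0)" "y - y' = (1 - \<tau>) *\<^sub>R (y - q0)" by (simp_all add: y'_def algebra_simps)
      then have d: "norm (y' - q0) = \<tau> * norm (y - q0)" "norm (y - y') = (1 - \<tau>) * norm (y - q0)" using \<tau> by simp_all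
      have "\<tau> * norm (y - q0) \<le> \<tau> * ((real j + 2) * \<sigma>)" using \<tau>(1) n by (intro mult_left_mono) auto
      also have "\<dots> = (real j + 1/2) * \<sigma>" using \<tau>(3) by (simp add: mult.assoc[symmetric])
      also have "\<dots> < (real j + 1) * \<sigma>" using \<sigma> by simp
      finally have 1: "norm (y' - q0) < (real j + 1) * \<sigma>" by (simp add: d)
      have "(1 - \<tau>) * norm (y - q0) \<le> (1 - \<tau>) * ((real j + 2) * \<sigma>)" using \<tau>(2) n by (intro mult_left_mono) auto
      also have "\<dots> = (real j + 2) * \<sigma> - (real j + 1/2) * \<sigma>" by (simp only: left_diff_distrib mult_1 mult.assoc[symmetric] \<tau>(3))
      also have "\<dots> < 2 * \<sigma>" using \<sigma> by (simp add: algebra_simps)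
      finally have 2: "norm (y - y') < 2 * \<sigma>" by (simp add: d)
      have "y' \<in> O'" unfolding y'_def using O'(2) q0O y \<tau>(1,2) by (intro convexD) (auto simp: W'_def)
      then show ?thesis using 1 2 by (intro bexI[of _ y']) (auto simp: W_def dist_norm norm_minus_commute)
    qed
    define Z where "Z = {z\<in>Q0. ball z \<sigma> \<inter> W' ~= {}}"
    have "\<forall>z\<in>Z. \<exists>\<psi>'. lifts \<psi>' (ball z (4 * \<sigma>)) \<and> (\<forall>x\<in>W \<inter> ball z (4 * \<sigma>). \<psi>' x = \<psi> x)"
    proof
      fix z assume z: "z \<in> Z"
      then obtain y where y: "dist z y < \<sigma>" "y \<in> W'" by (auto simp: Z_def)
      obtain y' where "y' \<in> W" "dist y y' < 2 * \<sigma>" using near[OF y(2)] by blast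
      then have "y' \<in> W \<inter> ball z (4 * \<sigma>)" using y(1) dist_triangle[of z y' y] \<sigma> by simp
      then have ne: "W \<inter> ball z (4 * \<sigma>) ~= {}" by blast
      have "z \<in> H" using z Q0(1) by (auto simp: Z_def)
      then show "\<exists>\<psi>'. lifts \<psi>' (ball z (4 * \<sigma>)) \<and> (\<forall>x\<in>W \<inter> ball z (4 * \<sigma>). \<psi>' x = \<psi> x)"
        using uni \<psi>(1) W(2) ne unfolding uni_def by blast
    qed
    from bchoice[OF this] obtain G where G0: "\<forall>z\<in>Z. lifts (G z) (ball z (4 * \<sigma>)) \<and> (\<forall>x\<in>W \<inter> ball z (4 * \<sigma>). G z x = \<psi> x)" ..
    have G: "lifts (G z) (ball z (4 * \<sigma>))" "!!x. x \<in> W ==> x \<in> ball z (4 * \<sigma>) ==> G z x = \<psi> x" if "z \<in> Z" for z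
      using G0 that by blast+
    have s4: "ball z \<sigma> \<subseteq> ball z (4 * \<sigma>)" for z :: "complex^'n" using \<sigma> by auto
    \<comment> \<open>Both continuations agree with \<psi> on \<open>W\<close>, which meets the
      convex intersection of the two large balls.\<close>
    have cons: "G z1 y = G z2 y" if z: "z1 \<in> Z" "z2 \<in> Z" and y: "y \<in> W'" "y \<in> ball z1 \<sigma>" "y \<in> ball z2 \<sigma>" for z1 z2 y
    proof -
      obtain y' where y': "y' \<in> W" "dist y y' < 2 * \<sigma>" using near[OF y(1)] by blast
      have "y' \<in> ball z1 (4 * \<sigma>)" "y' \<in> ball z2 (4 * \<sigma>)"
        using y(2,3) y'(2) dist_triangle[of z1 y' y] dist_triangle[of z2 y' y] \<sigma> by auto
      then have ne: "ball z1 (4 * \<sigma>) \<inter> ball z2 (4 * \<sigma>) \<inter> W ~= {}" using y'(1) by blast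
      have h: "holo_map_on (G z1) (ball z1 (4 * \<sigma>) \<inter> ball z2 (4 * \<sigma>))" "holo_map_on (G z2) (ball z1 (4 * \<sigma>) \<inter> ball z2 (4 * \<sigma>))"
        by (rule lifts_holo[OF G(1)[OF z(1)]], blast, rule lifts_holo[OF G(1)[OF z(2)]], blast)
      show ?thesis
        by (rule agree_convex[OF h _ _ _ ne]) (use W(1) G(2) z y \<sigma> in \<open>auto simp: open_Int convex_Int\<close>)
    qed
    define \<psi>' where "\<psi>' y = G (SOME z. z \<in> Z \<and> y \<in> ball z \<sigma>) y" for y
    have val: "\<psi>' y = G z y" if "z \<in> Z" "y \<in> W'" "y \<in> ball z \<sigma>" for z y
    proof -
      have "(SOME z. z \<in> Z \<and> y \<in> ball z \<sigma>) \<in> Z \<and> y \<in> ball (SOME z. z \<in> Z \<and> y \<in> ball z \<sigma>) \<sigma>"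
        by (rule someI[of "%z. z \<in> Z \<and> y \<in> ball z \<sigma>" z]) (use that in blast)
      then show ?thesis unfolding \<psi>'_def using cons that by blast
    qed
    have exZ: "\<exists>z\<in>Z. y \<in> ball z \<sigma>" if "y \<in> W'" for y
    proof -
      obtain z where "z \<in> Q0" "y \<in> ball z \<sigma>" using \<open>y \<in> W'\<close> by (auto simp: W'_def O'_def)
      moreover from this have "ball z \<sigma> \<inter> W' ~= {}" using \<open>y \<in> W'\<close> by blast
      ultimately show ?thesis unfolding Z_def by blast
    qed
    have oW': "open W'" using O'(1) by (auto simp: W'_def)
    have "lifts \<psi>' W'"
      unfolding lifts_def
    proof (intro conjI ballI oW')
      show "W' \<subseteq> dom"
      proof
        fix y assume "y \<in> W'"
        then obtain z where z: "z \<in> Z" "y \<in> ball z \<sigma>" using exZ by blast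
        have "y \<in> ball z (4 * \<sigma>)" using z(2) s4 by blast
        then show "y \<in> dom" using G(1)[OF z(1)] unfolding lifts_def by blast
      qed
      show "holo_map_on \<psi>' W'" unfolding holo_map_on_def
      proof (intro allI holo_local)
        fix i y assume y: "y \<in> W'"
        then obtain z where z: "z \<in> Z" "y \<in> ball z \<sigma>" using exZ by blast
        have hG: "holo_fun_on (%x. G z x $ i) (ball z (4 * \<sigma>))" using G(1)[OF z(1)] by (simp add: lifts_def holo_map_on_def)
        have "holo_fun_on (%x. \<psi>' x $ i) (ball z \<sigma> \<inter> W')"
          by (rule holo_cong[OF holo_subset[OF hG]]) (use s4 val[OF z(1)] oW' in \<open>auto simp: open_Int\<close>)
        then show "\<exists>V. y \<in> V \<and> holo_fun_on (%x. \<psi>' x $ i) V" using y z(2) by blast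
      qed
      fix y assume y: "y \<in> W'"
      then obtain z where z: "z \<in> Z" "y \<in> ball z \<sigma>" using exZ by blast
      moreover have "y \<in> ball z (4 * \<sigma>)" using z(2) s4 by blast
      ultimately show "rel cs Vs B y (\<psi>' y)" using val[OF z(1) y z(2)] G(1)[OF z(1)] unfolding lifts_def by simp
    qed
    moreover have "\<psi>' x = \<psi>0 x" if x: "x \<in> ball q0 \<sigma>" for x
    proof -
      have xW: "x \<in> W" "x \<in> W'" using W(3,4) x by blast+
      then obtain z where z: "z \<in> Z" "x \<in> ball z \<sigma>" using exZ by blast
      have "\<psi>' x = G z x" by (rule val[OF z(1) xW(2) z(2)])
      also have "\<dots> = \<psi> x" by (rule G(2)[OF z(1) xW(1)]) (use s4 z(2) in blast)
      finally show ?thesis using \<psi>(2)[OF x] by simp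
    qed
    ultimately show ?case unfolding W'_def by blast
  qed
  obtain R where R: "!!z. z \<in> Q0 ==> dist q0 z \<le> R" using Q0(3) unfolding bounded_any_center[of _ q0] by blast
  obtain j :: nat where j: "R / \<sigma> < real j" using reals_Archimedean2 by blast
  have "O' \<subseteq> ball q0 ((real j + 1) * \<sigma>)"
  proof
    fix y assume "y \<in> O'"
    then obtain z where "z \<in> Q0" "dist z y < \<sigma>" by (auto simp: O'_def)
    moreover have "R < real j * \<sigma>" using j \<sigma> by (simp add: field_simps)
    ultimately show "y \<in> ball q0 ((real j + 1) * \<sigma>)" using R[of z] dist_triangle[of q0 y z] by (simp add: algebra_simps)
  qed
  then have "O' \<inter> ball q0 ((real j + 1) * \<sigma>) = O'" by blast
  then show ?thesis using claim[of j] unfolding O'_def by simp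
qed

end

section \<open>The Hartogs figure and the spreading of the extended branch\<close>

context targeted
begin

text \<open>The branch is continued from \<open>e\<close> along the disc in direction
  \<open>v\<close>, and from each boundary point of that disc along a disc in direction
  \<open>e\<close>. Cauchy's integral over the circle of \<xi> then defines \<phi> on a
  neighbourhood of \<open>0\<close>, including points of the zero fibre.\<close>

lemma hartogs_figure:
  assumes e: "e \<in> dom" "rel cs Vs B e t" and v: "!!c. v ~= c *s e" and small: "2 * norm e + norm v < R0"
    and disc1: "!!\<mu>. cmod \<mu> \<le> 1 ==> e + \<mu> *s v \<in> dom"
    and disc2: "!!l \<xi>. cmod l \<le> 2 ==> cmod \<xi> = 1 ==> l *s e + \<xi> *s v \<in> dom"
  shows "\<exists>B' \<phi> W. open B' \<and> convex B' \<and> 0 \<in> B' \<and> B' \<subseteq> ball 0 R0 \<and> holo_map_on \<phi> B' \<and> lifts \<phi> W \<and> convex W \<and> W ~= {} \<and> W \<subseteq> B'"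
proof -
  have F0: "F 0 = 0" by (rule F_zero)
  have e0: "e ~= 0" using e(1) F0 by (auto simp: dom_def)
  obtain a b where ab: "cdot a e = 1" "cdot a v = 0" "cdot b e = 0" "cdot b v = 1" using dual_functionals[OF e0 v] by metis
  define H1 where "H1 = (+) e ` (%\<mu>. \<mu> *s v) ` cball 0 1"
  \<comment> \<open>The radius 2 makes both \<open>0\<close> and \<open>e\<close> interior points of
    the region on which \<phi> will be defined.\<close>
  define D where "D \<xi> = (+) (\<xi> *s v) ` (%l. l *s e) ` cball 0 2" for \<xi> :: complex
  define H where "H = H1 \<union> (%(l, \<xi>). l *s e + \<xi> *s v) ` (cball 0 2 \<times> sphere 0 1)"
  have lin: "linear (%l. l *s (u :: complex^'n))" for u using bounded_linear.linear[OF bounded_linear_vsm] .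
  have cvx: "convex H1" "convex (D \<xi>)" for \<xi>
    unfolding H1_def D_def by (intro convex_translation convex_linear_image lin convex_cball)+
  have cmp: "compact H1" "compact (D \<xi>)" for \<xi>
    unfolding H1_def D_def image_image by (intro compact_continuous_image continuous_intros compact_cball)+
  have H1_in: "e + \<mu> *s v \<in> H1" if "cmod \<mu> \<le> 1" for \<mu> using that by (auto simp: H1_def image_image)
  have D_in: "l *s e + \<xi> *s v \<in> D \<xi>" if "cmod l \<le> 2" for l \<xi> using that by (auto simp: D_def image_image add.commute)
  have DH: "D \<xi> \<subseteq> H" if "\<xi> \<in> sphere 0 1" for \<xi> using that by (force simp: D_def H_def image_image add.commute)
  have "compact H" unfolding H_def
    by (intro compact_Un cmp compact_continuous_image compact_Times compact_cball compact_sphere)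
       (auto simp: case_prod_unfold intro!: continuous_intros)
  moreover have "H \<subseteq> dom" using disc1 disc2 by (auto simp: H_def H1_def)
  moreover obtain s0 where s0: "s0 > 0" "\<forall>t. rel cs Vs B e t --> (\<exists>\<psi>. lifts \<psi> (ball e s0) \<and> \<psi> e = t)"
    using local_lifts[OF e(1)] by (elim exE conjE)
  moreover from this obtain \<psi>0 where \<psi>0: "lifts \<psi>0 (ball e s0)" using e(2) by blast
  ultimately obtain \<sigma> where \<sigma>s: "\<sigma> \<le> min s0 (R0 - 2 * norm e - norm v)" and uni: "uni H \<sigma>"
    using uniform[of H "min s0 (R0 - 2 * norm e - norm v)"] small by auto
  have \<sigma>: "\<sigma> > 0" using uni by (simp add: uni_def)
  define O1 where "O1 = (\<Union>z\<in>H1. ball z \<sigma>)"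
  define Ox where "Ox \<xi> = (\<Union>z\<in>D \<xi>. ball z \<sigma>)" for \<xi>
  have eH1: "e \<in> H1" using H1_in[of 0] by simp
  have "ball e \<sigma> \<subseteq> ball e s0" using \<sigma>s by auto
  then have "lifts \<psi>0 (ball e \<sigma>)" using lifts_subset[OF \<psi>0] by blast
  then obtain \<psi>1 where \<psi>1: "lifts \<psi>1 O1"
    using extend[OF uni _ cvx(1) compact_imp_bounded[OF cmp(1)] eH1] unfolding O1_def H_def by blast
  have ball1: "ball (e + \<mu> *s v) \<sigma> \<subseteq> O1" if "cmod \<mu> \<le> 1" for \<mu> using H1_in[OF that] by (auto simp: O1_def)
  have "\<exists>\<psi>. lifts \<psi> (Ox \<xi>) \<and> (\<forall>x\<in>ball (e + \<xi> *s v) \<sigma>. \<psi> x = \<psi>1 x)" if \<xi>: "\<xi> \<in> sphere 0 1" for \<xi>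
  proof -
    have "lifts \<psi>1 (ball (e + \<xi> *s v) \<sigma>)" using lifts_subset[OF \<psi>1 open_ball ball1] \<xi> by simp
    moreover have "e + \<xi> *s v \<in> D \<xi>" using D_in[of 1 \<xi>] by simp
    ultimately show ?thesis unfolding Ox_def
      by (intro extend[OF uni DH[OF \<xi>] cvx(2) compact_imp_bounded[OF cmp(2)]])
  qed
  then have "\<forall>\<xi>\<in>sphere 0 1. \<exists>\<psi>. lifts \<psi> (Ox \<xi>) \<and> (\<forall>x\<in>ball (e + \<xi> *s v) \<sigma>. \<psi> x = \<psi>1 x)" by blast
  from bchoice[OF this] obtain P where P0: "\<forall>\<xi>\<in>sphere 0 1. lifts (P \<xi>) (Ox \<xi>) \<and> (\<forall>x\<in>ball (e + \<xi> *s v) \<sigma>. P \<xi> x = \<psi>1 x)" ..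
  have P: "lifts (P \<xi>) (Ox \<xi>)" "!!x. x \<in> ball (e + \<xi> *s v) \<sigma> ==> P \<xi> x = \<psi>1 x" if "\<xi> \<in> sphere 0 1" for \<xi> using P0 that by blast+
  have oO: "open O1" "open (Ox \<xi>)" "convex (Ox \<xi>)" for \<xi> using convex_tube[OF cvx(2)] by (auto simp: O1_def Ox_def)
  have ballx: "ball (l *s e + \<xi> *s v) \<sigma> \<subseteq> Ox \<xi>" if "cmod l \<le> 2" for l \<xi> using D_in[OF that] by (auto simp: Ox_def)
  \<comment> \<open>Both branches continue \<psi>1, and for close \<xi> the small balls where they
    equal it overlap; the convex intersection of the two tubes carries the agreement.\<close>
  have cons: "P \<xi> x = P \<xi>' x" if \<xi>: "\<xi> \<in> sphere 0 1" "\<xi>' \<in> sphere 0 1" "cmod (\<xi> - \<xi>') * norm v < \<sigma>" and x: "x \<in> Ox \<xi>" "x \<in> Ox \<xi>'" for \<xi> \<xi>' x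
  proof -
    let ?W = "ball (e + \<xi> *s v) \<sigma> \<inter> ball (e + \<xi>' *s v) \<sigma>"
    have "dist (e + \<xi>' *s v) (e + \<xi> *s v) = norm ((\<xi> - \<xi>') *s v)"
      by (simp add: dist_norm vector_sub_rdistrib norm_minus_commute)
    also have "\<dots> < \<sigma>" using \<xi>(3) by (simp only: norm_vsm)
    finally have "e + \<xi> *s v \<in> ?W" using \<sigma> by simp
    then have ne: "?W ~= {}" by blast
    have sub: "?W \<subseteq> Ox \<xi> \<inter> Ox \<xi>'" using ballx[of 1 \<xi>] ballx[of 1 \<xi>'] by auto
    have h: "holo_map_on (P \<xi>) (Ox \<xi> \<inter> Ox \<xi>')" "holo_map_on (P \<xi>') (Ox \<xi> \<inter> Ox \<xi>')"
      by (rule lifts_holo[OF P(1)[OF \<xi>(1)]], blast, rule lifts_holo[OF P(1)[OF \<xi>(2)]], blast)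
    show ?thesis
      by (rule agree_convex[OF h _ _ _ ne sub]) (use oO P(2) \<xi> x in \<open>auto simp: open_Int convex_Int\<close>)
  qed
  define w where "w z = z - cdot a z *s e - cdot b z *s v" for z
  \<comment> \<open>The point of the line through \<open>z\<close> in direction \<open>v\<close> on
    which \<open>cdot b\<close> has the value \<xi>.\<close>
  define ar where "ar z \<xi> = z + (\<xi> - cdot b z) *s v" for z \<xi>
  have ar_eq: "ar z \<xi> = cdot a z *s e + \<xi> *s v + w z" for z \<xi>
    by (simp add: ar_def w_def vec_eq_iff algebra_simps)
  have bl_w: "bounded_linear w" unfolding w_def
    by (intro bounded_linear_sub bounded_linear_ident bounded_linear_compose[OF bounded_linear_vsm bounded_linear_cdot])
  define B' where "B' = cdot a -` ball 0 2 \<inter> (cdot b -` ball 0 1 \<inter> w -` ball 0 \<sigma>)"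
  have cw: "continuous_on UNIV w" "continuous_on UNIV (cdot a)" "continuous_on UNIV (cdot b)"
    by (intro linear_continuous_on bl_w bounded_linear_cdot)+
  have oB: "open B'" unfolding B'_def by (intro open_Int open_vimage open_ball cw)
  have cB: "convex B'" unfolding B'_def
    by (intro convex_Int convex_linear_vimage convex_ball bounded_linear.linear bl_w bounded_linear_cdot)
  have B'D: "cmod (cdot a z) < 2" "cmod (cdot b z) < 1" "norm (w z) < \<sigma>" if "z \<in> B'" for z using that by (auto simp: B'_def)
  have zB: "0 \<in> B'" using \<sigma> by (simp add: B'_def w_def)
  have B'sub: "B' \<subseteq> ball 0 R0"
  proof
    fix z assume z: "z \<in> B'"
    have "z = cdot a z *s e + cdot b z *s v + w z" by (simp add: w_def)
    then have "norm z \<le> norm (cdot a z *s e) + norm (cdot b z *s v) + norm (w z)" by (metis norm_triangle_le norm_triangle_ineq add_mono_thms_linordered_semiring(3))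
    also have "\<dots> \<le> 2 * norm e + 1 * norm v + norm (w z)" unfolding norm_vsm using B'D[OF z] by (intro add_mono mult_right_mono) auto
    also have "\<dots> < R0" using B'D(3)[OF z] \<sigma>s by simp
    finally show "z \<in> ball 0 R0" by simp
  qed
  have ar_in: "ar z \<xi> \<in> Ox \<xi>" if "z \<in> B'" for z \<xi>
  proof -
    have "ar z \<xi> \<in> ball (cdot a z *s e + \<xi> *s v) \<sigma>" using B'D(3)[OF that] by (simp add: ar_eq dist_norm)
    then show ?thesis using ballx[of "cdot a z" \<xi>] B'D(1)[OF that] by (meson less_imp_le subsetD)
  qed
  have ar_cont: "continuous_on UNIV (%x. ar (fst x) (snd x))" unfolding ar_def
    by (intro continuous_intros continuous_on_compose2[OF cw(3)]) auto
  have ar_holo: "holo_map_on (%z. ar z \<xi>) UNIV" for \<xi>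
    unfolding holo_map_on_def ar_def by (auto intro!: holo_add holo_mult holo_diff)
  define \<kappa> where "\<kappa> j z \<xi> = P \<xi> (ar z \<xi>) $ j / (\<xi> - cdot b z)" for j z \<xi>
  have nz: "\<xi> - cdot b z ~= 0" if "z \<in> B'" "\<xi> \<in> sphere 0 1" for z \<xi> using B'D(2)[OF that(1)] that(2) by auto
  \<comment> \<open>The branches \<open>P \<xi>\<close> were chosen separately for each \<xi>; near
    \<xi>0 they are replaced by the single branch \<open>P \<xi>0\<close>, using
    \<open>cons\<close>.\<close>
  have \<kappa>_cont: "continuous_on (B' \<times> sphere 0 1) (%(z, \<xi>). \<kappa> j z \<xi>)" for j
    unfolding continuous_on_eq_continuous_within
  proof
    fix x0 :: "(complex^'n) \<times> complex" assume x0: "x0 \<in> B' \<times> sphere 0 1"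
    obtain z0 \<xi>0 where x0eq: "x0 = (z0, \<xi>0)" by fastforce
    have z0: "z0 \<in> B'" "\<xi>0 \<in> sphere 0 1" using x0 x0eq by auto
    let ?g = "%x. P \<xi>0 (ar (fst x) (snd x)) $ j / (snd x - cdot b (fst x))"
    have "open ({x. cmod (snd x - \<xi>0) * norm v < \<sigma>} \<inter> (%x. ar (fst x) (snd x)) -` Ox \<xi>0)"
      by (intro open_Int open_vimage ar_cont oO open_Collect_less continuous_intros)
    moreover have "x0 \<in> {x. cmod (snd x - \<xi>0) * norm v < \<sigma>} \<inter> (%x. ar (fst x) (snd x)) -` Ox \<xi>0"
      using \<sigma> ar_in[OF z0(1)] by (simp add: x0eq)
    ultimately obtain d where d: "d > 0" "ball x0 d \<subseteq> {x. cmod (snd x - \<xi>0) * norm v < \<sigma>} \<inter> (%x. ar (fst x) (snd x)) -` Ox \<xi>0"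
      using open_contains_ball by blast
    have cg: "continuous (at x0 within B' \<times> sphere 0 1) ?g"
    proof (rule continuous_at_within_divide)
      have hP: "holo_fun_on (%x. P \<xi>0 x $ j) (Ox \<xi>0)" using lifts_holo[OF P(1)[OF z0(2)] order_refl] by (simp add: holo_map_on_def)
      have "isCont (%x. P \<xi>0 x $ j) (ar (fst x0) (snd x0))"
        using has_derivative_continuous[OF holo_D[OF hP ar_in[OF z0(1)]]] by (simp add: x0eq)
      moreover have "continuous (at x0 within B' \<times> sphere 0 1) (%x. ar (fst x) (snd x))"
        using ar_cont continuous_at_imp_continuous_at_within continuous_on_eq_continuous_at[OF open_UNIV] by blast
      ultimately show "continuous (at x0 within B' \<times> sphere 0 1) (%x. P \<xi>0 (ar (fst x) (snd x)) $ j)"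
        by (rule continuous_within_compose3)
      have "continuous_on UNIV (%x. snd x - cdot b (fst x))" by (intro continuous_intros)
      then show "continuous (at x0 within B' \<times> sphere 0 1) (%x. snd x - cdot b (fst x))"
        using continuous_at_imp_continuous_at_within continuous_on_eq_continuous_at[OF open_UNIV] by blast
      show "snd x0 - cdot b (fst x0) ~= 0" using nz[OF z0] by (simp add: x0eq)
    qed
    show "continuous (at x0 within B' \<times> sphere 0 1) (%(z, \<xi>). \<kappa> j z \<xi>)"
    proof (rule continuous_transform_within[OF cg d(1) x0])
      fix x assume x: "x \<in> B' \<times> sphere 0 1" "dist x x0 < d"
      obtain z \<xi> where xeq: "x = (z, \<xi>)" by fastforce
      have "x \<in> ball x0 d" using x(2) by (simp add: dist_commute)
      then have "cmod (\<xi> - \<xi>0) * norm v < \<sigma>" "ar z \<xi> \<in> Ox \<xi>0" using d(2) by (auto simp: xeq)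
      moreover have "z \<in> B'" "\<xi> \<in> sphere 0 1" using x(1) xeq by auto
      ultimately have "P \<xi> (ar z \<xi>) = P \<xi>0 (ar z \<xi>)" using cons[OF _ z0(2)] ar_in by blast
      then show "?g x = (case x of (z, \<xi>) => \<kappa> j z \<xi>)" by (simp add: \<kappa>_def xeq)
    qed
  qed
  have \<kappa>_holo: "holo_fun_on (%z. \<kappa> j z \<xi>) B'" if \<xi>: "\<xi> \<in> sphere 0 1" for j \<xi>
    unfolding \<kappa>_def
  proof (rule holo_divide)
    have hP: "holo_fun_on (%x. P \<xi> x $ j) (Ox \<xi>)" using lifts_holo[OF P(1)[OF \<xi>] order_refl] by (simp add: holo_map_on_def)
    show "holo_fun_on (%z. P \<xi> (ar z \<xi>) $ j) B'"
      by (rule holo_compose[OF holo_map_subset[OF ar_holo] hP]) (use ar_in in auto)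
  qed (use nz \<xi> in \<open>auto intro!: holo_diff\<close>)
  define \<phi> :: "complex^'n => complex^'q" where "\<phi> z = (\<chi> j. 1 / (2 * of_real pi * \<i>) * contour_integral (circlepath 0 1) (\<kappa> j z))" for z
  have \<phi>h: "holo_map_on \<phi> B'"
  proof -
    have "holo_fun_on (%z. contour_integral (circlepath 0 1) (\<kappa> j z)) B'" for j
      by (rule holo_contour_integral[OF oB _ \<kappa>_cont \<kappa>_holo]) auto
    then have "holo_fun_on (%z. 1 / (2 * of_real pi * \<i>) * contour_integral (circlepath 0 1) (\<kappa> j z)) B'" for j
      by (rule holo_mult[OF holo_const])
    then show ?thesis unfolding holo_map_on_def \<phi>_def by simp
  qed
  \<comment> \<open>Close to \<open>e\<close> all points \<open>ar z \<mu>\<close> with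
    \<open>cmod \<mu> \<le> 1\<close> lie in the tube \<open>O1\<close>, so Cauchy's formula
    identifies \<phi> with \<psi>1.\<close>
  define A where "A = {z. cmod (cdot a z - 1) * norm e + norm (w z) < \<sigma>}"
  have "open A" unfolding A_def by (intro open_Collect_less continuous_intros cw(1))
  then have "open (A \<inter> B')" using oB by (rule open_Int)
  moreover have "e \<in> A \<inter> B'" using \<sigma> ab by (simp add: A_def B'_def w_def)
  ultimately obtain s1 where s1: "s1 > 0" "ball e s1 \<subseteq> A \<inter> B'" using open_contains_ball by blast
  have key: "ar z \<mu> \<in> ball (e + \<mu> *s v) \<sigma>" if "z \<in> A" for z \<mu>
  proof -
    have eq: "ar z \<mu> - (e + \<mu> *s v) = (cdot a z - 1) *s e + w z" unfolding ar_eq by (simp add: vec_eq_iff algebra_simps)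
    have "dist (e + \<mu> *s v) (ar z \<mu>) = norm ((cdot a z - 1) *s e + w z)" unfolding eq[symmetric] by (rule dist_commute[THEN trans, OF dist_norm])
    also have "\<dots> \<le> norm ((cdot a z - 1) *s e) + norm (w z)" by (rule norm_triangle_ineq)
    finally have "dist (e + \<mu> *s v) (ar z \<mu>) \<le> cmod (cdot a z - 1) * norm e + norm (w z)" by (simp only: norm_vsm)
    then show ?thesis using that by (simp add: A_def)
  qed
  have \<phi>_eq: "\<phi> z = \<psi>1 z \<and> z \<in> O1" if z: "z \<in> A" "z \<in> B'" for z
  proof -
    have arb: "ar z (cdot b z) = z" by (simp add: ar_def)
    have zO: "z \<in> O1" using key[OF z(1), of "cdot b z"] ball1[of "cdot b z"] B'D(2)[OF z(2)] by (auto simp: arb)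
    have "\<phi> z $ j = \<psi>1 z $ j" for j
    proof -
      have h1: "holo_fun_on (%x. \<psi>1 x $ j) O1" using lifts_holo[OF \<psi>1 order_refl] by (simp add: holo_map_on_def)
      have ar_line: "ar z \<mu> = (z - cdot b z *s v) + \<mu> *s v" for \<mu> by (simp add: ar_def vec_eq_iff algebra_simps)
      have "(%\<mu>. \<psi>1 ((z - cdot b z *s v) + \<mu> *s v) $ j) holomorphic_on cball 0 1"
      proof (rule holo_line_on[OF h1])
        fix \<mu> :: complex assume "\<mu> \<in> cball 0 1"
        then show "(z - cdot b z *s v) + \<mu> *s v \<in> O1" using key[OF z(1), of \<mu>] ball1[of \<mu>] unfolding ar_line by auto
      qed
      then have "((%u. \<psi>1 (ar z u) $ j / (u - cdot b z)) has_contour_integral (2 * of_real pi * \<i> * \<psi>1 (ar z (cdot b z)) $ j)) (circlepath 0 1)"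
        unfolding ar_line[symmetric] by (rule Cauchy_integral_circlepath_simple) (use B'D(2)[OF z(2)] in simp)
      then have "contour_integral (circlepath 0 1) (%u. \<psi>1 (ar z u) $ j / (u - cdot b z)) = 2 * of_real pi * \<i> * \<psi>1 z $ j"
        unfolding arb by (rule contour_integral_unique)
      moreover have "contour_integral (circlepath 0 1) (\<kappa> j z) = contour_integral (circlepath 0 1) (%u. \<psi>1 (ar z u) $ j / (u - cdot b z))"
      proof (rule contour_integral_cong[OF refl])
        fix u :: complex assume "u \<in> path_image (circlepath 0 1)"
        then have u: "u \<in> sphere 0 1" by auto
        show "\<kappa> j z u = \<psi>1 (ar z u) $ j / (u - cdot b z)" unfolding \<kappa>_def using P(2)[OF u key[OF z(1)]] by simp
      qed
      ultimately show ?thesis by (simp add: \<phi>_def)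
    qed
    then show ?thesis using zO by (simp add: vec_eq_iff)
  qed
  have "lifts \<phi> (ball e s1)"
    unfolding lifts_def
  proof (intro conjI ballI open_ball)
    show "ball e s1 \<subseteq> dom" using \<phi>_eq s1(2) \<psi>1 by (auto simp: lifts_def)
    show "holo_map_on \<phi> (ball e s1)" by (rule holo_map_subset[OF \<phi>h]) (use s1(2) in blast)
    fix x assume "x \<in> ball e s1"
    then have "\<phi> x = \<psi>1 x" "x \<in> O1" using \<phi>_eq s1(2) by blast+
    then show "rel cs Vs B x (\<phi> x)" using \<psi>1 by (simp add: lifts_def)
  qed
  then show ?thesis using oB cB zB B'sub \<phi>h s1 by (intro exI[of _ B'] exI[of _ \<phi>] exI[of _ "ball e s1"]) auto
qed

text \<open>The part of the convex set \<open>B'\<close> where \<open>F\<close> is nonzero is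
  connected. Being a branch, and with it transversality, therefore propagates from \<open>W\<close>
  by the identity theorem.\<close>

lemma spread:
  assumes B': "open B'" "convex B'" "B' \<subseteq> ball 0 R0" and \<phi>: "holo_map_on \<phi> B'"
    and W: "lifts \<phi> W" "convex W" "W ~= {}" "W \<subseteq> B'" and z: "z \<in> B'" "F z ~= 0"
  shows "\<exists>r>0. ball z r \<subseteq> B' \<and> transverse \<phi> (ball z r)"
proof -
  define S where "S = {z\<in>B'. F z ~= 0}"
  have Sd: "S = B' \<inter> dom" using B'(3) by (auto simp: S_def dom_def)
  have oS: "open S" unfolding Sd by (rule open_Int[OF B'(1) open_dom])
  have "ball 0 R0 \<subseteq> ball (0::complex^'n) \<rho>0" using R0 \<epsilon> by auto
  then have "connected {z\<in>B'. \<exists>j. f j z ~= 0}"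
    by (intro connected_nonzero[OF B'(1,2)] holo_subset[OF f_holo0]) (use B'(3) in blast)
  moreover have "S = {z\<in>B'. \<exists>j. f j z ~= 0}" by (auto simp: S_def F_def vec_eq_iff)
  ultimately have cS: "connected S" by simp
  define P where "P z \<longleftrightarrow> (\<exists>r>0. ball z r \<subseteq> B' \<and> lifts \<phi> (ball z r) \<and> transverse \<phi> (ball z r))" for z
  have propagate: "\<exists>r>0. ball x r \<subseteq> S \<and> (\<forall>W. lifts \<phi> W --> convex W --> W \<inter> ball x r ~= {} --> lifts \<phi> (ball x r) \<and> transverse \<phi> (ball x r))"
    if x: "x \<in> S" for x
  proof -
    have "x \<in> dom" using x Sd by blast
    from local_lifts[OF this] obtain r where r: "r > 0" "ball x r \<subseteq> dom"
      "\<forall>W \<psi>. lifts \<psi> W --> convex W --> W \<inter> ball x r ~= {} -->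
        (\<exists>\<psi>'. lifts \<psi>' (ball x r) \<and> transverse \<psi>' (ball x r) \<and> (\<forall>y\<in>W \<inter> ball x r. \<psi>' y = \<psi> y))" by (elim exE conjE)
    obtain r1 where r1: "r1 > 0" "ball x r1 \<subseteq> S" using oS x open_contains_ball by blast
    define r2 where "r2 = min r r1"
    have r2: "r2 > 0" "ball x r2 \<subseteq> S" "ball x r2 \<subseteq> ball x r" using r(1) r1 by (auto simp: r2_def)
    have "lifts \<phi> (ball x r2) \<and> transverse \<phi> (ball x r2)" if W: "lifts \<phi> W" "convex W" "W \<inter> ball x r2 ~= {}" for W
    proof -
      have "W \<inter> ball x r ~= {}" using W(3) r2(3) by blast
      then obtain \<psi>' where \<psi>': "lifts \<psi>' (ball x r)" "transverse \<psi>' (ball x r)" "\<forall>y\<in>W \<inter> ball x r. \<psi>' y = \<phi> y"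
        using r(3) W(1,2) by blast
      have hp: "holo_map_on \<phi> (ball x r2)" by (rule holo_map_subset[OF \<phi>]) (use r2(2) Sd in blast)
      have oW: "open (W \<inter> ball x r2)" using W(1) by (auto simp: lifts_def)
      have eq: "\<phi> y = \<psi>' y" if "y \<in> ball x r2" for y
        by (rule agree_convex[OF hp lifts_holo[OF \<psi>'(1) r2(3)] _ _ oW W(3)]) (use \<psi>'(3) r2(3) that in auto)
      have L: "lifts \<psi>' (ball x r2)" by (rule lifts_subset[OF \<psi>'(1) open_ball r2(3)])
      have "lifts \<phi> (ball x r2)" using L hp eq unfolding lifts_def by simp
      moreover have "transverse \<phi> (ball x r2)" by (rule transverse_cong[OF transverse_subset[OF \<psi>'(2) r2(3)] eq])
      ultimately show ?thesis by blast
    qed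
    then show ?thesis using r2 by blast
  qed
  have WS: "W \<subseteq> S" using W(1,4) Sd by (auto simp: lifts_def)
  obtain a where a: "a \<in> W" using W(3) by blast
  have "P z"
  proof (rule connected_induction_simple[OF cS, of a z])
    show "a \<in> S" using a WS by blast
    show "z \<in> S" using z by (simp add: S_def)
    show "P a"
    proof -
      obtain r where r: "r > 0" "ball a r \<subseteq> S" "\<forall>W. lifts \<phi> W --> convex W --> W \<inter> ball a r ~= {} --> lifts \<phi> (ball a r) \<and> transverse \<phi> (ball a r)"
        using propagate[of a] a WS by blast
      have "W \<inter> ball a r ~= {}" using a r(1) by auto
      then show ?thesis unfolding P_def using r W(1,2) Sd by blast
    qed
    fix x assume "x \<in> S"
    then obtain r where r: "r > 0" "ball x r \<subseteq> S" "\<forall>W. lifts \<phi> W --> convex W --> W \<inter> ball x r ~= {} --> lifts \<phi> (ball x r) \<and> transverse \<phi> (ball x r)"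
      using propagate by blast
    show "\<exists>T. openin (top_of_set S) T \<and> x \<in> T \<and> (\<forall>x\<in>T. \<forall>y\<in>T. P x --> P y)"
    proof (intro exI[of _ "S \<inter> ball x r"] conjI ballI impI)
      show "openin (top_of_set S) (S \<inter> ball x r)" by (rule openin_open_Int) simp
      show "x \<in> S \<inter> ball x r" using r(1) \<open>x \<in> S\<close> by simp
      fix u y assume u: "u \<in> S \<inter> ball x r" "P u" and y: "y \<in> S \<inter> ball x r"
      obtain ru where ru: "ru > 0" "lifts \<phi> (ball u ru)" using u(2) unfolding P_def by blast
      have "u \<in> ball u ru \<inter> ball x r" using u(1) ru(1) by simp
      then have L: "lifts \<phi> (ball x r)" "transverse \<phi> (ball x r)" using r(3) ru(2) convex_ball by blast+
      obtain ry where ry: "ry > 0" "ball y ry \<subseteq> ball x r" using y openE[OF open_ball, of y x r] by blast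
      show "P y" unfolding P_def using ry lifts_subset[OF L(1) open_ball ry(2)] transverse_subset[OF L(2) ry(2)] r(2) Sd by blast
    qed
  qed
  then show ?thesis unfolding P_def by blast
qed

end

context good
begin

lemma extension:
  obtains B' \<phi> where "open B'" "convex B'" "0 \<in> B'" "B' \<subseteq> ball 0 \<epsilon>" "holo_map_on \<phi> B'"
    "!!z. z \<in> B' ==> F z ~= 0 ==> \<exists>r>0. ball z r \<subseteq> B' \<and> transverse \<phi> (ball z r)"
proof -
  obtain c V B m Q where T: "target c V B m Q"
    "!!\<nu>. \<nu> > 0 ==> \<exists>e. norm e < \<nu> \<and> norm e < \<epsilon> \<and> F e ~= 0 \<and> (\<exists>p\<in>comp e. p \<in> V \<and> snd c p \<in> B)"
    using target_exists by blast
  have m: "m > 0" using T(1) by (simp add: target_def)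
  have "open (ball 0 \<epsilon> \<inter> F -` ball 0 m)" by (intro continuous_open_preimage cont_F) (use \<epsilon> in auto)
  moreover have "0 \<in> ball 0 \<epsilon> \<inter> F -` ball 0 m" using \<epsilon> m F_zero by simp
  ultimately obtain R0 where R0: "R0 > 0" "ball 0 R0 \<subseteq> ball 0 \<epsilon> \<inter> F -` ball 0 m" using open_contains_ball by blast
  define R1 where "R1 = min R0 \<epsilon>"
  interpret targeted M \<A> f \<rho>0 \<epsilon> \<delta> c V B m Q R1
  proof
    show "target c V B m Q" by (rule T(1))
    show "0 < R1" "R1 \<le> \<epsilon>" using R0(1) \<epsilon> by (auto simp: R1_def)
    fix z :: "complex^'n" assume "z \<in> ball 0 R1"
    then have "z \<in> ball 0 R0" by (simp add: R1_def)
    then show "norm (F z) < m" using R0(2) by auto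
  qed
  have R1: "0 < R1" "R1 \<le> \<epsilon>" using R0(1) \<epsilon> by (auto simp: R1_def)
  obtain e where e: "norm e < R1 / 4" "F e ~= 0" "\<exists>p\<in>comp e. p \<in> V \<and> snd c p \<in> B" using T(2)[of "R1/4"] R1(1) by auto
  then obtain t where t: "rel c V B e t" by (auto simp: rel_def)
  have ed: "e \<in> dom" using e R1(1) by (simp add: dom_def)
  \<comment> \<open>The disc about \<open>e\<close> in direction \<open>v\<close> must stay off the
    zero fibre, so \<open>v\<close> is chosen after \<open>e\<close> and shorter than
    \<open>s\<close>.\<close>
  obtain s where s: "s > 0" "ball e s \<subseteq> dom" using open_dom ed open_contains_ball by blast
  have "min s (R1 / 4) > 0" using s(1) R1(1) by simp
  from exists_direction[OF this, of e] obtain v where v: "norm v < min s (R1 / 4)" "!!c. v ~= c *s e"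
    "!!l \<xi>. cmod \<xi> = 1 ==> norm (l *s e + \<xi> *s v) < \<rho>0 ==> F (l *s e + \<xi> *s v) ~= 0" by metis
  have "\<exists>B' \<phi> W. open B' \<and> convex B' \<and> 0 \<in> B' \<and> B' \<subseteq> ball 0 R1 \<and> holo_map_on \<phi> B' \<and> lifts \<phi> W \<and> convex W \<and> W ~= {} \<and> W \<subseteq> B'"
  proof (rule hartogs_figure[OF ed t v(2)])
    show "2 * norm e + norm v < R1" using e(1) v(1) R1(1) by simp
    show "e + \<mu> *s v \<in> dom" if "cmod \<mu> \<le> 1" for \<mu>
    proof -
      have "norm (\<mu> *s v) \<le> 1 * norm v" unfolding norm_vsm using that by (intro mult_right_mono) auto
      then have "e + \<mu> *s v \<in> ball e s" using v(1) by (simp add: dist_norm)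
      then show ?thesis using s(2) by blast
    qed
    show "l *s e + \<xi> *s v \<in> dom" if "cmod l \<le> 2" "cmod \<xi> = 1" for l \<xi>
    proof -
      have "norm (l *s e + \<xi> *s v) \<le> cmod l * norm e + cmod \<xi> * norm v" using norm_triangle_ineq[of "l *s e" "\<xi> *s v"] by (simp add: norm_vsm)
      also have "\<dots> \<le> 2 * norm e + 1 * norm v" using that by (intro add_mono mult_right_mono) auto
      also have "\<dots> < R1" using e(1) v(1) R1(1) by simp
      finally have n: "norm (l *s e + \<xi> *s v) < R1" .
      then have "F (l *s e + \<xi> *s v) ~= 0" using v(3)[OF that(2)] R1(2) \<epsilon> by simp
      then show ?thesis using n by (simp add: dom_def)
    qed
  qed
  then obtain B' \<phi> W where B': "open B'" "convex B'" "0 \<in> B'" "B' \<subseteq> ball 0 R1" "holo_map_on \<phi> B'" "lifts \<phi> W" "convex W" "W ~= {}" "W \<subseteq> B'"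
    by (elim exE conjE)
  show ?thesis
  proof (rule that[OF B'(1-3) _ B'(5)])
    show "B' \<subseteq> ball 0 \<epsilon>" using B'(4) R1(2) by auto
    show "\<exists>r>0. ball z r \<subseteq> B' \<and> transverse \<phi> (ball z r)" if "z \<in> B'" "F z ~= 0" for z
      by (rule spread[OF B'(1,2,4,5,6,7,8,9) that])
  qed
qed

end

section \<open>Extension across the singular point\<close>

text \<open>The conjugate of a real vector orthogonal to the image; as the image is a complex
  subspace, the complex pairing vanishes along with its real part.\<close>

lemma not_surj_row_relation:
  fixes A :: "complex^'n^'q::finite"
  assumes "\<not> surj (%v. A *v v)"
  shows "\<exists>w. w ~= 0 \<and> (\<forall>v. cdot w (A *v v) = 0)"
proof -
  have lin: "linear (%v. A *v v)" by (rule linearI) (simp_all add: matrix_vector_right_distrib matrix_scaleR)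
  have sub: "subspace (range (%v. A *v v))" by (rule linear_subspace_image[OF lin subspace_UNIV])
  have "dim (range (%v. A *v v)) ~= DIM(complex^'q)"
  proof
    assume "dim (range (%v. A *v v)) = DIM(complex^'q)"
    then have "span (range (%v. A *v v)) = UNIV" using dim_eq_full by blast
    then show False using assms span_eq_iff[THEN iffD2, OF sub] by metis
  qed
  then have "dim (range (%v. A *v v)) < DIM(complex^'q)" using dim_subset_UNIV[of "range (%v. A *v v)"] by linarith
  then obtain x where x: "x ~= 0" "!!y. y \<in> span (range (%v. A *v v)) ==> orthogonal x y"
    using orthogonal_to_subspace_exists by blast
  have orth: "Re (cdot (cnjv x) (A *v v)) = 0" for v
    using x(2)[OF span_base, of "A *v v"] by (simp add: orthogonal_def inner_cdot)
  have "cdot (cnjv x) (A *v v) = 0" for v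
    using orth[of v] orth[of "\<i> *s v"] by (simp add: matrix_vsm complex_eq_iff)
  moreover have "cnjv x ~= 0" using x(1) by (metis cnjv_simps(1) cnjv_simps(2) complex_cnj_zero vec_eq_iff zero_index)
  ultimately show ?thesis by blast
qed

lemma surj_imp_det: "surj (%v. A *v v) ==> det (A :: complex^'n^'n) ~= 0"
  by (metis invertible_det_nz invertible_left_inverse invertible_right_inverse matrix_right_invertible_surjective)

text \<open>The locus where two holomorphic row vectors become dependent is locally cut out by \<open>n - 1\<close>
  equations wherever one of the rows does not vanish, so it cannot be compact and nonempty.\<close>

lemma rows_dependent_at_boundary:
  fixes a b :: "complex^'n => complex^'n"
  assumes r: "r > 0" and U: "open U" "cball 0 r \<subseteq> U" and a: "holo_map_on a U" and b: "holo_map_on b U"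
    and b0: "b 0 = 0" and nz: "!!z. z \<in> cball 0 r ==> a z ~= 0 \<or> b z ~= 0"
    and ind: "!!z. z \<in> sphere 0 r ==> \<exists>i k. a z $ i * b z $ k ~= a z $ k * b z $ i"
  shows False
proof -
  have ac: "continuous_on U (%z. a z $ i)" "continuous_on U (%z. b z $ i)" for i
    using holo_map_continuous[OF a] holo_map_continuous[OF b] by (auto intro!: continuous_intros)
  define D where "D = {z\<in>cball 0 r. \<forall>i k. a z $ i * b z $ k = a z $ k * b z $ i}"
  have "closed (cball 0 r \<inter> (%z. a z $ i * b z $ k - a z $ k * b z $ i) -` {0})" for i k
    by (rule continuous_closed_preimage) (auto intro!: continuous_intros continuous_on_subset[OF ac(1) U(2)] continuous_on_subset[OF ac(2) U(2)])
  then have "closed (\<Inter>(i,k)\<in>UNIV. cball 0 r \<inter> (%z. a z $ i * b z $ k - a z $ k * b z $ i) -` {0})"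
    by (intro closed_INT) auto
  moreover have "D = (\<Inter>(i,k)\<in>UNIV. cball 0 r \<inter> (%z. a z $ i * b z $ k - a z $ k * b z $ i) -` {0})"
    by (auto simp: D_def)
  ultimately have "closed D" by simp
  moreover have "bounded D" by (rule bounded_subset[OF bounded_cball[of 0 r]]) (auto simp: D_def)
  ultimately have "compact D" by (simp add: compact_eq_bounded_closed)
  moreover have "0 \<in> D" using r b0 by (simp add: D_def)
  ultimately obtain x where x: "x \<in> D" "!!z. z \<in> D ==> norm z \<le> norm x"
    using continuous_attains_sup[of D norm] by (auto intro: continuous_intros)
  have xr: "norm x < r"
  proof -
    have "x \<notin> sphere 0 r" using ind[of x] x(1) by (auto simp: D_def)
    then show ?thesis using x(1) by (auto simp: D_def)
  qed
  then have xU: "x \<in> U" using U(2) by auto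
  \<comment> \<open>Where one row has a nonzero entry in column \<open>j\<close>, the minors that
    involve column \<open>j\<close> force all the others to vanish.\<close>
  have D: "z \<in> D" if "z \<in> ball 0 r" "c $ j ~= 0" "c = a z \<or> c = b z" "!!i. i ~= j ==> a z $ i * b z $ j = a z $ j * b z $ i" for z j and c :: "complex^'n"
  proof -
    have e: "a z $ i * b z $ j = a z $ j * b z $ i" for i using that(4) by (cases "i = j") auto
    have "c $ j * (a z $ i * b z $ k) = c $ j * (a z $ k * b z $ i)" for i k
      using that(3)
    proof
      assume c: "c = a z"
      have "a z $ j * (a z $ i * b z $ k) = a z $ i * (a z $ j * b z $ k)" by simp
      also have "\<dots> = a z $ k * (a z $ i * b z $ j)" unfolding e[of k, symmetric] by simp
      also have "\<dots> = a z $ j * (a z $ k * b z $ i)" unfolding e[of i] by simp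
      finally show ?thesis by (simp add: c)
    next
      assume c: "c = b z"
      have "b z $ j * (a z $ i * b z $ k) = (a z $ i * b z $ j) * b z $ k" by simp
      also have "\<dots> = (a z $ j * b z $ k) * b z $ i" unfolding e[of i] by simp
      also have "\<dots> = b z $ j * (a z $ k * b z $ i)" unfolding e[of k, symmetric] by simp
      finally show ?thesis by (simp add: c)
    qed
    then show ?thesis using that(1,2) by (auto simp: D_def)
  qed
  have fin: False if c: "c x $ j ~= 0" "continuous_on U c" "!!z. c z = a z \<or> c z = b z" for j and c :: "complex^'n => complex^'n"
  proof (rule no_local_max_norm[of "ball 0 r \<inter> (U \<inter> (%z. c z $ j) -` (- {0}))" x "UNIV - {j}" "%i z. a z $ i * b z $ j - a z $ j * b z $ i"])
    have "continuous_on U (%z. c z $ j)" using c(2) by (intro continuous_intros)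
    then show "open (ball 0 r \<inter> (U \<inter> (%z. c z $ j) -` (- {0})))" by (intro open_Int continuous_open_preimage U(1)) auto
    show "x \<in> ball 0 r \<inter> (U \<inter> (%z. c z $ j) -` (- {0}))" using xr xU c(1) by simp
    show "holo_fun_on (%z. a z $ i * b z $ j - a z $ j * b z $ i) (ball 0 r \<inter> (U \<inter> (%z. c z $ j) -` (- {0})))" for i
      using a b by (intro holo_diff holo_mult) (auto simp: holo_map_on_def intro: holo_subset)
    show "a x $ i * b x $ j - a x $ j * b x $ i = 0" for i using x(1) by (simp add: D_def)
    show "norm z \<le> norm x" if z: "z \<in> ball 0 r \<inter> (U \<inter> (%z. c z $ j) -` (- {0}))" "!!i. i \<in> UNIV - {j} ==> a z $ i * b z $ j - a z $ j * b z $ i = 0" for z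
      by (rule x(2), rule D[of z "c z" j]) (use z c(3) in auto)
  qed auto
  have "a x ~= 0 \<or> b x ~= 0" using nz x(1) by (auto simp: D_def)
  then show False
  proof
    assume "a x ~= 0"
    then obtain j where "a x $ j ~= 0" by (auto simp: vec_eq_iff)
    then show False using fin[of a j] holo_map_continuous[OF a] by blast
  next
    assume "b x ~= 0"
    then obtain j where "b x $ j ~= 0" by (auto simp: vec_eq_iff)
    then show False using fin[of b j] holo_map_continuous[OF b] by blast
  qed
qed

text \<open>Otherwise a combination \<open>R w\<close> of the Jacobian rows vanishes at
  \<open>0\<close>, and \<open>R w\<close> and a second combination \<open>R u\<close> are dependent
  at the origin alone. A small constant \<kappa> added to \<open>R u\<close> keeps the two rows from
  vanishing together at \<open>0\<close> and preserves independence on a sphere, against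
  \<open>rows_dependent_at_boundary\<close>.\<close>

lemma submersion_at_isolated_point:
  fixes \<phi> :: "complex^'n => complex^'q::finite"
  assumes q2: "2 \<le> CARD('q)" and U: "open U" "0 \<in> U" and \<phi>: "holo_map_on \<phi> U"
    and sub: "!!z. z \<in> U ==> z ~= 0 ==> surj (%v. jac \<phi> z *v v)"
  shows "surj (%v. jac \<phi> 0 *v v)"
proof (rule ccontr)
  assume "\<not> surj (%v. jac \<phi> 0 *v v)"
  then obtain w where w: "w ~= 0" "!!v. cdot w (jac \<phi> 0 *v v) = 0" using not_surj_row_relation by blast
  define R :: "complex^'q => complex^'n => complex^'n" where "R u z = (\<chi> k. \<Sum>j\<in>UNIV. u $ j * jac \<phi> z $ j $ k)" for u z
  have R: "cdot (R u z) v = cdot u (jac \<phi> z *v v)" for u z v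
  proof -
    have "cdot (R u z) v = (\<Sum>k\<in>UNIV. \<Sum>j\<in>UNIV. u $ j * jac \<phi> z $ j $ k * v $ k)" by (simp add: cdot_def R_def sum_distrib_right)
    also have "\<dots> = (\<Sum>j\<in>UNIV. \<Sum>k\<in>UNIV. u $ j * jac \<phi> z $ j $ k * v $ k)" by (rule sum.swap)
    also have "\<dots> = cdot u (jac \<phi> z *v v)" by (simp add: cdot_def matrix_vector_mult_def sum_distrib_left mult.assoc)
    finally show ?thesis .
  qed
  have R_nz: "R u z ~= 0" if "z \<in> U" "z ~= 0" "u ~= 0" for u z
  proof
    assume "R u z = 0"
    then have "cdot u (jac \<phi> z *v v) = 0" for v by (simp flip: R)
    then have "cdot u y = 0" for y using surjD[OF sub[OF that(1,2)], of y] by auto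
    then have "u = 0" using cdot_inject[of u 0] by simp
    then show False using that(3) by simp
  qed
  have R_holo: "holo_map_on (R u) U" for u
    unfolding holo_map_on_def R_def by (auto intro!: holo_sum holo_mult holo_jac[OF U(1) \<phi>])
  have Rw0: "R w 0 = 0" by (rule cdot_inject) (simp add: R w(2))
  obtain j where j: "w $ j ~= 0" using w(1) by (auto simp: vec_eq_iff)
  have "\<not> CARD('q) \<le> Suc 0" using q2 by simp
  then obtain k1 k2 :: 'q where "k1 ~= k2" using card_le_Suc0_iff_eq[of "UNIV :: 'q set"] by auto
  then obtain k :: 'q where k: "k ~= j" by metis
  define u :: "complex^'q" where "u = axis k 1"
  have uw: "u - c *s w ~= 0" for c
  proof
    assume "u - c *s w = 0"
    then have "u = c *s w" by simp
    then have "u $ j = c * w $ j" "u $ k = c * w $ k" by simp_all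
    then show False using j k by (auto simp: u_def axis_def)
  qed
  obtain r where r: "r > 0" "cball 0 r \<subseteq> U" using U open_contains_cball by blast
  have minors: "\<exists>i l. R u z $ i * R w z $ l ~= R u z $ l * R w z $ i" if z: "z \<in> U" "z ~= 0" for z
  proof (rule ccontr)
    assume "\<not> ?thesis"
    then have e: "R u z $ i * R w z $ l = R u z $ l * R w z $ i" for i l by blast
    obtain l where l: "R w z $ l ~= 0" using R_nz[OF z w(1)] by (auto simp: vec_eq_iff)
    have "R (u - (R u z $ l / R w z $ l) *s w) z $ i = R u z $ i - (R u z $ l / R w z $ l) * R w z $ i" for i
      by (simp add: R_def left_diff_distrib sum_subtractf sum_distrib_left mult.assoc)
    also have "\<dots> i = 0" for i using e[of i l] l by (simp add: field_simps)
    finally have "R (u - (R u z $ l / R w z $ l) *s w) z = 0" by (simp add: vec_eq_iff)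
    then show False using R_nz[OF z uw] by blast
  qed
  \<comment> \<open>The sum of the squared two by two minors, a single continuous function to which
    \<open>tube_positive\<close> applies.\<close>
  define G where "G \<kappa> z = (\<Sum>i\<in>UNIV. \<Sum>l\<in>UNIV. (cmod ((R u z $ i + \<kappa> $ i) * R w z $ l - (R u z $ l + \<kappa> $ l) * R w z $ i))\<^sup>2)" for \<kappa> z
  have Rc: "continuous_on (UNIV \<times> sphere 0 r) (%x. R u' (snd x) $ i)" for u' i
    by (intro continuous_on_component continuous_on_compose2[OF holo_map_continuous[OF R_holo]])
       (use r(2) in \<open>auto intro!: continuous_intros\<close>)
  have "continuous_on (UNIV \<times> sphere 0 r) (%x. G (fst x) (snd x))" unfolding G_def
    by (intro continuous_intros Rc)
  then have Gc: "continuous_on (UNIV \<times> sphere 0 r) (%(\<kappa>, z). G \<kappa> z)" by (simp add: case_prod_unfold)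
  have Gpos: "G 0 z > 0" if "z \<in> sphere 0 r" for z
  proof -
    have "z \<in> U" "z ~= 0" using that r by auto
    then obtain i l where il: "R u z $ i * R w z $ l - R u z $ l * R w z $ i ~= 0" using minors[of z] by auto
    have "0 < (\<Sum>l\<in>UNIV. (cmod ((R u z $ i + (0::complex^'n) $ i) * R w z $ l - (R u z $ l + (0::complex^'n) $ l) * R w z $ i))\<^sup>2)"
      by (rule sum_pos2[of _ l]) (use il in auto)
    then show ?thesis unfolding G_def by (rule sum_pos2[of _ i, OF _ _ _, rotated 2]) (auto intro: sum_nonneg)
  qed
  obtain d where d: "d > 0" "!!\<kappa> z. \<kappa> \<in> ball 0 d ==> z \<in> sphere 0 r ==> G \<kappa> z > 0"
    by (rule tube_positive[OF open_UNIV UNIV_I compact_sphere Gc Gpos]) blast+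
  define \<kappa> :: "complex^'n" where "\<kappa> = (if R u 0 = 0 then of_real (d/2) *s axis undefined 1 else 0)"
  have \<kappa>: "\<kappa> \<in> ball 0 d" "R u 0 + \<kappa> ~= 0" using d(1) by (auto simp: \<kappa>_def norm_vsm norm_axis_c axis_eq_0_iff)
  show False
  proof (rule rows_dependent_at_boundary[OF r(1) U(1) r(2) _ R_holo[of w] Rw0, of "%z. R u z + \<kappa>"])
    show "holo_map_on (%z. R u z + \<kappa>) U" using R_holo[of u] by (auto simp: holo_map_on_def intro!: holo_add)
    show "R u z + \<kappa> ~= 0 \<or> R w z ~= 0" if "z \<in> cball 0 r" for z
      using \<kappa>(2) R_nz[of z w] w(1) that r(2) by (cases "z = 0") auto
    show "\<exists>i k. (R u z + \<kappa>) $ i * R w z $ k ~= (R u z + \<kappa>) $ k * R w z $ i" if z: "z \<in> sphere 0 r" for z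
    proof (rule ccontr)
      assume "\<not> ?thesis"
      then have "G \<kappa> z = 0" by (simp add: G_def)
      then show False using d(2)[OF \<kappa>(1) z] by simp
    qed
  qed
qed

section \<open>Factorisation through the distinguished submersions\<close>

context good
begin

definition factors :: "(complex^'n => complex^'q) => ('n, 'q) fol_chart => complex^'n => bool" where
  "factors \<phi> c z \<longleftrightarrow> (\<exists>N \<zeta>. open N \<and> z \<in> N \<and> N \<subseteq> fst c \<and> holo_map_on \<zeta> (snd c ` N) \<and>
     (\<forall>p\<in>N. \<phi> p = \<zeta> (snd c p)) \<and> det (jac \<zeta> (snd c z)) ~= 0)"

lemma open_chart_image: "c \<in> \<A> ==> open N ==> N \<subseteq> fst c ==> open (snd c ` N)"
  using submersion_open_image submersion_subset chart_D(2) by blast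

lemma transverse_factors:
  assumes "transverse \<phi> N" "open N" "z \<in> N" "c \<in> \<A>" "z \<in> fst c" shows "factors \<phi> c z"
proof -
  obtain d \<theta> where d: "d \<in> \<A>" "N \<subseteq> fst d" "holo_map_on \<theta> (snd d ` N)" "!!x. x \<in> N ==> \<phi> x = \<theta> (snd d x)"
    "!!x. x \<in> N ==> surj (%v. jac \<theta> (snd d x) *v v)" using assms(1) unfolding transverse_def by blast
  obtain N' g where N': "open N'" "z \<in> N'" "N' \<subseteq> fst c \<inter> fst d" "biholomorphic g (snd c ` N') (snd d ` N')" "!!p. p \<in> N' ==> snd d p = g (snd c p)"
    using compat[OF assms(4) d(1) assms(5)] d(2) assms(3) by blast
  note B = biholomorphic_D[OF N'(4)]
  let ?N = "N \<inter> N'"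
  have gh: "holo_map_on g (snd c ` ?N)" by (rule holo_map_subset[OF B(3)]) auto
  have g_in: "g t \<in> snd d ` N" if t: "t \<in> snd c ` ?N" for t
  proof -
    obtain p where "p \<in> N" "p \<in> N'" "t = snd c p" using t by blast
    then show ?thesis using N'(5)[of p] by (metis imageI)
  qed
  have h: "holo_map_on (%t. \<theta> (g t)) (snd c ` ?N)" by (rule holo_map_compose[OF gh d(3) g_in])
  have zc: "snd c z \<in> snd c ` ?N" using assms(3) N'(2) by blast
  have "surj (%v. jac g (snd c z) *v v)" by (rule biholomorphic_surj[OF N'(4)]) (use N'(2) in blast)
  moreover have "surj (%v. jac \<theta> (g (snd c z)) *v v)" using d(5)[OF assms(3)] N'(5)[OF N'(2)] by simp
  ultimately have "surj (%v. jac (%t. \<theta> (g t)) (snd c z) *v v)" by (rule surj_jac_compose[OF gh d(3) zc g_in[OF zc]])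
  then have "det (jac (%t. \<theta> (g t)) (snd c z)) ~= 0" by (rule surj_imp_det)
  then show ?thesis unfolding factors_def
    by (intro exI[of _ ?N] exI[of _ "%t. \<theta> (g t)"]) (use assms(2,3) N' h d(4) in \<open>auto simp: open_Int\<close>)
qed

lemma factors_locally_constant:
  assumes "factors \<phi> c z"
  shows "\<exists>N. open N \<and> z \<in> N \<and> (\<forall>p\<in>N. snd c p = snd c z --> \<phi> p = \<phi> z)"
  using assms unfolding factors_def by metis

text \<open>Off the zero fibre \<phi> factors through the chart by transversality. On the
  exceptional level its constancy follows from the neighbouring levels by the identity theorem, and
  the Jacobian determinant of the factor \<zeta> could vanish only at that one parameter, which
  cannot happen in \<open>q \<ge> 2\<close> variables.\<close>

lemma factors_on_zero_fibre:
  assumes B': "open B'" "B' \<subseteq> ball 0 \<epsilon>" and \<phi>: "holo_map_on \<phi> B'"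
    and tr: "!!z. z \<in> B' ==> F z ~= 0 ==> \<exists>r>0. ball z r \<subseteq> B' \<and> transverse \<phi> (ball z r)"
    and z: "z \<in> B'" "z ~= 0" "F z = 0" and c: "c \<in> \<A>" "z \<in> fst c"
  shows "factors \<phi> c z"
proof -
  have "z \<in> ball 0 \<rho>0" using z(1) B'(2) \<epsilon> by auto
  then obtain V1 where V1: "open V1" "z \<in> V1" "V1 \<subseteq> fst c" "!!p. p \<in> V1 ==> F p = 0 ==> snd c p = snd c z"
    using isol[OF c _ z(3)] by blast
  obtain V where V: "z \<in> V" "V \<subseteq> V1 \<inter> B'" "box UNIV c V"
    using box_interior[of z UNIV "V1 \<inter> B'" c] V1(1,2) B'(1) z(1) c by (auto simp: open_Int)
  have Vo: "open V" "V \<subseteq> fst c" using V(3) by (auto simp: box_def)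
  have fac: "factors \<phi> c p" if p: "p \<in> V" "F p ~= 0" for p
  proof -
    have "p \<in> B'" using p(1) V(2) by blast
    then obtain r where "r > 0" "transverse \<phi> (ball p r)" using tr p(2) by blast
    then show ?thesis using transverse_factors[of \<phi> "ball p r" p c] c(1) p(1) Vo(2) by auto
  qed
  have const1: "\<phi> p = \<phi> p'" if p: "p \<in> V" "p' \<in> V" "snd c p = snd c p'" "F p ~= 0" for p p'
  proof -
    obtain P where P: "connected P" "P \<subseteq> UNIV \<inter> V" "!!x. x \<in> P \<longleftrightarrow> x \<in> UNIV \<inter> V \<and> snd c x = snd c p" "p \<in> P" "p' \<in> P"
      using box_plaque[OF V(3), of p p'] p by auto
    have "\<phi> constant_on P"
    proof (rule locally_constant_imp_constant[OF P(1)])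
      fix x assume x: "x \<in> P"
      have "F x = F p" by (rule F_plaque[OF c(1) P(1) _ _ x P(4)]) (use P(2,3) Vo(2) in auto)
      then have "factors \<phi> c x" using fac[of x] x P(2) p(4) by auto
      from factors_locally_constant[OF this] obtain N where N: "open N" "x \<in> N" "\<forall>y\<in>N. snd c y = snd c x --> \<phi> y = \<phi> x"
        by (elim exE conjE)
      show "\<exists>T. openin (top_of_set P) T \<and> x \<in> T \<and> (\<forall>y\<in>T. \<phi> y = \<phi> x)"
      proof (intro exI[of _ "P \<inter> N"] conjI ballI)
        show "openin (top_of_set P) (P \<inter> N)" using N(1) by (rule openin_open_Int)
        show "\<phi> y = \<phi> x" if "y \<in> P \<inter> N" for y using N(3) that P(3)[of y] P(3)[of x] x by auto
      qed (use x N(2) in auto)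
    qed
    then show ?thesis using P(4,5) by (auto simp: constant_on_def)
  qed
  have \<phi>V: "holo_map_on \<phi> V" by (rule holo_map_subset[OF \<phi>]) (use V(2) in blast)
  have const: "\<phi> p = \<phi> p'" if p: "p \<in> UNIV \<inter> V" "p' \<in> UNIV \<inter> V" "snd c p = snd c p'" for p p'
  proof (cases "F p = 0")
    case False then show ?thesis using const1 p by blast
  next
    case True
    define t0 where "t0 = snd c p"
    have pV: "p \<in> V1" using p V(2) by blast
    have t0z: "t0 = snd c z" using V1(4)[OF pV True] by (simp add: t0_def)
    have hc: "holo_map_on (snd c) V" by (rule holo_map_subset[OF chart_D(4)[OF c(1)] Vo(2)])
    have sec: "\<exists>T \<sigma>. open T \<and> snd c x \<in> T \<and> holo_map_on \<sigma> T \<and> \<sigma> ` T \<subseteq> V \<and> (\<forall>t\<in>T. snd c (\<sigma> t) = t) \<and> \<sigma> (snd c x) = x" if "x \<in> V" for x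
      by (rule submersion_section[OF Vo(1) hc that chart_D(5)[OF c(1)]]) (use that Vo(2) in blast)
    \<comment> \<open>Sections of the chart through \<open>p\<close> and through \<open>p'\<close>
      pass through the same plaques, and for parameters other than \<open>t0\<close> these plaques
      lie off the zero fibre.\<close>
    obtain T \<sigma> where T: "open T" "t0 \<in> T" "holo_map_on \<sigma> T" "\<sigma> ` T \<subseteq> V" "!!t. t \<in> T ==> snd c (\<sigma> t) = t" "\<sigma> t0 = p"
      using sec[of p] p(1) unfolding t0_def by blast
    obtain T' \<sigma>' where T': "open T'" "t0 \<in> T'" "holo_map_on \<sigma>' T'" "\<sigma>' ` T' \<subseteq> V" "!!t. t \<in> T' ==> snd c (\<sigma>' t) = t" "\<sigma>' t0 = p'"
      using sec[of p'] p(2,3) unfolding t0_def by auto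
    obtain r where r: "r > 0" "ball t0 r \<subseteq> T \<inter> T'" using open_contains_ball[of "T \<inter> T'"] open_Int[OF T(1) T'(1)] T(2) T'(2) by blast
    have "\<phi> (\<sigma> t0) = \<phi> (\<sigma>' t0)"
    proof (rule agree_convex[of "%t. \<phi> (\<sigma> t)" "ball t0 r" "%t. \<phi> (\<sigma>' t)" "ball t0 r - {t0}"])
      show "holo_map_on (%t. \<phi> (\<sigma> t)) (ball t0 r)"
        by (rule holo_map_compose[OF holo_map_subset[OF T(3)] \<phi>V]) (use r(2) T(4) in blast)+
      show "holo_map_on (%t. \<phi> (\<sigma>' t)) (ball t0 r)"
        by (rule holo_map_compose[OF holo_map_subset[OF T'(3)] \<phi>V]) (use r(2) T'(4) in blast)+
      show "ball t0 r - {t0} ~= {}"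
      proof
        assume "ball t0 r - {t0} = {}"
        then have "ball t0 r = {t0}" using r(1) by auto
        then show False using not_open_singleton[of t0] open_ball[of t0 r] by simp
      qed
      fix t assume t: "t \<in> ball t0 r - {t0}"
      then have tT: "t \<in> T" "t \<in> T'" using r(2) by auto
      have in_V: "\<sigma> t \<in> V" "\<sigma>' t \<in> V" using tT T(4) T'(4) by auto
      have "F (\<sigma> t) ~= 0"
      proof
        assume "F (\<sigma> t) = 0"
        then have "snd c (\<sigma> t) = snd c z" using V1(4) in_V(1) V(2) by blast
        then show False using t T(5)[OF tT(1)] t0z by simp
      qed
      then show "\<phi> (\<sigma> t) = \<phi> (\<sigma>' t)" using const1[OF in_V] T(5)[OF tT(1)] T'(5)[OF tT(2)] by simp
    qed (use r(1) in auto)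
    then show ?thesis by (simp add: T(6) T'(6))
  qed
  obtain \<zeta> where \<zeta>0: "holo_map_on \<zeta> (snd c ` (UNIV \<inter> V))" "\<forall>p\<in>UNIV \<inter> V. \<phi> p = \<zeta> (snd c p)"
    using box_factor[OF V(3) \<phi>V const] by blast
  then have \<zeta>: "holo_map_on \<zeta> (snd c ` V)" "!!p. p \<in> V ==> \<phi> p = \<zeta> (snd c p)" by auto
  have o\<beta>: "open (snd c ` V)" by (rule open_chart_image[OF c(1) Vo])
  have det: "det (jac \<zeta> t) ~= 0" if t: "t \<in> snd c ` V" "t ~= snd c z" for t
  proof -
    obtain p where p: "p \<in> V" "t = snd c p" using t(1) by blast
    have "F p ~= 0" using V1(4)[of p] p t(2) V(2) by blast
    then obtain N \<theta> where N: "open N" "p \<in> N" "N \<subseteq> fst c" "holo_map_on \<theta> (snd c ` N)" "\<forall>x\<in>N. \<phi> x = \<theta> (snd c x)" "det (jac \<theta> (snd c p)) ~= 0"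
      using fac[OF p(1)] unfolding factors_def by blast
    let ?I = "snd c ` (N \<inter> V)"
    have oI: "open ?I" by (rule open_chart_image[OF c(1)]) (use N(1,3) Vo in \<open>auto simp: open_Int\<close>)
    have eq: "\<zeta> s = \<theta> s" if "s \<in> ?I" for s
    proof -
      obtain x where "x \<in> N" "x \<in> V" "s = snd c x" using \<open>s \<in> ?I\<close> by blast
      then show ?thesis using \<zeta>(2)[of x] N(5) by simp
    qed
    have tI: "t \<in> ?I" using p N(2) by blast
    have hi: "holo_fun_on (%z. \<theta> z $ i) ?I" for i using holo_map_subset[OF N(4), of ?I] by (auto simp: holo_map_on_def)
    have "grad (%z. \<zeta> z $ i) t = grad (%z. \<theta> z $ i) t" for i
      by (rule grad_cong[OF oI tI _ hi]) (simp only: eq)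
    then have "jac \<zeta> t = jac \<theta> t" by (simp only: jac_def)
    then show ?thesis using N(6) p(2) by simp
  qed
  have "det (jac \<zeta> (snd c z)) ~= 0"
  proof
    assume d0: "det (jac \<zeta> (snd c z)) = 0"
    define j :: 'q where "j = undefined"
    \<comment> \<open>An isolated zero would trivially maximise the norm on the zero set of the
      determinant.\<close>
    show False
    proof (rule no_local_max_norm[OF o\<beta>, of "snd c z" "{j}" "%_ t. det (jac \<zeta> t)"])
      show "snd c z \<in> snd c ` V" using V(1) by blast
      show "{j} ~= UNIV"
      proof
        assume "{j} = UNIV"
        then have "CARD('q) = 1" by (metis card.empty card_insert_disjoint empty_iff finite.emptyI One_nat_def)
        then show False using q2 by simp
      qed
      show "holo_fun_on (%t. det (jac \<zeta> t)) (snd c ` V)" by (rule holo_det_jac[OF o\<beta> \<zeta>(1)])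
      show "det (jac \<zeta> (snd c z)) = 0" by (rule d0)
      show "norm t \<le> norm (snd c z)" if t: "t \<in> snd c ` V" "!!i. i \<in> {j} ==> det (jac \<zeta> t) = 0" for t
        using det[OF t(1)] t(2)[of j] by (cases "t = snd c z") auto
    qed
  qed
  then show ?thesis unfolding factors_def using Vo V(1) \<zeta> by (intro exI[of _ V] exI[of _ \<zeta>]) auto
qed

lemma extends_regularly:
  assumes M0: "0 \<notin> M"
  shows "\<exists>V \<phi>. open V \<and> 0 \<in> V \<and> V \<subseteq> ball 0 \<epsilon> \<and> submersion_on \<phi> V \<and> (\<forall>c\<in>\<A>. compatible_charts c (V, \<phi>))"
proof -
  obtain B' \<phi> where B': "open B'" "convex B'" "0 \<in> B'" "B' \<subseteq> ball 0 \<epsilon>" "holo_map_on \<phi> B'"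
    "!!z. z \<in> B' ==> F z ~= 0 ==> \<exists>r>0. ball z r \<subseteq> B' \<and> transverse \<phi> (ball z r)"
    using extension by metis
  have fac: "factors \<phi> c z" if z: "z \<in> B'" "z ~= 0" and c: "c \<in> \<A>" "z \<in> fst c" for z c
  proof (cases "F z = 0")
    case True then show ?thesis using factors_on_zero_fibre[OF B'(1,4,5) B'(6) z(1,2) _ c] by blast
  next
    case False
    then obtain r where "r > 0" "transverse \<phi> (ball z r)" using B'(6) z(1) by blast
    then show ?thesis using transverse_factors[of \<phi> "ball z r" z c] c by auto
  qed
  have sub: "surj (%v. jac \<phi> z *v v)" if z: "z \<in> B'" "z ~= 0" for z
  proof -
    have "z \<in> ball 0 \<rho>0" using z(1) B'(4) \<epsilon> by auto
    then obtain c where c: "c \<in> \<A>" "z \<in> fst c" using chart_at z(2) by blast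
    obtain N \<zeta> where N: "open N" "z \<in> N" "N \<subseteq> fst c" "holo_map_on \<zeta> (snd c ` N)" "\<forall>p\<in>N. \<phi> p = \<zeta> (snd c p)" "det (jac \<zeta> (snd c z)) ~= 0"
      using fac[OF z c] unfolding factors_def by blast
    have hc: "holo_map_on (snd c) N" by (rule holo_map_subset[OF chart_D(4)[OF c(1)] N(3)])
    have "((%p. \<zeta> (snd c p)) has_derivative (%v. jac \<zeta> (snd c z) *v (jac (snd c) z *v v))) (at z)"
      by (rule has_derivative_compose[OF holo_map_D[OF hc N(2)] holo_map_D[OF N(4)]]) (use N(2) in blast)
    then have "(\<phi> has_derivative (%v. jac \<zeta> (snd c z) *v (jac (snd c) z *v v))) (at z)"
      by (rule has_derivative_transform_within_open[OF _ N(1,2)]) (use N(5) in auto)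
    then have eq: "(%v. jac \<phi> z *v v) = (%v. jac \<zeta> (snd c z) *v v) \<circ> (%v. jac (snd c) z *v v)"
      using has_derivative_unique[OF holo_map_D[OF B'(5) z(1)]] by (simp add: o_def)
    have "surj (%v. jac \<zeta> (snd c z) *v v)"
      using N(6) by (metis invertible_det_nz invertible_right_inverse matrix_right_invertible_surjective)
    then show ?thesis unfolding eq using comp_surj[OF chart_D(5)[OF c]] by blast
  qed
  have "surj (%v. jac \<phi> 0 *v v)" by (rule submersion_at_isolated_point[OF q2 B'(1,3,5) sub])
  then have "submersion_on \<phi> B'" unfolding submersion_on_iff using B'(5) sub by metis
  moreover have "compatible_charts c (B', \<phi>)" if c: "c \<in> \<A>" for c
    unfolding compatible_charts_def fst_conv snd_conv
  proof
    fix x assume x: "x \<in> fst c \<inter> B'"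
    have x0: "x ~= 0" using x M0 chart_D(3)[OF c] by blast
    obtain N \<zeta> where N: "open N" "x \<in> N" "N \<subseteq> fst c" "holo_map_on \<zeta> (snd c ` N)" "\<forall>p\<in>N. \<phi> p = \<zeta> (snd c p)" "det (jac \<zeta> (snd c x)) ~= 0"
      using fac[OF _ x0 c] x unfolding factors_def by blast
    let ?N = "N \<inter> B'"
    have oN: "open ?N" using N(1) B'(1) by (rule open_Int)
    have oI: "open (snd c ` ?N)" by (rule open_chart_image[OF c oN]) (use N(3) in blast)
    have h\<zeta>: "holo_map_on \<zeta> (snd c ` ?N)" by (rule holo_map_subset[OF N(4)]) blast
    have xI: "snd c x \<in> snd c ` ?N" using x N(2) by blast
    obtain V W where VW: "open V" "snd c x \<in> V" "V \<subseteq> snd c ` ?N" "biholomorphic \<zeta> V W"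
      using inverse_function_holo[OF oI h\<zeta> xI N(6)] by metis
    define N1 where "N1 = ?N \<inter> snd c -` V"
    have "open N1" unfolding N1_def
      by (rule continuous_open_preimage[OF continuous_on_subset[OF holo_map_continuous[OF chart_D(4)[OF c]]] oN VW(1)]) (use N(3) in blast)
    moreover have "x \<in> N1" using x N(2) VW(2) by (simp add: N1_def)
    moreover have "N1 \<subseteq> fst c \<inter> B'" using N(3) by (auto simp: N1_def)
    moreover have im: "snd c ` N1 = V" using VW(3) by (auto simp: N1_def)
    moreover have \<phi>\<zeta>: "\<forall>z\<in>N1. \<phi> z = \<zeta> (snd c z)" using N(5) by (simp add: N1_def)
    moreover have "\<phi> ` N1 = W"
    proof -
      have "\<phi> ` N1 = \<zeta> ` (snd c ` N1)" using \<phi>\<zeta> by (auto simp: image_image)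
      then show ?thesis unfolding im using biholomorphic_D(5)[OF VW(4)] by simp
    qed
    ultimately show "\<exists>N g. open N \<and> x \<in> N \<and> N \<subseteq> fst c \<inter> B' \<and> biholomorphic g (snd c ` N) (\<phi> ` N) \<and> (\<forall>z\<in>N. \<phi> z = g (snd c z))"
      using VW(4) by (intro exI[of _ N1] exI[of _ \<zeta>]) simp
  qed
  ultimately show ?thesis using B'(1,3,4) by blast
qed

end

text \<open>If the zeros of \<open>F\<close> accumulated in the leaf parameter, their set would have
  regular points of positive dimension nearby. Pulled back by the chart, these show dimension at
  least \<open>n - q + 1\<close> at \<open>z\<close>, against pure codimension
  \<open>q\<close>.\<close>

lemma isolated_plaque_value:
  fixes U :: "(complex^'n) set" and f :: "'q::finite => complex^'n => complex" and \<A> :: "('n::finite, 'q) fol_chart set"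
  assumes fol: "foliated M \<A> f" and MU: "M \<subseteq> U" and c: "c \<in> \<A>" "z \<in> fst c" and z: "!!j. f j z = 0"
    and dim: "dim_at {z\<in>U. \<forall>j. f j z = 0} z = int CARD('n) - int CARD('q)"
  shows "\<exists>V. open V \<and> z \<in> V \<and> V \<subseteq> fst c \<and> (\<forall>p\<in>V. (\<forall>j. f j p = 0) --> snd c p = snd c z)"
proof -
  interpret foliated M \<A> f by (rule fol)
  let ?X = "{z\<in>U. \<forall>j. f j z = 0}"
  have F0: "F p = 0 \<longleftrightarrow> (\<forall>j. f j p = 0)" for p by (simp add: F_def vec_eq_iff)
  obtain V where V: "z \<in> V" "box UNIV c V" using box_interior[of z UNIV UNIV c] c by auto
  have Vo: "open V" "V \<subseteq> fst c" using V(2) by (auto simp: box_def)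
  have cont: "continuous_on V (snd c)" using holo_map_continuous[OF chart_D(4)[OF c(1)]] Vo(2) continuous_on_subset by blast
  have opn: "open (snd c ` (V \<inter> O'))" if "open O'" for O'
    by (rule submersion_open_image[OF _ submersion_subset[OF chart_D(2)[OF c(1)]]]) (use Vo that in \<open>auto simp: open_Int\<close>)
  define T where "T = snd c ` V"
  have oT: "open T" using opn[OF open_UNIV] by (simp add: T_def)
  obtain g where g: "holo_map_on g T" "!!p. p \<in> V ==> F p = g (snd c p)" using box_F[OF V(2)] by (auto simp: T_def)
  define \<G> where "\<G> = range (%j t. g t $ j)"
  define Y where "Y = {t\<in>T. \<forall>h\<in>\<G>. h t = 0}"
  have Y: "Y \<inter> T = {t\<in>T. \<forall>h\<in>\<G>. h t = 0}" by (auto simp: Y_def)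
  have hol: "holo_fun_on h T" if "h \<in> \<G>" for h using that g(1) by (auto simp: \<G>_def holo_map_on_def)
  have XY: "p \<in> ?X \<longleftrightarrow> snd c p \<in> Y" if "p \<in> V" for p
  proof -
    have "p \<in> U" using that Vo(2) chart_D(3)[OF c(1)] MU by blast
    then have "p \<in> ?X \<longleftrightarrow> g (snd c p) = 0" using F0[of p] g(2)[OF that] by simp
    then show ?thesis using that by (auto simp: Y_def \<G>_def T_def vec_eq_iff)
  qed
  have zT: "snd c z \<in> T" using V(1) by (simp add: T_def)
  have "\<not> snd c z islimpt Y"
  proof
    assume L: "snd c z islimpt Y"
    have "int (CARD('n) - CARD('q) + 1) \<le> dim_at ?X z"
    proof (rule dim_at_ge)
      fix O' assume O': "open O'" "z \<in> O'"
      have zO: "snd c z \<in> snd c ` (V \<inter> O')" using V(1) O'(2) by blast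
      obtain y d where y: "y \<in> Y \<inter> T \<inter> snd c ` (V \<inter> O')" "regular_point Y d y" "d \<ge> 1"
        using zero_set_positive_dim[OF oT hol Y zT L opn[OF O'(1)] zO] by metis
      then obtain x where x: "x \<in> V" "x \<in> O'" "y = snd c x" by blast
      have "regular_point ?X (CARD('n) - CARD('q) + d) x"
      proof (rule regular_point_pullback[OF Vo(1) submersion_subset[OF chart_D(2)[OF c(1)] Vo(2)] x(1)])
        show "regular_point Y d (snd c x)" using y(2) x(3) by simp
      qed (rule XY)
      then show "\<exists>z\<in>O'. \<exists>d\<ge>CARD('n) - CARD('q) + 1. regular_point ?X d z"
        using x(2) y(3) by (intro bexI[of _ x] exI[of _ "CARD('n) - CARD('q) + d"]) auto
    qed
    then show False using dim card_less by simp
  qed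
  then obtain T' where T': "open T'" "snd c z \<in> T'" "!!t. t \<in> T' ==> t \<in> Y ==> t = snd c z" unfolding islimpt_def by blast
  show ?thesis
  proof (intro exI conjI ballI impI)
    show "open (V \<inter> snd c -` T')" by (rule continuous_open_preimage[OF cont Vo(1) T'(1)])
    show "z \<in> V \<inter> snd c -` T'" using V(1) T'(2) by simp
    show "V \<inter> snd c -` T' \<subseteq> fst c" using Vo(2) by blast
    fix p assume p: "p \<in> V \<inter> snd c -` T'" "\<forall>j. f j p = 0"
    have "p \<in> U" using p(1) Vo(2) chart_D(3)[OF c(1)] MU by blast
    then have "snd c p \<in> Y" using XY[of p] p by blast
    then show "snd c p = snd c z" using T'(3) p(1) by blast
  qed
qed

lemma submersion_regular_foliation:
  assumes "open V" "submersion_on \<phi> V" shows "regular_foliation V {(V, \<phi>)}"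
proof -
  have "compatible_charts (V, \<phi>) (V, \<phi>)"
    unfolding compatible_charts_def fst_conv snd_conv
  proof
    fix x assume "x \<in> V \<inter> V"
    have o: "open (\<phi> ` V)" by (rule submersion_open_image[OF assms])
    have inv: "the_inv_into (\<phi> ` V) (%t. t) t = t" if "t \<in> \<phi> ` V" for t by (rule the_inv_into_f_eq) (use that in auto)
    have "holo_fun_on (%t. the_inv_into (\<phi> ` V) (%t. t) t $ i) (\<phi> ` V)" for i
      by (rule holo_cong[OF holo_nth o]) (simp add: inv)
    then have "holo_map_on (the_inv_into (\<phi> ` V) (%t. t)) (\<phi> ` V)" by (simp add: holo_map_on_def)
    then have "biholomorphic (%t. t) (\<phi> ` V) (\<phi> ` V)"
      unfolding biholomorphic_def using o holo_map_shift(2) by (simp add: bij_betw_def)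
    then show "\<exists>N g. open N \<and> x \<in> N \<and> N \<subseteq> V \<inter> V \<and> biholomorphic g (\<phi> ` N) (\<phi> ` N) \<and> (\<forall>z\<in>N. \<phi> z = g (\<phi> z))"
      using assms(1) \<open>x \<in> V \<inter> V\<close> by (intro exI[of _ V] exI[of _ "%t. t"]) auto
  qed
  then show ?thesis using assms unfolding regular_foliation_def by simp
qed

theorem corollary1:
  fixes U S :: "(complex^'n) set"
    and f :: "'q::finite \<Rightarrow> complex^'n \<Rightarrow> complex"
    and \<A> :: "('n, 'q) fol_chart set"
  assumes "2 \<le> CARD('q)" and "CARD('q) < CARD('n)"
    and "open U" and "0 \<in> U"
    and "\<forall>j. holo_fun_on (f j) U"
    and "\<forall>j. f j 0 = 0"
    and "pure_codim_at {z\<in>U. \<forall>j. f j z = 0} CARD('q) 0"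
    and "holomorphic_foliation U S \<A>"
    and "complete_first_integral_at 0 U S \<A> f"
  shows "0 \<notin> S \<or> dim_at S 0 \<ge> 1"
proof (rule ccontr)
  assume "\<not> ?thesis"
  then have S0: "0 \<in> S" "\<not> dim_at S 0 \<ge> 1" by auto
  have hf: "analytic_subset S U" "regular_foliation (U - S) \<A>"
    "\<And>V \<B>. open V \<Longrightarrow> 0 \<in> V \<Longrightarrow> V \<subseteq> U \<Longrightarrow> regular_foliation V (\<B> :: ('n, 'q) fol_chart set) \<Longrightarrow> \<forall>c\<in>\<A>. \<forall>d\<in>\<B>. compatible_charts c d \<Longrightarrow> False"
    using assms(8) S0(1) unfolding holomorphic_foliation_def by blast+
  obtain V0 G where V0: "open V0" "0 \<in> V0" "V0 \<subseteq> U" "\<forall>g\<in>G. holo_fun_on g V0" "S \<inter> V0 = {z\<in>V0. \<forall>g\<in>G. g z = 0}"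
    using bspec[OF conjunct2[OF hf(1)[unfolded analytic_subset_def]] assms(4)] by (elim exE conjE)
  \<comment> \<open>A zero set has dimension at least one at each of its accumulation points, so
    \<open>0\<close> is an isolated singular point.\<close>
  have "\<not> 0 islimpt S"
  proof
    assume "0 islimpt S"
    then have "1 \<le> dim_at S 0" by (rule dim_at_zero_set[OF V0(1) _ V0(5,2), rotated]) (use V0(4) in blast)
    then show False using S0(2) by simp
  qed
  then obtain V1 where V1: "open V1" "0 \<in> V1" "\<And>z. z \<in> V1 \<Longrightarrow> z \<in> S \<Longrightarrow> z = 0" unfolding islimpt_def by blast
  let ?X = "{z\<in>U. \<forall>j. f j z = 0}"
  obtain V2 where V2: "open V2" "0 \<in> V2" "\<forall>z\<in>?X \<inter> V2. dim_at ?X z = int CARD('n) - int CARD('q)"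
    using assms(7) unfolding pure_codim_at_def by blast
  have "open (U \<inter> V1 \<inter> V2)" "0 \<in> U \<inter> V1 \<inter> V2" using assms(3,4) V1(1,2) V2(1,2) by auto
  then obtain \<rho>0 where \<rho>0: "\<rho>0 > 0" "ball 0 \<rho>0 \<subseteq> U \<inter> V1 \<inter> V2" using open_contains_ball by blast
  have fol: "foliated (U - S) \<A> f"
  proof
    show "regular_foliation (U - S) \<A>" by (rule hf(2))
    show "holo_fun_on (f j) (U - S)" for j using assms(5) holo_subset[of "f j" U "U - S"] by blast
    show "f j constant_on leaf \<A> x" if "x \<in> U - S" for x j using assms(9) that unfolding complete_first_integral_at_def by blast
    show "CARD('q) < CARD('n)" by (rule assms(2))
  qed
  interpret foliated "U - S" \<A> f by (rule fol)
  interpret isolated "U - S" \<A> f \<rho>0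
  proof
    show "0 < \<rho>0" by (rule \<rho>0(1))
    show "ball 0 \<rho>0 \<subseteq> insert 0 (U - S)" using \<rho>0(2) V1(3) by blast
    show "holo_fun_on (f j) (ball 0 \<rho>0)" for j using assms(5) holo_subset[of "f j" U "ball 0 \<rho>0"] \<rho>0(2) by blast
    show "f j 0 = 0" for j using assms(6) by blast
    show "2 \<le> CARD('q)" by (rule assms(1))
    fix c z assume c: "c \<in> \<A>" "z \<in> fst c" and z: "z \<in> ball 0 \<rho>0" "F z = 0"
    have fz: "f j z = 0" for j using z(2) by (simp add: F_def vec_eq_iff)
    have "z \<in> ?X \<inter> V2" using z(1) \<rho>0(2) fz by blast
    then have "dim_at ?X z = int CARD('n) - int CARD('q)" using V2(3) by blast
    from isolated_plaque_value[OF fol _ c fz this]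
    show "\<exists>V. open V \<and> z \<in> V \<and> V \<subseteq> fst c \<and> (\<forall>p\<in>V. F p = 0 \<longrightarrow> snd c p = snd c z)"
      by (auto simp: F_def vec_eq_iff)
  qed
  obtain \<epsilon> \<delta> where "good (U - S) \<A> f \<rho>0 \<epsilon> \<delta>"
  proof (rule good_ball)
    fix \<epsilon> \<delta> assume g: "0 < \<epsilon>" "\<epsilon> < \<rho>0" "\<delta> > 0"
      "\<And>z. z \<in> cball 0 \<epsilon> \<Longrightarrow> z \<noteq> 0 \<Longrightarrow> norm (F z) < \<delta> \<Longrightarrow> iso z"
      "\<And>z O' c. z \<in> cball 0 \<epsilon> \<Longrightarrow> z \<noteq> 0 \<Longrightarrow> norm (F z) < \<delta> \<Longrightarrow> open O' \<Longrightarrow> z \<in> O' \<Longrightarrow> c \<in> \<A> \<Longrightarrow> z \<in> fst c \<Longrightarrow>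
        \<exists>V. z \<in> V \<and> V \<subseteq> O' \<and> box (cball 0 \<epsilon>) c V"
    have "good (U - S) \<A> f \<rho>0 \<epsilon> \<delta>" by unfold_locales (use g in blast)+
    then show thesis by (rule that)
  qed
  then interpret good "U - S" \<A> f \<rho>0 \<epsilon> \<delta> .
  obtain V \<phi> where V: "open V" "0 \<in> V" "V \<subseteq> ball 0 \<epsilon>" "submersion_on \<phi> V" "\<forall>c\<in>\<A>. compatible_charts c (V, \<phi>)"
    using extends_regularly S0(1) by blast
  have "ball 0 \<epsilon> \<subseteq> ball (0 :: complex^'n) \<rho>0" using \<epsilon>(2) by auto
  then have "V \<subseteq> U" using V(3) \<rho>0(2) assms(4) by blast
  then show False
    using hf(3)[OF V(1,2) _ submersion_regular_foliation[OF V(1,4)]] V(5) by blast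
qed

end
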